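(* Let $\Omega\subseteq\mathbb R^n$ be open. A generalized function $\widetilde R\in\mathcal G(\Omega)$ is zero if and only if one of the following conditions holds: (i) $\widetilde R(\widetilde X)=0$ in $\widetilde{\mathbb C}$ for all generalized points $\widetilde X\in\widetilde\Omega_c[\varepsilon]$; (ii) $\widetilde R(\widetilde X)=0$ in $\widetilde{\mathbb C}$ for all generalized points $\widetilde X\in\widetilde\Omega_c[\boldsymbol\varphi_\varepsilon]$; (iii) $\widetilde R(\widetilde X)=0$ in $\widetilde{\mathbb C}$ for all generalized points $\widetilde X\in\widetilde\Omega_c$.
   Context: Basic space. $\mathbb N=\{1,2,\dots\}$, $\mathbb N_0=\mathbb N\cup\{0\}$, $I=(0,1]$. $\mathcal D(\Omega)$ is the space of test functions, $\mathcal D'(\Omega)$ the space of distributions (strong dual), $C^\infty(\Omega)$ the Fréchet space of smooth complex-valued functions. Smoothness of maps between locally convex spaces is in the sense of convenient calculus (Kriegl–Michor), $\mathrm d^k$ is the $k$-th differential, $C^\infty(E,F)$ is the space of smooth maps; powers $E^I$ carry the product topology. $\mathcal L(E,F)$ is the space of continuous linear maps with the topology of bounded convergence, $\mathrm{csn}(E)$ the set of continuous seminorms on $E$. $\mathrm{SK}(\Omega):=C^\infty(\Omega,\mathcal D(\Omega))$, isomorphic to $\mathcal L(\mathcal D'(\Omega),C^\infty(\Omega))$ via $\Phi(u)(x)=\langle u,\vec\varphi(x)\rangle$. $\mathcal E(\Omega):=C^\infty(\mathrm{SK}(\Omega)^I,C^\infty(\Omega)^I)$, with pointwise operations; write $R(\boldsymbol\varphi)_\varepsilon(x)$.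 $C^\infty(\mathrm{SK}(\Omega)^I,\Omega^I)$ is the set of smooth maps into $(\mathbb R^n)^I$ with values in $\Omega^I$. Test objects. $\boldsymbol\varphi\in\mathrm{SK}(\Omega)^I$ with corresponding operators $\boldsymbol\Phi_\varepsilon\in\mathcal L(\mathcal D'(\Omega),C^\infty(\Omega))$ is a test object, $\boldsymbol\varphi\in S(\Omega)$, if (i) $\boldsymbol\Phi_\varepsilon\to\mathrm{id}$ in $\mathcal L(\mathcal D'(\Omega),\mathcal D'(\Omega))$ as $\varepsilon\to0$; (ii) for all $p\in\mathrm{csn}(\mathcal L(\mathcal D'(\Omega),C^\infty(\Omega)))$ there is $N\in\mathbb N$ with $p(\boldsymbol\Phi_\varepsilon)=O(\varepsilon^{-N})$; (iii) for all $p\in\mathrm{csn}(\mathcal L(C^\infty(\Omega),C^\infty(\Omega)))$ and $m\in\mathbb N$, $p(\boldsymbol\Phi_\varepsilon|_{C^\infty(\Omega)}-\mathrm{id})=O(\varepsilon^m)$; (iv) every $x\in\Omega$ has a neighborhood $V$ such that for all $r>0$ there is $\varepsilon_0>0$ with $\operatorname{supp}\boldsymbol\varphi_\varepsilon(y)\subseteq B_r(y)$ for all $y\in V$, $\varepsilon<\varepsilon_0$. It is a $0$-test object, $\boldsymbol\varphi\in S^0(\Omega)$, if (ii), (iv) hold and (i), (iii) hold with $\mathrm{id}$ replaced by $0$. Generalized functions. $R\in\mathcal E(\Omega)$ is moderate (in $\mathcal E_M(\Omega)$) if for all $k\in\mathbb N_0$, $p\in\mathrm{csn}(C^\infty(\Omega))$,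 $\boldsymbol\varphi\in S(\Omega)$, $\boldsymbol\psi_1,\dots,\boldsymbol\psi_k\in S^0(\Omega)$ there is $N\in\mathbb N$ with $p(\mathrm d^kR(\boldsymbol\varphi)(\boldsymbol\psi_1,\dots,\boldsymbol\psi_k)_\varepsilon)=O(\varepsilon^{-N})$; negligible (in $\mathcal N(\Omega)$) if for all such $k,p,\boldsymbol\varphi,\boldsymbol\psi_i$ and all $m\in\mathbb N$ it is $O(\varepsilon^m)$. $\mathcal G(\Omega):=\mathcal E_M(\Omega)/\mathcal N(\Omega)$. Generalized numbers. $\mathbb C_M$ is the set of $X\in C^\infty(\mathrm{SK}(\Omega)^I,\mathbb C^I)$ such that for all $k\in\mathbb N_0$, $\boldsymbol\varphi\in S(\Omega)$, $\boldsymbol\psi_1,\dots,\boldsymbol\psi_k\in S^0(\Omega)$ there is $N\in\mathbb N$ with $|\mathrm d^kX(\boldsymbol\varphi)(\boldsymbol\psi_1,\dots,\boldsymbol\psi_k)_\varepsilon|=O(\varepsilon^{-N})$; $\mathbb C_{\mathcal N}$ is defined likewise with $O(\varepsilon^m)$ for all $m\in\mathbb N$. $\widetilde{\mathbb C}:=\mathbb C_M/\mathbb C_{\mathcal N}$. Generalized points. $\Omega_M$ is the set of $X\in C^\infty(\mathrm{SK}(\Omega)^I,\Omega^I)$ such that for all $k\in\mathbb N_0$, $\boldsymbol\varphi\in S(\Omega)$, $\boldsymbol\psi_1,\dots,\boldsymbol\psi_k\in S^0(\Omega)$ there is $N\in\mathbb N$ with $\|\mathrm d^kX(\boldsymbol\varphi)(\boldsymbol\psi_1,\dots,\boldsymbol\psi_k)_\varepsilon\|=O(\varepsilon^{-N})$.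 For $X,Y\in\Omega_M$, $X\sim Y$ means that for all such $k,\boldsymbol\varphi,\boldsymbol\psi_i$ and all $m\in\mathbb N$, $\|\mathrm d^k(X-Y)(\boldsymbol\varphi)(\boldsymbol\psi_1,\dots,\boldsymbol\psi_k)_\varepsilon\|=O(\varepsilon^m)$. $\widetilde\Omega:=\Omega_M/{\sim}$. $\widetilde\Omega_c$ is the set of $\widetilde X\in\widetilde\Omega$ having a representative $X$ such that there is a compact $K\subseteq\Omega$ with: for all $\boldsymbol\varphi\in S(\Omega)$ there is $\varepsilon_0>0$ with $X(\boldsymbol\varphi)_\varepsilon\in K$ for all $\varepsilon<\varepsilon_0$. $X$ is called $\varepsilon$-local if $X(\boldsymbol\varphi)_\varepsilon$ depends only on $\varepsilon$ (i.e. $X(\boldsymbol\varphi)_\varepsilon=X(\boldsymbol\psi)_\varepsilon$ for all $\boldsymbol\varphi,\boldsymbol\psi\in\mathrm{SK}(\Omega)^I$, $\varepsilon\in I$), and $\boldsymbol\varphi_\varepsilon$-local if $\boldsymbol\varphi_\varepsilon=\boldsymbol\psi_\eta$ implies $X(\boldsymbol\varphi)_\varepsilon=X(\boldsymbol\psi)_\eta$ (for all $\boldsymbol\varphi,\boldsymbol\psi\in\mathrm{SK}(\Omega)^I$, $\varepsilon,\eta\in I$). $\widetilde\Omega_c[\varepsilon]$ and $\widetilde\Omega_c[\boldsymbol\varphi_\varepsilon]$ denote the sets of elements of $\widetilde\Omega_c$ having an $\varepsilon$-local, respectively $\boldsymbol\varphi_\varepsilon$-local, representative. Point values. For representatives $R$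 of $\widetilde R\in\mathcal G(\Omega)$ and $X$ of $\widetilde X\in\widetilde\Omega_c$, $R(X)(\boldsymbol\varphi)_\varepsilon:=R(\boldsymbol\varphi)_\varepsilon(X(\boldsymbol\varphi)_\varepsilon)$, and $\widetilde R(\widetilde X)\in\widetilde{\mathbb C}$ is the class of $R(X)$ (independent of the representatives). *)

theory Defs
  imports "HOL-Analysis.Analysis" "HOL-Library.Function_Algebras" "HOL-Library.Landau_Symbols"
begin

section \<open>Pointwise vector space structure on functions\<close>

instantiation "fun" :: (type, real_vector) real_vector
begin

definition scaleR_fun :: "real \<Rightarrow> ('a \<Rightarrow> 'b) \<Rightarrow> 'a \<Rightarrow> 'b" where
  "scaleR_fun r f = (\<lambda>x. r *\<^sub>R f x)"

instance
  by standard (simp_all add: scaleR_fun_def fun_eq_iff scaleR_add_right scaleR_add_left)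

end

class complex_vector = real_vector +
  fixes scaleC :: "complex \<Rightarrow> 'a \<Rightarrow> 'a" (infixr "*\<^sub>C" 75)
  assumes scaleC_add_right: "c *\<^sub>C (x + y) = c *\<^sub>C x + c *\<^sub>C y"
    and scaleC_add_left: "(c + d) *\<^sub>C x = c *\<^sub>C x + d *\<^sub>C x"
    and scaleC_scaleC: "c *\<^sub>C d *\<^sub>C x = (c * d) *\<^sub>C x"
    and scaleC_of_real: "complex_of_real r *\<^sub>C x = r *\<^sub>R x"

instantiation complex :: complex_vector
begin

definition scaleC_complex :: "complex \<Rightarrow> complex \<Rightarrow> complex" where
  "scaleC_complex c x = c * x"

instance
  by standard (simp_all add: scaleC_complex_def algebra_simps scaleR_conv_of_real)

end

instantiation "fun" :: (type, complex_vector) complex_vector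
begin

definition scaleC_fun :: "complex \<Rightarrow> ('a \<Rightarrow> 'b) \<Rightarrow> 'a \<Rightarrow> 'b" where
  "scaleC_fun c f = (\<lambda>x. c *\<^sub>C f x)"

instance
  by standard
    (simp_all add: scaleC_fun_def scaleR_fun_def fun_eq_iff
      scaleC_add_right scaleC_add_left scaleC_scaleC scaleC_of_real)

end

section \<open>Locally convex spaces\<close>

text \<open>
  A locally convex space is a topology whose underlying set is a linear subspace of the ambient
  vector space type. Spaces of maps consist of maps that vanish outside their domain, so that
  equality of elements is equality of HOL functions and each space is closed under the pointwise
  operations.
\<close>

definition seminorm_topology :: "'a::real_vector set \<Rightarrow> ('a \<Rightarrow> real) set \<Rightarrow> 'a topology" where
  "seminorm_topology V P =
     topology_generated_by (insert V {{y \<in> V. p (y - x) < r} | p x r. p \<in> P \<and> x \<in> V \<and> r > 0})"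

definition seminorm_on :: "'a::complex_vector set \<Rightarrow> ('a \<Rightarrow> real) \<Rightarrow> bool" where
  "seminorm_on V p \<longleftrightarrow>
     (\<forall>x\<in>V. \<forall>y\<in>V. p (x + y) \<le> p x + p y) \<and> (\<forall>c. \<forall>x\<in>V. p (c *\<^sub>C x) = cmod c * p x)"

definition csn :: "'a::complex_vector topology \<Rightarrow> ('a \<Rightarrow> real) set" where
  "csn E = {p. seminorm_on (topspace E) p \<and> continuous_map E euclideanreal p}"

definition bounded_in :: "'a::complex_vector topology \<Rightarrow> 'a set \<Rightarrow> bool" where
  "bounded_in E B \<longleftrightarrow> B \<subseteq> topspace E \<and> (\<forall>p\<in>csn E. bounded (p ` B))"

text \<open>Supremum of nonnegative reals; inserting 0 fixes the value on the empty set.\<close>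

definition sup0 :: "real set \<Rightarrow> real" where
  "sup0 A = Sup (insert 0 A)"

text \<open>Continuous linear maps with the topology of bounded convergence.\<close>

definition lin_maps ::
  "'a::complex_vector topology \<Rightarrow> 'b::complex_vector topology \<Rightarrow> ('a \<Rightarrow> 'b) set" where
  "lin_maps E F =
     {T. continuous_map E F T \<and>
         (\<forall>x\<in>topspace E. \<forall>y\<in>topspace E. T (x + y) = T x + T y) \<and>
         (\<forall>c. \<forall>x\<in>topspace E. T (c *\<^sub>C x) = c *\<^sub>C T x) \<and>
         (\<forall>x. x \<notin> topspace E \<longrightarrow> T x = 0)}"

definition lin_space ::
  "'a::complex_vector topology \<Rightarrow> 'b::complex_vector topology \<Rightarrow> ('a \<Rightarrow> 'b) topology" where
  "lin_space E F = seminorm_topology (lin_maps E F)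
     {\<lambda>T. sup0 {q (T u) | u. u \<in> B} | B q. bounded_in E B \<and> q \<in> csn F}"

abbreviation unit_ivl :: "real set" where
  "unit_ivl \<equiv> {0<..1}"

text \<open>
  The power \<open>E\<^sup>I\<close> with the product topology. The library's \<^const>\<open>product_topology\<close> consists of
  functions that are \<open>undefined\<close> outside the index set; here they are replaced by functions that are
  0 there.
\<close>

definition power_space :: "'a::zero topology \<Rightarrow> (real \<Rightarrow> 'a) topology" where
  "power_space E =
     pullback_topology {f. \<forall>\<epsilon>. \<epsilon> \<notin> unit_ivl \<longrightarrow> f \<epsilon> = 0} (\<lambda>f. restrict f unit_ivl)
       (product_topology (\<lambda>_. E) unit_ivl)"

section \<open>Convenient calculus\<close>

definition smooth_curve :: "'a::real_vector topology \<Rightarrow> (real \<Rightarrow> 'a) \<Rightarrow> bool" where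
  "smooth_curve E c \<longleftrightarrow>
     (\<exists>D :: nat \<Rightarrow> real \<Rightarrow> 'a. D 0 = c \<and>
        (\<forall>k t. D k t \<in> topspace E \<and>
           limitin E (\<lambda>h. inverse h *\<^sub>R (D k (t + h) - D k t)) (D (Suc k) t) (at 0)))"

text \<open>
  Smooth maps from \<open>U \<subseteq> E\<close> to \<open>F\<close>: smooth curves in \<open>U\<close> are mapped to smooth curves in \<open>F\<close>.
\<close>

definition smooth_maps ::
  "'a::real_vector topology \<Rightarrow> 'a set \<Rightarrow> 'b::real_vector topology \<Rightarrow> ('a \<Rightarrow> 'b) set" where
  "smooth_maps E U F =
     {f. (\<forall>x\<in>U. f x \<in> topspace F) \<and> (\<forall>x. x \<notin> U \<longrightarrow> f x = 0) \<and>
         (\<forall>c. smooth_curve E c \<and> range c \<subseteq> U \<longrightarrow> smooth_curve F (f \<circ> c))}"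

definition dir_deriv ::
  "'b::real_vector topology \<Rightarrow> ('a::real_vector \<Rightarrow> 'b) \<Rightarrow> 'a \<Rightarrow> 'a \<Rightarrow> 'b" where
  "dir_deriv F f x v = (THE l. limitin F (\<lambda>h. inverse h *\<^sub>R (f (x + h *\<^sub>R v) - f x)) l (at (0::real)))"

text \<open>\<open>differential F f x [v\<^sub>1, \<dots>, v\<^sub>k]\<close> is the \<open>k\<close>-th differential \<open>d\<^sup>k f(x)(v\<^sub>1, \<dots>, v\<^sub>k)\<close>.\<close>

fun differential ::
  "'b::real_vector topology \<Rightarrow> ('a::real_vector \<Rightarrow> 'b) \<Rightarrow> 'a \<Rightarrow> 'a list \<Rightarrow> 'b" where
  "differential F f x [] = f x"
| "differential F f x (v # vs) = dir_deriv F (\<lambda>y. differential F f y vs) x v"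

section \<open>Spaces of functions and distributions\<close>

type_synonym 'n cfun = "real^'n \<Rightarrow> complex"
type_synonym 'n distr = "'n cfun \<Rightarrow> complex"
type_synonym 'n kern = "real^'n \<Rightarrow> 'n cfun"

definition fsupp :: "('a::topological_space \<Rightarrow> 'b::zero) \<Rightarrow> 'a set" where
  "fsupp f = closure {x. f x \<noteq> 0}"

fun partial :: "'n list \<Rightarrow> 'n::finite cfun \<Rightarrow> 'n cfun" where
  "partial [] f = f"
| "partial (i # is) f = (\<lambda>x. vector_derivative (\<lambda>t. partial is f (x + t *\<^sub>R axis i 1)) (at 0))"

definition Cinf_funs :: "(real^'n::finite) set \<Rightarrow> 'n cfun set" where
  "Cinf_funs \<Omega> =
     {f. (\<forall>x. x \<notin> \<Omega> \<longrightarrow> f x = 0) \<and>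
         (\<forall>is. continuous_on \<Omega> (partial is f) \<and>
            (\<forall>i. \<forall>x\<in>\<Omega>. (\<lambda>t. partial is f (x + t *\<^sub>R axis i 1)) differentiable (at 0)))}"

definition Cinf :: "(real^'n::finite) set \<Rightarrow> 'n cfun topology" where
  "Cinf \<Omega> = seminorm_topology (Cinf_funs \<Omega>)
     {\<lambda>f. sup0 {cmod (partial is f x) | x. x \<in> K} | K is. compact K \<and> K \<subseteq> \<Omega>}"

definition test_funs :: "(real^'n::finite) set \<Rightarrow> 'n cfun set" where
  "test_funs \<Omega> = {f \<in> Cinf_funs \<Omega>. compact (fsupp f) \<and> fsupp f \<subseteq> \<Omega>}"

text \<open>
  The test function space carries the inductive limit topology: a seminorm is continuous iff its
  restriction to each Frechet space \<open>\<D>\<^sub>K\<close> of functions supported in a compact \<open>K \<subseteq> \<Omega>\<close> is continuous.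
\<close>

definition Dspace :: "(real^'n::finite) set \<Rightarrow> 'n cfun topology" where
  "Dspace \<Omega> = seminorm_topology (test_funs \<Omega>)
     {p. seminorm_on (test_funs \<Omega>) p \<and>
         (\<forall>K. compact K \<and> K \<subseteq> \<Omega> \<longrightarrow>
            continuous_map (subtopology (Cinf \<Omega>) {f \<in> test_funs \<Omega>. fsupp f \<subseteq> K}) euclideanreal p)}"

definition Distr :: "(real^'n::finite) set \<Rightarrow> 'n distr topology" where
  "Distr \<Omega> = lin_space (Dspace \<Omega>) euclidean"

text \<open>The embedding of smooth functions into distributions.\<close>

definition reg_distr :: "(real^'n::finite) set \<Rightarrow> 'n cfun \<Rightarrow> 'n distr" where
  "reg_distr \<Omega> f = (\<lambda>g. if g \<in> topspace (Dspace \<Omega>) then LINT x:\<Omega>|lborel. f x * g x else 0)"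

text \<open>
  Smoothing kernels \<open>C\<^sup>\<infinity>(\<Omega>, \<D>(\<Omega>))\<close>, with uniform convergence on compact sets of all partial
  derivatives.
\<close>

definition SK :: "(real^'n::finite) set \<Rightarrow> 'n kern topology" where
  "SK \<Omega> = seminorm_topology (smooth_maps euclidean \<Omega> (Dspace \<Omega>))
     {\<lambda>\<phi>. sup0 {q (differential (Dspace \<Omega>) \<phi> x (map (\<lambda>i. axis i 1) is)) | x. x \<in> K} | K is q.
        compact K \<and> K \<subseteq> \<Omega> \<and> q \<in> csn (Dspace \<Omega>)}"

abbreviation SKI :: "(real^'n::finite) set \<Rightarrow> (real \<Rightarrow> 'n kern) topology" where
  "SKI \<Omega> \<equiv> power_space (SK \<Omega>)"

definition smoothing_op :: "(real^'n::finite) set \<Rightarrow> 'n kern \<Rightarrow> 'n distr \<Rightarrow> 'n cfun" where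
  "smoothing_op \<Omega> \<phi> u = (\<lambda>x. if u \<in> topspace (Distr \<Omega>) \<and> x \<in> \<Omega> then u (\<phi> x) else 0)"

section \<open>Test objects\<close>

definition id_on :: "'a::zero topology \<Rightarrow> 'a \<Rightarrow> 'a" where
  "id_on E x = (if x \<in> topspace E then x else 0)"

text \<open>
  The operator of a kernel as an element of \<open>L(\<D>', \<D>')\<close>, and its restriction to smooth functions.
\<close>

definition op_distr :: "(real^'n::finite) set \<Rightarrow> 'n kern \<Rightarrow> 'n distr \<Rightarrow> 'n distr" where
  "op_distr \<Omega> \<phi> u = reg_distr \<Omega> (smoothing_op \<Omega> \<phi> u)"

definition op_Cinf :: "(real^'n::finite) set \<Rightarrow> 'n kern \<Rightarrow> 'n cfun \<Rightarrow> 'n cfun" where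
  "op_Cinf \<Omega> \<phi> f = (if f \<in> topspace (Cinf \<Omega>) then smoothing_op \<Omega> \<phi> (reg_distr \<Omega> f) else 0)"

text \<open>Growth conditions as \<open>\<epsilon> \<rightarrow> 0\<close>.\<close>

definition moderate_net :: "(real \<Rightarrow> real) \<Rightarrow> bool" where
  "moderate_net g \<longleftrightarrow> (\<exists>N::nat. N \<ge> 1 \<and> g \<in> O[at_right 0](\<lambda>\<epsilon>. inverse (\<epsilon> ^ N)))"

definition negligible_net :: "(real \<Rightarrow> real) \<Rightarrow> bool" where
  "negligible_net g \<longleftrightarrow> (\<forall>m::nat. m \<ge> 1 \<longrightarrow> g \<in> O[at_right 0](\<lambda>\<epsilon>. \<epsilon> ^ m))"

definition moderate_op :: "(real^'n::finite) set \<Rightarrow> (real \<Rightarrow> 'n kern) \<Rightarrow> bool" where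
  "moderate_op \<Omega> \<phi> \<longleftrightarrow>
     (\<forall>p \<in> csn (lin_space (Distr \<Omega>) (Cinf \<Omega>)). moderate_net (\<lambda>\<epsilon>. p (smoothing_op \<Omega> (\<phi> \<epsilon>))))"

definition localizing :: "(real^'n::finite) set \<Rightarrow> (real \<Rightarrow> 'n kern) \<Rightarrow> bool" where
  "localizing \<Omega> \<phi> \<longleftrightarrow>
     (\<forall>x\<in>\<Omega>. \<exists>V. open V \<and> x \<in> V \<and> V \<subseteq> \<Omega> \<and>
        (\<forall>r>0. \<exists>\<epsilon>\<^sub>0>0. \<forall>y\<in>V. \<forall>\<epsilon>\<in>unit_ivl. \<epsilon> < \<epsilon>\<^sub>0 \<longrightarrow> fsupp (\<phi> \<epsilon> y) \<subseteq> ball y r))"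

definition test_objs :: "(real^'n::finite) set \<Rightarrow> (real \<Rightarrow> 'n kern) set" where
  "test_objs \<Omega> =
     {\<phi> \<in> topspace (SKI \<Omega>).
        limitin (lin_space (Distr \<Omega>) (Distr \<Omega>))
          (\<lambda>\<epsilon>. op_distr \<Omega> (\<phi> \<epsilon>)) (id_on (Distr \<Omega>)) (at_right 0) \<and>
        moderate_op \<Omega> \<phi> \<and>
        (\<forall>p \<in> csn (lin_space (Cinf \<Omega>) (Cinf \<Omega>)).
           negligible_net (\<lambda>\<epsilon>. p (op_Cinf \<Omega> (\<phi> \<epsilon>) - id_on (Cinf \<Omega>)))) \<and>
        localizing \<Omega> \<phi>}"

definition test_objs0 :: "(real^'n::finite) set \<Rightarrow> (real \<Rightarrow> 'n kern) set" where
  "test_objs0 \<Omega> =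
     {\<phi> \<in> topspace (SKI \<Omega>).
        limitin (lin_space (Distr \<Omega>) (Distr \<Omega>)) (\<lambda>\<epsilon>. op_distr \<Omega> (\<phi> \<epsilon>)) 0 (at_right 0) \<and>
        moderate_op \<Omega> \<phi> \<and>
        (\<forall>p \<in> csn (lin_space (Cinf \<Omega>) (Cinf \<Omega>)).
           negligible_net (\<lambda>\<epsilon>. p (op_Cinf \<Omega> (\<phi> \<epsilon>)))) \<and>
        localizing \<Omega> \<phi>}"

section \<open>Generalized functions, numbers and points\<close>

text \<open>Quotient of a set by the relation that the difference lies in \<open>N\<close>.\<close>

definition quot_rel :: "'a::minus set \<Rightarrow> 'a set \<Rightarrow> 'a rel" where
  "quot_rel M N = {(a, b). a \<in> M \<and> b \<in> M \<and> a - b \<in> N}"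

type_synonym 'n gfun = "(real \<Rightarrow> 'n kern) \<Rightarrow> real \<Rightarrow> 'n cfun"
type_synonym 'n gnum = "(real \<Rightarrow> 'n kern) \<Rightarrow> real \<Rightarrow> complex"
type_synonym 'n gpoint = "(real \<Rightarrow> 'n kern) \<Rightarrow> real \<Rightarrow> real^'n"

definition basic_space :: "(real^'n::finite) set \<Rightarrow> 'n gfun set" where
  "basic_space \<Omega> = smooth_maps (SKI \<Omega>) (topspace (SKI \<Omega>)) (power_space (Cinf \<Omega>))"

definition moderate_funs :: "(real^'n::finite) set \<Rightarrow> 'n gfun set" where
  "moderate_funs \<Omega> =
     {R \<in> basic_space \<Omega>.
        \<forall>p \<in> csn (Cinf \<Omega>). \<forall>\<phi> \<in> test_objs \<Omega>. \<forall>\<psi>s. set \<psi>s \<subseteq> test_objs0 \<Omega> \<longrightarrow>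
          moderate_net (\<lambda>\<epsilon>. p (differential (power_space (Cinf \<Omega>)) R \<phi> \<psi>s \<epsilon>))}"

definition negligible_funs :: "(real^'n::finite) set \<Rightarrow> 'n gfun set" where
  "negligible_funs \<Omega> =
     {R \<in> basic_space \<Omega>.
        \<forall>p \<in> csn (Cinf \<Omega>). \<forall>\<phi> \<in> test_objs \<Omega>. \<forall>\<psi>s. set \<psi>s \<subseteq> test_objs0 \<Omega> \<longrightarrow>
          negligible_net (\<lambda>\<epsilon>. p (differential (power_space (Cinf \<Omega>)) R \<phi> \<psi>s \<epsilon>))}"

definition gfun_rel :: "(real^'n::finite) set \<Rightarrow> 'n gfun rel" where
  "gfun_rel \<Omega> = quot_rel (moderate_funs \<Omega>) (negligible_funs \<Omega>)"

definition gen_funs :: "(real^'n::finite) set \<Rightarrow> 'n gfun set set" where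
  "gen_funs \<Omega> = moderate_funs \<Omega> // gfun_rel \<Omega>"

definition gfun_zero :: "(real^'n::finite) set \<Rightarrow> 'n gfun set" where
  "gfun_zero \<Omega> = gfun_rel \<Omega> `` {0}"

text \<open>Maps \<open>SK(\<Omega>)\<^sup>I \<rightarrow> Y\<^sup>I\<close> for a finite-dimensional normed space \<open>Y\<close>.\<close>

definition basic_maps ::
  "(real^'n::finite) set \<Rightarrow> ((real \<Rightarrow> 'n kern) \<Rightarrow> real \<Rightarrow> 'y::euclidean_space) set" where
  "basic_maps \<Omega> = smooth_maps (SKI \<Omega>) (topspace (SKI \<Omega>)) (power_space euclidean)"

definition moderate_map ::
  "(real^'n::finite) set \<Rightarrow> ((real \<Rightarrow> 'n kern) \<Rightarrow> real \<Rightarrow> 'y::euclidean_space) \<Rightarrow> bool" where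
  "moderate_map \<Omega> X \<longleftrightarrow>
     (\<forall>\<phi> \<in> test_objs \<Omega>. \<forall>\<psi>s. set \<psi>s \<subseteq> test_objs0 \<Omega> \<longrightarrow>
        moderate_net (\<lambda>\<epsilon>. norm (differential (power_space euclidean) X \<phi> \<psi>s \<epsilon>)))"

definition negligible_map ::
  "(real^'n::finite) set \<Rightarrow> ((real \<Rightarrow> 'n kern) \<Rightarrow> real \<Rightarrow> 'y::euclidean_space) \<Rightarrow> bool" where
  "negligible_map \<Omega> X \<longleftrightarrow>
     (\<forall>\<phi> \<in> test_objs \<Omega>. \<forall>\<psi>s. set \<psi>s \<subseteq> test_objs0 \<Omega> \<longrightarrow>
        negligible_net (\<lambda>\<epsilon>. norm (differential (power_space euclidean) X \<phi> \<psi>s \<epsilon>)))"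

definition moderate_nums :: "(real^'n::finite) set \<Rightarrow> 'n gnum set" where
  "moderate_nums \<Omega> = {X \<in> basic_maps \<Omega>. moderate_map \<Omega> X}"

definition negligible_nums :: "(real^'n::finite) set \<Rightarrow> 'n gnum set" where
  "negligible_nums \<Omega> = {X \<in> basic_maps \<Omega>. negligible_map \<Omega> X}"

definition gnum_rel :: "(real^'n::finite) set \<Rightarrow> 'n gnum rel" where
  "gnum_rel \<Omega> = quot_rel (moderate_nums \<Omega>) (negligible_nums \<Omega>)"

definition gen_nums :: "(real^'n::finite) set \<Rightarrow> 'n gnum set set" where
  "gen_nums \<Omega> = moderate_nums \<Omega> // gnum_rel \<Omega>"

definition gnum_zero :: "(real^'n::finite) set \<Rightarrow> 'n gnum set" where
  "gnum_zero \<Omega> = gnum_rel \<Omega> `` {0}"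

definition moderate_points :: "(real^'n::finite) set \<Rightarrow> 'n gpoint set" where
  "moderate_points \<Omega> =
     {X \<in> basic_maps \<Omega>.
        (\<forall>\<phi> \<in> topspace (SKI \<Omega>). \<forall>\<epsilon>\<in>unit_ivl. X \<phi> \<epsilon> \<in> \<Omega>) \<and> moderate_map \<Omega> X}"

definition gpoint_rel :: "(real^'n::finite) set \<Rightarrow> 'n gpoint rel" where
  "gpoint_rel \<Omega> = quot_rel (moderate_points \<Omega>) {X. negligible_map \<Omega> X}"

definition gen_points :: "(real^'n::finite) set \<Rightarrow> 'n gpoint set set" where
  "gen_points \<Omega> = moderate_points \<Omega> // gpoint_rel \<Omega>"

definition compact_points :: "(real^'n::finite) set \<Rightarrow> 'n gpoint set set" where
  "compact_points \<Omega> =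
     {Xt \<in> gen_points \<Omega>. \<exists>X\<in>Xt. \<exists>K. compact K \<and> K \<subseteq> \<Omega> \<and>
        (\<forall>\<phi> \<in> test_objs \<Omega>. \<exists>\<epsilon>\<^sub>0>0. \<forall>\<epsilon>\<in>unit_ivl. \<epsilon> < \<epsilon>\<^sub>0 \<longrightarrow> X \<phi> \<epsilon> \<in> K)}"

definition eps_local :: "(real^'n::finite) set \<Rightarrow> 'n gpoint \<Rightarrow> bool" where
  "eps_local \<Omega> X \<longleftrightarrow>
     (\<forall>\<phi> \<in> topspace (SKI \<Omega>). \<forall>\<psi> \<in> topspace (SKI \<Omega>). \<forall>\<epsilon>\<in>unit_ivl. X \<phi> \<epsilon> = X \<psi> \<epsilon>)"

definition phi_eps_local :: "(real^'n::finite) set \<Rightarrow> 'n gpoint \<Rightarrow> bool" where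
  "phi_eps_local \<Omega> X \<longleftrightarrow>
     (\<forall>\<phi> \<in> topspace (SKI \<Omega>). \<forall>\<psi> \<in> topspace (SKI \<Omega>). \<forall>\<epsilon>\<in>unit_ivl. \<forall>\<eta>\<in>unit_ivl.
        \<phi> \<epsilon> = \<psi> \<eta> \<longrightarrow> X \<phi> \<epsilon> = X \<psi> \<eta>)"

definition compact_points_eps :: "(real^'n::finite) set \<Rightarrow> 'n gpoint set set" where
  "compact_points_eps \<Omega> = {Xt \<in> compact_points \<Omega>. \<exists>X\<in>Xt. eps_local \<Omega> X}"

definition compact_points_phi_eps :: "(real^'n::finite) set \<Rightarrow> 'n gpoint set set" where
  "compact_points_phi_eps \<Omega> = {Xt \<in> compact_points \<Omega>. \<exists>X\<in>Xt. phi_eps_local \<Omega> X}"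

section \<open>Point values\<close>

definition rep_value :: "'n gfun \<Rightarrow> 'n gpoint \<Rightarrow> 'n gnum" where
  "rep_value R X = (\<lambda>\<phi> \<epsilon>. R \<phi> \<epsilon> (X \<phi> \<epsilon>))"

text \<open>
  The class of \<open>R(X)\<close>, lifted to the quotients by collecting the images of all representatives.
\<close>

definition point_value ::
  "(real^'n::finite) set \<Rightarrow> 'n gfun set \<Rightarrow> 'n gpoint set \<Rightarrow> 'n gnum set" where
  "point_value \<Omega> Rt Xt = gnum_rel \<Omega> `` {rep_value R X | R X. R \<in> Rt \<and> X \<in> Xt}"

end

theory Submission
  imports Defs
begin

text \<open>
  By the chain rule, the differentials of \<open>R(X)\<close> are sums of products of differentials of the
  components of \<open>X\<close> with values at \<open>X\<close> of spatial derivatives of differentials of \<open>R\<close>, so \<open>R(X)\<close> is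
  negligible if \<open>R\<close> is. That these differentials exist, and are smooth and linear, follows from the
  behaviour along smooth curves by a Boman type argument.

  Conversely, Landau--Kolmogorov interpolation reduces the negligibility of \<open>R\<close> to bounds for
  \<open>|d\<^sup>k R(\<phi>)(\<psi>\<^sub>1, \<dots>, \<psi>\<^sub>k)\<^sub>\<epsilon>(x\<^sub>\<epsilon>)|\<close> with \<open>x\<^sub>\<epsilon>\<close> in a compact set, and the \<open>\<epsilon>\<close>-local point
  \<open>X(\<phi>)\<^sub>\<epsilon> = x\<^sub>\<epsilon>\<close> has these as its point values. This point need not be \<open>\<phi>\<^sub>\<epsilon>\<close>-local, since different
  \<open>\<epsilon>\<close> may share a kernel. If the bounds fail along \<open>\<epsilon>\<^sub>k\<close> with \<open>x\<^sub>\<epsilon>\<close> converging to \<open>x\<^sub>0\<close>, the functions \<open>\<phi>\<^sub>\<epsilon>(x\<^sub>0)\<close> are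
  unbounded, because their integrals tend to 1 while their supports shrink; by a gliding hump there is
  a distribution \<open>u\<close> for which the numbers \<open>l\<^sub>k = Re u(\<phi>\<^sub>\<epsilon>(x\<^sub>0))\<close> at \<open>\<epsilon> = \<epsilon>\<^sub>k\<close> grow as fast as needed on a
  subsequence. A smooth curve \<open>Z\<close> that is constant near \<open>l\<^sub>k\<close> with the value \<open>x\<^sub>\<epsilon>\<close> at \<open>\<epsilon> = \<epsilon>\<^sub>k\<close> then gives the point
  \<open>X(\<phi>)\<^sub>\<epsilon> = Z(Re u(\<phi>\<^sub>\<epsilon>(x\<^sub>0)))\<close>, which depends on \<open>\<phi>\<^sub>\<epsilon>\<close> only.
\<close>

subsection \<open>Seminorms and locally convex spaces\<close>

text \<open>Smoothness is given only along curves, \<open>dir_deriv\<close> is a definite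
  description that says nothing unless the limit exists, and the suprema in the seminorms of
  \<open>SK\<close> mean nothing unless they are finite. Existence and finiteness have to be drawn
  from curves before anything can be computed; this is where sequential completeness of the target
  spaces, the test functions included, enters. In the converse direction the obstacle is that the
  differentials of \<open>R(X)\<close> mix those of \<open>R\<close> with those of \<open>X\<close>.
  It disappears for points that are constant, at the given \<epsilon>, on a set of nets open along
  lines: there the differentials of \<open>R(X)\<close> are those of \<open>R\<close> at a fixed
  point of \<Omega>. Hence the plateaus of the curve Z, and hence gaps of 4 between the numbers
  \<open>l_k\<close>, which keep the bumps disjoint. The base point is frozen at \<open>x_0\<close>
  so that the number fed into Z is real linear and continuous in the kernel; on 0-test objects it is
  moderate by condition (ii), and all derivatives of Z are bounded, however fast the
  \<open>l_k\<close> grow.\<close>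

definition real_seminorm :: "'a::real_vector set \<Rightarrow> ('a \<Rightarrow> real) \<Rightarrow> bool" where
  "real_seminorm V p \<longleftrightarrow>
     (\<forall>x\<in>V. \<forall>y\<in>V. p (x + y) \<le> p x + p y) \<and> (\<forall>r. \<forall>x\<in>V. p (r *\<^sub>R x) = \<bar>r\<bar> * p x)"

text \<open>The calculus of curves uses real scalars only, and its targets include
  \<open>real^'n\<close>, which is no \<open>complex_vector\<close>; so it is built on real
  homogeneity, and complex seminorms enter through this lemma.\<close>

lemma real_seminorm_of_seminorm_on: "seminorm_on V p \<Longrightarrow> real_seminorm V p"
  unfolding seminorm_on_def real_seminorm_def by (metis scaleC_of_real norm_of_real)

lemma real_seminorm_norm: "real_seminorm V norm"
  by (simp add: real_seminorm_def norm_triangle_ineq)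

context
  fixes V :: "'a::real_vector set" and p
  assumes V: "subspace V" and p: "real_seminorm V p"
begin

lemma real_seminorm_zero: "p 0 = 0"
  using p subspace_0[OF V] unfolding real_seminorm_def by (metis abs_zero mult_zero_left scaleR_zero_left)

lemma real_seminorm_scaleR: "x \<in> V \<Longrightarrow> p (r *\<^sub>R x) = \<bar>r\<bar> * p x"
  using p unfolding real_seminorm_def by blast

lemma real_seminorm_minus: "x \<in> V \<Longrightarrow> p (- x) = p x"
  using real_seminorm_scaleR[of x "-1"] by simp

lemma real_seminorm_add: "x \<in> V \<Longrightarrow> y \<in> V \<Longrightarrow> p (x + y) \<le> p x + p y"
  using p unfolding real_seminorm_def by blast

lemma real_seminorm_diff: "x \<in> V \<Longrightarrow> y \<in> V \<Longrightarrow> p (x - y) \<le> p x + p y"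
  using real_seminorm_add[of x "-y"] real_seminorm_minus[of y] subspace_neg[OF V] by simp

lemma real_seminorm_nonneg: "x \<in> V \<Longrightarrow> 0 \<le> p x"
  using real_seminorm_diff[of x x] real_seminorm_zero by simp

lemma real_seminorm_commute: "x \<in> V \<Longrightarrow> y \<in> V \<Longrightarrow> p (x - y) = p (y - x)"
  using real_seminorm_minus[of "x - y"] subspace_diff[OF V] by simp

lemma real_seminorm_triangle: "x \<in> V \<Longrightarrow> y \<in> V \<Longrightarrow> z \<in> V \<Longrightarrow> p (x - z) \<le> p (x - y) + p (y - z)"
  using real_seminorm_add[of "x - y" "y - z"] subspace_diff[OF V] by simp

lemma real_seminorm_reverse: "x \<in> V \<Longrightarrow> y \<in> V \<Longrightarrow> \<bar>p x - p y\<bar> \<le> p (x - y)"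
  using real_seminorm_add[of "x - y" y] real_seminorm_add[of "y - x" x] real_seminorm_commute[of x y]
    subspace_diff[OF V, of x y] subspace_diff[OF V, of y x] by (simp add: abs_le_iff)

end

lemma sup0_upper: "bdd_above A \<Longrightarrow> a \<in> A \<Longrightarrow> a \<le> sup0 A"
  unfolding sup0_def by (rule cSup_upper) auto

lemma sup0_least: "0 \<le> B \<Longrightarrow> (\<And>a. a \<in> A \<Longrightarrow> a \<le> B) \<Longrightarrow> sup0 A \<le> B"
  unfolding sup0_def by (rule cSup_least) auto

lemma sup0_nonneg: "bdd_above A \<Longrightarrow> 0 \<le> sup0 A"
  unfolding sup0_def by (rule cSup_upper) auto

lemma sup0_scale:
  assumes "bdd_above A" "0 \<le> c"
  shows "sup0 ((\<lambda>a. c * a) ` A) = c * sup0 A"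
proof (cases "c = 0")
  case True
  then have "insert 0 ((\<lambda>a. c * a) ` A) = {0}" by auto
  then show ?thesis unfolding sup0_def using True by (metis cSup_singleton mult_zero_left)
next
  case False
  then have c: "c > 0" using assms by simp
  have b: "bdd_above ((\<lambda>a. c * a) ` A)"
    using assms unfolding bdd_above_def by (auto intro: mult_left_mono)
  show ?thesis
  proof (rule antisym)
    show "sup0 ((\<lambda>a. c * a) ` A) \<le> c * sup0 A"
      using assms by (intro sup0_least) (auto intro!: mult_left_mono sup0_upper sup0_nonneg mult_nonneg_nonneg)
    have "sup0 A \<le> sup0 ((\<lambda>a. c * a) ` A) / c"
    proof (rule sup0_least)
      fix a assume "a \<in> A"
      then show "a \<le> sup0 ((\<lambda>a. c * a) ` A) / c"
        using sup0_upper[OF b, of "c * a"] c by (simp add: field_simps)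
    qed (use c sup0_nonneg[OF b] in simp)
    then show "c * sup0 A \<le> sup0 ((\<lambda>a. c * a) ` A)" using c by (simp add: field_simps)
  qed
qed

text \<open>The suprema must be bounded: the supremum of an unbounded set of reals is a junk value.\<close>

lemma sup0_subadditive:
  assumes "\<And>x. x \<in> K \<Longrightarrow> q x (f + g) \<le> q x f + q x g"
    and "bdd_above {q x f | x. x \<in> K}" "bdd_above {q x g | x. x \<in> K}"
  shows "sup0 {q x (f + g) | x. x \<in> K} \<le> sup0 {q x f | x. x \<in> K} + sup0 {q x g | x. x \<in> K}"
proof (rule sup0_least)
  show "0 \<le> sup0 {q x f | x. x \<in> K} + sup0 {q x g | x. x \<in> K}"
    using assms by (simp add: sup0_nonneg)
  fix a assume "a \<in> {q x (f + g) | x. x \<in> K}"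
  then obtain x where x: "x \<in> K" "a = q x (f + g)" by blast
  show "a \<le> sup0 {q x f | x. x \<in> K} + sup0 {q x g | x. x \<in> K}"
    unfolding x by (rule order_trans[OF assms(1)[OF x(1)] add_mono]; rule sup0_upper) (use assms x in auto)
qed

lemma real_seminorm_sup0:
  assumes "\<And>x. x \<in> K \<Longrightarrow> real_seminorm V (q x)"
    and "\<And>f. f \<in> V \<Longrightarrow> bdd_above {q x f | x. x \<in> K}"
  shows "real_seminorm V (\<lambda>f. sup0 {q x f | x. x \<in> K})"
  unfolding real_seminorm_def
proof (intro conjI ballI allI)
  fix f g assume "f \<in> V" "g \<in> V"
  then show "sup0 {q x (f + g) | x. x \<in> K} \<le> sup0 {q x f | x. x \<in> K} + sup0 {q x g | x. x \<in> K}"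
    using assms by (intro sup0_subadditive) (auto simp: real_seminorm_def)
next
  fix r :: real and f assume f: "f \<in> V"
  have "{q x (r *\<^sub>R f) | x. x \<in> K} = (\<lambda>x. q x (r *\<^sub>R f)) ` K" by auto
  also have "\<dots> = (\<lambda>x. \<bar>r\<bar> * q x f) ` K"
    using assms(1) f by (intro image_cong refl) (simp add: real_seminorm_def)
  also have "\<dots> = (\<lambda>a. \<bar>r\<bar> * a) ` {q x f | x. x \<in> K}" by auto
  finally have "{q x (r *\<^sub>R f) | x. x \<in> K} = (\<lambda>a. \<bar>r\<bar> * a) ` {q x f | x. x \<in> K}" .
  then show "sup0 {q x (r *\<^sub>R f) | x. x \<in> K} = \<bar>r\<bar> * sup0 {q x f | x. x \<in> K}"
    using sup0_scale[OF assms(2)[OF f], of "\<bar>r\<bar>"] by simp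
qed

lemma seminorm_on_sup0:
  assumes "\<And>x. x \<in> K \<Longrightarrow> seminorm_on V (q x)"
    and "\<And>f. f \<in> V \<Longrightarrow> bdd_above {q x f | x. x \<in> K}"
  shows "seminorm_on V (\<lambda>f. sup0 {q x f | x. x \<in> K})"
  unfolding seminorm_on_def
proof (intro conjI ballI allI)
  fix f g assume "f \<in> V" "g \<in> V"
  then show "sup0 {q x (f + g) | x. x \<in> K} \<le> sup0 {q x f | x. x \<in> K} + sup0 {q x g | x. x \<in> K}"
    using assms by (intro sup0_subadditive) (auto simp: seminorm_on_def)
next
  fix r :: complex and f assume f: "f \<in> V"
  have "{q x (r *\<^sub>C f) | x. x \<in> K} = (\<lambda>x. q x (r *\<^sub>C f)) ` K" by auto
  also have "\<dots> = (\<lambda>x. cmod r * q x f) ` K"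
    using assms(1) f by (intro image_cong refl) (simp add: seminorm_on_def)
  also have "\<dots> = (\<lambda>a. cmod r * a) ` {q x f | x. x \<in> K}" by auto
  finally have "{q x (r *\<^sub>C f) | x. x \<in> K} = (\<lambda>a. cmod r * a) ` {q x f | x. x \<in> K}" .
  then show "sup0 {q x (r *\<^sub>C f) | x. x \<in> K} = cmod r * sup0 {q x f | x. x \<in> K}"
    using sup0_scale[OF assms(2)[OF f], of "cmod r"] by simp
qed

text \<open>Limits are only needed along filters on the reals: a locale cannot fix a polymorphic law.\<close>

locale lcs =
  fixes T :: "'a::real_vector topology" and P :: "('a \<Rightarrow> real) set"
  assumes subspace: "subspace (topspace T)"
    and seminorm: "p \<in> P \<Longrightarrow> real_seminorm (topspace T) p"
    and separating: "x \<in> topspace T \<Longrightarrow> (\<And>p. p \<in> P \<Longrightarrow> p x = 0) \<Longrightarrow> x = 0"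
    and limitin_iff: "limitin T f l (F :: real filter) \<longleftrightarrow>
      l \<in> topspace T \<and> (\<forall>\<^sub>F h in F. f h \<in> topspace T) \<and> (\<forall>p\<in>P. ((\<lambda>h. p (f h - l)) \<longlongrightarrow> 0) F)"

text \<open>Completeness for sequences is what the construction of partial derivatives needs: they
  are obtained as limits of difference quotients with the steps \<open>(1/2)^n\<close>.\<close>

locale complete_lcs = lcs +
  assumes complete: "(\<And>n::nat. X n \<in> topspace T) \<Longrightarrow>
      (\<And>p e. p \<in> P \<Longrightarrow> e > 0 \<Longrightarrow> \<exists>N. \<forall>m\<ge>N. \<forall>n\<ge>N. p (X m - X n) < e) \<Longrightarrow>
      \<exists>l\<in>topspace T. \<forall>p\<in>P. (\<lambda>n. p (X n - l)) \<longlonglongrightarrow> 0"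

section \<open>Topologies generated by seminorms\<close>

lemma topspace_seminorm_topology: "topspace (seminorm_topology V P) = V"
  unfolding seminorm_topology_def by auto

lemma openin_seminorm_ball:
  assumes "p \<in> P" "x \<in> V" "r > 0"
  shows "openin (seminorm_topology V P) {y \<in> V. p (y - x) < r}"
  unfolding seminorm_topology_def
  by (rule topology_generated_by_Basis) (use assms in auto)

text \<open>The generating balls have arbitrary centres \<open>z\<close>. By the triangle inequality
  such a ball contains one centred at \<open>x\<close> with radius \<open>r - p (x - z)\<close>;
  induction over the generated topology then only has to handle intersections and unions.\<close>

lemma openin_seminorm_topology_imp:
  assumes V: "subspace V" and P: "\<forall>p\<in>P. real_seminorm V p"
    and "openin (seminorm_topology V P) U" "x \<in> U"
  shows "\<exists>Q r. finite Q \<and> Q \<subseteq> P \<and> r > 0 \<and> {y \<in> V. \<forall>p\<in>Q. p (y - x) < r} \<subseteq> U"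
proof -
  let ?S = "insert V {{y \<in> V. p (y - x) < r} | p x r. p \<in> P \<and> x \<in> V \<and> r > 0}"
  have "generate_topology_on ?S U"
    using assms(3) unfolding seminorm_topology_def by (rule openin_topology_generated_by)
  then show ?thesis using \<open>x \<in> U\<close>
  proof (induction rule: generate_topology_on.induct)
    case Empty then show ?case by simp
  next
    case (Int A B)
    from Int obtain Q r where A: "finite Q" "Q \<subseteq> P" "r > 0" "{y \<in> V. \<forall>p\<in>Q. p (y - x) < r} \<subseteq> A" by blast
    from Int obtain Q' r' where B: "finite Q'" "Q' \<subseteq> P" "r' > 0" "{y \<in> V. \<forall>p\<in>Q'. p (y - x) < r'} \<subseteq> B" by blast
    show ?case
      by (rule exI[of _ "Q \<union> Q'"], rule exI[of _ "min r r'"]) (use A B in auto)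
  next
    case (UN K) then show ?case by (meson Union_iff Union_upper order_trans)
  next
    case (Basis s)
    show ?case
    proof (cases "s = V")
      case True
      then show ?thesis by (intro exI[of _ "{}"] exI[of _ 1]) auto
    next
      case False
      with Basis(1) obtain p z r where s: "s = {y \<in> V. p (y - z) < r}" "p \<in> P" "z \<in> V" "r > 0" by blast
      with Basis have x: "x \<in> V" "p (x - z) < r" by auto
      have "p (y - z) < r" if "y \<in> V" "p (y - x) < r - p (x - z)" for y
        using real_seminorm_triangle[OF V bspec[OF P], OF s(2) that(1) x(1) s(3)] that by simp
      then show ?thesis
        by (intro exI[of _ "{p}"] exI[of _ "r - p (x - z)"]) (use s x in auto)
    qed
  qed
qed

lemma limitin_seminorm_topology:
  assumes V: "subspace V" and P: "\<forall>p\<in>P. real_seminorm V p"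
  shows "limitin (seminorm_topology V P) f l F \<longleftrightarrow>
    l \<in> V \<and> (\<forall>\<^sub>F h in F. f h \<in> V) \<and> (\<forall>p\<in>P. ((\<lambda>h. p (f h - l)) \<longlongrightarrow> 0) F)"
proof
  assume L: "limitin (seminorm_topology V P) f l F"
  then have l: "l \<in> V" unfolding limitin_def topspace_seminorm_topology by blast
  have "openin (seminorm_topology V P) V"
    using openin_topspace[of "seminorm_topology V P"] by (simp add: topspace_seminorm_topology)
  then have ev: "\<forall>\<^sub>F h in F. f h \<in> V" using L l unfolding limitin_def by blast
  have "((\<lambda>h. p (f h - l)) \<longlongrightarrow> 0) F" if p: "p \<in> P" for p
  proof (rule tendstoI)
    fix e :: real assume "e > 0"
    have "l \<in> {y \<in> V. p (y - l) < e}"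
      using l real_seminorm_zero[OF V bspec[OF P p]] \<open>e > 0\<close> by simp
    then have "\<forall>\<^sub>F h in F. f h \<in> {y \<in> V. p (y - l) < e}"
      using L openin_seminorm_ball[OF p l \<open>e > 0\<close>] unfolding limitin_def by blast
    then show "\<forall>\<^sub>F h in F. dist (p (f h - l)) 0 < e"
    proof eventually_elim
      case (elim h)
      then show ?case using real_seminorm_nonneg[OF V bspec[OF P p], of "f h - l"] subspace_diff[OF V _ l] by auto
    qed
  qed
  with l ev show "l \<in> V \<and> (\<forall>\<^sub>F h in F. f h \<in> V) \<and> (\<forall>p\<in>P. ((\<lambda>h. p (f h - l)) \<longlongrightarrow> 0) F)" by blast
next
  assume A: "l \<in> V \<and> (\<forall>\<^sub>F h in F. f h \<in> V) \<and> (\<forall>p\<in>P. ((\<lambda>h. p (f h - l)) \<longlongrightarrow> 0) F)"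
  show "limitin (seminorm_topology V P) f l F"
    unfolding limitin_def topspace_seminorm_topology
  proof (intro conjI allI impI)
    show "l \<in> V" using A by blast
    fix U assume U: "openin (seminorm_topology V P) U \<and> l \<in> U"
    obtain Q r where Q: "finite Q" "Q \<subseteq> P" "r > 0" "{y \<in> V. \<forall>p\<in>Q. p (y - l) < r} \<subseteq> U"
      using openin_seminorm_topology_imp[OF V P conjunct1[OF U] conjunct2[OF U]] by blast
    have "\<forall>\<^sub>F h in F. p (f h - l) < r" if "p \<in> Q" for p
      by (rule order_tendstoD(2)[of _ 0]) (use that A Q in auto)
    then have "\<forall>\<^sub>F h in F. \<forall>p\<in>Q. p (f h - l) < r"
      using Q by (intro eventually_ball_finite) auto
    with A have "\<forall>\<^sub>F h in F. f h \<in> V \<and> (\<forall>p\<in>Q. p (f h - l) < r)"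
      by (simp add: eventually_conj)
    then show "\<forall>\<^sub>F h in F. f h \<in> U"
      by (rule eventually_mono) (use Q in auto)
  qed
qed

lemma lcs_seminorm_topology:
  assumes "subspace V" "\<And>p. p \<in> P \<Longrightarrow> real_seminorm V p"
    and "\<And>x. x \<in> V \<Longrightarrow> (\<And>p. p \<in> P \<Longrightarrow> p x = 0) \<Longrightarrow> x = 0"
  shows "lcs (seminorm_topology V P) P"
  by standard (simp_all add: topspace_seminorm_topology limitin_seminorm_topology assms)

text \<open>The reverse triangle inequality and the value at 0 are hypotheses here, so that the rule
  also serves for spaces of linear maps, which are never shown to be subspaces.\<close>

lemma csn_seminorm_topologyI:
  assumes "p \<in> P" "seminorm_on V p"
    and "\<And>x y. x \<in> V \<Longrightarrow> y \<in> V \<Longrightarrow> \<bar>p y - p x\<bar> \<le> p (y - x)" "p 0 = 0"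
  shows "p \<in> csn (seminorm_topology V P)"
  unfolding csn_def topspace_seminorm_topology
proof (intro CollectI conjI assms(2))
  show "continuous_map (seminorm_topology V P) euclideanreal p"
    unfolding continuous_map topspace_seminorm_topology
  proof (intro conjI allI impI)
    fix U :: "real set" assume "openin euclideanreal U"
    then have U: "open U" by simp
    show "openin (seminorm_topology V P) {x \<in> V. p x \<in> U}"
    proof (subst openin_subopen, intro ballI)
      fix x assume x: "x \<in> {x \<in> V. p x \<in> U}"
      then obtain e where e: "e > 0" "\<And>y. \<bar>y - p x\<bar> < e \<Longrightarrow> y \<in> U"
        using U unfolding open_dist by (auto simp: dist_real_def)
      show "\<exists>S. openin (seminorm_topology V P) S \<and> x \<in> S \<and> S \<subseteq> {x \<in> V. p x \<in> U}"
      proof (intro exI conjI)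
        show "openin (seminorm_topology V P) {y \<in> V. p (y - x) < e}"
          using x assms e by (intro openin_seminorm_ball) auto
        show "x \<in> {y \<in> V. p (y - x) < e}" using x e assms(4) by simp
        show "{y \<in> V. p (y - x) < e} \<subseteq> {x \<in> V. p x \<in> U}"
          using assms(3) e x by (smt (verit) mem_Collect_eq subsetI)
      qed
    qed
  qed simp
qed

lemma csn_generating:
  assumes V: "subspace V" and "p \<in> P" "seminorm_on V p"
  shows "p \<in> csn (seminorm_topology V P)"
  by (rule csn_seminorm_topologyI[OF assms(2,3)])
    (use real_seminorm_reverse[OF V real_seminorm_of_seminorm_on[OF assms(3)]]
      real_seminorm_zero[OF V real_seminorm_of_seminorm_on[OF assms(3)]] in auto)

text \<open>The set where \<open>q\<close> is less than 1 is a neighbourhood of 0, hence contains a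
  finite intersection of balls of the generating seminorms; homogeneity turns this inclusion into an
  inequality.\<close>

lemma csn_dominated:
  assumes V: "subspace V" and P: "\<forall>p\<in>P. real_seminorm V p"
    and q: "q \<in> csn (seminorm_topology V P)"
  shows "\<exists>Q C. finite Q \<and> Q \<subseteq> P \<and> C > 0 \<and> (\<forall>x\<in>V. q x \<le> C * (\<Sum>p\<in>Q. p x))"
proof -
  have sq: "real_seminorm V q" and cq: "continuous_map (seminorm_topology V P) euclideanreal q"
    using q by (auto simp: csn_def topspace_seminorm_topology intro: real_seminorm_of_seminorm_on)
  have op: "openin (seminorm_topology V P) {x \<in> V. q x \<in> {..<1}}"
    using openin_continuous_map_preimage[OF cq, of "{..<1}"] by (simp add: topspace_seminorm_topology)
  have "0 \<in> {x \<in> V. q x \<in> {..<1}}"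
    using real_seminorm_zero[OF V sq] subspace_0[OF V] by simp
  from openin_seminorm_topology_imp[OF V P op this] obtain Q r where Q: "finite Q" "Q \<subseteq> P" "r > 0"
      and sub: "{y \<in> V. \<forall>p\<in>Q. p (y - 0) < r} \<subseteq> {x \<in> V. q x \<in> {..<1}}"
    by (elim exE conjE)
  have "q x \<le> (2 / r) * (\<Sum>p\<in>Q. p x)" if x: "x \<in> V" for x
  proof -
    define s where "s = (\<Sum>p\<in>Q. p x)"
    have le: "p x \<le> s" if "p \<in> Q" for p
      unfolding s_def using that Q real_seminorm_nonneg[OF V bspec[OF P] x] by (intro member_le_sum) auto
    have s0: "0 \<le> s" unfolding s_def using Q real_seminorm_nonneg[OF V bspec[OF P] x] by (intro sum_nonneg) auto
    \<comment> \<open>\<open>t\<close> may exceed the sum \<open>s\<close>: it is taken equal to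
      \<open>s\<close> if \<open>s > 0\<close>, and is sent to 0 if \<open>s = 0\<close>. The factor
      2 keeps the rescaled vector strictly inside the balls.\<close>
    have small: "q x \<le> 2 / r * t" if t: "t > 0" "s \<le> t" for t
    proof -
      have "(r / (2 * t)) *\<^sub>R x \<in> {y \<in> V. \<forall>p\<in>Q. p (y - 0) < r}"
      proof (intro CollectI conjI ballI)
        show "(r / (2 * t)) *\<^sub>R x \<in> V" using V x by (rule subspace_scale)
        fix p assume p: "p \<in> Q"
        have "p ((r / (2 * t)) *\<^sub>R x - 0) = r / (2 * t) * p x"
          using real_seminorm_scaleR[OF V bspec[OF P] x, of p "r / (2*t)"] p Q t by auto
        also have "\<dots> \<le> r / (2 * t) * t" using le[OF p] t Q by (intro mult_left_mono) auto
        also have "\<dots> < r" using t Q by simp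
        finally show "p ((r / (2 * t)) *\<^sub>R x - 0) < r" .
      qed
      then have "q ((r / (2 * t)) *\<^sub>R x) < 1" using sub by blast
      then have "r / (2 * t) * q x < 1"
        using real_seminorm_scaleR[OF V sq x, of "r / (2*t)"] t Q by auto
      then show ?thesis using t Q by (simp add: field_simps)
    qed
    show ?thesis
    proof (cases "s > 0")
      case True then show ?thesis using small[of s] by (simp add: s_def)
    next
      case False
      with s0 have s: "s = 0" by simp
      have "q x \<le> 0"
      proof (rule field_le_epsilon)
        fix e :: real assume "e > 0"
        then show "q x \<le> 0 + e" using small[of "e * r / 2"] Q s by simp
      qed
      then show ?thesis using s by (simp add: s_def)
    qed
  qed
  then show ?thesis using Q by (intro exI[of _ Q] exI[of _ "2 / r"]) auto
qed

lemma csn_tendsto: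
  assumes V: "subspace V" and P: "\<forall>p\<in>P. real_seminorm V p"
    and Pl: "\<forall>p\<in>P. ((\<lambda>h. p (f h - l)) \<longlongrightarrow> 0) F"
    and ev: "\<forall>\<^sub>F h in F. f h \<in> V" and l: "l \<in> V"
    and q: "q \<in> csn (seminorm_topology V P)"
  shows "((\<lambda>h. q (f h - l)) \<longlongrightarrow> 0) F"
proof -
  have sq: "real_seminorm V q"
    using q by (auto simp: csn_def topspace_seminorm_topology intro: real_seminorm_of_seminorm_on)
  obtain Q C where Q: "finite Q" "Q \<subseteq> P" "C > 0" "\<And>x. x \<in> V \<Longrightarrow> q x \<le> C * (\<Sum>p\<in>Q. p x)"
    using csn_dominated[OF V P q] by blast
  have "((\<lambda>h. C * (\<Sum>p\<in>Q. p (f h - l))) \<longlongrightarrow> C * (\<Sum>p\<in>Q. 0)) F"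
    using Q Pl by (intro tendsto_mult tendsto_sum tendsto_const) blast
  then have up: "((\<lambda>h. C * (\<Sum>p\<in>Q. p (f h - l))) \<longlongrightarrow> 0) F" by simp
  have diff: "\<forall>\<^sub>F h in F. f h - l \<in> V"
    using ev by eventually_elim (rule subspace_diff[OF V _ l])
  show ?thesis
  proof (rule tendsto_sandwich[OF _ _ tendsto_const up])
    show "\<forall>\<^sub>F h in F. 0 \<le> q (f h - l)"
      using diff by eventually_elim (rule real_seminorm_nonneg[OF V sq])
    show "\<forall>\<^sub>F h in F. q (f h - l) \<le> C * (\<Sum>p\<in>Q. p (f h - l))"
      using diff by eventually_elim (rule Q(4))
  qed
qed

text \<open>\<open>SK\<close> is defined through all continuous seminorms of \<open>Dspace\<close>,
  so the calculus there is run with \<open>csn\<close> itself as the family of seminorms.\<close>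

lemma lcs_csn:
  assumes V: "subspace V" and P: "\<And>p. p \<in> P \<Longrightarrow> seminorm_on V p"
    and sep: "\<And>x. x \<in> V \<Longrightarrow> (\<And>p. p \<in> P \<Longrightarrow> p x = 0) \<Longrightarrow> x = 0"
  shows "lcs (seminorm_topology V P) (csn (seminorm_topology V P))"
    and "P \<subseteq> csn (seminorm_topology V P)"
proof -
  have P': "\<forall>p\<in>P. real_seminorm V p" using P by (simp add: real_seminorm_of_seminorm_on)
  show sub: "P \<subseteq> csn (seminorm_topology V P)" using csn_generating[OF V] P by blast
  have csn: "real_seminorm V q" if "q \<in> csn (seminorm_topology V P)" for q
    using that by (auto simp: csn_def topspace_seminorm_topology intro: real_seminorm_of_seminorm_on)
  show "lcs (seminorm_topology V P) (csn (seminorm_topology V P))"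
  proof (standard, simp_all only: topspace_seminorm_topology)
    show "x = 0" if "x \<in> V" "\<And>p. p \<in> csn (seminorm_topology V P) \<Longrightarrow> p x = 0" for x
      using that sep sub by blast
    show "limitin (seminorm_topology V P) f l F \<longleftrightarrow> l \<in> V \<and> (\<forall>\<^sub>F h in F. f h \<in> V) \<and>
      (\<forall>p\<in>csn (seminorm_topology V P). ((\<lambda>h. p (f h - l)) \<longlongrightarrow> 0) F)"
      (is "?lhs \<longleftrightarrow> ?l \<and> ?ev \<and> ?lim") for f l and F :: "real filter"
    proof
      assume ?lhs
      then have *: "?l" "?ev" "\<forall>p\<in>P. ((\<lambda>h. p (f h - l)) \<longlongrightarrow> 0) F"
        using limitin_seminorm_topology[OF V P', of f l F] by blast+
      then show "?l \<and> ?ev \<and> ?lim" using csn_tendsto[OF V P' *(3) *(2) *(1)] by blast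
    next
      assume "?l \<and> ?ev \<and> ?lim"
      then show ?lhs using limitin_seminorm_topology[OF V P', of f l F] sub by blast
    qed
  qed (use V csn in auto)
qed

lemma lcs_euclidean: "complete_lcs (euclidean :: 'a::banach topology) {norm}"
proof
  show "\<exists>l\<in>topspace euclidean. \<forall>p\<in>{norm}. (\<lambda>n. p (X n - l)) \<longlonglongrightarrow> 0"
    if C: "\<And>p e. p \<in> {norm} \<Longrightarrow> e > 0 \<Longrightarrow> \<exists>N. \<forall>m\<ge>N. \<forall>n\<ge>N. p (X m - X n) < e" for X :: "nat \<Rightarrow> 'a"
  proof -
    have "Cauchy X" using C[of norm] by (intro CauchyI) auto
    then obtain l where "X \<longlonglongrightarrow> l" using Cauchy_convergent convergent_def by blast
    then have "(\<lambda>n. norm (X n - l)) \<longlonglongrightarrow> 0" by (intro tendsto_norm_zero) (rule LIM_zero)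
    then show ?thesis by auto
  qed
  show "limitin euclidean f l F \<longleftrightarrow> l \<in> topspace euclidean \<and> (\<forall>\<^sub>F h in F. f h \<in> topspace euclidean) \<and>
      (\<forall>p\<in>{norm}. ((\<lambda>h. p (f h - l)) \<longlongrightarrow> 0) F)" for f :: "real \<Rightarrow> 'a" and l F
    by (simp add: tendsto_norm_zero_iff LIM_zero_iff)
qed (auto simp: real_seminorm_norm)

section \<open>Powers over the unit interval\<close>

lemma topspace_power_space:
  "topspace (power_space E) = {f. (\<forall>\<epsilon>. \<epsilon> \<notin> unit_ivl \<longrightarrow> f \<epsilon> = 0) \<and> (\<forall>\<epsilon>\<in>unit_ivl. f \<epsilon> \<in> topspace E)}"
  unfolding power_space_def topspace_pullback_topology by (auto simp: PiE_def Pi_def)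

text \<open>Restriction to \<open>unit_ivl\<close> identifies the space with the library product,
  where convergence is componentwise. Eventual membership stays a separate conjunct, because the
  components in \<open>unit_ivl\<close> do not see the values outside it.\<close>

lemma limitin_power_space:
  "limitin (power_space E) f l F \<longleftrightarrow> l \<in> topspace (power_space E) \<and>
     (\<forall>\<^sub>F h in F. f h \<in> topspace (power_space E)) \<and> (\<forall>\<epsilon>\<in>unit_ivl. limitin E (\<lambda>h. f h \<epsilon>) (l \<epsilon>) F)"
proof -
  let ?A = "{f. \<forall>\<epsilon>. \<epsilon> \<notin> unit_ivl \<longrightarrow> f \<epsilon> = 0}" and ?r = "\<lambda>f :: real \<Rightarrow> 'a. restrict f unit_ivl"
  have "limitin (power_space E) f l F \<longleftrightarrow> l \<in> topspace (power_space E) \<and> (\<forall>\<^sub>F h in F. f h \<in> ?A) \<and>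
      limitin (product_topology (\<lambda>_. E) unit_ivl) (\<lambda>h. ?r (f h)) (?r l) F" (is "?L \<longleftrightarrow> ?R")
  proof
    assume L: ?L
    then have l: "l \<in> topspace (power_space E)" by (simp add: limitin_def)
    then have lr: "?r l \<in> topspace (product_topology (\<lambda>_. E) unit_ivl)"
      by (auto simp: topspace_power_space)
    have ev: "\<forall>\<^sub>F h in F. f h \<in> topspace (power_space E)"
      using L l unfolding limitin_def by blast
    have "\<forall>\<^sub>F h in F. ?r (f h) \<in> U" if "openin (product_topology (\<lambda>_. E) unit_ivl) U" "?r l \<in> U" for U
    proof -
      have "openin (power_space E) (?r -` U \<inter> ?A)"
        unfolding power_space_def openin_pullback_topology using that by blast
      moreover have "l \<in> ?r -` U \<inter> ?A" using that l by (auto simp: topspace_power_space)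
      ultimately have "\<forall>\<^sub>F h in F. f h \<in> ?r -` U \<inter> ?A"
        using L unfolding limitin_def by blast
      then show ?thesis by (rule eventually_mono) auto
    qed
    then have "limitin (product_topology (\<lambda>_. E) unit_ivl) (\<lambda>h. ?r (f h)) (?r l) F"
      unfolding limitin_def using lr by blast
    moreover have "\<forall>\<^sub>F h in F. f h \<in> ?A"
      using ev by (rule eventually_mono) (simp add: topspace_power_space)
    ultimately show ?R using l by blast
  next
    assume R: ?R
    show ?L unfolding limitin_def
    proof (intro conjI allI impI)
      show "l \<in> topspace (power_space E)" using R by blast
      fix U assume U: "openin (power_space E) U \<and> l \<in> U"
      then obtain W where W: "openin (product_topology (\<lambda>_. E) unit_ivl) W" "U = ?r -` W \<inter> ?A"
        unfolding power_space_def openin_pullback_topology by blast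
      then have "\<forall>\<^sub>F h in F. ?r (f h) \<in> W" using R U unfolding limitin_def by blast
      with R have "\<forall>\<^sub>F h in F. f h \<in> ?A \<and> ?r (f h) \<in> W" by (simp add: eventually_conj)
      then show "\<forall>\<^sub>F h in F. f h \<in> U" by (rule eventually_mono) (use W in auto)
    qed
  qed
  also have "\<dots> \<longleftrightarrow> l \<in> topspace (power_space E) \<and>
     (\<forall>\<^sub>F h in F. f h \<in> topspace (power_space E)) \<and> (\<forall>\<epsilon>\<in>unit_ivl. limitin E (\<lambda>h. f h \<epsilon>) (l \<epsilon>) F)"
  proof -
    have "(\<forall>\<epsilon>\<in>unit_ivl. limitin E (\<lambda>h. ?r (f h) \<epsilon>) (?r l \<epsilon>) F) \<longleftrightarrow> (\<forall>\<epsilon>\<in>unit_ivl. limitin E (\<lambda>h. f h \<epsilon>) (l \<epsilon>) F)"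
      by (intro ball_cong refl) simp
    moreover
    have "?r (f h) \<in> topspace (product_topology (\<lambda>_. E) unit_ivl) \<and> f h \<in> ?A \<longleftrightarrow> f h \<in> topspace (power_space E)" for h
      by (auto simp: topspace_power_space PiE_def Pi_def)
    then have "(\<forall>\<^sub>F h in F. f h \<in> ?A) \<and> (\<forall>\<^sub>F h in F. ?r (f h) \<in> topspace (product_topology (\<lambda>_. E) unit_ivl))
        \<longleftrightarrow> (\<forall>\<^sub>F h in F. f h \<in> topspace (power_space E))"
      unfolding eventually_conj_iff[symmetric] by (simp only: conj_commute)
    ultimately show ?thesis
      unfolding limitin_componentwise using restrict_extensional by blast
  qed
  finally show ?thesis .
qed

definition power_seminorms :: "('a \<Rightarrow> real) set \<Rightarrow> ((real \<Rightarrow> 'a) \<Rightarrow> real) set" where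
  "power_seminorms P = {\<lambda>f. p (f \<epsilon>) | p \<epsilon>. p \<in> P \<and> \<epsilon> \<in> unit_ivl}"

lemma (in lcs) lcs_power_space: "lcs (power_space T) (power_seminorms P)"
proof
  show "subspace (topspace (power_space T))"
    using subspace unfolding topspace_power_space subspace_def by (simp add: scaleR_fun_def)
  show "real_seminorm (topspace (power_space T)) q" if "q \<in> power_seminorms P" for q
    using that seminorm unfolding power_seminorms_def real_seminorm_def topspace_power_space
    by (auto simp: scaleR_fun_def)
  show "x = 0" if x: "x \<in> topspace (power_space T)" and "\<And>p. p \<in> power_seminorms P \<Longrightarrow> p x = 0" for x
  proof
    fix \<epsilon>
    have "x \<epsilon> = 0" if "\<epsilon> \<in> unit_ivl"
      using separating[of "x \<epsilon>"] x that \<open>\<And>p. p \<in> power_seminorms P \<Longrightarrow> p x = 0\<close>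
      unfolding power_seminorms_def topspace_power_space by blast
    then show "x \<epsilon> = 0 \<epsilon>" using x by (auto simp: topspace_power_space)
  qed
  show "limitin (power_space T) f l F \<longleftrightarrow> l \<in> topspace (power_space T) \<and>
      (\<forall>\<^sub>F h in F. f h \<in> topspace (power_space T)) \<and> (\<forall>p\<in>power_seminorms P. ((\<lambda>h. p (f h - l)) \<longlongrightarrow> 0) F)"
      (is "_ \<longleftrightarrow> ?l \<and> ?ev \<and> ?lim") for f l and F :: "real filter"
  proof -
    have "(\<forall>\<epsilon>\<in>unit_ivl. limitin T (\<lambda>h. f h \<epsilon>) (l \<epsilon>) F) \<longleftrightarrow> ?lim" if l: ?l and ev: ?ev
    proof -
      have "\<forall>\<^sub>F h in F. f h \<epsilon> \<in> topspace T" if "\<epsilon> \<in> unit_ivl" for \<epsilon>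
        using ev by (rule eventually_mono) (use that in \<open>auto simp: topspace_power_space\<close>)
      then have "limitin T (\<lambda>h. f h \<epsilon>) (l \<epsilon>) F \<longleftrightarrow> (\<forall>p\<in>P. ((\<lambda>h. p (f h \<epsilon> - l \<epsilon>)) \<longlongrightarrow> 0) F)"
        if "\<epsilon> \<in> unit_ivl" for \<epsilon>
        using l that by (simp add: limitin_iff topspace_power_space)
      then have "(\<forall>\<epsilon>\<in>unit_ivl. limitin T (\<lambda>h. f h \<epsilon>) (l \<epsilon>) F) \<longleftrightarrow>
          (\<forall>\<epsilon>\<in>unit_ivl. \<forall>p\<in>P. ((\<lambda>h. p (f h \<epsilon> - l \<epsilon>)) \<longlongrightarrow> 0) F)"
        by (intro ball_cong refl) simp
      also have "\<dots> \<longleftrightarrow> ?lim" unfolding power_seminorms_def by fastforce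
      finally show ?thesis .
    qed
    then show ?thesis unfolding limitin_power_space by blast
  qed
qed

lemma (in complete_lcs) complete_lcs_power_space: "complete_lcs (power_space T) (power_seminorms P)"
proof (intro complete_lcs.intro lcs_power_space, standard)
  fix X :: "nat \<Rightarrow> real \<Rightarrow> 'a"
  assume X: "\<And>n. X n \<in> topspace (power_space T)"
    and C: "\<And>p e. p \<in> power_seminorms P \<Longrightarrow> 0 < e \<Longrightarrow> \<exists>N. \<forall>m\<ge>N. \<forall>n\<ge>N. p (X m - X n) < e"
  have "\<exists>l\<in>topspace T. \<forall>p\<in>P. (\<lambda>n. p (X n \<epsilon> - l)) \<longlonglongrightarrow> 0" if \<epsilon>: "\<epsilon> \<in> unit_ivl" for \<epsilon>
  proof (rule complete)
    show "X n \<epsilon> \<in> topspace T" for n using X \<epsilon> by (simp add: topspace_power_space)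
    show "\<exists>N. \<forall>m\<ge>N. \<forall>n\<ge>N. p (X m \<epsilon> - X n \<epsilon>) < e" if "p \<in> P" "e > 0" for p e
      using C[of "\<lambda>f. p (f \<epsilon>)" e] that \<epsilon> unfolding power_seminorms_def by auto
  qed
  then obtain l where l: "\<And>\<epsilon>. \<epsilon> \<in> unit_ivl \<Longrightarrow> l \<epsilon> \<in> topspace T \<and> (\<forall>p\<in>P. (\<lambda>n. p (X n \<epsilon> - l \<epsilon>)) \<longlonglongrightarrow> 0)"
    by metis
  show "\<exists>l\<in>topspace (power_space T). \<forall>p\<in>power_seminorms P. (\<lambda>n. p (X n - l)) \<longlonglongrightarrow> 0"
    by (rule bexI[of _ "\<lambda>\<epsilon>. if \<epsilon> \<in> unit_ivl then l \<epsilon> else 0"])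
      (use l in \<open>auto simp: power_seminorms_def topspace_power_space\<close>)
qed

subsection \<open>Calculus of curves\<close>

definition curve_deriv :: "'a::real_vector topology \<Rightarrow> (real \<Rightarrow> 'a) \<Rightarrow> real \<Rightarrow> 'a \<Rightarrow> bool" where
  "curve_deriv T c t d \<longleftrightarrow> limitin T (\<lambda>h. inverse h *\<^sub>R (c (t + h) - c t)) d (at 0)"

definition derivs :: "'a::real_vector topology \<Rightarrow> (nat \<Rightarrow> real \<Rightarrow> 'a) \<Rightarrow> bool" where
  "derivs T D \<longleftrightarrow> (\<forall>k t. D k t \<in> topspace T \<and> curve_deriv T (D k) t (D (Suc k) t))"

text \<open>Finite orders of differentiability, so that sums, products and composites can be treated
  by induction on the order; the single infinite sequence of derivatives in
  \<open>smooth_curve\<close> offers no such induction.\<close>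

fun curve_Cn :: "'a::real_vector topology \<Rightarrow> nat \<Rightarrow> (real \<Rightarrow> 'a) \<Rightarrow> bool" where
  "curve_Cn T 0 c \<longleftrightarrow> range c \<subseteq> topspace T"
| "curve_Cn T (Suc n) c \<longleftrightarrow>
     range c \<subseteq> topspace T \<and> (\<exists>c'. (\<forall>t. curve_deriv T c t (c' t)) \<and> curve_Cn T n c')"

lemma smooth_curve_derivs: "smooth_curve T c \<longleftrightarrow> (\<exists>D. D 0 = c \<and> derivs T D)"
  unfolding smooth_curve_def derivs_def curve_deriv_def ..

lemma derivs_shift: "derivs T D \<Longrightarrow> derivs T (\<lambda>k. D (k + j))"
  unfolding derivs_def by simp

lemma derivs_in: "derivs T D \<Longrightarrow> D k t \<in> topspace T"
  unfolding derivs_def by blast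

lemma curve_Cn_range: "curve_Cn T n c \<Longrightarrow> c t \<in> topspace T"
  by (cases n) auto

lemma curve_Cn_mono: "curve_Cn T (Suc n) c \<Longrightarrow> curve_Cn T n c"
proof (induction n arbitrary: c)
  case (Suc n)
  then obtain c' where "range c \<subseteq> topspace T" "\<forall>t. curve_deriv T c t (c' t)" "curve_Cn T (Suc n) c'"
    by auto
  with Suc.IH[of c'] show ?case by auto
qed auto

lemma curve_deriv_cong:
  assumes "\<forall>\<^sub>F s in nhds t. c s = c' s"
  shows "curve_deriv T c t d \<longleftrightarrow> curve_deriv T c' t d"
proof -
  have *: "curve_deriv T c' t d" if "curve_deriv T c t d" "\<forall>\<^sub>F s in nhds t. c s = c' s" for c c' :: "real \<Rightarrow> 'a"
  proof -
    have "filterlim (\<lambda>h. t + h) (nhds t) (at 0)"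
      using tendsto_add[OF tendsto_const tendsto_ident_at, of t 0] by simp
    then have "\<forall>\<^sub>F h in at 0. c (t + h) = c' (t + h)"
      using that(2) unfolding filterlim_iff by blast
    moreover have "c t = c' t" using that(2) by (rule eventually_nhds_x_imp_x)
    ultimately have "\<forall>\<^sub>F h in at 0. inverse h *\<^sub>R (c (t + h) - c t) = inverse h *\<^sub>R (c' (t + h) - c' t)"
      by (auto elim: eventually_mono)
    then show ?thesis
      using that(1) unfolding curve_deriv_def by (rule limitin_transform_eventually)
  qed
  have "\<forall>\<^sub>F s in nhds t. c' s = c s" using assms by (rule eventually_mono) simp
  then show ?thesis using * assms by blast
qed

context lcs
begin

lemmas p_zero = real_seminorm_zero[OF subspace seminorm]
  and p_scaleR = real_seminorm_scaleR[OF subspace seminorm]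
  and p_add = real_seminorm_add[OF subspace seminorm]
  and p_diff = real_seminorm_diff[OF subspace seminorm]
  and p_nonneg = real_seminorm_nonneg[OF subspace seminorm]
  and p_commute = real_seminorm_commute[OF subspace seminorm]
  and p_triangle = real_seminorm_triangle[OF subspace seminorm]
  and p_reverse = real_seminorm_reverse[OF subspace seminorm]

lemmas in_add = subspace_add[OF subspace]
  and in_diff = subspace_diff[OF subspace]
  and in_scale = subspace_scale[OF subspace]
  and in_zero = subspace_0[OF subspace]

lemma curve_deriv_iff_tendsto:
  assumes "range c \<subseteq> topspace T"
  shows "curve_deriv T c t d \<longleftrightarrow>
    d \<in> topspace T \<and> (\<forall>p\<in>P. ((\<lambda>h. p (inverse h *\<^sub>R (c (t + h) - c t) - d)) \<longlongrightarrow> 0) (at 0))"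
proof -
  have "inverse h *\<^sub>R (c (t + h) - c t) \<in> topspace T" for h
    by (intro in_scale in_diff) (use assms in auto)
  then show ?thesis unfolding curve_deriv_def limitin_iff by simp
qed

text \<open>The form without division makes sense at \<open>h = 0\<close> too and survives the
  substitution of another increment for \<open>h\<close>, as the chain rule and the mean value
  estimate require.\<close>

lemma curve_deriv_iff:
  assumes c: "range c \<subseteq> topspace T"
  shows "curve_deriv T c t d \<longleftrightarrow> d \<in> topspace T \<and>
    (\<forall>p\<in>P. \<forall>e>0. \<exists>\<delta>>0. \<forall>h. \<bar>h\<bar> < \<delta> \<longrightarrow> p (c (t + h) - c t - h *\<^sub>R d) \<le> e * \<bar>h\<bar>)"
proof -
  have "((\<lambda>h. p (inverse h *\<^sub>R (c (t + h) - c t) - d)) \<longlongrightarrow> 0) (at 0) \<longleftrightarrow>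
      (\<forall>e>0. \<exists>\<delta>>0. \<forall>h. \<bar>h\<bar> < \<delta> \<longrightarrow> p (c (t + h) - c t - h *\<^sub>R d) \<le> e * \<bar>h\<bar>)"
      (is "?L \<longleftrightarrow> ?R") if p: "p \<in> P" and d: "d \<in> topspace T" for p
  proof -
    have in1: "c (t + h) - c t - h *\<^sub>R d \<in> topspace T" for h
      by (intro in_diff in_scale d) (use c in auto)
    have in2: "inverse h *\<^sub>R (c (t + h) - c t) - d \<in> topspace T" for h
      by (intro in_diff in_scale d) (use c in auto)
    have eq: "p (inverse h *\<^sub>R (c (t + h) - c t) - d) = p (c (t + h) - c t - h *\<^sub>R d) / \<bar>h\<bar>" if "h \<noteq> 0" for h
    proof -
      have "inverse h *\<^sub>R (c (t + h) - c t) - d = inverse h *\<^sub>R (c (t + h) - c t - h *\<^sub>R d)"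
        using that by (simp add: scaleR_diff_right)
      then show ?thesis using p_scaleR[OF p in1, of "inverse h" h] by (simp add: field_simps)
    qed
    show ?thesis
    proof
      assume ?L
      show ?R
      proof (intro allI impI)
        fix e :: real assume "e > 0"
        then have "\<forall>\<^sub>F h in at 0. p (inverse h *\<^sub>R (c (t + h) - c t) - d) < e"
          using \<open>?L\<close> order_tendstoD(2) by blast
        then obtain \<delta> where \<delta>: "\<delta> > 0" "\<And>h. h \<noteq> 0 \<Longrightarrow> \<bar>h\<bar> < \<delta> \<Longrightarrow> p (inverse h *\<^sub>R (c (t + h) - c t) - d) < e"
          unfolding eventually_at by (auto simp: dist_real_def)
        have "p (c (t + h) - c t - h *\<^sub>R d) \<le> e * \<bar>h\<bar>" if "\<bar>h\<bar> < \<delta>" for h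
        proof (cases "h = 0")
          case True then show ?thesis using p_zero[OF p] by simp
        next
          case False
          then have "p (c (t + h) - c t - h *\<^sub>R d) / \<bar>h\<bar> < e" using \<delta>(2)[OF False that] eq[OF False] by metis
          then have "p (c (t + h) - c t - h *\<^sub>R d) < e * \<bar>h\<bar>"
            using False by (simp only: pos_divide_less_eq zero_less_abs_iff not_False_eq_True)
          then show ?thesis by simp
        qed
        with \<delta>(1) show "\<exists>\<delta>>0. \<forall>h. \<bar>h\<bar> < \<delta> \<longrightarrow> p (c (t + h) - c t - h *\<^sub>R d) \<le> e * \<bar>h\<bar>" by blast
      qed
    next
      assume R: ?R
      show ?L
      proof (rule tendstoI)
        fix e :: real assume "e > 0"
        then have "e / 2 > 0" by simp
        then obtain \<delta> where \<delta>: "\<delta> > 0" "\<And>h. \<bar>h\<bar> < \<delta> \<Longrightarrow> p (c (t + h) - c t - h *\<^sub>R d) \<le> e / 2 * \<bar>h\<bar>"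
          using R by meson
        show "\<forall>\<^sub>F h in at 0. dist (p (inverse h *\<^sub>R (c (t + h) - c t) - d)) 0 < e"
          unfolding eventually_at
        proof (intro exI[of _ \<delta>] conjI ballI impI \<delta>(1))
          fix h :: real assume h: "h \<noteq> 0 \<and> dist h 0 < \<delta>"
          have "p (c (t + h) - c t - h *\<^sub>R d) \<le> e / 2 * \<bar>h\<bar>"
            using \<delta>(2)[of h] h by (simp add: dist_real_def)
          then have "p (c (t + h) - c t - h *\<^sub>R d) / \<bar>h\<bar> \<le> e / 2"
            using h by (simp only: pos_divide_le_eq zero_less_abs_iff not_False_eq_True)
          then have "p (inverse h *\<^sub>R (c (t + h) - c t) - d) \<le> e / 2"
            using eq[of h] h by metis
          then show "dist (p (inverse h *\<^sub>R (c (t + h) - c t) - d)) 0 < e"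
            using p_nonneg[OF p in2, of h] \<open>e > 0\<close> by (simp add: dist_real_def)
        qed
      qed
    qed
  qed
  then show ?thesis unfolding curve_deriv_iff_tendsto[OF c] by blast
qed

lemma curve_derivD:
  assumes "range c \<subseteq> topspace T" "curve_deriv T c t d" "p \<in> P" "e > 0"
  obtains \<delta> where "\<delta> > 0" "\<And>h. \<bar>h\<bar> < \<delta> \<Longrightarrow> p (c (t + h) - c t - h *\<^sub>R d) \<le> e * \<bar>h\<bar>"
  using assms curve_deriv_iff by meson

lemma limitin_unique:
  assumes "limitin T f l (F :: real filter)" "limitin T f l' F" "F \<noteq> bot"
  shows "l = l'"
proof -
  have l: "l \<in> topspace T" "l' \<in> topspace T" and ev: "\<forall>\<^sub>F h in F. f h \<in> topspace T"
    using assms limitin_iff by auto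
  have "p (l - l') = 0" if p: "p \<in> P" for p
  proof -
    have "((\<lambda>h. p (f h - l) + p (f h - l')) \<longlongrightarrow> 0 + 0) F"
      using assms p unfolding limitin_iff by (intro tendsto_add) auto
    moreover have "\<forall>\<^sub>F h in F. p (l - l') \<le> p (f h - l) + p (f h - l')"
      using ev by eventually_elim (use p_triangle[OF p l(1) _ l(2)] p_commute[OF p l(1)] in metis)
    ultimately have "p (l - l') \<le> 0 + 0"
      using assms(3) by (intro tendsto_le[OF _ _ tendsto_const])
    then show ?thesis using p_nonneg[OF p in_diff[OF l]] by simp
  qed
  then have "l - l' = 0" using separating in_diff[OF l] by blast
  then show ?thesis by simp
qed

lemma curve_deriv_unique: "curve_deriv T c t d \<Longrightarrow> curve_deriv T c t d' \<Longrightarrow> d = d'"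
  unfolding curve_deriv_def using limitin_unique trivial_limit_at by blast

lemma curve_deriv_in: "curve_deriv T c t d \<Longrightarrow> d \<in> topspace T"
  unfolding curve_deriv_def limitin_iff by blast

lemma curve_deriv_const: "x \<in> topspace T \<Longrightarrow> curve_deriv T (\<lambda>_. x) t 0"
  by (subst curve_deriv_iff_tendsto) (auto simp: in_zero p_zero)

lemma curve_deriv_continuous:
  assumes c: "range c \<subseteq> topspace T" and "curve_deriv T c t d" and p: "p \<in> P"
  shows "((\<lambda>h. p (c (t + h) - c t)) \<longlongrightarrow> 0) (at 0)" "((\<lambda>h. p (c (t + h))) \<longlongrightarrow> p (c t)) (at 0)"
proof -
  have d: "d \<in> topspace T" using curve_deriv_in assms(2) by blast
  obtain \<delta> where \<delta>: "\<delta> > 0" "\<And>h. \<bar>h\<bar> < \<delta> \<Longrightarrow> p (c (t + h) - c t - h *\<^sub>R d) \<le> 1 * \<bar>h\<bar>"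
    using curve_derivD[OF assms zero_less_one] by blast
  have bound: "p (c (t + h) - c t) \<le> (1 + p d) * \<bar>h\<bar>" if "\<bar>h\<bar> < \<delta>" for h
  proof -
    have "p ((c (t + h) - c t - h *\<^sub>R d) + h *\<^sub>R d) \<le> p (c (t + h) - c t - h *\<^sub>R d) + p (h *\<^sub>R d)"
      by (intro p_add p in_diff in_scale d) (use c in auto)
    with \<delta>(2)[OF that] show ?thesis using p_scaleR[OF p d] by (simp add: algebra_simps)
  qed
  have nn: "0 \<le> p (c (t + h) - c t)" for h by (intro p_nonneg p in_diff) (use c in auto)
  have ev: "\<forall>\<^sub>F h in at 0. \<bar>h\<bar> < \<delta>"
    using \<delta>(1) unfolding eventually_at by (auto simp: dist_real_def)
  have lim: "((\<lambda>h. (1 + p d) * \<bar>h\<bar>) \<longlongrightarrow> 0) (at 0)"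
    by (rule tendsto_eq_intros refl | simp)+
  show *: "((\<lambda>h. p (c (t + h) - c t)) \<longlongrightarrow> 0) (at 0)"
    by (rule tendsto_sandwich[OF _ _ tendsto_const lim])
      (use nn bound ev in \<open>auto elim: eventually_mono\<close>)
  have "((\<lambda>h. p (c (t + h)) - p (c t)) \<longlongrightarrow> 0) (at 0)"
  proof (rule Lim_null_comparison[OF _ *])
    show "\<forall>\<^sub>F h in at 0. norm (p (c (t + h)) - p (c t)) \<le> p (c (t + h) - c t)"
      unfolding real_norm_def by (intro always_eventually allI p_reverse[OF p]) (use c in auto)
  qed
  then show "((\<lambda>h. p (c (t + h))) \<longlongrightarrow> p (c t)) (at 0)" by (rule LIM_zero_cancel)
qed

lemma continuous_on_seminorm_curve:
  assumes "range c \<subseteq> topspace T" "\<And>t. t \<in> A \<Longrightarrow> curve_deriv T c t (c' t)" "p \<in> P"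
  shows "continuous_on A (\<lambda>t. p (c t))"
proof (rule continuous_at_imp_continuous_on, rule ballI)
  fix t assume "t \<in> A"
  then show "isCont (\<lambda>t. p (c t)) t"
    using curve_deriv_continuous(2)[OF assms(1) assms(2) assms(3)] unfolding isCont_iff by blast
qed

lemma curve_deriv_add:
  assumes c: "range c \<subseteq> topspace T" and e: "range e \<subseteq> topspace T"
    and c': "curve_deriv T c t c'" and e': "curve_deriv T e t e'"
  shows "curve_deriv T (\<lambda>s. c s + e s) t (c' + e')"
proof -
  have ce: "range (\<lambda>s. c s + e s) \<subseteq> topspace T" using c e in_add by auto
  have in': "c' \<in> topspace T" "e' \<in> topspace T" using c' e' curve_deriv_in by auto
  show ?thesis
    unfolding curve_deriv_iff_tendsto[OF ce]
  proof (intro conjI ballI)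
    show "c' + e' \<in> topspace T" using in' in_add by blast
    fix p assume p: "p \<in> P"
    let ?C = "\<lambda>h. inverse h *\<^sub>R (c (t + h) - c t) - c'" and ?E = "\<lambda>h. inverse h *\<^sub>R (e (t + h) - e t) - e'"
    have CE: "?C h \<in> topspace T" "?E h \<in> topspace T" for h
      by (intro in_diff in_scale in'; use c e in auto)+
    have eq: "inverse h *\<^sub>R (c (t + h) + e (t + h) - (c t + e t)) - (c' + e') = ?C h + ?E h" for h
      by (simp add: algebra_simps)
    have "((\<lambda>h. p (?C h) + p (?E h)) \<longlongrightarrow> 0 + 0) (at 0)"
      using c' e' p c e by (intro tendsto_add) (auto simp: curve_deriv_iff_tendsto)
    then have up: "((\<lambda>h. p (?C h) + p (?E h)) \<longlongrightarrow> 0) (at 0)" by simp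
    show "((\<lambda>h. p (inverse h *\<^sub>R (c (t + h) + e (t + h) - (c t + e t)) - (c' + e'))) \<longlongrightarrow> 0) (at 0)"
      unfolding eq
      by (rule tendsto_sandwich[OF _ _ tendsto_const up])
        (use p_nonneg[OF p in_add[OF CE]] p_add[OF p CE] in auto)
  qed
qed

lemma curve_deriv_mult:
  fixes \<gamma> :: "real \<Rightarrow> real"
  assumes c: "range c \<subseteq> topspace T"
    and c': "curve_deriv T c t c'" and g: "(\<gamma> has_real_derivative \<gamma>') (at t)"
  shows "curve_deriv T (\<lambda>s. \<gamma> s *\<^sub>R c s) t (\<gamma>' *\<^sub>R c t + \<gamma> t *\<^sub>R c')"
proof -
  have gc: "range (\<lambda>s. \<gamma> s *\<^sub>R c s) \<subseteq> topspace T" using c in_scale by auto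
  have in': "c' \<in> topspace T" "\<And>s. c s \<in> topspace T" using c' c curve_deriv_in by auto
  show ?thesis
    unfolding curve_deriv_iff_tendsto[OF gc]
  proof (intro conjI ballI)
    show "\<gamma>' *\<^sub>R c t + \<gamma> t *\<^sub>R c' \<in> topspace T" using in' in_add in_scale by blast
    fix p assume p: "p \<in> P"
    let ?g = "\<lambda>h. (\<gamma> (t + h) - \<gamma> t) / h - \<gamma>'"
    let ?C = "\<lambda>h. inverse h *\<^sub>R (c (t + h) - c t) - c'"
    let ?d = "\<lambda>h. \<gamma> (t + h) - \<gamma> t"
    have C: "?C h \<in> topspace T" for h
      by (intro in_diff in_scale in')
    have eq: "inverse h *\<^sub>R (\<gamma> (t + h) *\<^sub>R c (t + h) - \<gamma> t *\<^sub>R c t) - (\<gamma>' *\<^sub>R c t + \<gamma> t *\<^sub>R c')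
        = ?g h *\<^sub>R c t + (\<gamma> (t + h) *\<^sub>R ?C h + ?d h *\<^sub>R c')" for h
      by (simp add: algebra_simps divide_inverse)
    have g0: "(?g \<longlongrightarrow> 0) (at 0)" using g unfolding DERIV_def by (rule LIM_zero)
    have gt: "((\<lambda>h. \<gamma> (t + h)) \<longlongrightarrow> \<gamma> t) (at 0)"
      using DERIV_isCont[OF g] unfolding isCont_iff .
    have d0: "(?d \<longlongrightarrow> 0) (at 0)" using gt by (rule LIM_zero)
    have C0: "((\<lambda>h. p (?C h)) \<longlongrightarrow> 0) (at 0)" using c' p c by (auto simp: curve_deriv_iff_tendsto)
    have "((\<lambda>h. \<bar>?g h\<bar> * p (c t) + (\<bar>\<gamma> (t + h)\<bar> * p (?C h) + \<bar>?d h\<bar> * p c'))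
        \<longlongrightarrow> \<bar>0\<bar> * p (c t) + (\<bar>\<gamma> t\<bar> * 0 + \<bar>0\<bar> * p c')) (at 0)"
      by (intro tendsto_add tendsto_mult tendsto_rabs g0 gt d0 C0 tendsto_const)
    then have up: "((\<lambda>h. \<bar>?g h\<bar> * p (c t) + (\<bar>\<gamma> (t + h)\<bar> * p (?C h) + \<bar>?d h\<bar> * p c')) \<longlongrightarrow> 0) (at 0)" by simp
    have le: "p (?g h *\<^sub>R c t + (\<gamma> (t + h) *\<^sub>R ?C h + ?d h *\<^sub>R c'))
        \<le> \<bar>?g h\<bar> * p (c t) + (\<bar>\<gamma> (t + h)\<bar> * p (?C h) + \<bar>?d h\<bar> * p c')" for h
    proof -
      have "p (?g h *\<^sub>R c t + (\<gamma> (t + h) *\<^sub>R ?C h + ?d h *\<^sub>R c'))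
          \<le> p (?g h *\<^sub>R c t) + (p (\<gamma> (t + h) *\<^sub>R ?C h) + p (?d h *\<^sub>R c'))"
        by (intro order_trans[OF p_add[OF p]] add_left_mono p_add[OF p] in_add in_scale C in')
      then show ?thesis using p_scaleR[OF p] C in' by simp
    qed
    show "((\<lambda>h. p (inverse h *\<^sub>R (\<gamma> (t + h) *\<^sub>R c (t + h) - \<gamma> t *\<^sub>R c t) - (\<gamma>' *\<^sub>R c t + \<gamma> t *\<^sub>R c'))) \<longlongrightarrow> 0) (at 0)"
      unfolding eq
      by (rule tendsto_sandwich[OF _ _ tendsto_const up])
        (use le in \<open>auto intro!: always_eventually p_nonneg[OF p] in_add in_scale in' C\<close>)
  qed
qed

lemma curve_deriv_compose:
  fixes \<gamma> :: "real \<Rightarrow> real"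
  assumes c: "range c \<subseteq> topspace T"
    and c': "curve_deriv T c (\<gamma> t) c'" and g: "(\<gamma> has_real_derivative \<gamma>') (at t)"
  shows "curve_deriv T (\<lambda>s. c (\<gamma> s)) t (\<gamma>' *\<^sub>R c')"
proof -
  have cg: "range (\<lambda>s. c (\<gamma> s)) \<subseteq> topspace T" using c by auto
  have in': "c' \<in> topspace T" "\<And>s. c s \<in> topspace T" using c' c curve_deriv_in by auto
  show ?thesis unfolding curve_deriv_iff[OF cg]
  proof (intro conjI ballI allI impI)
    show "\<gamma>' *\<^sub>R c' \<in> topspace T" using in' in_scale by blast
    fix p and e :: real assume p: "p \<in> P" and e: "e > 0"
    \<comment> \<open>\<open>e1\<close> absorbs the remainder of \<open>c\<close>, \<open>e2\<close>
      that of \<gamma>. The bound \<open>e2 \<le> 1\<close> makes the increment of \<gamma> at most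
      \<open>(\<bar>\<gamma>'\<bar> + 1) * \<bar>h\<bar>\<close>, which is where the denominators of
      \<open>e1\<close> and of \<delta> come from.\<close>
    define e1 where "e1 = e / (2 * (\<bar>\<gamma>'\<bar> + 1))"
    define e2 where "e2 = min 1 (e / (2 * (p c' + 1)))"
    have pc: "0 \<le> p c'" using p_nonneg[OF p in'(1)] .
    have e12: "e1 > 0" "e2 > 0" using e pc by (auto simp: e1_def e2_def)
    obtain \<delta>1 where d1: "\<delta>1 > 0" "\<And>h. \<bar>h\<bar> < \<delta>1 \<Longrightarrow> p (c (\<gamma> t + h) - c (\<gamma> t) - h *\<^sub>R c') \<le> e1 * \<bar>h\<bar>"
      using curve_derivD[OF c c' p e12(1)] by blast
    have "(\<gamma> has_derivative (*) \<gamma>') (at t)" using g by (simp add: has_field_derivative_def)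
    then obtain \<delta>2 where d2: "\<delta>2 > 0" "\<And>y. \<bar>y - t\<bar> < \<delta>2 \<Longrightarrow> \<bar>\<gamma> y - \<gamma> t - \<gamma>' * (y - t)\<bar> \<le> e2 * \<bar>y - t\<bar>"
      unfolding has_derivative_at_alt using e12(2) by (auto simp: real_norm_def)
    define \<delta> where "\<delta> = min \<delta>2 (\<delta>1 / (\<bar>\<gamma>'\<bar> + 1))"
    have "p (c (\<gamma> (t + h)) - c (\<gamma> t) - h *\<^sub>R (\<gamma>' *\<^sub>R c')) \<le> e * \<bar>h\<bar>" if h: "\<bar>h\<bar> < \<delta>" for h
    proof -
      define k where "k = \<gamma> (t + h) - \<gamma> t"
      have k1: "\<bar>k - \<gamma>' * h\<bar> \<le> e2 * \<bar>h\<bar>" using d2(2)[of "t + h"] h by (simp add: \<delta>_def k_def)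
      also have "\<dots> \<le> 1 * \<bar>h\<bar>" by (intro mult_right_mono) (simp_all add: e2_def)
      finally have "\<bar>k\<bar> \<le> \<bar>\<gamma>' * h\<bar> + \<bar>h\<bar>" by linarith
      then have k2: "\<bar>k\<bar> \<le> (\<bar>\<gamma>'\<bar> + 1) * \<bar>h\<bar>" by (simp add: abs_mult algebra_simps)
      also have "\<dots> < \<delta>1" using h by (simp add: \<delta>_def pos_less_divide_eq mult.commute)
      finally have "\<bar>k\<bar> < \<delta>1" .
      then have A: "p (c (\<gamma> t + k) - c (\<gamma> t) - k *\<^sub>R c') \<le> e1 * \<bar>k\<bar>" by (rule d1(2))
      have A2: "e1 * \<bar>k\<bar> \<le> e / 2 * \<bar>h\<bar>"
      proof -
        have "e1 * \<bar>k\<bar> \<le> e1 * ((\<bar>\<gamma>'\<bar> + 1) * \<bar>h\<bar>)" using k2 e12 by (intro mult_left_mono) auto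
        also have "\<dots> = e / 2 * \<bar>h\<bar>" by (simp add: e1_def field_simps)
        finally show ?thesis .
      qed
      have B: "p ((k - \<gamma>' * h) *\<^sub>R c') \<le> e / 2 * \<bar>h\<bar>"
      proof -
        have "\<bar>k - \<gamma>' * h\<bar> * p c' \<le> e2 * \<bar>h\<bar> * (p c' + 1)"
          using k1 pc e12 by (intro mult_mono) auto
        also have "\<dots> \<le> e / (2 * (p c' + 1)) * \<bar>h\<bar> * (p c' + 1)"
          using pc by (intro mult_right_mono) (auto simp: e2_def)
        also have "\<dots> = e / 2 * \<bar>h\<bar>" using pc by (simp add: field_simps)
        finally show ?thesis using p_scaleR[OF p in'(1)] by simp
      qed
      have "c (\<gamma> (t + h)) - c (\<gamma> t) - h *\<^sub>R (\<gamma>' *\<^sub>R c') =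
          (c (\<gamma> t + k) - c (\<gamma> t) - k *\<^sub>R c') + (k - \<gamma>' * h) *\<^sub>R c'"
        by (simp add: k_def algebra_simps)
      then have "p (c (\<gamma> (t + h)) - c (\<gamma> t) - h *\<^sub>R (\<gamma>' *\<^sub>R c')) \<le>
          p (c (\<gamma> t + k) - c (\<gamma> t) - k *\<^sub>R c') + p ((k - \<gamma>' * h) *\<^sub>R c')"
        by (simp only:) (intro p_add[OF p] in_diff in_scale in')
      with A A2 B show ?thesis by simp
    qed
    moreover have "\<delta> > 0" using d1 d2 by (simp add: \<delta>_def)
    ultimately show "\<exists>\<delta>>0. \<forall>h. \<bar>h\<bar> < \<delta> \<longrightarrow> p (c (\<gamma> (t + h)) - c (\<gamma> t) - h *\<^sub>R (\<gamma>' *\<^sub>R c')) \<le> e * \<bar>h\<bar>" by blast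
  qed
qed

lemma curve_deriv_scaleR:
  assumes "range c \<subseteq> topspace T" "curve_deriv T c t c'"
  shows "curve_deriv T (\<lambda>s. r *\<^sub>R c s) t (r *\<^sub>R c')"
  using curve_deriv_mult[OF assms DERIV_const, of r] by simp

lemma curve_deriv_diff:
  assumes "range c \<subseteq> topspace T" "range e \<subseteq> topspace T" "curve_deriv T c t c'" "curve_deriv T e t e'"
  shows "curve_deriv T (\<lambda>s. c s - e s) t (c' - e')"
proof -
  have "range (\<lambda>s. (-1) *\<^sub>R e s) \<subseteq> topspace T" using assms(2) in_scale by blast
  from curve_deriv_add[OF assms(1) this assms(3) curve_deriv_scaleR[OF assms(2,4), of "-1"]]
  show ?thesis by simp
qed

text \<open>Derivatives are unique, so the witnesses for the various orders agree and can be glued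
  into one sequence, obtained by iterating the definite description of the derivative.\<close>

lemma smooth_curve_iff_Cn: "smooth_curve T c \<longleftrightarrow> (\<forall>n. curve_Cn T n c)"
proof
  assume "smooth_curve T c"
  then obtain D where D: "D 0 = c" "derivs T D" unfolding smooth_curve_derivs by blast
  have "curve_Cn T n (D k)" for n k
  proof (induction n arbitrary: k)
    case 0 then show ?case using D by (auto simp: derivs_def)
  next
    case (Suc n)
    then show ?case using D by (auto simp: derivs_def intro!: exI[of _ "D (Suc k)"])
  qed
  then show "\<forall>n. curve_Cn T n c" using D by metis
next
  assume Cn: "\<forall>n. curve_Cn T n c"
  define D where "D = rec_nat c (\<lambda>_ f t. THE d. curve_deriv T f t d)"
  have D0: "D 0 = c" and DS: "D (Suc k) = (\<lambda>t. THE d. curve_deriv T (D k) t d)" for k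
    by (simp_all add: D_def)
  have "curve_Cn T n (D k)" for n k
  proof (induction k arbitrary: n)
    case 0 then show ?case using Cn D0 by simp
  next
    case (Suc k)
    then obtain c' where c': "\<forall>t. curve_deriv T (D k) t (c' t)" "curve_Cn T n c'"
      using curve_Cn.simps(2) by blast
    then have "D (Suc k) = c'" unfolding DS using curve_deriv_unique by blast
    then show ?case using c' by simp
  qed note Cn' = this
  have "derivs T D" unfolding derivs_def
  proof (intro allI conjI)
    fix k t
    show "D k t \<in> topspace T" using Cn' curve_Cn_range by blast
    obtain c' where c': "curve_deriv T (D k) t (c' t)"
      using Cn'[of "Suc 0" k] by auto
    then show "curve_deriv T (D k) t (D (Suc k) t)" unfolding DS
      using curve_deriv_unique by (metis theI)
  qed
  then show "smooth_curve T c" unfolding smooth_curve_derivs using D0 by blast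
qed

lemma curve_Cn_const: "x \<in> topspace T \<Longrightarrow> curve_Cn T n (\<lambda>_. x)"
proof (induction n arbitrary: x)
  case (Suc n)
  then show ?case using curve_deriv_const in_zero by (auto intro!: exI[of _ "\<lambda>_. 0"])
qed auto

lemma curve_Cn_add: "curve_Cn T n c \<Longrightarrow> curve_Cn T n e \<Longrightarrow> curve_Cn T n (\<lambda>t. c t + e t)"
proof (induction n arbitrary: c e)
  case 0 then show ?case using in_add by auto
next
  case (Suc n)
  then obtain c' e' where "\<forall>t. curve_deriv T c t (c' t)" "curve_Cn T n c'"
     "\<forall>t. curve_deriv T e t (e' t)" "curve_Cn T n e'" "range c \<subseteq> topspace T" "range e \<subseteq> topspace T" by auto
  with Suc.IH[of c' e'] show ?case
    by (auto intro!: exI[of _ "\<lambda>t. c' t + e' t"] curve_deriv_add in_add)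
qed

lemma curve_Cn_sum:
  "(\<And>i. i \<in> A \<Longrightarrow> curve_Cn T n (c i)) \<Longrightarrow> curve_Cn T n (\<lambda>t. \<Sum>i\<in>A. c i t)"
  by (induction A rule: infinite_finite_induct) (auto intro: curve_Cn_const curve_Cn_add in_zero)

end

lemma curve_deriv_euclidean:
  "curve_deriv euclidean c t (d :: 'a::banach) \<longleftrightarrow> (c has_vector_derivative d) (at t)"
proof -
  interpret complete_lcs "euclidean :: 'a topology" "{norm}" by (rule lcs_euclidean)
  have "(c has_vector_derivative d) (at t) \<longleftrightarrow>
      (\<forall>e>0. \<exists>\<delta>>0. \<forall>y. \<bar>y - t\<bar> < \<delta> \<longrightarrow> norm (c y - c t - (y - t) *\<^sub>R d) \<le> e * \<bar>y - t\<bar>)"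
    unfolding has_vector_derivative_def has_derivative_at_alt by (simp add: bounded_linear_scaleR_left)
  also have "\<dots> \<longleftrightarrow> (\<forall>e>0. \<exists>\<delta>>0. \<forall>h. \<bar>h\<bar> < \<delta> \<longrightarrow> norm (c (t + h) - c t - h *\<^sub>R d) \<le> e * \<bar>h\<bar>)"
  proof -
    have "(\<forall>y. \<bar>y - t\<bar> < \<delta> \<longrightarrow> norm (c y - c t - (y - t) *\<^sub>R d) \<le> e * \<bar>y - t\<bar>) \<longleftrightarrow>
      (\<forall>h. \<bar>h\<bar> < \<delta> \<longrightarrow> norm (c (t + h) - c t - h *\<^sub>R d) \<le> e * \<bar>h\<bar>)" for e \<delta>
      by (metis add_diff_cancel_left' diff_add_cancel add.commute)
    then show ?thesis by simp
  qed
  finally show ?thesis by (subst curve_deriv_iff) auto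
qed

lemma curve_deriv_real:
  "curve_deriv euclidean (\<gamma> :: real \<Rightarrow> real) t d \<longleftrightarrow> (\<gamma> has_real_derivative d) (at t)"
  by (simp add: curve_deriv_euclidean has_real_derivative_iff_has_vector_derivative)

context lcs
begin

lemma curve_Cn_mult:
  fixes \<gamma> :: "real \<Rightarrow> real"
  shows "curve_Cn euclidean n \<gamma> \<Longrightarrow> curve_Cn T n c \<Longrightarrow> curve_Cn T n (\<lambda>t. \<gamma> t *\<^sub>R c t)"
proof (induction n arbitrary: c \<gamma>)
  case 0 then show ?case using in_scale by auto
next
  case (Suc n)
  then obtain c' \<gamma>' where *: "\<forall>t. curve_deriv T c t (c' t)" "curve_Cn T n c'"
     "\<forall>t. (\<gamma> has_real_derivative \<gamma>' t) (at t)" "curve_Cn euclidean n \<gamma>'" "range c \<subseteq> topspace T"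
    by (auto simp: curve_deriv_real)
  have "curve_Cn T n (\<lambda>t. \<gamma>' t *\<^sub>R c t + \<gamma> t *\<^sub>R c' t)"
    by (intro curve_Cn_add Suc.IH * curve_Cn_mono[OF Suc.prems(1)] curve_Cn_mono[OF Suc.prems(2)])
  with * show ?case
    by (auto intro!: exI[of _ "\<lambda>t. \<gamma>' t *\<^sub>R c t + \<gamma> t *\<^sub>R c' t"] curve_deriv_mult in_scale)
qed

lemma curve_Cn_scaleR: "curve_Cn T n c \<Longrightarrow> curve_Cn T n (\<lambda>t. r *\<^sub>R c t)"
proof (induction n arbitrary: c)
  case 0 then show ?case using in_scale by auto
next
  case (Suc n)
  then obtain c' where *: "\<forall>t. curve_deriv T c t (c' t)" "curve_Cn T n c'" "range c \<subseteq> topspace T" by auto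
  with Suc.IH[of c'] show ?case
    by (auto intro!: exI[of _ "\<lambda>t. r *\<^sub>R c' t"] curve_deriv_scaleR in_scale)
qed

lemma curve_Cn_compose:
  fixes \<gamma> :: "real \<Rightarrow> real"
  shows "curve_Cn euclidean n \<gamma> \<Longrightarrow> curve_Cn T n c \<Longrightarrow> curve_Cn T n (\<lambda>t. c (\<gamma> t))"
proof (induction n arbitrary: c)
  case 0 then show ?case by auto
next
  case (Suc n)
  then obtain c' \<gamma>' where *: "\<forall>t. curve_deriv T c t (c' t)" "curve_Cn T n c'"
     "\<forall>t. (\<gamma> has_real_derivative \<gamma>' t) (at t)" "curve_Cn euclidean n \<gamma>'" "range c \<subseteq> topspace T"
    by (auto simp: curve_deriv_real)
  have "curve_Cn T n (\<lambda>t. \<gamma>' t *\<^sub>R c' (\<gamma> t))"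
    by (intro curve_Cn_mult Suc.IH * curve_Cn_mono[OF Suc.prems(1)])
  with * show ?case
    by (auto intro!: exI[of _ "\<lambda>t. \<gamma>' t *\<^sub>R c' (\<gamma> t)"] curve_deriv_compose)
qed

lemma smooth_curve_const: "x \<in> topspace T \<Longrightarrow> smooth_curve T (\<lambda>_. x)"
  and smooth_curve_add: "smooth_curve T c \<Longrightarrow> smooth_curve T e \<Longrightarrow> smooth_curve T (\<lambda>t. c t + e t)"
  and smooth_curve_scaleR: "smooth_curve T c \<Longrightarrow> smooth_curve T (\<lambda>t. r *\<^sub>R c t)"
  unfolding smooth_curve_iff_Cn
  by (simp_all add: curve_Cn_const curve_Cn_add curve_Cn_scaleR)

end

lemmas smooth_curve_real_iff_Cn = lcs.smooth_curve_iff_Cn[OF complete_lcs.axioms(1)[OF lcs_euclidean]]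

context lcs
begin

lemma smooth_curve_mult: "smooth_curve euclideanreal \<gamma> \<Longrightarrow> smooth_curve T c \<Longrightarrow> smooth_curve T (\<lambda>t. \<gamma> t *\<^sub>R c t)"
  and smooth_curve_compose: "smooth_curve euclideanreal \<gamma> \<Longrightarrow> smooth_curve T c \<Longrightarrow> smooth_curve T (\<lambda>t. c (\<gamma> t))"
  unfolding smooth_curve_iff_Cn smooth_curve_real_iff_Cn
  by (simp_all add: curve_Cn_mult curve_Cn_compose)

text \<open>Smooth curves are defined on the whole line, so a curve known only piecewise has to be
  compared near each time with a global one. The hypothesis passes to derivatives because agreement
  near \<open>t0\<close> is agreement near every time close to \<open>t0\<close>.\<close>

lemma curve_Cn_local:
  assumes "\<And>t0. \<exists>e. curve_Cn T n e \<and> (\<forall>\<^sub>F t in nhds t0. e t = c t)"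
  shows "curve_Cn T n c"
  using assms
proof (induction n arbitrary: c)
  case 0
  have "c t \<in> topspace T" for t
  proof -
    obtain e where e: "curve_Cn T 0 e" "\<forall>\<^sub>F s in nhds t. e s = c s" using 0 by blast
    then show ?thesis using curve_Cn_range[OF e(1)] eventually_nhds_x_imp_x[OF e(2)] by metis
  qed
  then show ?case by auto
next
  case (Suc n)
  have c: "range c \<subseteq> topspace T"
  proof safe
    fix t obtain e where e: "curve_Cn T (Suc n) e" "\<forall>\<^sub>F t in nhds t. e t = c t" using Suc.prems by blast
    show "c t \<in> topspace T" using curve_Cn_range[OF e(1)] eventually_nhds_x_imp_x[OF e(2)] by metis
  qed
  define c' where "c' t = (THE d. curve_deriv T c t d)" for t
  have c'I: "c' t = d" if "curve_deriv T c t d" for t d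
    unfolding c'_def using that curve_deriv_unique by blast
  have ex: "\<exists>e'. curve_Cn T n e' \<and> curve_deriv T c t0 (e' t0) \<and> (\<forall>\<^sub>F t in nhds t0. e' t = c' t)" for t0
  proof -
    obtain e where e: "curve_Cn T (Suc n) e" "\<forall>\<^sub>F t in nhds t0. e t = c t" using Suc.prems by blast
    then obtain e' where e': "curve_Cn T n e'" "\<And>t. curve_deriv T e t (e' t)" by auto
    have "\<forall>\<^sub>F t in nhds t0. \<forall>\<^sub>F s in nhds t. e s = c s" using e(2) unfolding eventually_eventually .
    then have ev: "\<forall>\<^sub>F t in nhds t0. curve_deriv T c t (e' t)"
      by (rule eventually_mono) (use e'(2) curve_deriv_cong in blast)
    moreover have "\<forall>\<^sub>F t in nhds t0. e' t = c' t"
      using ev by (rule eventually_mono) (use c'I in simp)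
    ultimately show ?thesis using e' eventually_nhds_x_imp_x[OF ev] by blast
  qed
  then have "\<forall>t. curve_deriv T c t (c' t)" using c'I by metis
  moreover have "curve_Cn T n c'" using ex by (intro Suc.IH) blast
  ultimately show ?case using c by auto
qed

lemma smooth_curve_local:
  assumes "\<And>t0. \<exists>e. smooth_curve T e \<and> (\<forall>\<^sub>F t in nhds t0. e t = c t)"
  shows "smooth_curve T c"
  using assms unfolding smooth_curve_iff_Cn by (metis curve_Cn_local)

text \<open>Reads off the derivatives along a line from a curve that runs along that line for a
  short time only; the speed \<open>l\<close> enters with the power \<open>k\<close>. Compared with
  the zero curve it also shows that derivatives vanish where a curve vanishes locally.\<close>

lemma derivs_affine_local:
  assumes D1: "derivs T D1" and D2: "derivs T D2"
    and eq: "\<forall>\<^sub>F t in nhds t0. D1 0 t = D2 0 (x + l * (t - t0))"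
  shows "\<forall>\<^sub>F t in nhds t0. D1 k t = l ^ k *\<^sub>R D2 k (x + l * (t - t0))"
proof (induction k)
  case 0 then show ?case using eq by simp
next
  case (Suc k)
  have der: "((\<lambda>t. x + l * (t - t0)) has_real_derivative l) (at t)" for t
    by (auto intro!: derivative_eq_intros)
  have "curve_deriv T (\<lambda>t. l ^ k *\<^sub>R D2 k (x + l * (t - t0))) t (l ^ k *\<^sub>R (l *\<^sub>R D2 (Suc k) (x + l * (t - t0))))" for t
    using D2 by (intro curve_deriv_scaleR curve_deriv_compose der) (auto simp: derivs_def)
  then have d: "curve_deriv T (\<lambda>t. l ^ k *\<^sub>R D2 k (x + l * (t - t0))) t (l ^ Suc k *\<^sub>R D2 (Suc k) (x + l * (t - t0)))" for t
    by (simp add: mult.commute)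
  have "\<forall>\<^sub>F t in nhds t0. \<forall>\<^sub>F s in nhds t. D1 k s = l ^ k *\<^sub>R D2 k (x + l * (s - t0))"
    using Suc unfolding eventually_eventually .
  then show ?case
  proof (rule eventually_mono)
    fix t assume ev: "\<forall>\<^sub>F s in nhds t. D1 k s = l ^ k *\<^sub>R D2 k (x + l * (s - t0))"
    have "curve_deriv T (\<lambda>t. l ^ k *\<^sub>R D2 k (x + l * (t - t0))) t (D1 (Suc k) t)"
      using D1 curve_deriv_cong[OF ev] unfolding derivs_def by blast
    then show "D1 (Suc k) t = l ^ Suc k *\<^sub>R D2 (Suc k) (x + l * (t - t0))"
      using d curve_deriv_unique by blast
  qed
qed

section \<open>Mean value estimates and interpolation of derivatives\<close>

text \<open>Bisection: the bound with \<open>M + e\<close> in place of \<open>M\<close> adds up over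
  adjacent intervals, and on short intervals around a point it is the definition of the derivative
  there.\<close>

lemma mean_value:
  assumes p: "p \<in> P" and c: "range c \<subseteq> topspace T" and ab: "a \<le> b"
    and c': "\<And>t. a \<le> t \<Longrightarrow> t \<le> b \<Longrightarrow> curve_deriv T c t (c' t)"
    and M: "\<And>t. a \<le> t \<Longrightarrow> t \<le> b \<Longrightarrow> p (c' t) \<le> M"
  shows "p (c b - c a) \<le> M * (b - a)"
proof -
  have cin: "c t \<in> topspace T" for t using c by auto
  have "p (c b - c a) \<le> (M + e) * (b - a)" if e: "e > 0" for e
  proof -
    have "a \<le> a \<longrightarrow> b \<le> b \<longrightarrow> p (c b - c a) \<le> (M + e) * (b - a)"
      using ab
    proof (induction rule: Bolzano[where P = "\<lambda>u w. a \<le> u \<longrightarrow> w \<le> b \<longrightarrow> p (c w - c u) \<le> (M + e) * (w - u)"])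
      case (trans u v w)
      show ?case
      proof (intro impI)
        assume "a \<le> u" "w \<le> b"
        then have "p (c v - c u) \<le> (M + e) * (v - u)" "p (c w - c v) \<le> (M + e) * (w - v)" using trans by auto
        moreover have "p (c w - c u) \<le> p (c w - c v) + p (c v - c u)" using p_triangle[OF p cin cin cin] .
        ultimately show "p (c w - c u) \<le> (M + e) * (w - u)" by (simp add: algebra_simps)
      qed
    next
      case (local x)
      obtain \<delta> where \<delta>: "\<delta> > 0" "\<And>h. \<bar>h\<bar> < \<delta> \<Longrightarrow> p (c (x + h) - c x - h *\<^sub>R c' x) \<le> e * \<bar>h\<bar>"
        using curve_derivD[OF c c'[OF local] p e] by blast
      have c'x: "c' x \<in> topspace T" using c'[OF local] curve_deriv_in by blast
      show ?case
      proof (intro exI[of _ \<delta>] conjI \<delta>(1) allI impI)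
        fix u w assume uw: "u \<le> x \<and> x \<le> w \<and> w - u < \<delta>" "a \<le> u" "w \<le> b"
        let ?A = "c w - c x - (w - x) *\<^sub>R c' x" and ?B = "c u - c x - (u - x) *\<^sub>R c' x"
        have A: "p ?A \<le> e * (w - x)" using \<delta>(2)[of "w - x"] uw by simp
        have B: "p ?B \<le> e * (x - u)" using \<delta>(2)[of "u - x"] uw by simp
        have AB: "?A \<in> topspace T" "?B \<in> topspace T" by (intro in_diff in_scale cin c'x)+
        have "c w - c u = (?A - ?B) + (w - u) *\<^sub>R c' x" by (simp add: algebra_simps)
        then have "p (c w - c u) \<le> p (?A - ?B) + p ((w - u) *\<^sub>R c' x)"
          using p_add[OF p in_diff[OF AB] in_scale[OF c'x]] by metis
        also have "\<dots> \<le> p ?A + p ?B + (w - u) * p (c' x)"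
          using p_diff[OF p AB] p_scaleR[OF p c'x] uw by simp
        also have "\<dots> \<le> e * (w - x) + e * (x - u) + (w - u) * M"
          using A B M[OF local] uw by (intro add_mono mult_left_mono) auto
        finally show "p (c w - c u) \<le> (M + e) * (w - u)" by (simp add: algebra_simps)
      qed
    qed
    then show ?thesis by simp
  qed
  then have *: "p (c b - c a) \<le> M * (b - a) + e * (b - a)" if "e > 0" for e
    using that by (simp add: distrib_right)
  show ?thesis
  proof (rule field_le_epsilon)
    fix e :: real assume "e > 0"
    \<comment> \<open>The summand 1 covers the case \<open>a = b\<close>.\<close>
    have "e / (b - a + 1) * (b - a) \<le> e" using ab \<open>e > 0\<close> by (simp add: field_simps)
    then show "p (c b - c a) \<le> M * (b - a) + e"
      using *[of "e / (b - a + 1)"] ab \<open>e > 0\<close> by simp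
  qed
qed

text \<open>Two applications of the mean value estimate, which is why the constant is
  \<open>M\<close> and not half of it. The point \<open>u\<close> may lie on either side of
  \<open>t\<close>, since interpolation will step in the direction that stays inside the
  interval.\<close>

lemma taylor1:
  assumes p: "p \<in> P" and D: "derivs T D"
    and M: "\<And>s. s \<in> closed_segment t u \<Longrightarrow> p (D 2 s) \<le> M"
  shows "p (D 0 u - D 0 t - (u - t) *\<^sub>R D 1 t) \<le> M * (u - t)\<^sup>2"
proof -
  have Din: "D k s \<in> topspace T" for k s using D by (rule derivs_in)
  have M0: "0 \<le> M" using M[of t] p_nonneg[OF p Din, of 2 t] by simp
  have rD: "range (D k) \<subseteq> topspace T" for k using Din by auto
  have D2: "curve_deriv T (D 0) s (D 1 s)" "curve_deriv T (D 1) s (D 2 s)" for s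
    using D unfolding derivs_def by (auto simp: numeral_2_eq_2)
  have mv: "p (D 1 b - D 1 a) \<le> M * (b - a)" if "a \<le> b" "{a..b} \<subseteq> closed_segment t u" for a b
    by (rule mean_value[where c'="D 2"]) (use p rD D2 that M in auto)
  have inc: "p (D 1 s - D 1 t) \<le> M * \<bar>u - t\<bar>" if s: "s \<in> closed_segment t u" for s
  proof (cases "t \<le> s")
    case True
    then have "p (D 1 s - D 1 t) \<le> M * (s - t)" using s by (intro mv) (auto simp: closed_segment_eq_real_ivl)
    also have "\<dots> \<le> M * \<bar>u - t\<bar>" using M0 s True by (intro mult_left_mono) (auto simp: closed_segment_eq_real_ivl split: if_splits)
    finally show ?thesis .
  next
    case False
    then have "p (D 1 t - D 1 s) \<le> M * (t - s)" using s by (intro mv) (auto simp: closed_segment_eq_real_ivl)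
    also have "\<dots> \<le> M * \<bar>u - t\<bar>" using M0 s False by (intro mult_left_mono) (auto simp: closed_segment_eq_real_ivl split: if_splits)
    finally show ?thesis using p_commute[OF p Din Din] by metis
  qed
  \<comment> \<open>Subtracting the linear term leaves a curve whose derivative is the increment of
    \<open>D 1\<close>, already bounded by \<open>inc\<close>.\<close>
  let ?e = "\<lambda>s. D 0 s - s *\<^sub>R D 1 t"
  have re: "range ?e \<subseteq> topspace T" using Din in_diff in_scale by auto
  have de: "curve_deriv T ?e s (D 1 s - D 1 t)" for s
  proof -
    have "curve_deriv T (\<lambda>s. s *\<^sub>R D 1 t) s (1 *\<^sub>R D 1 t + s *\<^sub>R 0)"
      by (rule curve_deriv_mult[OF _ curve_deriv_const]) (auto simp: Din)
    then show ?thesis using D2(1) rD Din in_scale by (intro curve_deriv_diff) auto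
  qed
  have eq: "?e u - ?e t = D 0 u - D 0 t - (u - t) *\<^sub>R D 1 t" by (simp add: algebra_simps)
  have ein: "?e s \<in> topspace T" for s using re by auto
  have "p (?e u - ?e t) \<le> M * \<bar>u - t\<bar> * \<bar>u - t\<bar>"
  proof (cases "t \<le> u")
    case True
    have "p (?e u - ?e t) \<le> M * \<bar>u - t\<bar> * (u - t)"
      by (rule mean_value[OF p re True de inc]) (use True in \<open>auto simp: closed_segment_eq_real_ivl\<close>)
    then show ?thesis using True by simp
  next
    case False
    have "p (?e t - ?e u) \<le> M * \<bar>u - t\<bar> * (t - u)"
      by (rule mean_value[OF p re _ de inc]) (use False in \<open>auto simp: closed_segment_eq_real_ivl\<close>)
    then show ?thesis using False p_commute[OF p ein ein] by (metis abs_minus_commute abs_of_pos diff_gt_0_iff_gt not_le)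
  qed
  then show ?thesis unfolding eq by (simp add: power2_eq_square abs_mult_self mult.assoc)
qed

lemma derivs_bounded:
  assumes "p \<in> P" "derivs T D"
  obtains B where "\<And>t. t \<in> {a..b} \<Longrightarrow> p (D k t) \<le> B"
proof -
  have "continuous_on {a..b} (\<lambda>t. p (D k t))"
    by (rule continuous_on_seminorm_curve[where c'="D (Suc k)"]) (use assms in \<open>auto simp: derivs_def\<close>)
  then have "bounded ((\<lambda>t. p (D k t)) ` {a..b})"
    by (intro compact_imp_bounded compact_continuous_image) auto
  then obtain B where "\<forall>x\<in>(\<lambda>t. p (D k t)) ` {a..b}. norm x \<le> B" unfolding bounded_iff by blast
  then have "p (D k t) \<le> B" if "t \<in> {a..b}" for t using that by (simp add: abs_le_iff)
  then show ?thesis by (rule that)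
qed

text \<open>Landau--Kolmogorov: one-sided steps towards the centre keep the interval fixed.\<close>

lemma landau2:
  assumes p: "p \<in> P" and D: "derivs T D" and h: "0 < h" "h \<le> r"
    and M0: "\<And>t. \<bar>t\<bar> \<le> r \<Longrightarrow> p (D 0 t) \<le> M0" and M2: "\<And>t. \<bar>t\<bar> \<le> r \<Longrightarrow> p (D 2 t) \<le> M2"
    and t: "\<bar>t\<bar> \<le> r"
  shows "p (D 1 t) \<le> 2 * M0 / h + h * M2"
proof -
  have Din: "D k s \<in> topspace T" for k s using D by (rule derivs_in)
  define u where "u = (if t \<le> 0 then t + h else t - h)"
  have u: "\<bar>u\<bar> \<le> r" "\<bar>u - t\<bar> = h" using h t by (auto simp: u_def)
  have seg: "\<bar>s\<bar> \<le> r" if "s \<in> closed_segment t u" for s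
    using that u t by (auto simp: closed_segment_eq_real_ivl split: if_splits)
  have A: "p (D 0 u - D 0 t - (u - t) *\<^sub>R D 1 t) \<le> M2 * h\<^sup>2"
    using taylor1[OF p D, of t u M2] M2 seg u(2) by (metis power2_abs)
  have "(u - t) *\<^sub>R D 1 t = (D 0 u - D 0 t) - (D 0 u - D 0 t - (u - t) *\<^sub>R D 1 t)" by simp
  then have "p ((u - t) *\<^sub>R D 1 t) \<le> p (D 0 u - D 0 t) + p (D 0 u - D 0 t - (u - t) *\<^sub>R D 1 t)"
    using p_diff[OF p, of "D 0 u - D 0 t" "D 0 u - D 0 t - (u - t) *\<^sub>R D 1 t"] Din in_diff in_scale by metis
  also have "\<dots> \<le> (M0 + M0) + M2 * h\<^sup>2"
    using p_diff[OF p Din Din, of 0 u 0 t] M0[OF u(1)] M0[OF t] A by linarith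
  finally have "h * p (D 1 t) \<le> 2 * M0 + M2 * h\<^sup>2" using p_scaleR[OF p Din] u(2) by simp
  then show ?thesis using h by (simp add: field_simps power2_eq_square)
qed

text \<open>Induction on the order. The hypothesis, applied to the sequence shifted by one, bounds
  \<open>D 2\<close> by the supremum \<open>M1\<close> of \<open>D 1\<close>; \<open>landau2\<close>
  with the step \<open>h / (2 * C)\<close> then bounds \<open>M1\<close> by terms in which
  \<open>M1\<close> itself has the factor 1/2 and can be absorbed.\<close>

lemma landau:
  assumes p: "p \<in> P"
  shows "\<exists>C\<ge>1. \<forall>D M0 M h r. derivs T D \<longrightarrow> 0 < h \<longrightarrow> h \<le> r \<longrightarrow> (\<forall>t. \<bar>t\<bar> \<le> r \<longrightarrow> p (D 0 t) \<le> M0) \<longrightarrow>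
    (\<forall>t. \<bar>t\<bar> \<le> r \<longrightarrow> p (D (k + 2) t) \<le> M) \<longrightarrow> (\<forall>t. \<bar>t\<bar> \<le> r \<longrightarrow> p (D 1 t) \<le> C * (M0 / h + h ^ (k + 1) * M))"
proof (induction k)
  case 0
  show ?case
  proof (intro exI[of _ 2] conjI allI impI)
    fix D M0 M h r t
    assume *: "derivs T D" "0 < h" "h \<le> r" "\<forall>t. \<bar>t\<bar> \<le> r \<longrightarrow> p (D 0 t) \<le> M0"
      "\<forall>t. \<bar>t\<bar> \<le> r \<longrightarrow> p (D (0 + 2) t) \<le> M" "\<bar>t\<bar> \<le> (r::real)"
    have "0 \<le> M" using *(5)[rule_format, of t] *(6) p_nonneg[OF p derivs_in[OF *(1)], of "0 + 2" t] by linarith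
    then have "0 \<le> h * M" using * by simp
    then show "p (D 1 t) \<le> 2 * (M0 / h + h ^ (0 + 1) * M)"
      using landau2[OF p *(1-3), of M0 M t] * by (simp add: numeral_2_eq_2)
  qed simp
next
  case (Suc k)
  then obtain C where C1: "C \<ge> 1" and C: "\<And>D M0 M h r t. derivs T D \<Longrightarrow> 0 < h \<Longrightarrow> h \<le> r \<Longrightarrow>
    (\<forall>t. \<bar>t\<bar> \<le> r \<longrightarrow> p (D 0 t) \<le> M0) \<Longrightarrow> (\<forall>t. \<bar>t\<bar> \<le> r \<longrightarrow> p (D (k + 2) t) \<le> M) \<Longrightarrow> \<bar>t\<bar> \<le> r \<Longrightarrow>
     p (D 1 t) \<le> C * (M0 / h + h ^ (k + 1) * M)" by blast
  show ?case
  proof (intro exI[of _ "8 * C"] conjI allI impI)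
    show "1 \<le> 8 * C" using C1 by simp
    fix D M0 M h r t
    assume *: "derivs T D" "0 < h" "h \<le> r" "\<forall>t. \<bar>t\<bar> \<le> r \<longrightarrow> p (D 0 t) \<le> M0"
      "\<forall>t. \<bar>t\<bar> \<le> r \<longrightarrow> p (D (Suc k + 2) t) \<le> M" "\<bar>t\<bar> \<le> (r::real)"
    \<comment> \<open>\<open>M1\<close> has to be finite before half of it can be moved to the other
      side; continuity on the compact interval provides this.\<close>
    define A where "A = (\<lambda>t. p (D 1 t)) ` {-r..r}"
    obtain B where "\<And>t. t \<in> {-r..r} \<Longrightarrow> p (D 1 t) \<le> B" using derivs_bounded[OF p *(1)] by blast
    then have bdd: "bdd_above A" unfolding A_def by (intro bdd_aboveI[of _ B]) auto
    have ne: "A \<noteq> {}" using * by (auto simp: A_def)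
    define M1 where "M1 = Sup A"
    have M1: "p (D 1 t) \<le> M1" if "\<bar>t\<bar> \<le> r" for t
      unfolding M1_def A_def by (rule cSUP_upper) (use that bdd A_def in auto)
    have M2: "p (D 2 t) \<le> C * (M1 / h + h ^ (k + 1) * M)" if "\<bar>t\<bar> \<le> r" for t
      using C[of "\<lambda>j. D (j + 1)" h r M1 M t] derivs_shift[OF *(1), of 1] * M1 that by (simp add: numeral_2_eq_2)
    define \<delta> where "\<delta> = h / (2 * C)"
    have "h / (2 * C) \<le> h" using C1 * by (simp add: field_simps)
    then have \<delta>: "0 < \<delta>" "\<delta> \<le> r" using * C1 by (auto simp: \<delta>_def)
    have "p (D 1 t) \<le> 4 * C * M0 / h + M1 / 2 + h ^ Suc (k + 1) * M / 2" if "\<bar>t\<bar> \<le> r" for t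
    proof -
      have "p (D 1 t) \<le> 2 * M0 / \<delta> + \<delta> * (C * (M1 / h + h ^ (k + 1) * M))"
        by (rule landau2[OF p *(1) \<delta> _ _ that]) (use * M2 in auto)
      also have "\<dots> = 4 * C * M0 / h + M1 / 2 + h ^ Suc (k + 1) * M / 2"
        using C1 *(2) by (simp add: \<delta>_def field_simps)
      finally show ?thesis .
    qed
    then have "M1 \<le> 4 * C * M0 / h + M1 / 2 + h ^ Suc (k + 1) * M / 2"
      unfolding M1_def A_def by (intro cSUP_least) (use ne A_def in auto)
    then have le: "M1 \<le> 8 * C * M0 / h + h ^ Suc (k + 1) * M" by simp
    have "0 \<le> M" using *(5)[rule_format, of t] *(6) p_nonneg[OF p derivs_in[OF *(1)], of "Suc k + 2" t] by linarith
    then have "h ^ Suc (k + 1) * M \<le> 8 * C * (h ^ Suc (k + 1) * M)"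
      using C1 * by (intro mult_right_mono[of 1 "8*C", simplified]) auto
    with le M1[OF *(6)] show "p (D 1 t) \<le> 8 * C * (M0 / h + h ^ (Suc k + 1) * M)"
      by (simp add: algebra_simps)
  qed
qed

end

subsection \<open>Smooth curves through prescribed points\<close>

interpretation real_lcs: complete_lcs euclideanreal "{norm}"
  by (rule lcs_euclidean)

lemma curve_Cn_real_id: "curve_Cn euclideanreal n (\<lambda>x. x)"
proof (cases n)
  case (Suc m)
  then show ?thesis
    by (auto simp: curve_deriv_real intro!: exI[of _ "\<lambda>_. 1"] real_lcs.curve_Cn_const)
qed auto

definition flat :: "nat \<Rightarrow> real \<Rightarrow> real" where
  "flat k x = (if x \<le> 0 then 0 else exp (- (1 / x)) / x ^ k)"

lemma flat_DERIV: "(flat k has_real_derivative flat (k + 2) x - real k * flat (k + 1) x) (at x)"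
proof -
  consider "x < 0" | "x > 0" | "x = 0" by linarith
  then show ?thesis
  proof cases
    case 1
    have ev: "\<forall>\<^sub>F y in nhds x. flat k y = 0"
      by (rule eventually_mono[OF order_tendstoD(2)[OF filterlim_ident 1]]) (simp add: flat_def)
    show ?thesis by (subst DERIV_cong_ev[OF refl ev refl]) (use 1 in \<open>simp add: flat_def\<close>)
  next
    case 2
    have ev: "\<forall>\<^sub>F y in nhds x. flat k y = exp (- (1 / y)) / y ^ k"
      by (rule eventually_mono[OF order_tendstoD(1)[OF filterlim_ident 2]]) (simp add: flat_def)
    have "((\<lambda>y. exp (- (1 / y)) / y ^ k) has_real_derivative flat (k + 2) x - real k * flat (k + 1) x) (at x)"
    proof (cases k)
      case 0
      then show ?thesis using 2
        by (auto intro!: derivative_eq_intros simp: flat_def power2_eq_square)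
    next
      case (Suc j)
      show ?thesis using 2 unfolding Suc
        by (auto intro!: derivative_eq_intros simp: flat_def field_simps power2_eq_square) (cases j; simp)
    qed
    then show ?thesis by (subst DERIV_cong_ev[OF refl ev refl])
  next
    case 3
    have "((\<lambda>h. (flat k (0 + h) - flat k 0) / h) \<longlongrightarrow> 0) (at 0)"
    proof (rule filterlim_split_at)
      show "((\<lambda>h. (flat k (0 + h) - flat k 0) / h) \<longlongrightarrow> 0) (at_left 0)"
        by (rule tendsto_eventually) (auto simp: eventually_at_filter flat_def)
      \<comment> \<open>In terms of \<open>inverse h\<close>, which tends to infinity, the
        exponential beats the power \<open>k + 1\<close>: one power more than in
        \<open>flat k\<close>, from the difference quotient.\<close>
      have lim: "((\<lambda>h. inverse h ^ (k + 1) / exp (inverse h)) \<longlongrightarrow> (0::real)) (at_right 0)"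
        by (rule filterlim_compose[OF tendsto_power_div_exp_0 filterlim_inverse_at_top_right])
      show "((\<lambda>h. (flat k (0 + h) - flat k 0) / h) \<longlongrightarrow> 0) (at_right 0)"
        by (rule Lim_transform_eventually[OF lim])
          (auto simp: eventually_at_filter flat_def exp_minus field_simps)
    qed
    then show ?thesis using 3 by (simp add: DERIV_def flat_def)
  qed
qed

lemma curve_Cn_flat: "curve_Cn euclideanreal n (flat k)"
proof (induction n arbitrary: k)
  case (Suc n)
  have "curve_Cn euclideanreal n (\<lambda>x. flat (k + 2) x + (- real k) *\<^sub>R flat (k + 1) x)"
    by (intro real_lcs.curve_Cn_add real_lcs.curve_Cn_scaleR Suc)
  then show ?case using flat_DERIV
    by (auto simp: curve_deriv_real intro!: exI[of _ "\<lambda>x. flat (k + 2) x - real k * flat (k + 1) x"])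
qed auto

text \<open>The inner term \<open>flat 0 (x * x - 1)\<close> is 0 for
  \<open>\<bar>x\<bar> \<le> 1\<close> and at least \<open>flat 0 3\<close> once
  \<open>x * x - 1 \<ge> 3\<close>, that is for \<open>\<bar>x\<bar> \<ge> 2\<close>; the outer
  \<open>flat 0\<close> turns this into a plateau and a zero set, and the denominator is the value
  on the plateau.\<close>

definition bump :: "real \<Rightarrow> real" where
  "bump x = flat 0 (flat 0 3 - flat 0 (x * x - 1)) / flat 0 (flat 0 3)"

lemma flat_pos: "x > 0 \<Longrightarrow> flat 0 x > 0"
  by (simp add: flat_def)

lemma flat_mono: "x \<le> y \<Longrightarrow> flat 0 x \<le> flat 0 y"
  by (auto simp: flat_def frac_le)

lemma bump_range: "0 \<le> bump x" "bump x \<le> 1" "\<bar>bump x\<bar> \<le> 1"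
proof -
  have "0 < flat 0 (flat 0 3)" by (intro flat_pos) simp
  moreover have "0 \<le> flat 0 y" for y by (simp add: flat_def)
  moreover have "flat 0 (flat 0 3 - flat 0 (x * x - 1)) \<le> flat 0 (flat 0 3)"
    by (intro flat_mono) (simp add: flat_def)
  ultimately show "0 \<le> bump x" "bump x \<le> 1" unfolding bump_def by (simp_all add: divide_le_eq_1)
  then show "\<bar>bump x\<bar> \<le> 1" by simp
qed

lemma bump_eq_1: "\<bar>x\<bar> \<le> 1 \<Longrightarrow> bump x = 1"
proof -
  assume "\<bar>x\<bar> \<le> 1"
  then have "x * x \<le> 1" by (metis abs_le_square_iff abs_one one_power2 power2_eq_square)
  then have "flat 0 (x * x - 1) = 0" by (simp add: flat_def)
  moreover have "0 < flat 0 (flat 0 3)" by (intro flat_pos) simp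
  ultimately show ?thesis by (simp add: bump_def)
qed

lemma bump_eq_0: "2 \<le> \<bar>x\<bar> \<Longrightarrow> bump x = 0"
proof -
  assume "2 \<le> \<bar>x\<bar>"
  then have "2\<^sup>2 \<le> \<bar>x\<bar>\<^sup>2" by (intro power_mono) auto
  then have "3 \<le> x * x - 1" by (simp add: power2_eq_square)
  then have "flat 0 3 - flat 0 (x * x - 1) \<le> 0" using flat_mono by simp
  then show ?thesis by (simp add: bump_def flat_def)
qed

lemma smooth_bump: "smooth_curve euclideanreal bump"
  unfolding real_lcs.smooth_curve_iff_Cn
proof
  fix n
  have "curve_Cn euclideanreal n (\<lambda>x. x *\<^sub>R x + (-1))"
    by (intro real_lcs.curve_Cn_add real_lcs.curve_Cn_mult real_lcs.curve_Cn_const curve_Cn_real_id) simp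
  from real_lcs.curve_Cn_compose[OF this curve_Cn_flat[of n 0]]
  have "curve_Cn euclideanreal n (\<lambda>x. flat 0 3 + (-1) *\<^sub>R flat 0 (x *\<^sub>R x + (-1)))"
    by (intro real_lcs.curve_Cn_add real_lcs.curve_Cn_scaleR real_lcs.curve_Cn_const) auto
  from real_lcs.curve_Cn_compose[OF this curve_Cn_flat[of n 0]]
  have "curve_Cn euclideanreal n (\<lambda>x. (1 / flat 0 (flat 0 3)) *\<^sub>R flat 0 (flat 0 3 + (-1) *\<^sub>R flat 0 (x *\<^sub>R x + (-1))))"
    by (rule real_lcs.curve_Cn_scaleR)
  then show "curve_Cn euclideanreal n bump" by (simp add: bump_def[abs_def])
qed

lemma smooth_curve_real_id: "smooth_curve euclideanreal (\<lambda>x. x)"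
  unfolding real_lcs.smooth_curve_iff_Cn using curve_Cn_real_id by blast

text \<open>Confines a parameter to \<open>(-d, d)\<close> without changing it near 0. Composed with
  it, a map known only for small parameters becomes one defined for all of them.\<close>

definition cutoff :: "real \<Rightarrow> real \<Rightarrow> real" where
  "cutoff d x = bump (2 / d * x) * x"

lemma smooth_cutoff: "smooth_curve euclideanreal (cutoff d)"
proof -
  have "smooth_curve euclideanreal (\<lambda>x. bump ((2 / d) *\<^sub>R x) *\<^sub>R x)"
    by (intro real_lcs.smooth_curve_mult real_lcs.smooth_curve_compose[OF _ smooth_bump]
        real_lcs.smooth_curve_scaleR smooth_curve_real_id)
  then show ?thesis by (simp add: cutoff_def[abs_def])
qed

lemma cutoff_less: "d > 0 \<Longrightarrow> \<bar>cutoff d x\<bar> < d"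
proof (cases "\<bar>x\<bar> < d")
  case True
  have "\<bar>cutoff d x\<bar> \<le> 1 * \<bar>x\<bar>"
    unfolding cutoff_def abs_mult using bump_range by (intro mult_right_mono) auto
  then show ?thesis using True by simp
next
  case False
  assume "d > 0"
  with False have "2 \<le> \<bar>2 / d * x\<bar>" by (simp add: abs_mult field_simps)
  then show ?thesis using \<open>d > 0\<close> by (simp add: cutoff_def bump_eq_0)
qed

lemma cutoff_eq: "d > 0 \<Longrightarrow> \<bar>x\<bar> \<le> d / 2 \<Longrightarrow> cutoff d x = x"
  unfolding cutoff_def by (subst bump_eq_1) (auto simp: abs_mult field_simps)

text \<open>Beyond radius \<open>r\<close> all derivatives vanish, by local comparison with the zero
  curve; on the remaining compact interval they are continuous.\<close>

lemma compact_support_derivs_bounded: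
  assumes D: "derivs euclideanreal D" and 0: "\<And>x. r \<le> \<bar>x\<bar> \<Longrightarrow> D 0 x = 0"
  shows "\<exists>C. \<forall>x. \<bar>D k x\<bar> \<le> C"
proof -
  have Z: "derivs euclideanreal (\<lambda>_ _. 0)"
    unfolding derivs_def using real_lcs.curve_deriv_const[of 0] by auto
  have "D k x = 0" if "r < \<bar>x\<bar>" for x
  proof -
    have "open {y::real. r < \<bar>y\<bar>}" by (intro open_Collect_less continuous_intros)
    then have "\<forall>\<^sub>F y in nhds x. r < \<bar>y\<bar>" using that by (auto simp: eventually_nhds)
    then have "\<forall>\<^sub>F y in nhds x. D 0 y = (\<lambda>_ _. 0) (0::nat) (0 + 1 * (y - x))"
      by (rule eventually_mono) (use 0 in simp)
    from eventually_nhds_x_imp_x[OF real_lcs.derivs_affine_local[OF D Z this, of k]]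
    show ?thesis by simp
  qed
  moreover obtain B where "\<And>t. t \<in> {-\<bar>r\<bar>..\<bar>r\<bar>} \<Longrightarrow> norm (D k t) \<le> B"
    using real_lcs.derivs_bounded[OF _ D] by blast
  ultimately have "\<bar>D k x\<bar> \<le> max B 0" for x
  proof (cases "r < \<bar>x\<bar>")
    case False
    then have "x \<in> {-\<bar>r\<bar>..\<bar>r\<bar>}" by auto
    from \<open>\<And>t. t \<in> {-\<bar>r\<bar>..\<bar>r\<bar>} \<Longrightarrow> norm (D k t) \<le> B\<close>[OF this] show ?thesis by simp
  qed simp
  then show ?thesis by blast
qed

section \<open>Series of rescaled bumps and the special curve\<close>

text \<open>Each differentiation brings out a factor \<open>a n\<close>, so summability of the
  weights against every power of \<open>\<bar>a n\<bar>\<close> makes all derived series converge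
  uniformly, and they may be differentiated term by term.\<close>

lemma smooth_series:
  fixes w :: "nat \<Rightarrow> 'a::banach" and a b :: "nat \<Rightarrow> real"
  assumes D: "derivs euclideanreal D" and C: "\<And>k x. \<bar>D k x\<bar> \<le> C k"
    and sm: "\<And>k. summable (\<lambda>n. \<bar>a n\<bar> ^ k * norm (w n))"
  defines "S \<equiv> \<lambda>k x. \<Sum>n. (a n ^ k * D k (a n * x + b n)) *\<^sub>R w n"
  shows "derivs euclidean S" "norm (S k x) \<le> C k * (\<Sum>n. \<bar>a n\<bar> ^ k * norm (w n))"
proof -
  define f where "f k n x = (a n ^ k * D k (a n * x + b n)) *\<^sub>R w n" for k n x
  have fb: "norm (f k n x) \<le> C k * (\<bar>a n\<bar> ^ k * norm (w n))" for k n x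
  proof -
    have "norm (f k n x) = \<bar>D k (a n * x + b n)\<bar> * (\<bar>a n\<bar> ^ k * norm (w n))"
      by (simp add: f_def abs_mult power_abs)
    also have "\<dots> \<le> C k * (\<bar>a n\<bar> ^ k * norm (w n))" using C by (intro mult_right_mono) auto
    finally show ?thesis .
  qed
  have sC: "summable (\<lambda>n. C k * (\<bar>a n\<bar> ^ k * norm (w n)))" for k
    using sm by (rule summable_mult)
  have sn: "summable (\<lambda>n. norm (f k n x))" for k x
    by (rule summable_comparison_test'[OF sC[of k], of 0]) (use fb in simp)
  have S: "(\<lambda>n. f k n x) sums S k x" for k x
    using summable_norm_cancel[OF sn] unfolding S_def f_def by (rule summable_sums)
  show "norm (S k x) \<le> C k * (\<Sum>n. \<bar>a n\<bar> ^ k * norm (w n))"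
  proof -
    have "norm (S k x) \<le> (\<Sum>n. norm (f k n x))"
      unfolding S_def f_def[symmetric] by (rule summable_norm[OF sn])
    also have "\<dots> \<le> (\<Sum>n. C k * (\<bar>a n\<bar> ^ k * norm (w n)))" by (rule suminf_le[OF fb sn sC])
    finally show ?thesis using suminf_mult[OF sm] by simp
  qed
  show "derivs euclidean S" unfolding derivs_def
  proof (intro allI conjI)
    fix k t
    have df: "((\<lambda>x. f k n x) has_derivative (\<lambda>h. h *\<^sub>R f (Suc k) n x)) (at x within UNIV)" for n x
    proof -
      have 1: "(D k has_real_derivative D (Suc k) (a n * x + b n)) (at (a n * x + b n))"
        using D by (simp add: derivs_def curve_deriv_real)
      have 2: "((\<lambda>x. a n * x + b n) has_real_derivative a n) (at x)"
        by (auto intro!: derivative_eq_intros)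
      have 3: "((\<lambda>x. a n ^ k * D k (a n * x + b n)) has_real_derivative a n ^ k * (D (Suc k) (a n * x + b n) * a n)) (at x)"
        by (rule DERIV_cmult[OF DERIV_chain2[OF 1 2]])
      show ?thesis
        using has_vector_derivative_scaleR[OF 3 has_vector_derivative_const, of "w n"]
        unfolding f_def has_vector_derivative_def by (simp add: algebra_simps)
    qed
    have ul: "uniform_limit UNIV (\<lambda>n x. \<Sum>i<n. f (Suc k) i x) (\<lambda>x. S (Suc k) x) sequentially"
      unfolding S_def f_def[symmetric] by (rule Weierstrass_m_test[OF fb sC])
    have "\<exists>g. \<forall>x\<in>UNIV. (\<lambda>n. f k n x) sums g x \<and> (g has_derivative (\<lambda>h. h *\<^sub>R S (Suc k) x)) (at x within UNIV)"
    proof (rule has_derivative_series[OF convex_UNIV df _ UNIV_I S[of k t]])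
      fix e :: real assume "e > 0"
      then have "\<forall>\<^sub>F n in sequentially. \<forall>x. dist (\<Sum>i<n. f (Suc k) i x) (S (Suc k) x) < e"
        using ul unfolding uniform_limit_iff by auto
      then show "\<forall>\<^sub>F n in sequentially. \<forall>x\<in>UNIV. \<forall>h. norm ((\<Sum>i<n. h *\<^sub>R f (Suc k) i x) - h *\<^sub>R S (Suc k) x) \<le> e * norm h"
      proof eventually_elim
        case (elim n)
        show ?case
        proof (intro ballI allI)
          fix x h
          have "norm ((\<Sum>i<n. h *\<^sub>R f (Suc k) i x) - h *\<^sub>R S (Suc k) x)
              = norm h * norm ((\<Sum>i<n. f (Suc k) i x) - S (Suc k) x)"
            by (simp flip: scaleR_sum_right scaleR_diff_right)
          also have "\<dots> \<le> norm h * e"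
            using elim[rule_format, of x] by (intro mult_left_mono) (auto simp: dist_norm)
          finally show "norm ((\<Sum>i<n. h *\<^sub>R f (Suc k) i x) - h *\<^sub>R S (Suc k) x) \<le> e * norm h"
            by (simp add: mult.commute)
        qed
      qed
    qed
    then obtain g where g: "\<And>x. (\<lambda>n. f k n x) sums g x" "\<And>x. (g has_derivative (\<lambda>h. h *\<^sub>R S (Suc k) x)) (at x)" by auto
    have "g = S k" using sums_unique2[OF g(1) S] by auto
    then show "curve_deriv euclidean (S k) t (S (Suc k) t)"
      using g(2) unfolding curve_deriv_euclidean has_vector_derivative_def by blast
  qed auto
qed

text \<open>A bump in \<open>8 * 2^n * \<tau> - 8\<close> is centred at \<open>(1/2)^n\<close> and
  vanishes from distance \<open>(1/2)^n / 4\<close> on. Close to \<open>(1/2)^m\<close> all bumps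
  but the \<open>m\<close>-th are therefore zero.\<close>

lemma dyadic_separated:
  fixes \<tau> :: real
  assumes "\<bar>\<tau> - (1/2)^m\<bar> < (1/2)^m / 8" "n \<noteq> m"
  shows "2 \<le> \<bar>8 * 2^n * \<tau> + (-8)\<bar>"
proof -
  have e: "(2::real)^m * (1/2)^m = 1" by (simp add: flip: power_mult_distrib)
  have "2^m * \<bar>\<tau> - (1/2)^m\<bar> < 2^m * ((1/2)^m / 8)" using assms(1) by (intro mult_strict_left_mono) auto
  then have "\<bar>2^m * \<tau> - 1\<bar> < 1 / 8"
    using e by (simp add: abs_mult_pos' right_diff_distrib[symmetric]) (metis (no_types, opaque_lifting) abs_mult abs_numeral e power_abs right_diff_distrib)
  then have lo: "7/8 < 2^m * \<tau>" and hi: "2^m * \<tau> < 9/8" by linarith+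
  consider "n < m" | "m < n" using assms(2) by linarith
  then show ?thesis
  proof cases
    case 1
    then obtain j where m: "m = n + Suc j" using less_imp_Suc_add by auto
    have "2^n * \<tau> * 2^Suc j < 9/8" using hi by (simp add: m power_add mult_ac)
    moreover have "(2::real) \<le> 2^Suc j" by simp
    moreover have "0 < 2^m * \<tau>" using lo by simp
    then have "0 < \<tau>" by (simp add: zero_less_mult_iff)
    then have "2^n * \<tau> * 2 \<le> 2^n * \<tau> * 2^Suc j" by (intro mult_left_mono) auto
    ultimately have "2^n * \<tau> * 2 < 9/8" by linarith
    then have "8 * 2^n * \<tau> + (-8) \<le> -2" by linarith
    then show ?thesis by linarith
  next
    case 2
    then obtain j where n: "n = m + Suc j" using less_imp_Suc_add by auto
    have "7/8 * 2 \<le> 2^m * \<tau> * 2^Suc j" using lo by (intro mult_mono) auto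
    then have "7/4 \<le> 2^n * \<tau>" by (simp add: n power_add mult_ac)
    then show ?thesis by linarith
  qed
qed

text \<open>For fixed \<open>k\<close> the terms are \<open>8^k\<close> times those of the
  exponential series at \<open>2^k / 2\<close>: the factorial outweighs all the factors that
  differentiation of bumps with dyadic supports produces.\<close>

lemma summable_dyadic_fact: "summable (\<lambda>n. \<bar>8 * 2^n\<bar>^k * ((1/2)^n / fact n :: real))"
proof -
  have "8^k * (inverse (fact n) * (2^k / 2)^n) = \<bar>8 * 2^n\<bar>^k * ((1/2)^n / fact n :: real)" for n :: nat
  proof -
    have 1: "\<bar>8 * 2^n :: real\<bar>^k = 8^k * (2^n)^k" by (simp add: power_mult_distrib)
    have 2: "((2::real)^k)^n = (2^n)^k" by (simp only: power_mult[symmetric] mult.commute[of k n])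
    have 3: "((2::real)^k / 2)^n = (2^n)^k * (1/2)^n" by (simp only: power_divide 2) simp
    show ?thesis unfolding 1 3 by (simp add: field_simps)
  qed
  moreover have "summable (\<lambda>n. 8^k * (inverse (fact n) * (2^k / 2 :: real)^n))"
    by (intro summable_mult summable_exp)
  ultimately show ?thesis by (simp only:)
qed

text \<open>
  The special curve lemma: if \<open>Q\<close> were unbounded near \<open>x\<close>, a single smooth curve could run through
  rapidly converging points \<open>y n\<close> at the times \<open>2\<^sup>-\<^sup>n\<close>, moving there with slope \<open>l n\<close> in direction \<open>e\<close>.
\<close>

lemma bounded_along_curves:
  fixes Q :: "'a::euclidean_space \<Rightarrow> real"
  assumes U: "open U" and K: "compact K" "K \<subseteq> U"
    and H: "\<And>c. smooth_curve euclidean c \<Longrightarrow> range c \<subseteq> U \<Longrightarrow> \<exists>C. continuous_on {0..1} C \<and>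
      (\<forall>t0 x l. l > 0 \<longrightarrow> (\<forall>\<^sub>F t in nhds t0. c t = x + (l * (t - t0)) *\<^sub>R e) \<longrightarrow> C t0 = l ^ k * Q x)"
  shows "\<exists>B. \<forall>x\<in>K. Q x \<le> B"
proof (rule ccontr)
  assume "\<not> ?thesis"
  then have "\<forall>n::nat. \<exists>x\<in>K. Q x > real n" by (meson linorder_not_le)
  then obtain X where X: "\<And>n. X n \<in> K" "\<And>n. Q (X n) > real n" by metis
  obtain x r where x: "x \<in> K" "strict_mono r" "(X \<circ> r) \<longlonglongrightarrow> x"
    using K(1) X(1) unfolding compact_def by blast
  have ex: "\<exists>y\<in>K. norm (y - x) < d \<and> Q y > b" if "d > 0" for d b
  proof -
    have "\<forall>\<^sub>F n in sequentially. dist (X (r n)) x < d"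
      using tendstoD[OF x(3) that] by (simp add: comp_def)
    then obtain N where N: "\<And>n. n \<ge> N \<Longrightarrow> dist (X (r n)) x < d" unfolding eventually_sequentially by blast
    obtain n where n: "dist (X (r n)) x < d" "b \<le> real n"
    proof (rule that[of "max N (nat \<lceil>b\<rceil>)"])
      show "dist (X (r (max N (nat \<lceil>b\<rceil>)))) x < d" by (rule N) simp
      show "b \<le> real (max N (nat \<lceil>b\<rceil>))" by linarith
    qed
    have "real n \<le> real (r n)" using seq_suble[OF x(2)] by simp
    then show ?thesis using n X(1,2)[of "r n"] by (intro bexI[of _ "X (r n)"]) (auto simp: dist_norm)
  qed
  obtain \<rho> where \<rho>: "\<rho> > 0" "cball x \<rho> \<subseteq> U"
    using U K(2) x(1) open_contains_cball by (metis subsetD)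
  \<comment> \<open>The factorial pays for the derivatives of all orders; the geometric factor and
    \<open>\<rho> / 8\<close> make the total at most \<open>\<rho> / 4\<close>.\<close>
  define \<omega> where "\<omega> n = (1/2)^n / fact n * (\<rho> / 8)" for n :: nat
  have \<omega>0: "\<omega> n > 0" for n using \<rho> by (simp add: \<omega>_def)
  define l where "l n = \<omega> n / (1 + norm e)" for n
  have l0: "l n > 0" for n using \<omega>0 by (simp add: l_def add_pos_nonneg)
  \<comment> \<open>\<open>Q (y n)\<close> will only be visible multiplied by
    \<open>l n ^ k\<close>, so \<open>y n\<close> is chosen after the slope and has to compensate
    for it.\<close>
  have "\<forall>n. \<exists>y. y \<in> K \<and> norm (y - x) < \<omega> n \<and> Q y > real n / l n ^ k" using ex \<omega>0 by blast
  then obtain y where y: "\<And>n. y n \<in> K" "\<And>n. norm (y n - x) < \<omega> n" "\<And>n. Q (y n) > real n / l n ^ k" by metis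
  define a :: "nat \<Rightarrow> real" where "a n = 8 * 2 ^ n" for n
  \<comment> \<open>The argument of the \<open>n\<close>-th bump grows at rate \<open>a n\<close>,
    so dividing by \<open>a n\<close> gives the motion along \<open>e\<close> the slope
    \<open>l n\<close>.\<close>
  define z where "z n = (l n / a n) *\<^sub>R e" for n
  have le: "norm ((l n) *\<^sub>R e) \<le> \<omega> n" for n
  proof -
    have "norm ((l n) *\<^sub>R e) = \<omega> n * (norm e / (1 + norm e))" using l0[of n] \<omega>0[of n] by (simp add: l_def)
    also have "\<dots> \<le> \<omega> n * 1" using \<omega>0[of n] by (intro mult_left_mono) (auto simp: divide_le_eq add_pos_nonneg)
    finally show ?thesis by simp
  qed
  have zn: "norm (z n) \<le> \<omega> n / 8" for n
  proof -
    have "norm (z n) = norm ((l n) *\<^sub>R e) / a n" by (simp add: z_def a_def)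
    also have "\<dots> \<le> \<omega> n / 8" using le[of n] \<omega>0[of n] by (intro frac_le) (auto simp: a_def)
    finally show ?thesis .
  qed
  have s\<omega>: "summable (\<lambda>n. \<bar>a n\<bar>^j * \<omega> n)" for j
    using summable_mult2[OF summable_dyadic_fact[of j], of "\<rho> / 8"] by (simp add: a_def \<omega>_def mult.assoc)
  have sy: "summable (\<lambda>n. \<bar>a n\<bar>^j * norm (y n - x))" for j
    by (rule summable_comparison_test'[OF s\<omega>[of j], of 0]) (use less_imp_le[OF y(2)] in \<open>auto intro!: mult_left_mono\<close>)
  have sz: "summable (\<lambda>n. \<bar>a n\<bar>^j * norm (z n))" for j
  proof (rule summable_comparison_test'[OF s\<omega>[of j], of 0])
    fix n have "norm (z n) \<le> \<omega> n" using zn[of n] \<omega>0[of n] by linarith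
    then show "norm (\<bar>a n\<bar>^j * norm (z n)) \<le> \<bar>a n\<bar>^j * \<omega> n" by (simp add: mult_left_mono)
  qed
  have sum\<omega>: "summable \<omega>" "suminf \<omega> \<le> \<rho> / 4"
  proof -
    show s: "summable \<omega>" using s\<omega>[of 0] by simp
    have "(\<lambda>n. (1/2)^n * (\<rho> / 8)) sums (1 / (1 - 1/2) * (\<rho> / 8))"
      by (intro sums_mult2 geometric_sums) simp
    then have g: "summable (\<lambda>n. (1/2)^n * (\<rho> / 8))" "(\<Sum>n. (1/2)^n * (\<rho> / 8)) = \<rho> / 4"
      by (simp_all add: sums_iff)
    have "\<omega> n \<le> (1/2)^n * (\<rho> / 8)" for n
      unfolding \<omega>_def using \<rho>(1) by (intro mult_right_mono) (auto simp: divide_le_eq fact_ge_1)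
    from suminf_le[OF this s g(1)] g(2) show "suminf \<omega> \<le> \<rho> / 4" by simp
  qed
  obtain D1 where D1: "D1 0 = bump" "derivs euclideanreal D1" using smooth_bump smooth_curve_derivs by metis
  \<comment> \<open>The second profile is the identity near 0 and yields the motion along
    \<open>e\<close>; the first, \<open>bump\<close> alone, yields the displacement to
    \<open>y n\<close>.\<close>
  have "smooth_curve euclideanreal (\<lambda>x. bump x *\<^sub>R x)"
    by (intro real_lcs.smooth_curve_mult smooth_bump smooth_curve_real_id)
  then obtain D2 where D2: "D2 0 = (\<lambda>x. bump x *\<^sub>R x)" "derivs euclideanreal D2"
    unfolding smooth_curve_derivs by blast
  have "\<exists>C. \<forall>x. \<bar>D1 j x\<bar> \<le> C" "\<exists>C. \<forall>x. \<bar>D2 j x\<bar> \<le> C" for j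
    using compact_support_derivs_bounded[OF D1(2), of 2] compact_support_derivs_bounded[OF D2(2), of 2]
    by (simp_all add: D1(1) D2(1) bump_eq_0)
  then obtain C1 C2 where C12: "\<And>j x. \<bar>D1 j x\<bar> \<le> C1 j" "\<And>j x. \<bar>D2 j x\<bar> \<le> C2 j" by metis
  note S1 = smooth_series(1)[OF D1(2) C12(1) sy, of "\<lambda>_. -8"]
  note S2 = smooth_series(1)[OF D2(2) C12(2) sz, of "\<lambda>_. -8"]
  define A where "A \<tau> = (\<Sum>n. bump (a n * \<tau> + (-8)) *\<^sub>R (y n - x))" for \<tau>
  define B where "B \<tau> = (\<Sum>n. (bump (a n * \<tau> + (-8)) * (a n * \<tau> + (-8))) *\<^sub>R z n)" for \<tau>
  define c where "c \<tau> = x + (A \<tau> + B \<tau>)" for \<tau>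
  interpret V: complete_lcs "euclidean :: 'a topology" "{norm}" by (rule lcs_euclidean)
  have "smooth_curve euclidean A"
    unfolding smooth_curve_derivs by (rule exI, rule conjI[OF _ S1]) (simp add: A_def[abs_def] D1(1))
  moreover have "smooth_curve euclidean B"
    unfolding smooth_curve_derivs by (rule exI, rule conjI[OF _ S2]) (simp add: B_def[abs_def] D2(1))
  ultimately have smooth: "smooth_curve euclidean c"
    unfolding c_def[abs_def] by (intro V.smooth_curve_add V.smooth_curve_const) auto
  have "norm (A \<tau>) \<le> \<rho> / 4" for \<tau>
  proof -
    have b: "norm (bump (a n * \<tau> + (-8)) *\<^sub>R (y n - x)) \<le> \<omega> n" for n
    proof -
      have "\<bar>bump (a n * \<tau> + (-8))\<bar> * norm (y n - x) \<le> 1 * \<omega> n"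
        using less_imp_le[OF y(2)] by (intro mult_mono bump_range(3)) auto
      then show ?thesis by simp
    qed
    then have s: "summable (\<lambda>n. norm (bump (a n * \<tau> + (-8)) *\<^sub>R (y n - x)))"
      by (intro summable_comparison_test'[OF sum\<omega>(1), of 0]) simp
    have "norm (A \<tau>) \<le> (\<Sum>n. norm (bump (a n * \<tau> + (-8)) *\<^sub>R (y n - x)))"
      unfolding A_def by (rule summable_norm[OF s])
    also have "\<dots> \<le> suminf \<omega>" by (rule suminf_le[OF b s sum\<omega>(1)])
    finally show ?thesis using sum\<omega>(2) by simp
  qed
  moreover have "norm (B \<tau>) \<le> \<rho> / 4" for \<tau>
  proof -
    have b: "norm ((bump (a n * \<tau> + (-8)) * (a n * \<tau> + (-8))) *\<^sub>R z n) \<le> \<omega> n" for n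
    proof -
      have "\<bar>bump s * s\<bar> \<le> 2" for s
      proof (cases "2 \<le> \<bar>s\<bar>")
        case False
        then have "\<bar>bump s\<bar> * \<bar>s\<bar> \<le> 1 * 2" using bump_range(3) by (intro mult_mono) auto
        then show ?thesis by (simp add: abs_mult)
      qed (simp add: bump_eq_0)
      then have "\<bar>bump (a n * \<tau> + (-8)) * (a n * \<tau> + (-8))\<bar> * norm (z n) \<le> 2 * (\<omega> n / 8)"
        using zn by (intro mult_mono) auto
      then show ?thesis using \<omega>0[of n] by simp
    qed
    then have s: "summable (\<lambda>n. norm ((bump (a n * \<tau> + (-8)) * (a n * \<tau> + (-8))) *\<^sub>R z n))"
      by (intro summable_comparison_test'[OF sum\<omega>(1), of 0]) simp
    have "norm (B \<tau>) \<le> (\<Sum>n. norm ((bump (a n * \<tau> + (-8)) * (a n * \<tau> + (-8))) *\<^sub>R z n))"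
      unfolding B_def by (rule summable_norm[OF s])
    also have "\<dots> \<le> suminf \<omega>" by (rule suminf_le[OF b s sum\<omega>(1)])
    finally show ?thesis using sum\<omega>(2) by simp
  qed
  \<comment> \<open>The curve has to lie in \<open>U\<close> at all times, not only near the
    prescribed ones, for the hypothesis on curves to apply.\<close>
  ultimately have "norm (A \<tau> + B \<tau>) \<le> \<rho> / 4 + \<rho> / 4" for \<tau> by (rule norm_triangle_mono)
  then have AB: "norm (A \<tau> + B \<tau>) \<le> \<rho>" for \<tau> by (rule order_trans) (use \<rho>(1) in simp)
  have "dist x (c \<tau>) = norm (A \<tau> + B \<tau>)" for \<tau>
    unfolding c_def dist_norm by (metis add_diff_cancel_left' norm_minus_commute)
  with AB have "c \<tau> \<in> cball x \<rho>" for \<tau> by simp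
  then have "range c \<subseteq> U" using \<rho>(2) by blast
  then obtain C where C: "continuous_on {0..1} C"
    "\<And>t0 x l. l > 0 \<Longrightarrow> (\<forall>\<^sub>F t in nhds t0. c t = x + (l * (t - t0)) *\<^sub>R e) \<Longrightarrow> C t0 = l ^ k * Q x"
    using H[OF smooth] by blast
  have near: "c \<tau> = y m + (l m * (\<tau> - (1/2)^m)) *\<^sub>R e" if "\<bar>\<tau> - (1/2)^m\<bar> < (1/2)^m / 8" for \<tau> m
  proof -
    have 0: "bump (a n * \<tau> + (-8)) = 0" if "n \<noteq> m" for n
      unfolding a_def using dyadic_separated[OF \<open>\<bar>\<tau> - (1/2)^m\<bar> < (1/2)^m / 8\<close> that] by (rule bump_eq_0)
    have e: "a m * (1/2)^m = 8" by (simp add: a_def flip: power_mult_distrib)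
    have am: "a m * \<tau> + (-8) = a m * (\<tau> - (1/2)^m)" using e by (simp add: algebra_simps)
    have "\<bar>a m * \<tau> + (-8)\<bar> = a m * \<bar>\<tau> - (1/2)^m\<bar>" unfolding am by (simp add: abs_mult a_def)
    also have "\<dots> \<le> a m * ((1/2)^m / 8)" using that by (intro mult_left_mono) (auto simp: a_def)
    finally have 1: "bump (a m * \<tau> + (-8)) = 1" using e by (intro bump_eq_1) simp
    have "A \<tau> = y m - x" unfolding A_def by (subst suminf_finite[of "{m}"]) (use 0 1 in auto)
    moreover have "B \<tau> = (a m * (\<tau> - (1/2)^m)) *\<^sub>R z m"
      unfolding B_def by (subst suminf_finite[of "{m}"]) (use 0 1 am in auto)
    moreover have "a m \<noteq> 0" by (simp add: a_def)
    ultimately show ?thesis unfolding c_def z_def by (simp add: mult.commute)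
  qed
  have "C ((1/2)^m) = l m ^ k * Q (y m)" for m
  proof (rule C(2)[OF l0])
    have "open {\<tau>::real. \<bar>\<tau> - (1/2)^m\<bar> < (1/2)^m / 8}" by (intro open_Collect_less continuous_intros)
    then have "\<forall>\<^sub>F \<tau> in nhds ((1/2)^m). \<bar>\<tau> - (1/2::real)^m\<bar> < (1/2)^m / 8"
      unfolding eventually_nhds by (intro exI[of _ "{\<tau>::real. \<bar>\<tau> - (1/2)^m\<bar> < (1/2)^m / 8}"]) simp
    then show "\<forall>\<^sub>F \<tau> in nhds ((1/2)^m). c \<tau> = y m + (l m * (\<tau> - (1/2)^m)) *\<^sub>R e"
      by (rule eventually_mono) (rule near)
  qed
  then have big: "C ((1/2)^m) > real m" for m
    using y(3)[of m] l0[of m] by (simp add: pos_divide_less_eq mult.commute)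
  have "bounded (C ` {0..1})" by (intro compact_imp_bounded compact_continuous_image C(1)) auto
  then obtain M where M: "\<forall>v\<in>C ` {0..1}. norm v \<le> M" unfolding bounded_iff by blast
  obtain m :: nat where "M < real m" using reals_Archimedean2 by blast
  moreover have "C ((1/2)^m) \<le> M" using M by (auto simp: power_le_one abs_le_iff)
  ultimately show False using big[of m] by simp
qed

subsection \<open>Directional derivatives of smooth maps are smooth\<close>

lemma smooth_curve_bounded_linear:
  fixes c :: "real \<Rightarrow> 'a::banach" and L :: "'a \<Rightarrow> 'b::banach"
  assumes "smooth_curve euclidean c" "bounded_linear L"
  shows "smooth_curve euclidean (\<lambda>t. L (c t))"
proof -
  obtain D where D: "D 0 = c" "derivs euclidean D" using assms smooth_curve_derivs by metis
  have "derivs euclidean (\<lambda>k t. L (D k t))"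
    using D(2) bounded_linear.has_vector_derivative[OF assms(2)]
    unfolding derivs_def curve_deriv_euclidean by auto
  then show ?thesis unfolding smooth_curve_derivs using D(1) by (intro exI[of _ "\<lambda>k t. L (D k t)"]) auto
qed

lemma smooth_curve_in: "smooth_curve T c \<Longrightarrow> c t \<in> topspace T"
  unfolding smooth_curve_def by metis

context lcs
begin

lemma derivs_scaleR: "derivs T D \<Longrightarrow> derivs T (\<lambda>k t. r *\<^sub>R D k t)"
  unfolding derivs_def by (simp add: in_scale curve_deriv_scaleR image_subset_iff)

lemma derivs_diff: "derivs T D \<Longrightarrow> derivs T E \<Longrightarrow> derivs T (\<lambda>k t. D k t - E k t)"
  unfolding derivs_def by (simp add: in_diff curve_deriv_diff image_subset_iff)

lemma geometric_steps:
  assumes p: "p \<in> P" and X: "\<And>n. X n \<in> topspace T" and b: "0 < b" "b < 1"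
    and st: "\<And>n. p (X (Suc n) - X n) \<le> C * b ^ n" and "n \<le> m"
  shows "p (X m - X n) \<le> C * b ^ n / (1 - b)"
proof -
  have C0: "0 \<le> C" using st[of 0] p_nonneg[OF p in_diff[OF X X], of "Suc 0" 0] by simp
  \<comment> \<open>The exact geometric sum, with the difference of powers, is the form that
    reproduces itself in the induction on \<open>m\<close>.\<close>
  have "p (X m - X n) \<le> C * (b ^ n - b ^ m) / (1 - b)"
    using \<open>n \<le> m\<close>
  proof (induction m rule: dec_induct)
    case base then show ?case using p_zero[OF p] by simp
  next
    case (step m)
    have "p (X (Suc m) - X n) \<le> p (X (Suc m) - X m) + p (X m - X n)" by (rule p_triangle[OF p X X X])
    also have "\<dots> \<le> C * b ^ m + C * (b ^ n - b ^ m) / (1 - b)" using st step.IH by (rule add_mono)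
    also have "\<dots> = C * (b ^ n - b ^ Suc m) / (1 - b)" using b by (simp add: field_simps)
    finally show ?case .
  qed
  also have "\<dots> \<le> C * b ^ n / (1 - b)"
    using b C0 by (intro divide_right_mono mult_left_mono) auto
  finally show ?thesis .
qed

lemma sequence_limit_unique:
  assumes X: "\<And>n::nat. X n \<in> topspace T" and l: "l \<in> topspace T" "l' \<in> topspace T"
    and "\<And>p. p \<in> P \<Longrightarrow> (\<lambda>n. p (X n - l)) \<longlonglongrightarrow> 0" "\<And>p. p \<in> P \<Longrightarrow> (\<lambda>n. p (X n - l')) \<longlonglongrightarrow> 0"
  shows "l = l'"
proof -
  have "p (l - l') = 0" if p: "p \<in> P" for p
  proof -
    have "(\<lambda>n. p (X n - l) + p (X n - l')) \<longlonglongrightarrow> 0 + 0" using assms p by (intro tendsto_add) auto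
    moreover have "p (l - l') \<le> p (X n - l) + p (X n - l')" for n
      using p_triangle[OF p l(1) X l(2)] p_commute[OF p l(1) X] by metis
    ultimately have "p (l - l') \<le> 0 + 0"
      by (intro tendsto_le[OF sequentially_bot _ tendsto_const]) auto
    then show ?thesis using p_nonneg[OF p in_diff[OF l]] by simp
  qed
  then have "l - l' = 0" using separating in_diff[OF l] by blast
  then show ?thesis by simp
qed

text \<open>The special curve lemma with \<open>Q x\<close> the size of the \<open>k\<close>-th
  derivative at \<open>x\<close> along \<open>e\<close>. The \<open>k\<close>-th derivative of
  \<open>g\<close> along a single smooth curve is continuous, and where the curve runs along
  \<open>e\<close> with slope \<open>l\<close> it equals \<open>l^k\<close> times that
  derivative.\<close>

lemma bounded_unidirectional_derivs:
  fixes g :: "'b::euclidean_space \<Rightarrow> 'a"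
  assumes g: "\<And>c. smooth_curve euclidean c \<Longrightarrow> smooth_curve T (\<lambda>t. g (c t))"
    and p: "p \<in> P" and K: "compact K"
    and A: "\<And>x. derivs T (A x)" "\<And>x. A x 0 = (\<lambda>t. g (x + t *\<^sub>R e))"
  shows "\<exists>M. \<forall>x\<in>K. p (A x k 0) \<le> M"
proof (rule bounded_along_curves[OF open_UNIV K subset_UNIV])
  fix c :: "real \<Rightarrow> 'b" assume "smooth_curve euclidean c"
  then obtain D where D: "D 0 = (\<lambda>t. g (c t))" "derivs T D" using g smooth_curve_derivs by metis
  show "\<exists>C. continuous_on {0..1} C \<and>
      (\<forall>t0 x l. 0 < l \<longrightarrow> (\<forall>\<^sub>F t in nhds t0. c t = x + (l * (t - t0)) *\<^sub>R e) \<longrightarrow> C t0 = l ^ k * p (A x k 0))"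
  proof (intro exI[of _ "\<lambda>t. p (D k t)"] conjI allI impI)
    show "continuous_on {0..1} (\<lambda>t. p (D k t))"
      by (rule continuous_on_seminorm_curve[where c'="D (Suc k)"]) (use D p in \<open>auto simp: derivs_def\<close>)
    fix t0 x and l :: real assume l: "0 < l" and ev: "\<forall>\<^sub>F t in nhds t0. c t = x + (l * (t - t0)) *\<^sub>R e"
    have "\<forall>\<^sub>F t in nhds t0. D 0 t = A x 0 (0 + l * (t - t0))"
      using ev by (rule eventually_mono) (simp add: D A)
    from eventually_nhds_x_imp_x[OF derivs_affine_local[OF D(2) A(1) this, of k]]
    show "p (D k t0) = l ^ k * p (A x k 0)"
      using p_scaleR[OF p derivs_in[OF A(1)]] l by simp
  qed
qed

end

text \<open>
  A form of Boman's theorem: the difference quotients of \<open>g\<close> in the second variable converge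
  geometrically, while their derivatives in the first variable grow at most geometrically, so by
  Landau--Kolmogorov interpolation all these derivatives converge.
\<close>

lemma (in complete_lcs) smooth_partial_derivative:
  fixes g :: "real \<times> real \<Rightarrow> 'a"
  assumes g: "\<And>c. smooth_curve euclidean c \<Longrightarrow> smooth_curve T (\<lambda>t. g (c t))"
  shows "\<exists>h. smooth_curve T h \<and> (\<forall>t. curve_deriv T (\<lambda>s. g (t, s)) 0 (h t))"
proof -
  interpret V: complete_lcs "euclidean :: (real \<times> real) topology" "{norm}" by (rule lcs_euclidean)
  have line: "smooth_curve euclidean (\<lambda>t. x + t *\<^sub>R e)" for x e :: "real \<times> real"
    by (intro V.smooth_curve_add V.smooth_curve_mult V.smooth_curve_const smooth_curve_real_id) auto
  have ex: "\<exists>D. D 0 = (\<lambda>t. g (x + t *\<^sub>R e)) \<and> derivs T D" for x e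
    using g[OF line] unfolding smooth_curve_derivs .
  define G where "G e x = (SOME D. D 0 = (\<lambda>t. g (x + t *\<^sub>R e)) \<and> derivs T D)" for e x
  have G: "G e x 0 = (\<lambda>t. g (x + t *\<^sub>R e))" "derivs T (G e x)" for e x
    using someI_ex[OF ex[of x e]] unfolding G_def by blast+
  \<comment> \<open>\<open>A s\<close> holds the derivatives in the first variable at height
    \<open>s\<close>, \<open>B t\<close> those in the second variable over \<open>t\<close>. They
    are built from separate lines, and nothing relates their dependence on the other variable
    yet.\<close>
  define A where "A s = G (1, 0) (0, s)" for s
  define B where "B t = G (0, 1) (t, 0)" for t
  have A: "A s 0 = (\<lambda>t. g (t, s))" "derivs T (A s)" for s by (auto simp: A_def G)
  have B: "B t 0 = (\<lambda>s. g (t, s))" "derivs T (B t)" for t by (auto simp: B_def G)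
  have GA: "G (1, 0) (t, s) k 0 = A s k t" for t s k
  proof -
    have "\<forall>\<^sub>F x in nhds 0. G (1, 0) (t, s) 0 x = A s 0 (t + 1 * (x - 0))" by (simp add: G A)
    from eventually_nhds_x_imp_x[OF derivs_affine_local[OF G(2) A(2) this, of k]] show ?thesis by simp
  qed
  have GB: "G (0, 1) (t, s) k 0 = B t k s" for t s k
  proof -
    have "\<forall>\<^sub>F x in nhds 0. G (0, 1) (t, s) 0 x = B t 0 (s + 1 * (x - 0))" by (simp add: G B)
    from eventually_nhds_x_imp_x[OF derivs_affine_local[OF G(2) B(2) this, of k]] show ?thesis by simp
  qed
  \<comment> \<open>Bounds that are joint in both variables, although each derivative belongs to a
    single line: this is the gain from the special curves.\<close>
  have bnd: "\<exists>M. \<forall>t s. \<bar>t\<bar> \<le> r \<longrightarrow> \<bar>s\<bar> \<le> r \<longrightarrow> p (A s k t) \<le> M \<and> p (B t k s) \<le> M"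
    if p: "p \<in> P" for p k and r :: real
  proof -
    have K: "compact ({-r..r} \<times> {-r..r})" by (intro compact_Times) auto
    obtain M1 where M1: "\<And>x. x \<in> {-r..r} \<times> {-r..r} \<Longrightarrow> p (G (1,0) x k 0) \<le> M1"
      using bounded_unidirectional_derivs[OF g p K G(2) G(1), of "(1,0)" k] by blast
    obtain M2 where M2: "\<And>x. x \<in> {-r..r} \<times> {-r..r} \<Longrightarrow> p (G (0,1) x k 0) \<le> M2"
      using bounded_unidirectional_derivs[OF g p K G(2) G(1), of "(0,1)" k] by blast
    show ?thesis
    proof (intro exI[of _ "max M1 M2"] allI impI)
      fix t s assume "\<bar>t\<bar> \<le> r" "\<bar>s\<bar> \<le> r"
      then have "(t, s) \<in> {-r..r} \<times> {-r..r}" by auto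
      from M1[OF this] M2[OF this] show "p (A s k t) \<le> max M1 M2 \<and> p (B t k s) \<le> max M1 M2"
        unfolding GA GB by auto
    qed
  qed
  define \<sigma> :: "nat \<Rightarrow> real" where "\<sigma> n = (1/2)^n" for n
  have \<sigma>: "0 < \<sigma> n" "\<bar>\<sigma> n\<bar> \<le> 1" "2^n * \<sigma> n = 1" "\<sigma> (Suc n) = \<sigma> n / 2" for n
    by (simp_all add: \<sigma>_def power_le_one flip: power_mult_distrib)
  \<comment> \<open>The \<open>k\<close>-th derivative in \<open>t\<close> of the difference
    quotient in \<open>s\<close> with step \<open>\<sigma> n\<close>; \<open>2^n\<close> is the
    reciprocal of the step.\<close>
  define X where "X n k t = 2^n *\<^sub>R (A (\<sigma> n) k t - A 0 k t)" for n :: nat and k t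
  have X: "derivs T (X n)" for n
    unfolding X_def[abs_def] by (intro derivs_scaleR derivs_diff A)
  define H where "H n k t = X (Suc n) k t - X n k t" for n k t
  have H: "derivs T (H n)" for n unfolding H_def[abs_def] by (intro derivs_diff X)
  have Bin: "B t k s \<in> topspace T" for t k s using derivs_in[OF B(2)] .
  have Ain: "A t k s \<in> topspace T" for t k s using derivs_in[OF A(2)] .
  have Xin: "X n k t \<in> topspace T" for n k t using derivs_in[OF X] .
  \<comment> \<open>At order 0 Taylor's formula in \<open>s\<close> gives the limit and the rate
    \<open>\<sigma> n\<close>, the second derivative in \<open>s\<close> being bounded.\<close>
  have X0: "\<exists>M. \<forall>n t. \<bar>t\<bar> \<le> r \<longrightarrow> p (X n 0 t - B t 1 0) \<le> M * \<sigma> n" if p: "p \<in> P" and r: "1 \<le> r" for p r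
  proof -
    obtain M where M: "\<And>t s. \<bar>t\<bar> \<le> r \<Longrightarrow> \<bar>s\<bar> \<le> r \<Longrightarrow> p (B t 2 s) \<le> M"
      using bnd[OF p, of r 2] by blast
    show ?thesis
    proof (intro exI[of _ M] allI impI)
      fix n t assume t: "\<bar>t\<bar> \<le> r"
      have "p (B t 0 (\<sigma> n) - B t 0 0 - (\<sigma> n - 0) *\<^sub>R B t 1 0) \<le> M * (\<sigma> n - 0)\<^sup>2"
        by (rule taylor1[OF p B(2)]) (use M[OF t] \<sigma>[of n] r in \<open>auto simp: closed_segment_eq_real_ivl\<close>)
      moreover have "X n 0 t - B t 1 0 = 2^n *\<^sub>R (B t 0 (\<sigma> n) - B t 0 0 - (\<sigma> n - 0) *\<^sub>R B t 1 0)"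
        using \<sigma>(3)[of n] by (simp add: X_def A B scaleR_diff_right)
      moreover have "p (2^n *\<^sub>R (B t 0 (\<sigma> n) - B t 0 0 - (\<sigma> n - 0) *\<^sub>R B t 1 0)) =
          2^n * p (B t 0 (\<sigma> n) - B t 0 0 - (\<sigma> n - 0) *\<^sub>R B t 1 0)"
        by (subst p_scaleR[OF p]) (use Bin in_diff in_scale in auto)
      ultimately have "p (X n 0 t - B t 1 0) \<le> 2^n * (M * (\<sigma> n - 0)\<^sup>2)" by simp
      also have "\<dots> = M * (2^n * \<sigma> n) * \<sigma> n" by (simp add: power2_eq_square)
      finally show "p (X n 0 t - B t 1 0) \<le> M * \<sigma> n" using \<sigma>(3) by simp
    qed
  qed
  \<comment> \<open>For higher orders only the trivial bound is known at this stage: dividing by the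
    step costs a factor \<open>2^n\<close>.\<close>
  have Hk: "\<exists>M\<ge>0. \<forall>n t. \<bar>t\<bar> \<le> r \<longrightarrow> p (H n k t) \<le> M * 2^n" if p: "p \<in> P" and r: "1 \<le> r" for p k r
  proof -
    obtain M where M: "\<And>t s. \<bar>t\<bar> \<le> r \<Longrightarrow> \<bar>s\<bar> \<le> r \<Longrightarrow> p (A s k t) \<le> M"
      using bnd[OF p, of r k] by blast
    have M0: "0 \<le> M" using M[of 0 0] p_nonneg[OF p Ain[of 0 k 0]] r by simp
    have XM: "p (X n k t) \<le> 2^n * (2 * M)" if t: "\<bar>t\<bar> \<le> r" for n t
    proof -
      have "p (A (\<sigma> n) k t - A 0 k t) \<le> M + M"
        using p_diff[OF p Ain[of "\<sigma> n" k t] Ain[of 0 k t]] M[OF t, of "\<sigma> n"] M[OF t, of 0] \<sigma>(2)[of n] r by linarith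
      then show ?thesis unfolding X_def using p_scaleR[OF p in_diff[OF Ain Ain]] by simp
    qed
    have "p (H n k t) \<le> 6 * M * 2^n" if t: "\<bar>t\<bar> \<le> r" for n t
      unfolding H_def using p_diff[OF p Xin[of "Suc n" k t] Xin[of n k t]] XM[OF t, of n] XM[OF t, of "Suc n"]
      by (simp add: algebra_simps)
    then show ?thesis using M0 by (intro exI[of _ "6 * M"]) auto
  qed
  have Hgeo: "\<exists>C b. 0 < b \<and> b < 1 \<and> (\<forall>n t. \<bar>t\<bar> \<le> r \<longrightarrow> p (H n k t) \<le> C * b^n)"
    if p: "p \<in> P" and r: "1 \<le> r" for p k r
  proof (induction k)
    case 0
    obtain M where M: "\<And>n t. \<bar>t\<bar> \<le> r \<Longrightarrow> p (X n 0 t - B t 1 0) \<le> M * \<sigma> n" using X0[OF p r] by blast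
    have "p (H n 0 t) \<le> 2 * M * (1/2)^n" if t: "\<bar>t\<bar> \<le> r" for n t
    proof -
      have "p (H n 0 t) \<le> p (X (Suc n) 0 t - B t 1 0) + p (X n 0 t - B t 1 0)"
        unfolding H_def using p_triangle[OF p Xin[of "Suc n" 0 t] Bin[of t 1 0] Xin[of n 0 t]] p_commute[OF p Xin[of n 0 t] Bin[of t 1 0]] by simp
      also have "\<dots> \<le> M * \<sigma> (Suc n) + M * \<sigma> n" using M[OF t] by (intro add_mono) auto
      also have "\<dots> \<le> 2 * M * \<sigma> n"
      proof -
        have "0 \<le> M * \<sigma> n" using M[OF t, of n] p_nonneg[OF p in_diff[OF Xin[of n 0 t] Bin[of t 1 0]]] by linarith
        then show ?thesis by (simp add: \<sigma>(4))
      qed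
      finally show ?thesis by (simp add: \<sigma>_def)
    qed
    then show ?case by (intro exI[of _ "2 * M"] exI[of _ "1/2"]) auto
  next
    case (Suc k)
    then obtain C b where b: "0 < b" "b < 1" and C: "\<And>n t. \<bar>t\<bar> \<le> r \<Longrightarrow> p (H n k t) \<le> C * b^n" by blast
    \<comment> \<open>Interpolation with step \<open>s^n\<close>: the term \<open>b^n / s^n\<close>
      is again geometric with ratio \<open>s\<close>, and \<open>j\<close> is so large that
      \<open>s^j\<close> outweighs the growth rate 2 of the derivative of order
      \<open>j + 2 + k\<close>.\<close>
    define s where "s = sqrt b"
    have s: "0 < s" "s < 1" "s * s = b" using b by (auto simp: s_def)
    obtain j where j: "s ^ j < 1 / 2" using real_arch_pow_inv[of "1/2" s] s by auto
    obtain M where M: "0 \<le> M" "\<And>n t. \<bar>t\<bar> \<le> r \<Longrightarrow> p (H n (j + 2 + k) t) \<le> M * 2^n" using Hk[OF p r] by blast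
    obtain L where L: "1 \<le> L" and L': "\<forall>D M0 M h r. derivs T D \<longrightarrow> 0 < h \<longrightarrow> h \<le> r \<longrightarrow> (\<forall>t. \<bar>t\<bar> \<le> r \<longrightarrow> p (D 0 t) \<le> M0) \<longrightarrow>
        (\<forall>t. \<bar>t\<bar> \<le> r \<longrightarrow> p (D (j + 2) t) \<le> M) \<longrightarrow> (\<forall>t. \<bar>t\<bar> \<le> r \<longrightarrow> p (D 1 t) \<le> L * (M0 / h + h ^ (j + 1) * M))"
      using landau[OF p, of j] by (elim exE conjE)
    have "p (H n (Suc k) t) \<le> L * (C + M) * s^n" if t: "\<bar>t\<bar> \<le> r" for n t
    proof -
      have sn: "0 < s^n" "s^n \<le> r" using s r power_le_one[of s n] by auto
      have "p (H n (1 + k) t) \<le> L * (C * b^n / s^n + (s^n) ^ (j + 1) * (M * 2^n))"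
        using L'[rule_format, OF derivs_shift[OF H, of n k] sn, of "C * b^n" "M * 2^n" t] C M(2) t by simp
      also have "C * b^n / s^n = C * s^n" using s by (simp add: power_mult_distrib flip: s(3))
      also have "(s^n) ^ (j + 1) * (M * 2^n) = M * s^n * (s^j * 2)^n"
        by (simp add: power_mult_distrib mult_ac flip: power_mult)
      also have "L * (C * s^n + M * s^n * (s^j * 2)^n) \<le> L * (C * s^n + M * s^n * 1)"
        using L M(1) s j by (intro mult_left_mono add_left_mono power_le_one) auto
      finally show ?thesis by (simp add: algebra_simps)
    qed
    then show ?case using s by blast
  qed
  have "\<exists>l\<in>topspace T. \<forall>p\<in>P. (\<lambda>n. p (X n k t - l)) \<longlonglongrightarrow> 0" for k t
  proof (rule complete[OF Xin])
    fix p and e :: real assume p: "p \<in> P" and e: "0 < e"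
    obtain C b where b: "0 < b" "b < 1" and C: "\<And>n. p (X (Suc n) k t - X n k t) \<le> C * b^n"
      using Hgeo[OF p, of "max 1 \<bar>t\<bar>" k] unfolding H_def by (metis max.cobounded1 max.cobounded2)
    have "(\<lambda>n. C * b^n / (1 - b)) \<longlonglongrightarrow> C * 0 / (1 - b)"
      using b by (intro tendsto_intros LIMSEQ_power_zero) auto
    then have "\<forall>\<^sub>F n in sequentially. C * b^n / (1 - b) < e" using e by (intro order_tendstoD(2)[of _ 0]) auto
    then obtain N where N: "\<And>n. n \<ge> N \<Longrightarrow> C * b^n / (1 - b) < e" unfolding eventually_sequentially by blast
    have *: "p (X m k t - X n k t) < e" if "n \<ge> N" "n \<le> m" for m n
      using geometric_steps[where X="\<lambda>n. X n k t", OF p Xin b C that(2)] N[OF that(1)] by linarith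
    show "\<exists>N. \<forall>m\<ge>N. \<forall>n\<ge>N. p (X m k t - X n k t) < e"
    proof (intro exI[of _ N] allI impI)
      fix m n assume "N \<le> m" "N \<le> n"
      then show "p (X m k t - X n k t) < e" using *[of n m] *[of m n] p_commute[OF p Xin Xin] by (metis nle_le)
    qed
  qed
  then obtain L where L: "\<And>k t. L k t \<in> topspace T" "\<And>k t p. p \<in> P \<Longrightarrow> (\<lambda>n. p (X n k t - L k t)) \<longlonglongrightarrow> 0" by metis
  \<comment> \<open>Bounds uniform in \<open>n\<close>. Applied to the order \<open>k + 2\<close>,
    they make the Taylor remainders of \<open>X n k\<close> uniform, so that the remainder estimate
    passes to the limit \<open>L k\<close>.\<close>
  have Xb: "\<exists>M. \<forall>n t. \<bar>t\<bar> \<le> r \<longrightarrow> p (X n k t) \<le> M" if p: "p \<in> P" and r: "1 \<le> r" for p k r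
  proof -
    obtain C b where b: "0 < b" "b < 1" and C: "\<And>n t. \<bar>t\<bar> \<le> r \<Longrightarrow> p (X (Suc n) k t - X n k t) \<le> C * b^n"
      using Hgeo[OF p r, of k] unfolding H_def by blast
    obtain M where M: "\<And>t. t \<in> {-r..r} \<Longrightarrow> p (X 0 k t) \<le> M" using derivs_bounded[OF p X] by blast
    have "p (X n k t) \<le> C * b^0 / (1 - b) + M" if t: "\<bar>t\<bar> \<le> r" for n t
    proof -
      have "p (X n k t - X 0 k t) \<le> C * b^0 / (1 - b)"
        by (rule geometric_steps[where X="\<lambda>n. X n k t", OF p Xin b C[OF t]]) simp
      moreover have "p (X n k t) \<le> p (X n k t - X 0 k t) + p (X 0 k t)"
        using p_add[OF p in_diff[OF Xin[of n k t] Xin[of 0 k t]] Xin[of 0 k t]] by simp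
      ultimately show ?thesis using M[of t] t by (simp add: abs_le_iff)
    qed
    then show ?thesis by blast
  qed
  have "derivs T L" unfolding derivs_def
  proof (intro allI conjI L(1))
    fix k t
    have rL: "range (L k) \<subseteq> topspace T" using L(1) by auto
    show "curve_deriv T (L k) t (L (Suc k) t)"
      unfolding curve_deriv_iff[OF rL]
    proof (intro conjI ballI allI impI L(1))
      fix p and e :: real assume p: "p \<in> P" and e: "0 < e"
      obtain M where M: "\<And>n s. \<bar>s\<bar> \<le> \<bar>t\<bar> + 1 \<Longrightarrow> p (X n (2 + k) s) \<le> M" using Xb[OF p, of "\<bar>t\<bar> + 1"] by fastforce
      have M0: "0 \<le> M" using M[of t 0] p_nonneg[OF p Xin[of 0 "2 + k" t]] by linarith
      have "p (L k (t + h) - L k t - h *\<^sub>R L (Suc k) t) \<le> e * \<bar>h\<bar>" if h: "\<bar>h\<bar> < min 1 (e / (M + 1))" for h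
      proof -
        let ?x = "\<lambda>n. X n k (t + h) - X n k t - h *\<^sub>R X n (Suc k) t"
        let ?l = "L k (t + h) - L k t - h *\<^sub>R L (Suc k) t"
        let ?a = "\<lambda>n. X n k (t + h) - L k (t + h)" and ?b = "\<lambda>n. X n k t - L k t" and ?c = "\<lambda>n. X n (Suc k) t - L (Suc k) t"
        have inn: "?x n \<in> topspace T" "?l \<in> topspace T" "?a n \<in> topspace T" "?b n \<in> topspace T" "?c n \<in> topspace T" for n
          by (intro in_diff in_scale Xin L(1))+
        have xM: "p (?x n) \<le> M * h\<^sup>2" for n
        proof -
          have "p (X n (0 + k) (t + h) - X n (0 + k) t - (t + h - t) *\<^sub>R X n (1 + k) t) \<le> M * (t + h - t)\<^sup>2"
            by (rule taylor1[OF p derivs_shift[OF X, of n k]])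
              (use M h in \<open>auto simp: closed_segment_eq_real_ivl split: if_splits\<close>)
          then show ?thesis by simp
        qed
        have "p ?l \<le> M * h\<^sup>2 + (p (?a n) + p (?b n) + \<bar>h\<bar> * p (?c n))" for n
        proof -
          have "?l = ?x n - ((?a n - ?b n) - h *\<^sub>R ?c n)" by (simp add: algebra_simps)
          then have "p ?l \<le> p (?x n) + p ((?a n - ?b n) - h *\<^sub>R ?c n)"
            using p_diff[OF p inn(1) in_diff[OF in_diff[OF inn(3,4)] in_scale[OF inn(5)]]] by metis
          also have "\<dots> \<le> p (?x n) + (p (?a n - ?b n) + p (h *\<^sub>R ?c n))"
            by (intro add_left_mono p_diff[OF p] in_diff inn in_scale)
          also have "\<dots> \<le> p (?x n) + (p (?a n) + p (?b n) + \<bar>h\<bar> * p (?c n))"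
            using p_diff[OF p inn(3,4)] p_scaleR[OF p inn(5)] by simp
          finally show ?thesis using xM[of n] by linarith
        qed
        moreover have "(\<lambda>n. M * h\<^sup>2 + (p (?a n) + p (?b n) + \<bar>h\<bar> * p (?c n))) \<longlonglongrightarrow> M * h\<^sup>2 + (0 + 0 + \<bar>h\<bar> * 0)"
          by (intro tendsto_intros L(2) p)
        ultimately have "p ?l \<le> M * h\<^sup>2 + (0 + 0 + \<bar>h\<bar> * 0)"
          by (intro tendsto_le[OF sequentially_bot _ tendsto_const]) auto
        also have "\<dots> = (M * \<bar>h\<bar>) * \<bar>h\<bar>" by (simp add: power2_eq_square)
        also have "\<dots> \<le> e * \<bar>h\<bar>"
        proof (rule mult_right_mono)
          have "M * \<bar>h\<bar> \<le> (M + 1) * (e / (M + 1))" using h M0 by (intro mult_mono) auto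
          then show "M * \<bar>h\<bar> \<le> e" using M0 by simp
        qed simp
        finally show ?thesis .
      qed
      moreover have "min 1 (e / (M + 1)) > 0" using e M0 by simp
      ultimately show "\<exists>\<delta>>0. \<forall>h. \<bar>h\<bar> < \<delta> \<longrightarrow> p (L k (t + h) - L k t - h *\<^sub>R L (Suc k) t) \<le> e * \<bar>h\<bar>" by blast
    qed
  qed
  then have "smooth_curve T (L 0)" unfolding smooth_curve_derivs by blast
  moreover have "L 0 t = B t 1 0" for t
  proof (rule sequence_limit_unique[where X="\<lambda>n. X n 0 t", OF Xin L(1) Bin L(2)])
    fix p assume p: "p \<in> P"
    obtain M where M: "\<And>n. p (X n 0 t - B t 1 0) \<le> M * \<sigma> n" using X0[OF p, of "max 1 \<bar>t\<bar>"] by (metis max.cobounded1 max.cobounded2)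
    have "(\<lambda>n. M * \<sigma> n) \<longlonglongrightarrow> M * 0" unfolding \<sigma>_def by (intro tendsto_intros LIMSEQ_power_zero) auto
    then have up: "(\<lambda>n. M * \<sigma> n) \<longlonglongrightarrow> 0" by simp
    show "(\<lambda>n. p (X n 0 t - B t 1 0)) \<longlonglongrightarrow> 0"
      by (rule tendsto_sandwich[OF _ _ tendsto_const up]) (use M p_nonneg[OF p in_diff[OF Xin Bin]] in auto)
  qed
  moreover have "curve_deriv T (\<lambda>s. g (t, s)) 0 (B t 1 0)" for t
    using B[of t] unfolding derivs_def by (metis One_nat_def)
  ultimately show ?thesis by (intro exI[of _ "L 0"]) simp
qed

section \<open>Differentials of all orders\<close>

text \<open>The amount of openness that the calculus uses: near each time of a curve, small
  displacements in a fixed direction stay in the set. It covers both domains that occur, the whole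
  of \<open>SKI \<Omega>\<close> and the open set \<Omega> itself, without any continuity of curves
  in the first.\<close>

definition curve_open :: "'a::real_vector topology \<Rightarrow> 'a set \<Rightarrow> bool" where
  "curve_open E U \<longleftrightarrow> U \<subseteq> topspace E \<and>
     (\<forall>c v t0. smooth_curve E c \<longrightarrow> range c \<subseteq> U \<longrightarrow> v \<in> topspace E \<longrightarrow>
        (\<exists>\<delta>>0. \<forall>t s. \<bar>t - t0\<bar> < \<delta> \<longrightarrow> \<bar>s\<bar> < \<delta> \<longrightarrow> c t + s *\<^sub>R v \<in> U))"

lemma (in lcs) curve_open_topspace: "curve_open T (topspace T)"
  unfolding curve_open_def
proof (intro conjI allI impI order_refl)
  fix c v t0 assume "smooth_curve T c" "v \<in> topspace T"
  then have "\<forall>t s. c t + s *\<^sub>R v \<in> topspace T"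
    by (intro allI in_add in_scale smooth_curve_in[of T c])
  then show "\<exists>\<delta>>0. \<forall>t s. \<bar>t - t0\<bar> < \<delta> \<longrightarrow> \<bar>s\<bar> < \<delta> \<longrightarrow> c t + s *\<^sub>R v \<in> topspace T"
    by (intro exI[of _ 1]) simp
qed

lemma curve_open_euclidean:
  fixes U :: "'a::banach set"
  assumes U: "open U"
  shows "curve_open euclidean U"
  unfolding curve_open_def
proof (intro conjI allI impI)
  fix c :: "real \<Rightarrow> 'a" and v t0 assume c: "smooth_curve euclidean c" "range c \<subseteq> U"
  then obtain D where D: "D 0 = c" "derivs euclidean D" using smooth_curve_derivs by metis
  have "(c has_vector_derivative D 1 t) (at t)" for t
    using D unfolding derivs_def curve_deriv_euclidean by (metis One_nat_def)
  then have "isCont c t" for t by (rule has_vector_derivative_continuous)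
  then have cc: "continuous_on UNIV c" by (simp add: continuous_at_imp_continuous_on)
  have "open ((\<lambda>(t, s). c t + s *\<^sub>R v) -` U)"
    by (intro open_vimage U) (auto simp: case_prod_unfold intro!: continuous_intros continuous_on_compose2[OF cc])
  moreover have "(t0, 0) \<in> (\<lambda>(t, s). c t + s *\<^sub>R v) -` U" using c by auto
  ultimately obtain e where e: "e > 0" "ball (t0, 0) e \<subseteq> (\<lambda>(t, s). c t + s *\<^sub>R v) -` U"
    using open_contains_ball by blast
  have "c t + s *\<^sub>R v \<in> U" if "\<bar>t - t0\<bar> < e / 2" "\<bar>s\<bar> < e / 2" for t s
  proof -
    have "dist (t0, 0) (t, s) \<le> \<bar>t - t0\<bar> + \<bar>s\<bar>"
      unfolding dist_prod_def by (rule order_trans[OF sqrt_sum_squares_le_sum_abs]) (auto simp: dist_real_def)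
    then have "(t, s) \<in> ball (t0, 0) e" using that by simp
    then show ?thesis using e(2) by auto
  qed
  then show "\<exists>\<delta>>0. \<forall>t s. \<bar>t - t0\<bar> < \<delta> \<longrightarrow> \<bar>s\<bar> < \<delta> \<longrightarrow> c t + s *\<^sub>R v \<in> U"
    using e(1) by (intro exI[of _ "e / 2"]) auto
qed simp

lemma (in lcs) dir_deriv_eqI:
  assumes "curve_deriv T (\<lambda>s. f (x + s *\<^sub>R v)) 0 d"
  shows "dir_deriv T f x v = d"
proof -
  have "limitin T (\<lambda>h. inverse h *\<^sub>R (f (x + h *\<^sub>R v) - f x)) d (at 0)"
    using assms unfolding curve_deriv_def by simp
  then show ?thesis unfolding dir_deriv_def
    by (rule the_equality) (use limitin_unique trivial_limit_at \<open>limitin T _ d (at 0)\<close> in blast)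
qed

locale smooth_calculus = E: lcs E PE + F: complete_lcs F PF
  for E :: "'a::real_vector topology" and PE and F :: "'b::real_vector topology" and PF +
  fixes U :: "'a set"
  assumes U: "curve_open E U"
begin

lemma curve_openD:
  assumes "x \<in> U" "v \<in> topspace E"
  shows "\<forall>\<^sub>F s in nhds 0. x + s *\<^sub>R v \<in> U"
proof -
  have "smooth_curve E (\<lambda>_. x)" using U assms(1) by (intro E.smooth_curve_const) (auto simp: curve_open_def)
  then obtain \<delta> where \<delta>: "\<delta> > 0" "\<And>t s. \<bar>t - 0\<bar> < \<delta> \<Longrightarrow> \<bar>s\<bar> < \<delta> \<Longrightarrow> x + s *\<^sub>R v \<in> U"
    using U assms unfolding curve_open_def by (metis image_subset_iff)
  have "x + s *\<^sub>R v \<in> U" if "\<bar>s\<bar> < \<delta>" for s using \<delta>(2)[of 0 s] \<delta>(1) that by simp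
  then show ?thesis using \<delta>(1) unfolding eventually_nhds_metric by (auto simp: dist_real_def intro!: exI[of _ \<delta>])
qed

lemma smooth_maps_in: "f \<in> smooth_maps E U F \<Longrightarrow> f x \<in> topspace F"
  unfolding smooth_maps_def using F.in_zero by (cases "x \<in> U") auto

text \<open>For a curve \<open>c\<close>, the map \<open>f (c t + s *\<^sub>R v)\<close> of two real
  variables sends curves to curves, and its partial derivative in \<open>s\<close> at 0 is the
  directional derivative along \<open>c\<close>. The smoothness of that partial derivative in
  \<open>t\<close> is what the two-variable theorem supplies.\<close>

lemma dir_deriv_smooth:
  assumes f: "f \<in> smooth_maps E U F" and v: "v \<in> topspace E"
  shows "x \<in> U \<Longrightarrow> curve_deriv F (\<lambda>s. f (x + s *\<^sub>R v)) 0 (dir_deriv F f x v)"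
    and "(\<lambda>x. if x \<in> U then dir_deriv F f x v else 0) \<in> smooth_maps E U F"
proof -
  have local: "\<exists>h. smooth_curve F h \<and> (\<forall>\<^sub>F t in nhds t0. curve_deriv F (\<lambda>s. f (c t + s *\<^sub>R v)) 0 (h t))"
    if c: "smooth_curve E c" "range c \<subseteq> U" for c t0
  proof -
    obtain \<delta> where \<delta>: "\<delta> > 0" "\<And>t s. \<bar>t - t0\<bar> < \<delta> \<Longrightarrow> \<bar>s\<bar> < \<delta> \<Longrightarrow> c t + s *\<^sub>R v \<in> U"
      using U c v unfolding curve_open_def by blast
    \<comment> \<open>The point \<open>c t + s *\<^sub>R v\<close> need not lie in \<open>U\<close>
      for large parameters. Both are cut off, which changes nothing near
      \<open>(t0, 0)\<close>.\<close>
    define \<gamma> where "\<gamma> y = c (t0 + cutoff \<delta> (fst y - t0)) + cutoff \<delta> (snd y) *\<^sub>R v" for y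
    have \<gamma>U: "\<gamma> y \<in> U" for y
      unfolding \<gamma>_def by (rule \<delta>(2)) (auto simp: cutoff_less \<delta>(1))
    have "smooth_curve F (\<lambda>t. f (\<gamma> (e t)))" if e: "smooth_curve euclidean e" for e :: "real \<Rightarrow> real \<times> real"
    proof -
      have fs: "smooth_curve euclideanreal (\<lambda>t. fst (e t))" "smooth_curve euclideanreal (\<lambda>t. snd (e t))"
        by (intro smooth_curve_bounded_linear[OF e] bounded_linear_fst bounded_linear_snd)+
      have "smooth_curve euclideanreal (\<lambda>t. fst (e t) + (- t0))"
        by (intro real_lcs.smooth_curve_add fs real_lcs.smooth_curve_const) simp
      from real_lcs.smooth_curve_compose[OF this smooth_cutoff, of \<delta>]
      have 1: "smooth_curve euclideanreal (\<lambda>t. t0 + cutoff \<delta> (fst (e t) + (- t0)))"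
        by (intro real_lcs.smooth_curve_add real_lcs.smooth_curve_const) auto
      have "smooth_curve E (\<lambda>t. c (t0 + cutoff \<delta> (fst (e t) + (- t0))) + cutoff \<delta> (snd (e t)) *\<^sub>R v)"
        by (intro E.smooth_curve_add E.smooth_curve_compose[OF 1 c(1)] E.smooth_curve_mult
            real_lcs.smooth_curve_compose[OF fs(2) smooth_cutoff] E.smooth_curve_const v)
      then have "smooth_curve E (\<lambda>t. \<gamma> (e t))" by (simp add: \<gamma>_def)
      then have "smooth_curve F (f \<circ> (\<lambda>t. \<gamma> (e t)))"
        using f \<gamma>U unfolding smooth_maps_def by blast
      then show ?thesis by (simp add: comp_def)
    qed
    from F.smooth_partial_derivative[of "\<lambda>y. f (\<gamma> y)", OF this]
    obtain h where h: "smooth_curve F h" "\<And>t. curve_deriv F (\<lambda>s. f (\<gamma> (t, s))) 0 (h t)" by blast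
    have "curve_deriv F (\<lambda>s. f (c t + s *\<^sub>R v)) 0 (h t)" if t: "\<bar>t - t0\<bar> \<le> \<delta> / 2" for t
    proof -
      have "\<forall>\<^sub>F s in nhds 0. \<bar>s::real\<bar> < \<delta> / 2"
        using \<delta>(1) unfolding eventually_nhds_metric by (auto simp: dist_real_def intro!: exI[of _ "\<delta>/2"])
      then have "\<forall>\<^sub>F s in nhds 0. f (\<gamma> (t, s)) = f (c t + s *\<^sub>R v)"
        by (rule eventually_mono) (use t \<delta>(1) in \<open>simp add: \<gamma>_def cutoff_eq\<close>)
      from curve_deriv_cong[OF this] h(2)[of t] show ?thesis by blast
    qed
    moreover have "\<forall>\<^sub>F t in nhds t0. \<bar>t - t0\<bar> < \<delta> / 2"
      using \<delta>(1) unfolding eventually_nhds_metric by (auto simp: dist_real_def intro!: exI[of _ "\<delta>/2"])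
    ultimately have "\<forall>\<^sub>F t in nhds t0. curve_deriv F (\<lambda>s. f (c t + s *\<^sub>R v)) 0 (h t)"
      by (auto elim: eventually_mono)
    then show ?thesis using h(1) by blast
  qed
  show der: "curve_deriv F (\<lambda>s. f (x + s *\<^sub>R v)) 0 (dir_deriv F f x v)" if x: "x \<in> U" for x
  proof -
    have sm: "smooth_curve E (\<lambda>_. x)" using U x by (intro E.smooth_curve_const) (auto simp: curve_open_def)
    have "range (\<lambda>_. x) \<subseteq> U" using x by auto
    from local[OF sm this, of 0] obtain h where
      "\<forall>\<^sub>F t in nhds 0. curve_deriv F (\<lambda>s. f (x + s *\<^sub>R v)) 0 (h (t::real))" by blast
    note d = eventually_nhds_x_imp_x[OF this]
    show ?thesis using d unfolding F.dir_deriv_eqI[OF d] .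
  qed
  show "(\<lambda>x. if x \<in> U then dir_deriv F f x v else 0) \<in> smooth_maps E U F"
    unfolding smooth_maps_def
  proof (intro CollectI conjI ballI allI impI)
    show "(if x \<in> U then dir_deriv F f x v else 0) \<in> topspace F" if "x \<in> U" for x
      using F.curve_deriv_in[OF der[OF that]] that by simp
    show "smooth_curve F ((\<lambda>x. if x \<in> U then dir_deriv F f x v else 0) \<circ> c)"
      if c: "smooth_curve E c \<and> range c \<subseteq> U" for c
    proof (rule F.smooth_curve_local)
      fix t0
      obtain h where h: "smooth_curve F h" "\<forall>\<^sub>F t in nhds t0. curve_deriv F (\<lambda>s. f (c t + s *\<^sub>R v)) 0 (h t)"
        using local[of c t0] c by blast
      have "\<forall>\<^sub>F t in nhds t0. h t = ((\<lambda>x. if x \<in> U then dir_deriv F f x v else 0) \<circ> c) t"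
        using h(2) by (rule eventually_mono) (use c in \<open>auto simp: image_subset_iff intro!: F.dir_deriv_eqI[symmetric]\<close>)
      with h(1) show "\<exists>h. smooth_curve F h \<and>
          (\<forall>\<^sub>F t in nhds t0. h t = ((\<lambda>x. if x \<in> U then dir_deriv F f x v else 0) \<circ> c) t)" by blast
    qed
  qed auto
qed

lemma dir_deriv_cong:
  assumes eq: "\<And>x. x \<in> U \<Longrightarrow> f x = g x" and x: "x \<in> U" and v: "v \<in> topspace E"
  shows "dir_deriv F f x v = dir_deriv F g x v"
proof -
  have "\<forall>\<^sub>F s in nhds 0. f (x + s *\<^sub>R v) = g (x + s *\<^sub>R v)"
    using curve_openD[OF x v] by (rule eventually_mono) (rule eq)
  from curve_deriv_cong[OF this]
  have "curve_deriv F (\<lambda>s. f (x + s *\<^sub>R v)) 0 d \<longleftrightarrow> curve_deriv F (\<lambda>s. g (x + s *\<^sub>R v)) 0 d" for d .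
  then show ?thesis unfolding curve_deriv_def dir_deriv_def by simp
qed

text \<open>Members of \<open>smooth_maps\<close> vanish outside \<open>U\<close>, where
  \<open>differential\<close> may have any value; so the induction runs over the map extended by 0,
  and \<open>dir_deriv_cong\<close> exchanges the two inside \<open>U\<close>.\<close>

lemma differential_smooth:
  assumes f: "f \<in> smooth_maps E U F" and vs: "set vs \<subseteq> topspace E"
  shows "(\<lambda>x. if x \<in> U then differential F f x vs else 0) \<in> smooth_maps E U F"
  using vs
proof (induction vs)
  case Nil
  have "(\<lambda>x. if x \<in> U then f x else 0) = f" using f by (auto simp: smooth_maps_def)
  then show ?case using f by (simp only: differential.simps)
next
  case (Cons v vs)
  let ?g = "\<lambda>x. if x \<in> U then differential F f x vs else 0"
  have "?g \<in> smooth_maps E U F" "v \<in> topspace E" using Cons by auto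
  from dir_deriv_smooth(2)[OF this]
  have "(\<lambda>x. if x \<in> U then dir_deriv F ?g x v else 0) \<in> smooth_maps E U F" .
  moreover have "dir_deriv F ?g x v = differential F f x (v # vs)" if "x \<in> U" for x
    using dir_deriv_cong[of ?g "\<lambda>y. differential F f y vs"] that Cons.prems by simp
  then have "(\<lambda>x. if x \<in> U then dir_deriv F ?g x v else 0) = (\<lambda>x. if x \<in> U then differential F f x (v # vs) else 0)"
    by (auto simp del: differential.simps)
  ultimately show ?case by metis
qed

lemma differential_in:
  assumes "f \<in> smooth_maps E U F" "set vs \<subseteq> topspace E" "x \<in> U"
  shows "differential F f x vs \<in> topspace F"
  using smooth_maps_in[OF differential_smooth[OF assms(1,2)], of x] unfolding if_P[OF assms(3)] .

lemma differential_deriv: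
  assumes f: "f \<in> smooth_maps E U F" and vs: "set vs \<subseteq> topspace E" and v: "v \<in> topspace E" and x: "x \<in> U"
  shows "curve_deriv F (\<lambda>s. differential F f (x + s *\<^sub>R v) vs) 0 (differential F f x (v # vs))"
proof -
  let ?g = "\<lambda>x. if x \<in> U then differential F f x vs else 0"
  have 1: "curve_deriv F (\<lambda>s. ?g (x + s *\<^sub>R v)) 0 (dir_deriv F ?g x v)"
    by (rule dir_deriv_smooth(1)[OF differential_smooth[OF f vs] v x])
  have 2: "dir_deriv F ?g x v = differential F f x (v # vs)"
    using dir_deriv_cong[of ?g "\<lambda>y. differential F f y vs"] x v by simp
  have 3: "\<forall>\<^sub>F s in nhds 0. ?g (x + s *\<^sub>R v) = differential F f (x + s *\<^sub>R v) vs"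
    using curve_openD[OF x v] by (rule eventually_mono) simp
  show ?thesis using 1 unfolding 2 curve_deriv_cong[OF 3] .
qed

lemma smooth_maps_linear:
  assumes f: "f \<in> smooth_maps E U F" and g: "g \<in> smooth_maps E U F"
  shows "(\<lambda>x. a *\<^sub>R f x + b *\<^sub>R g x) \<in> smooth_maps E U F"
proof -
  have "smooth_curve F ((\<lambda>x. a *\<^sub>R f x + b *\<^sub>R g x) \<circ> c)" if "smooth_curve E c" "range c \<subseteq> U" for c
  proof -
    have "smooth_curve F (f \<circ> c)" "smooth_curve F (g \<circ> c)"
      using f g that unfolding smooth_maps_def by blast+
    then have "smooth_curve F (\<lambda>t. a *\<^sub>R (f \<circ> c) t + b *\<^sub>R (g \<circ> c) t)"
      by (intro F.smooth_curve_add F.smooth_curve_scaleR)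
    then show ?thesis by (simp add: comp_def)
  qed
  then show ?thesis using f g F.in_add F.in_scale by (auto simp: smooth_maps_def)
qed

lemma differential_linear:
  assumes f: "f \<in> smooth_maps E U F" and g: "g \<in> smooth_maps E U F"
    and vs: "set vs \<subseteq> topspace E" and x: "x \<in> U"
  shows "differential F (\<lambda>x. a *\<^sub>R f x + b *\<^sub>R g x) x vs = a *\<^sub>R differential F f x vs + b *\<^sub>R differential F g x vs"
  using vs x
proof (induction vs arbitrary: x)
  case (Cons v vs)
  let ?r = "\<lambda>f x. if x \<in> U then differential F f x vs else 0"
  have v: "v \<in> topspace E" and vs: "set vs \<subseteq> topspace E" using Cons.prems by auto
  note sm = differential_smooth[OF f vs] differential_smooth[OF g vs]
  have "differential F (\<lambda>x. a *\<^sub>R f x + b *\<^sub>R g x) x (v # vs) = dir_deriv F (\<lambda>x. a *\<^sub>R ?r f x + b *\<^sub>R ?r g x) x v"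
    using Cons v by (auto intro!: dir_deriv_cong)
  also have "\<dots> = a *\<^sub>R dir_deriv F (?r f) x v + b *\<^sub>R dir_deriv F (?r g) x v"
  proof (rule F.dir_deriv_eqI)
    have in': "range (\<lambda>s. ?r f (x + s *\<^sub>R v)) \<subseteq> topspace F" "range (\<lambda>s. ?r g (x + s *\<^sub>R v)) \<subseteq> topspace F"
      using smooth_maps_in[OF sm(1)] smooth_maps_in[OF sm(2)] by blast+
    have "curve_deriv F (\<lambda>s. a *\<^sub>R ?r f (x + s *\<^sub>R v) + b *\<^sub>R ?r g (x + s *\<^sub>R v)) 0
        (a *\<^sub>R dir_deriv F (?r f) x v + b *\<^sub>R dir_deriv F (?r g) x v)"
      by (intro F.curve_deriv_add F.curve_deriv_scaleR in' dir_deriv_smooth(1)[OF sm(1)] dir_deriv_smooth(1)[OF sm(2)] v Cons.prems)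
        (use in' F.in_scale in blast)+
    then show "curve_deriv F (\<lambda>s. a *\<^sub>R ?r f (x + s *\<^sub>R v) + b *\<^sub>R ?r g (x + s *\<^sub>R v)) 0
        (a *\<^sub>R dir_deriv F (?r f) x v + b *\<^sub>R dir_deriv F (?r g) x v)" .
  qed
  also have "dir_deriv F (?r f) x v = differential F f x (v # vs)"
    using dir_deriv_cong[of "?r f" "\<lambda>y. differential F f y vs"] Cons.prems v by simp
  also have "dir_deriv F (?r g) x v = differential F g x (v # vs)"
    using dir_deriv_cong[of "?r g" "\<lambda>y. differential F g y vs"] Cons.prems v by simp
  finally show ?case .
qed simp

lemma subspace_smooth_maps: "subspace (smooth_maps E U F)"
  unfolding subspace_def
proof (intro conjI ballI allI)
  have "smooth_curve F (\<lambda>_. 0)" by (intro F.smooth_curve_const F.in_zero)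
  then show z: "0 \<in> smooth_maps E U F" using F.in_zero by (auto simp: smooth_maps_def comp_def)
  fix f g and a :: real assume *: "f \<in> smooth_maps E U F"
  { assume "g \<in> smooth_maps E U F"
    from smooth_maps_linear[OF * this, of 1 1] show "f + g \<in> smooth_maps E U F" by (simp add: plus_fun_def) }
  from smooth_maps_linear[OF * *, of a 0] show "a *\<^sub>R f \<in> smooth_maps E U F" by (simp add: scaleR_fun_def)
qed

end

subsection \<open>The Frechet space of smooth functions\<close>

definition Cinf_seminorm :: "(real^'n::finite) set \<Rightarrow> 'n list \<Rightarrow> 'n cfun \<Rightarrow> real" where
  "Cinf_seminorm K is f = sup0 {cmod (partial is f x) | x. x \<in> K}"

definition Cinf_seminorms :: "(real^'n::finite) set \<Rightarrow> ('n cfun \<Rightarrow> real) set" where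
  "Cinf_seminorms \<Omega> = {Cinf_seminorm K is | K is. compact K \<and> K \<subseteq> \<Omega>}"

lemma Cinf_alt: "Cinf \<Omega> = seminorm_topology (Cinf_funs \<Omega>) (Cinf_seminorms \<Omega>)"
  unfolding Cinf_def Cinf_seminorms_def Cinf_seminorm_def ..

lemma topspace_Cinf: "topspace (Cinf \<Omega>) = Cinf_funs \<Omega>"
  unfolding Cinf_alt topspace_seminorm_topology ..

lemma has_vector_derivative_cong_nhds:
  fixes f g :: "real \<Rightarrow> 'a::banach"
  assumes "\<forall>\<^sub>F s in nhds t. f s = g s"
  shows "(f has_vector_derivative d) (at t) \<longleftrightarrow> (g has_vector_derivative d) (at t)"
  using curve_deriv_cong[OF assms, of euclidean d] unfolding curve_deriv_euclidean .

declare partial.simps(2) [simp del]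

locale open_set =
  fixes \<Omega> :: "(real^'n::finite) set"
  assumes open_Omega: "open \<Omega>"
begin

lemma eventually_line_in:
  assumes "x + t0 *\<^sub>R e \<in> \<Omega>"
  shows "\<forall>\<^sub>F t in nhds t0. x + t *\<^sub>R e \<in> \<Omega>"
proof -
  have "((\<lambda>t. x + t *\<^sub>R e) \<longlongrightarrow> x + t0 *\<^sub>R e) (nhds t0)"
    by (intro tendsto_intros filterlim_ident)
  then show ?thesis using open_Omega assms by (simp add: tendsto_def)
qed

text \<open>\<open>Cinf_funs\<close> speaks of the derivative at parameter 0 on a line through each
  point; translating the line gives every other parameter.\<close>

lemma Cinf_funs_deriv:
  assumes f: "f \<in> Cinf_funs \<Omega>" and x: "x + t0 *\<^sub>R axis i 1 \<in> \<Omega>"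
  shows "((\<lambda>t. partial is f (x + t *\<^sub>R axis i 1)) has_vector_derivative partial (i # is) f (x + t0 *\<^sub>R axis i 1)) (at t0)"
proof -
  let ?y = "x + t0 *\<^sub>R axis i 1"
  have "(\<lambda>t. partial is f (?y + t *\<^sub>R axis i 1)) differentiable (at 0)"
    using f x unfolding Cinf_funs_def by blast
  then have "((\<lambda>t. partial is f (?y + t *\<^sub>R axis i 1)) has_vector_derivative partial (i # is) f ?y) (at 0)"
    by (simp add: vector_derivative_works partial.simps)
  then have 1: "((\<lambda>t. partial is f (?y + t *\<^sub>R axis i 1)) has_vector_derivative partial (i # is) f ?y) (at (t0 - t0))"
    by simp
  have 2: "((\<lambda>t. t - t0) has_vector_derivative 1) (at t0)"
    by (auto intro!: derivative_eq_intros)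
  show ?thesis using vector_diff_chain_at[OF 2 1] by (simp add: comp_def algebra_simps)
qed

lemma Cinf_funs_linear:
  assumes f: "f \<in> Cinf_funs \<Omega>" and g: "g \<in> Cinf_funs \<Omega>"
  shows "x \<in> \<Omega> \<Longrightarrow> partial is (\<lambda>x. a * f x + b * g x) x = a * partial is f x + b * partial is g x"
    and "(\<lambda>x. a * f x + b * g x) \<in> Cinf_funs \<Omega>"
proof -
  let ?h = "\<lambda>x. a * f x + b * g x"
  have der: "((\<lambda>t. a * partial is f (x + t *\<^sub>R axis i 1) + b * partial is g (x + t *\<^sub>R axis i 1)) has_vector_derivative
      a * partial (i # is) f x + b * partial (i # is) g x) (at 0)" if "x \<in> \<Omega>" for x i "is"
    using Cinf_funs_deriv[OF f, of x 0 i "is"] Cinf_funs_deriv[OF g, of x 0 i "is"] that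
    by (intro has_vector_derivative_add has_vector_derivative_mult_right) auto
  have transfer: "((\<lambda>t. partial is ?h (x + t *\<^sub>R axis i 1)) has_vector_derivative
      a * partial (i # is) f x + b * partial (i # is) g x) (at 0)"
    if "x \<in> \<Omega>" and eq: "\<And>y. y \<in> \<Omega> \<Longrightarrow> partial is ?h y = a * partial is f y + b * partial is g y" for x i "is"
  proof -
    have "\<forall>\<^sub>F t in nhds 0. a * partial is f (x + t *\<^sub>R axis i 1) + b * partial is g (x + t *\<^sub>R axis i 1) = partial is ?h (x + t *\<^sub>R axis i 1)"
      using eventually_line_in[of x 0 "axis i 1"] that(1) by (auto elim!: eventually_mono simp: eq)
    from has_vector_derivative_cong_nhds[OF this] show ?thesis using der[OF that(1)] by blast
  qed
  show eq: "partial is ?h x = a * partial is f x + b * partial is g x" if "x \<in> \<Omega>" for x "is"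
    using that
  proof (induction "is" arbitrary: x)
    case (Cons i "is")
    show ?case using vector_derivative_at[OF transfer[OF Cons.prems Cons.IH]] by (simp add: partial.simps)
  qed simp
  have "continuous_on \<Omega> (partial is ?h)" for "is"
  proof -
    have "continuous_on \<Omega> (\<lambda>x. a * partial is f x + b * partial is g x)"
      using f g unfolding Cinf_funs_def by (intro continuous_intros) auto
    then show ?thesis using eq continuous_on_cong by (metis (no_types, lifting))
  qed
  moreover have "(\<lambda>t. partial is ?h (x + t *\<^sub>R axis i 1)) differentiable (at 0)" if "x \<in> \<Omega>" for x i "is"
    using transfer[OF that eq] by (auto intro: differentiableI_vector)
  moreover have "\<forall>x. x \<notin> \<Omega> \<longrightarrow> ?h x = 0" using f g by (auto simp: Cinf_funs_def)
  ultimately show "?h \<in> Cinf_funs \<Omega>" unfolding Cinf_funs_def by blast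
qed

lemma zero_Cinf_funs: "0 \<in> Cinf_funs \<Omega>" and partial_zero: "partial is (0 :: 'n cfun) x = 0"
proof -
  have p: "partial is (0 :: 'n cfun) = (\<lambda>_. 0)" for "is"
    by (induction "is") (auto simp: partial.simps)
  then show "0 \<in> Cinf_funs \<Omega>" "partial is (0 :: 'n cfun) x = 0" by (auto simp: Cinf_funs_def)
qed

lemma Cinf_funs_add: "f \<in> Cinf_funs \<Omega> \<Longrightarrow> g \<in> Cinf_funs \<Omega> \<Longrightarrow> f + g \<in> Cinf_funs \<Omega>"
  and Cinf_funs_scaleR: "f \<in> Cinf_funs \<Omega> \<Longrightarrow> r *\<^sub>R f \<in> Cinf_funs \<Omega>"
  and Cinf_funs_diff: "f \<in> Cinf_funs \<Omega> \<Longrightarrow> g \<in> Cinf_funs \<Omega> \<Longrightarrow> f - g \<in> Cinf_funs \<Omega>"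
  using Cinf_funs_linear(2)[of f g 1 1] Cinf_funs_linear(2)[of f f r 0]
    Cinf_funs_linear(2)[of f g 1 "-1"]
  by (simp_all add: plus_fun_def fun_diff_def scaleC_fun_def scaleC_complex_def scaleR_fun_def scaleR_conv_of_real)

lemma partial_add: "f \<in> Cinf_funs \<Omega> \<Longrightarrow> g \<in> Cinf_funs \<Omega> \<Longrightarrow> x \<in> \<Omega> \<Longrightarrow> partial is (f + g) x = partial is f x + partial is g x"
  and partial_scaleC: "f \<in> Cinf_funs \<Omega> \<Longrightarrow> x \<in> \<Omega> \<Longrightarrow> partial is (c *\<^sub>C f) x = c * partial is f x"
  and partial_scaleR: "f \<in> Cinf_funs \<Omega> \<Longrightarrow> x \<in> \<Omega> \<Longrightarrow> partial is (r *\<^sub>R f) x = r *\<^sub>R partial is f x"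
  and partial_diff: "f \<in> Cinf_funs \<Omega> \<Longrightarrow> g \<in> Cinf_funs \<Omega> \<Longrightarrow> x \<in> \<Omega> \<Longrightarrow> partial is (f - g) x = partial is f x - partial is g x"
  using Cinf_funs_linear(1)[of f g x "is" 1 1] Cinf_funs_linear(1)[of f f x "is" c 0] Cinf_funs_linear(1)[of f f x "is" r 0]
    Cinf_funs_linear(1)[of f g x "is" 1 "-1"]
  by (simp_all add: plus_fun_def fun_diff_def scaleC_fun_def scaleC_complex_def scaleR_fun_def scaleR_conv_of_real)

lemma subspace_Cinf_funs: "subspace (Cinf_funs \<Omega>)"
  by (intro subspaceI zero_Cinf_funs Cinf_funs_add Cinf_funs_scaleR)

lemma Cinf_bdd:
  assumes "f \<in> Cinf_funs \<Omega>" "compact K" "K \<subseteq> \<Omega>"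
  shows "bdd_above {cmod (partial is f x) | x. x \<in> K}"
proof -
  have "continuous_on K (partial is f)"
    using assms continuous_on_subset unfolding Cinf_funs_def by blast
  then have "compact ((\<lambda>x. cmod (partial is f x)) ` K)"
    using assms by (intro compact_continuous_image continuous_intros)
  then have "bdd_above ((\<lambda>x. cmod (partial is f x)) ` K)" by (intro bounded_imp_bdd_above compact_imp_bounded)
  then show ?thesis by (simp add: setcompr_eq_image)
qed

lemma Cinf_seminorm_upper:
  assumes "f \<in> Cinf_funs \<Omega>" "compact K" "K \<subseteq> \<Omega>" "x \<in> K"
  shows "cmod (partial is f x) \<le> Cinf_seminorm K is f"
  unfolding Cinf_seminorm_def using assms by (intro sup0_upper Cinf_bdd) auto

lemma Cinf_seminorm_least:
  assumes "0 \<le> B" "\<And>x. x \<in> K \<Longrightarrow> cmod (partial is f x) \<le> B"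
  shows "Cinf_seminorm K is f \<le> B"
  unfolding Cinf_seminorm_def using assms by (intro sup0_least) auto

lemma seminorm_on_Cinf:
  assumes "p \<in> Cinf_seminorms \<Omega>"
  shows "seminorm_on (Cinf_funs \<Omega>) p"
proof -
  obtain K "is" where p: "p = Cinf_seminorm K is" "compact K" "K \<subseteq> \<Omega>"
    using assms unfolding Cinf_seminorms_def by blast
  have "seminorm_on (Cinf_funs \<Omega>) (\<lambda>f. sup0 {cmod (partial is f x) | x. x \<in> K})"
  proof (rule seminorm_on_sup0)
    fix x assume "x \<in> K"
    then have "x \<in> \<Omega>" using p by auto
    then show "seminorm_on (Cinf_funs \<Omega>) (\<lambda>f. cmod (partial is f x))"
      unfolding seminorm_on_def by (simp add: partial_add partial_scaleC norm_triangle_ineq norm_mult)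
  next
    fix f assume "f \<in> Cinf_funs \<Omega>"
    then show "bdd_above {cmod (partial is f x) | x. x \<in> K}" using p by (intro Cinf_bdd)
  qed
  then show ?thesis by (simp add: p(1) Cinf_seminorm_def[abs_def])
qed

lemma real_seminorm_Cinf: "p \<in> Cinf_seminorms \<Omega> \<Longrightarrow> real_seminorm (Cinf_funs \<Omega>) p"
  by (intro real_seminorm_of_seminorm_on seminorm_on_Cinf)

lemma Cinf_seminorms_csn: "p \<in> Cinf_seminorms \<Omega> \<Longrightarrow> p \<in> csn (Cinf \<Omega>)"
  unfolding Cinf_alt by (intro csn_generating subspace_Cinf_funs seminorm_on_Cinf)

lemma Cinf_separating:
  assumes "f \<in> Cinf_funs \<Omega>" "\<And>p. p \<in> Cinf_seminorms \<Omega> \<Longrightarrow> p f = 0"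
  shows "f = 0"
proof
  fix x
  show "f x = 0 x"
  proof (cases "x \<in> \<Omega>")
    case True
    then have "Cinf_seminorm {x} [] f = 0" by (intro assms(2)) (auto simp: Cinf_seminorms_def)
    then show ?thesis using Cinf_seminorm_upper[OF assms(1), of "{x}" x "[]"] True by simp
  next
    case False
    then show ?thesis using assms(1) by (simp add: Cinf_funs_def)
  qed
qed

lemma lcs_Cinf: "lcs (Cinf \<Omega>) (Cinf_seminorms \<Omega>)"
  unfolding Cinf_alt
  by (intro lcs_seminorm_topology subspace_Cinf_funs real_seminorm_Cinf Cinf_separating)

text \<open>All partial derivatives converge uniformly on compact sets. Termwise differentiation
  along coordinate lines shows that the limit \<open>g (i # is)\<close> is a derivative of
  \<open>g is\<close>, so the limits are the partial derivatives of one function.\<close>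

lemma Cinf_complete:
  fixes X :: "nat \<Rightarrow> 'n cfun"
  assumes X: "\<And>n. X n \<in> Cinf_funs \<Omega>"
    and C: "\<And>p e. p \<in> Cinf_seminorms \<Omega> \<Longrightarrow> e > 0 \<Longrightarrow> \<exists>N. \<forall>m\<ge>N. \<forall>n\<ge>N. p (X m - X n) < e"
  shows "\<exists>l\<in>Cinf_funs \<Omega>. \<forall>p\<in>Cinf_seminorms \<Omega>. (\<lambda>n. p (X n - l)) \<longlonglongrightarrow> 0"
proof -
  have uC: "\<exists>N. \<forall>m\<ge>N. \<forall>n\<ge>N. \<forall>x\<in>K. cmod (partial is (X m) x - partial is (X n) x) < e"
    if K: "compact K" "K \<subseteq> \<Omega>" and e: "e > 0" for K "is" e
  proof -
    have "Cinf_seminorm K is \<in> Cinf_seminorms \<Omega>" using K by (auto simp: Cinf_seminorms_def)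
    then obtain N where N: "\<And>m n. m \<ge> N \<Longrightarrow> n \<ge> N \<Longrightarrow> Cinf_seminorm K is (X m - X n) < e"
      using C e by meson
    have "cmod (partial is (X m) x - partial is (X n) x) < e" if "m \<ge> N" "n \<ge> N" "x \<in> K" for m n x
    proof -
      have eq: "partial is (X m - X n) x = partial is (X m) x - partial is (X n) x"
        using K that by (intro partial_diff X) auto
      have "cmod (partial is (X m - X n) x) \<le> Cinf_seminorm K is (X m - X n)"
        by (intro Cinf_seminorm_upper Cinf_funs_diff X K that)
      then show ?thesis using N[OF that(1,2)] unfolding eq by linarith
    qed
    then show ?thesis by blast
  qed
  define g where "g is x = lim (\<lambda>n. partial is (X n) x)" for "is" x
  have conv: "(\<lambda>n. partial is (X n) x) \<longlonglongrightarrow> g is x" if "x \<in> \<Omega>" for x "is"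
  proof -
    have "Cauchy (\<lambda>n. partial is (X n) x)"
    proof (rule CauchyI)
      fix e :: real assume "e > 0"
      from uC[of "{x}", OF _ _ this, of "is"] that
      show "\<exists>M. \<forall>m\<ge>M. \<forall>n\<ge>M. norm (partial is (X m) x - partial is (X n) x) < e" by simp
    qed
    then show ?thesis unfolding g_def using Cauchy_convergent_iff convergent_LIMSEQ_iff by blast
  qed
  have uni: "\<exists>N. \<forall>n\<ge>N. \<forall>x\<in>K. cmod (partial is (X n) x - g is x) \<le> e"
    if K: "compact K" "K \<subseteq> \<Omega>" and e: "e > 0" for K "is" e
  proof -
    obtain N where N: "\<And>m n x. m \<ge> N \<Longrightarrow> n \<ge> N \<Longrightarrow> x \<in> K \<Longrightarrow> cmod (partial is (X n) x - partial is (X m) x) < e"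
      using uC[OF K e] by blast
    have "cmod (partial is (X n) x - g is x) \<le> e" if "n \<ge> N" "x \<in> K" for n x
    proof (rule tendsto_upperbound)
      show "(\<lambda>m. cmod (partial is (X n) x - partial is (X m) x)) \<longlonglongrightarrow> cmod (partial is (X n) x - g is x)"
        using that K by (intro tendsto_intros conv) auto
      show "\<forall>\<^sub>F m in sequentially. cmod (partial is (X n) x - partial is (X m) x) \<le> e"
        unfolding eventually_sequentially by (intro exI[of _ N]) (use N that in \<open>auto intro: less_imp_le\<close>)
    qed simp
    then show ?thesis by blast
  qed
  have gder: "((\<lambda>t. g is (x + t *\<^sub>R axis i 1)) has_vector_derivative g (i # is) x) (at 0)" if x: "x \<in> \<Omega>" for x i "is"
  proof -
    obtain r where r: "r > 0" "cball x r \<subseteq> \<Omega>" using open_Omega x open_contains_cball by blast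
    have inn: "x + t *\<^sub>R axis i 1 \<in> cball x r" if "t \<in> ball 0 r" for t
      using that by (simp add: dist_norm norm_axis_1)
    have "\<exists>G. \<forall>t\<in>ball 0 r. (\<lambda>n. partial is (X n) (x + t *\<^sub>R axis i 1)) \<longlonglongrightarrow> G t \<and>
        (G has_derivative (\<lambda>h. h *\<^sub>R g (i # is) (x + t *\<^sub>R axis i 1))) (at t within ball 0 r)"
    proof (rule has_derivative_sequence[where f'="\<lambda>n t h. h *\<^sub>R partial (i # is) (X n) (x + t *\<^sub>R axis i 1)"])
      show "convex (ball (0::real) r)" "0 \<in> ball 0 r" using r by auto
      show "((\<lambda>t. partial is (X n) (x + t *\<^sub>R axis i 1)) has_derivative (\<lambda>h. h *\<^sub>R partial (i # is) (X n) (x + t *\<^sub>R axis i 1))) (at t within ball 0 r)"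
        if "t \<in> ball 0 r" for n t
        using Cinf_funs_deriv[OF X, of x t i "is" n] inn[OF that] r(2) has_derivative_at_withinI
        unfolding has_vector_derivative_def by blast
      show "(\<lambda>n. partial is (X n) (x + 0 *\<^sub>R axis i 1)) \<longlonglongrightarrow> g is x" using conv[OF x] by simp
      fix e :: real assume "e > 0"
      then obtain N where N: "\<And>n y. n \<ge> N \<Longrightarrow> y \<in> cball x r \<Longrightarrow> cmod (partial (i # is) (X n) y - g (i # is) y) \<le> e"
        using uni[OF compact_cball r(2) \<open>e > 0\<close>, of "i # is"] by blast
      show "\<forall>\<^sub>F n in sequentially. \<forall>t\<in>ball 0 r. \<forall>h. norm (h *\<^sub>R partial (i # is) (X n) (x + t *\<^sub>R axis i 1) - h *\<^sub>R g (i # is) (x + t *\<^sub>R axis i 1)) \<le> e * norm h"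
        unfolding eventually_sequentially
      proof (intro exI[of _ N] allI impI ballI)
        fix n :: nat and t h :: real assume "n \<ge> N" "t \<in> ball 0 r"
        have "norm (h *\<^sub>R partial (i # is) (X n) (x + t *\<^sub>R axis i 1) - h *\<^sub>R g (i # is) (x + t *\<^sub>R axis i 1)) =
           \<bar>h\<bar> * cmod (partial (i # is) (X n) (x + t *\<^sub>R axis i 1) - g (i # is) (x + t *\<^sub>R axis i 1))"
          by (simp only: scaleR_diff_right[symmetric] norm_scaleR)
        also have "\<dots> \<le> \<bar>h\<bar> * e" by (intro mult_left_mono N inn \<open>n \<ge> N\<close> \<open>t \<in> ball 0 r\<close>) simp
        finally show "norm (h *\<^sub>R partial (i # is) (X n) (x + t *\<^sub>R axis i 1) - h *\<^sub>R g (i # is) (x + t *\<^sub>R axis i 1)) \<le> e * norm h"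
          by (simp only: real_norm_def mult.commute)
      qed
    qed
    then obtain G where G: "\<And>t. t \<in> ball 0 r \<Longrightarrow> (\<lambda>n. partial is (X n) (x + t *\<^sub>R axis i 1)) \<longlonglongrightarrow> G t"
      "\<And>t. t \<in> ball 0 r \<Longrightarrow> (G has_derivative (\<lambda>h. h *\<^sub>R g (i # is) (x + t *\<^sub>R axis i 1))) (at t within ball 0 r)" by blast
    have "(G has_derivative (\<lambda>h. h *\<^sub>R g (i # is) (x + 0 *\<^sub>R axis i 1))) (at 0)"
      using G(2)[of 0] r(1) at_within_open[of 0 "ball (0::real) r"] by simp
    then have Gd: "(G has_vector_derivative g (i # is) x) (at 0)" by (simp add: has_vector_derivative_def)
    have "G t = g is (x + t *\<^sub>R axis i 1)" if "t \<in> ball 0 r" for t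
      using LIMSEQ_unique[OF G(1)[OF that] conv] inn[OF that] r(2) by blast
    then show ?thesis
      by (intro has_vector_derivative_transform_within_open[OF Gd, of "ball 0 r"]) (use r in auto)
  qed
  define f where "f x = (if x \<in> \<Omega> then g [] x else 0)" for x
  have pf: "partial is f x = g is x" if "x \<in> \<Omega>" for x "is"
    using that
  proof (induction "is" arbitrary: x)
    case Nil then show ?case by (simp add: f_def)
  next
    case (Cons i "is")
    have "\<forall>\<^sub>F t in nhds 0. partial is f (x + t *\<^sub>R axis i 1) = g is (x + t *\<^sub>R axis i 1)"
      using eventually_line_in[of x 0 "axis i 1"] Cons by (auto elim!: eventually_mono)
    then have "vector_derivative (\<lambda>t. partial is f (x + t *\<^sub>R axis i 1)) (at 0) = vector_derivative (\<lambda>t. g is (x + t *\<^sub>R axis i 1)) (at 0)"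
      by (intro vector_derivative_cong_eq) (auto elim: eventually_mono)
    then show ?case using vector_derivative_at[OF gder[OF Cons.prems]] by (simp add: partial.simps)
  qed
  have "f \<in> Cinf_funs \<Omega>" unfolding Cinf_funs_def
  proof (intro CollectI conjI allI ballI impI)
    show "f x = 0" if "x \<notin> \<Omega>" for x using that by (simp add: f_def)
    fix "is"
    have "continuous_on \<Omega> (g is)"
    proof (rule continuous_at_imp_continuous_on, rule ballI)
      fix x assume "x \<in> \<Omega>"
      then obtain r where r: "r > 0" "cball x r \<subseteq> \<Omega>" using open_Omega open_contains_cball by blast
      have "continuous_on (cball x r) (g is)"
      proof (rule uniform_limit_theorem[of _ "\<lambda>n. partial is (X n)" sequentially])
        show "\<forall>\<^sub>F n in sequentially. continuous_on (cball x r) (partial is (X n))"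
          using X r(2) continuous_on_subset unfolding Cinf_funs_def by (intro always_eventually) blast
        show "uniform_limit (cball x r) (\<lambda>n. partial is (X n)) (g is) sequentially"
          unfolding uniform_limit_iff
        proof (intro allI impI)
          fix e :: real assume "e > 0"
          then obtain N where "\<And>n y. n \<ge> N \<Longrightarrow> y \<in> cball x r \<Longrightarrow> cmod (partial is (X n) y - g is y) \<le> e / 2"
            using uni[OF compact_cball r(2) half_gt_zero[OF \<open>e > 0\<close>], of "is"] by blast
          then show "\<forall>\<^sub>F n in sequentially. \<forall>y\<in>cball x r. dist (partial is (X n) y) (g is y) < e"
            unfolding eventually_sequentially dist_norm using \<open>e > 0\<close>
            by (intro exI[of _ N]) (fastforce intro: order.strict_trans1)
        qed
      qed simp
      then show "isCont (g is) x" by (rule continuous_on_interior) (use r(1) in \<open>simp add: interior_cball\<close>)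
    qed
    then show "continuous_on \<Omega> (partial is f)" using pf continuous_on_cong by metis
    fix i x assume x: "x \<in> \<Omega>"
    have "\<forall>\<^sub>F t in nhds 0. g is (x + t *\<^sub>R axis i 1) = partial is f (x + t *\<^sub>R axis i 1)"
      using eventually_line_in[of x 0 "axis i 1"] x by (auto elim!: eventually_mono simp: pf)
    from has_vector_derivative_cong_nhds[OF this]
    have "((\<lambda>t. partial is f (x + t *\<^sub>R axis i 1)) has_vector_derivative g (i # is) x) (at 0)"
      using gder[OF x] by blast
    then show "(\<lambda>t. partial is f (x + t *\<^sub>R axis i 1)) differentiable (at 0)"
      by (auto intro: differentiableI_vector)
  qed
  moreover have "(\<lambda>n. p (X n - f)) \<longlonglongrightarrow> 0" if pC: "p \<in> Cinf_seminorms \<Omega>" for p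
  proof -
    obtain K "is" where p: "p = Cinf_seminorm K is" "compact K" "K \<subseteq> \<Omega>"
      using pC unfolding Cinf_seminorms_def by blast
    show ?thesis
    proof (rule LIMSEQ_I)
      fix e :: real assume e: "e > 0"
      then obtain N where N: "\<And>n y. n \<ge> N \<Longrightarrow> y \<in> K \<Longrightarrow> cmod (partial is (X n) y - g is y) \<le> e / 2"
        using uni[OF p(2,3) half_gt_zero[OF e], of "is"] by blast
      have "norm (p (X n - f) - 0) < e" if "n \<ge> N" for n
      proof -
        have "p (X n - f) \<le> e / 2" unfolding p
        proof (rule Cinf_seminorm_least)
          fix y assume y: "y \<in> K"
          then have "y \<in> \<Omega>" using p by auto
          then show "cmod (partial is (X n - f) y) \<le> e / 2"
            using N[OF that y] partial_diff[OF X \<open>f \<in> Cinf_funs \<Omega>\<close>] pf by simp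
        qed (use e in simp)
        moreover have "0 \<le> p (X n - f)"
          using real_seminorm_nonneg[OF subspace_Cinf_funs real_seminorm_Cinf[OF pC] Cinf_funs_diff[OF X \<open>f \<in> Cinf_funs \<Omega>\<close>]] .
        ultimately show ?thesis using e by simp
      qed
      then show "\<exists>N. \<forall>n\<ge>N. norm (p (X n - f) - 0) < e" by blast
    qed
  qed
  ultimately show ?thesis by blast
qed

lemma complete_lcs_Cinf: "complete_lcs (Cinf \<Omega>) (Cinf_seminorms \<Omega>)"
  by (intro complete_lcs.intro lcs_Cinf complete_lcs_axioms.intro) (simp add: topspace_Cinf Cinf_complete)

text \<open>The coordinates of the increment are switched on one at a time, in a finite induction
  over the set of active ones; each new coordinate is handled by continuity of one partial
  derivative.\<close>

lemma Cinf_has_derivative: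
  assumes f: "f \<in> Cinf_funs \<Omega>" and x: "x \<in> \<Omega>"
  shows "(partial is f has_derivative (\<lambda>h. \<Sum>i\<in>UNIV. h $ i *\<^sub>R partial (i # is) f x)) (at x)"
proof -
  have step: "\<exists>\<delta>>0. \<forall>h. norm h < \<delta> \<longrightarrow> norm (partial is f (x + (\<Sum>i\<in>A. h $ i *\<^sub>R axis i 1)) - partial is f x
      - (\<Sum>i\<in>A. h $ i *\<^sub>R partial (i # is) f x)) \<le> e * norm h" if "e > 0" for e and A :: "'n set"
    using finite[of A] that
  proof (induction A arbitrary: e rule: finite_induct)
    case empty then show ?case by (intro exI[of _ 1]) auto
  next
    case (insert j A)
    obtain \<delta>1 where d1: "\<delta>1 > 0" "\<And>h. norm h < \<delta>1 \<Longrightarrow> norm (partial is f (x + (\<Sum>i\<in>A. h $ i *\<^sub>R axis i 1)) - partial is f x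
      - (\<Sum>i\<in>A. h $ i *\<^sub>R partial (i # is) f x)) \<le> e / 2 * norm h"
      using insert.IH[of "e / 2"] insert.prems by auto
    have "isCont (partial (j # is) f) x"
      using f x open_Omega unfolding Cinf_funs_def by (simp add: continuous_on_eq_continuous_at)
    then obtain \<delta>2 where d2: "\<delta>2 > 0" "\<And>y. dist y x < \<delta>2 \<Longrightarrow> norm (partial (j # is) f y - partial (j # is) f x) < e / 2"
      unfolding continuous_at_eps_delta dist_norm using insert.prems half_gt_zero by blast
    obtain \<delta>3 where d3: "\<delta>3 > 0" "ball x \<delta>3 \<subseteq> \<Omega>" using open_Omega x open_contains_ball by blast
    have "norm (partial is f (x + (\<Sum>i\<in>insert j A. h $ i *\<^sub>R axis i 1)) - partial is f x
      - (\<Sum>i\<in>insert j A. h $ i *\<^sub>R partial (i # is) f x)) \<le> e * norm h" if h: "norm h < min \<delta>1 (min \<delta>2 \<delta>3)" for h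
    proof -
      define y where "y = x + (\<Sum>i\<in>A. h $ i *\<^sub>R axis i 1)"
      \<comment> \<open>Each component of the displacement is 0 or bounded by the corresponding
        component of \<open>h\<close>, so all intermediate points stay within \<open>norm h\<close>
        of \<open>x\<close>.\<close>
      have near: "norm (y + s *\<^sub>R axis j 1 - x) \<le> norm h" if "\<bar>s\<bar> \<le> \<bar>h $ j\<bar>" for s
      proof (rule norm_le_componentwise_cart)
        fix k
        have "(y + s *\<^sub>R axis j 1 - x) $ k = (\<Sum>i\<in>A. if i = k then h $ i else 0) + (if j = k then s else 0)"
          by (simp add: y_def axis_def if_distrib cong: if_cong)
        also have "\<dots> = (if k \<in> A then h $ k else 0) + (if j = k then s else 0)"
          using insert.hyps by simp
        finally show "norm ((y + s *\<^sub>R axis j 1 - x) $ k) \<le> norm (h $ k)" using that insert.hyps by auto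
      qed
      \<comment> \<open>With the linear term at \<open>x\<close> removed, the derivative is the
        difference of a partial derivative at two nearby points, hence at most
        \<open>e / 2\<close>.\<close>
      define \<phi> where "\<phi> s = partial is f (y + s *\<^sub>R axis j 1) - s *\<^sub>R partial (j # is) f x" for s
      have "norm (\<phi> (h $ j) - \<phi> 0) \<le> e / 2 * norm (h $ j - 0)"
      proof (rule differentiable_bound[where f'="\<lambda>s r. r *\<^sub>R (partial (j # is) f (y + s *\<^sub>R axis j 1) - partial (j # is) f x)"])
        show "convex (closed_segment 0 (h $ j))" "h $ j \<in> closed_segment 0 (h $ j)" "0 \<in> closed_segment 0 (h $ j)" by auto
        fix s assume s: "s \<in> closed_segment 0 (h $ j)"
        then have "\<bar>s\<bar> \<le> \<bar>h $ j\<bar>" by (auto simp: closed_segment_eq_real_ivl split: if_splits)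
        then have ds: "dist (y + s *\<^sub>R axis j 1) x < min \<delta>1 (min \<delta>2 \<delta>3)" using near[of s] h by (simp add: dist_norm)
        then have "y + s *\<^sub>R axis j 1 \<in> \<Omega>" using d3(2) by (auto simp: dist_commute)
        then have "(\<phi> has_vector_derivative (partial (j # is) f (y + s *\<^sub>R axis j 1) - 1 *\<^sub>R partial (j # is) f x)) (at s)"
          unfolding \<phi>_def
          by (intro has_vector_derivative_diff Cinf_funs_deriv f)
            (auto intro!: derivative_eq_intros)
        then show "(\<phi> has_derivative (\<lambda>r. r *\<^sub>R (partial (j # is) f (y + s *\<^sub>R axis j 1) - partial (j # is) f x))) (at s within closed_segment 0 (h $ j))"
          by (simp add: has_vector_derivative_def has_derivative_at_withinI)
        show "onorm (\<lambda>r. r *\<^sub>R (partial (j # is) f (y + s *\<^sub>R axis j 1) - partial (j # is) f x)) \<le> e / 2"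
        proof (rule onorm_le)
          fix r
          have "norm (r *\<^sub>R (partial (j # is) f (y + s *\<^sub>R axis j 1) - partial (j # is) f x)) \<le> norm r * (e / 2)"
            unfolding norm_scaleR real_norm_def using less_imp_le[OF d2(2)] ds by (intro mult_left_mono) auto
          then show "norm (r *\<^sub>R (partial (j # is) f (y + s *\<^sub>R axis j 1) - partial (j # is) f x)) \<le> e / 2 * norm r"
            by (simp only: mult.commute)
        qed
      qed
      also have "\<dots> \<le> e / 2 * norm h" using component_le_norm_cart[of h j] insert.prems by (intro mult_left_mono) auto
      finally have A: "norm (\<phi> (h $ j) - \<phi> 0) \<le> e / 2 * norm h" .
      have B: "norm (partial is f y - partial is f x - (\<Sum>i\<in>A. h $ i *\<^sub>R partial (i # is) f x)) \<le> e / 2 * norm h"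
        using d1(2)[of h] h unfolding y_def by simp
      have eq: "partial is f (x + (\<Sum>i\<in>insert j A. h $ i *\<^sub>R axis i 1)) - partial is f x - (\<Sum>i\<in>insert j A. h $ i *\<^sub>R partial (i # is) f x)
        = (\<phi> (h $ j) - \<phi> 0) + (partial is f y - partial is f x - (\<Sum>i\<in>A. h $ i *\<^sub>R partial (i # is) f x))"
        using insert.hyps by (simp add: \<phi>_def y_def algebra_simps)
      have "e / 2 * norm h + e / 2 * norm h = e * norm h" by simp
      then show ?thesis unfolding eq using norm_triangle_le[OF add_mono[OF A B]] by metis
    qed
    then show ?case using d1(1) d2(1) d3(1) by (intro exI[of _ "min \<delta>1 (min \<delta>2 \<delta>3)"]) simp
  qed
  have basis: "(\<Sum>i\<in>UNIV. h $ i *\<^sub>R axis i 1) = h" for h :: "real^'n"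
    by (simp add: vec_eq_iff axis_def if_distrib cong: if_cong)
  show ?thesis unfolding has_derivative_at_alt
  proof (intro conjI allI impI)
    show "bounded_linear (\<lambda>h. \<Sum>i\<in>UNIV. h $ i *\<^sub>R partial (i # is) f x)"
      by (intro bounded_linear_sum bounded_linear_scaleR_const bounded_linear_vec_nth)
    fix e :: real assume "e > 0"
    then obtain \<delta> where d: "\<delta> > 0" "\<And>h. norm h < \<delta> \<Longrightarrow> norm (partial is f (x + h) - partial is f x
      - (\<Sum>i\<in>UNIV. h $ i *\<^sub>R partial (i # is) f x)) \<le> e * norm h"
      using step[of e UNIV] unfolding basis by auto
    show "\<exists>d>0. \<forall>y. norm (y - x) < d \<longrightarrow> norm (partial is f y - partial is f x - (\<Sum>i\<in>UNIV. (y - x) $ i *\<^sub>R partial (i # is) f x)) \<le> e * norm (y - x)"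
      by (intro exI[of _ \<delta>] conjI d(1) allI impI) (use d(2)[of "_ - x"] in \<open>simp\<close>)
  qed
qed

section \<open>Evaluation of moving functions at moving points\<close>

text \<open>Splitting \<open>c s\<close> into \<open>c t\<close> and \<open>c s - c t\<close>
  separates the two motions: the first part is the ordinary chain rule, and for the second the
  difference quotients of \<open>c\<close> converge uniformly near \<open>y t\<close>, so they may
  be evaluated at the moving point.\<close>

lemma evaluation_deriv:
  assumes c: "range c \<subseteq> Cinf_funs \<Omega>" and c': "curve_deriv (Cinf \<Omega>) c t c'"
    and y: "(y has_vector_derivative y') (at t)" and yt: "y t \<in> \<Omega>"
  shows "((\<lambda>s. partial is (c s) (y s)) has_vector_derivative
      partial is c' (y t) + (\<Sum>i\<in>UNIV. y' $ i *\<^sub>R partial (i # is) (c t) (y t))) (at t)"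
proof -
  interpret C: lcs "Cinf \<Omega>" "Cinf_seminorms \<Omega>" by (rule lcs_Cinf)
  have cin: "c s \<in> Cinf_funs \<Omega>" for s using c by auto
  have c'in: "c' \<in> Cinf_funs \<Omega>" using C.curve_deriv_in[OF c'] by (simp add: topspace_Cinf)
  have rc: "range c \<subseteq> topspace (Cinf \<Omega>)" using c by (simp add: topspace_Cinf)
  have 1: "((\<lambda>s. partial is (c t) (y s)) has_vector_derivative (\<Sum>i\<in>UNIV. y' $ i *\<^sub>R partial (i # is) (c t) (y t))) (at t)"
    using vector_derivative_diff_chain_within[OF y has_derivative_at_withinI[OF Cinf_has_derivative[OF cin yt]], of "is" t]
    unfolding comp_def .
  obtain r where r: "r > 0" "cball (y t) r \<subseteq> \<Omega>" using open_Omega yt open_contains_cball by blast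
  define p where "p = Cinf_seminorm (cball (y t) r) is"
  have p: "p \<in> Cinf_seminorms \<Omega>" using r by (auto simp: p_def Cinf_seminorms_def)
  let ?q = "\<lambda>h. inverse h *\<^sub>R (c (t + h) - c t)"
  have qin: "?q h \<in> Cinf_funs \<Omega>" for h by (intro Cinf_funs_scaleR Cinf_funs_diff cin)
  have ycont: "((\<lambda>h. y (t + h)) \<longlongrightarrow> y t) (at 0)"
    using has_vector_derivative_continuous[OF y] by (simp add: isCont_iff)
  have "\<forall>\<^sub>F h in at 0. dist (y (t + h)) (y t) < r" using tendstoD[OF ycont r(1)] .
  then have evK: "\<forall>\<^sub>F h in at 0. y (t + h) \<in> cball (y t) r"
    by (rule eventually_mono) (simp add: dist_commute)
  have "((\<lambda>h. partial is (?q h - c') (y (t + h))) \<longlongrightarrow> 0) (at 0)"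
  proof (rule Lim_null_comparison)
    show "\<forall>\<^sub>F h in at 0. norm (partial is (?q h - c') (y (t + h))) \<le> p (?q h - c')"
      using evK by (rule eventually_mono)
        (unfold p_def, intro Cinf_seminorm_upper Cinf_funs_diff qin c'in compact_cball r(2), simp)
    show "((\<lambda>h. p (?q h - c')) \<longlongrightarrow> 0) (at 0)"
      using c' p unfolding C.curve_deriv_iff_tendsto[OF rc] by blast
  qed
  moreover have "((\<lambda>h. partial is c' (y (t + h))) \<longlongrightarrow> partial is c' (y t)) (at 0)"
  proof -
    have "isCont (partial is c') (y t)"
      using c'in yt open_Omega unfolding Cinf_funs_def by (simp add: continuous_on_eq_continuous_at)
    then show ?thesis using ycont by (rule isCont_tendsto_compose)
  qed
  ultimately have "((\<lambda>h. partial is (?q h - c') (y (t + h)) + partial is c' (y (t + h))) \<longlongrightarrow> 0 + partial is c' (y t)) (at 0)"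
    by (rule tendsto_add)
  moreover have "\<forall>\<^sub>F h in at 0. partial is (?q h - c') (y (t + h)) + partial is c' (y (t + h)) =
      inverse h *\<^sub>R ((partial is (c (t + h)) (y (t + h)) - partial is (c t) (y (t + h))) - (partial is (c t) (y t) - partial is (c t) (y t)))"
    using evK
  proof eventually_elim
    case (elim h)
    then have "y (t + h) \<in> \<Omega>" using r(2) by auto
    then show ?case
      by (simp add: partial_diff partial_scaleR qin c'in cin Cinf_funs_diff Cinf_funs_scaleR)
  qed
  ultimately have "((\<lambda>h. inverse h *\<^sub>R ((partial is (c (t + h)) (y (t + h)) - partial is (c t) (y (t + h))) - (partial is (c t) (y t) - partial is (c t) (y t)))) \<longlongrightarrow> partial is c' (y t)) (at 0)"
    using Lim_transform_eventually by fastforce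
  then have "curve_deriv euclidean (\<lambda>s. partial is (c s) (y s) - partial is (c t) (y s)) t (partial is c' (y t))"
    unfolding curve_deriv_def by simp
  then have 2: "((\<lambda>s. partial is (c s) (y s) - partial is (c t) (y s)) has_vector_derivative partial is c' (y t)) (at t)"
    unfolding curve_deriv_euclidean .
  show ?thesis using has_vector_derivative_add[OF 2 1] by simp
qed

lemma smooth_curve_evaluation:
  assumes c: "smooth_curve (Cinf \<Omega>) c" and y: "smooth_curve euclidean y" and yO: "\<And>t. y t \<in> \<Omega>"
  shows "smooth_curve euclidean (\<lambda>t. partial is (c t) (y t))"
proof -
  interpret V: complete_lcs "euclidean :: complex topology" "{norm}" by (rule lcs_euclidean)
  obtain D where D: "D 0 = c" "derivs (Cinf \<Omega>) D" using c smooth_curve_derivs by metis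
  obtain Y where Y: "Y 0 = y" "derivs euclidean Y" using y smooth_curve_derivs by metis
  have dy: "(y has_vector_derivative Y 1 t) (at t)" for t
    using Y unfolding derivs_def curve_deriv_euclidean by (metis One_nat_def)
  have "smooth_curve euclidean (Y 1)"
    unfolding smooth_curve_derivs using derivs_shift[OF Y(2), of 1] by (intro exI[of _ "\<lambda>k. Y (k + 1)"]) simp
  then have Y1: "smooth_curve euclideanreal (\<lambda>t. Y 1 t $ i)" for i
    by (rule smooth_curve_bounded_linear) (rule bounded_linear_vec_nth)
  have Din: "range (D k) \<subseteq> Cinf_funs \<Omega>" for k
    using derivs_in[OF D(2)] by (auto simp: topspace_Cinf)
  \<comment> \<open>Generalised over \<open>k\<close> and \<open>is\<close>, because the derivative
    of one such evaluation is a sum of others multiplied by components of the velocity of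
    \<open>y\<close>.\<close>
  have "curve_Cn euclidean n (\<lambda>t. partial is (D k t) (y t))" for n k "is"
  proof (induction n arbitrary: k "is")
    case (Suc n)
    have "((\<lambda>t. partial is (D k t) (y t)) has_vector_derivative
        partial is (D (Suc k) t) (y t) + (\<Sum>i\<in>UNIV. Y 1 t $ i *\<^sub>R partial (i # is) (D k t) (y t))) (at t)" for t
      using D(2) by (intro evaluation_deriv[OF Din _ dy yO]) (simp add: derivs_def)
    moreover have "curve_Cn euclidean n (\<lambda>t. partial is (D (Suc k) t) (y t) + (\<Sum>i\<in>UNIV. Y 1 t $ i *\<^sub>R partial (i # is) (D k t) (y t)))"
      using Y1 by (intro V.curve_Cn_add V.curve_Cn_sum V.curve_Cn_mult Suc) (simp add: real_lcs.smooth_curve_iff_Cn)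
    ultimately have "\<exists>c'. (\<forall>t. curve_deriv euclidean (\<lambda>t. partial is (D k t) (y t)) t (c' t)) \<and> curve_Cn euclidean n c'"
      unfolding curve_deriv_euclidean by (intro exI conjI allI)
    then show ?case by simp
  qed auto
  then show ?thesis unfolding V.smooth_curve_iff_Cn using D(1) by metis
qed

end

subsection \<open>Test functions and smoothing kernels\<close>

definition D_seminorms :: "(real^'n::finite) set \<Rightarrow> ('n cfun \<Rightarrow> real) set" where
  "D_seminorms \<Omega> = {p. seminorm_on (test_funs \<Omega>) p \<and>
     (\<forall>K. compact K \<and> K \<subseteq> \<Omega> \<longrightarrow>
        continuous_map (subtopology (Cinf \<Omega>) {f \<in> test_funs \<Omega>. fsupp f \<subseteq> K}) euclideanreal p)}"

lemma Dspace_alt: "Dspace \<Omega> = seminorm_topology (test_funs \<Omega>) (D_seminorms \<Omega>)"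
  unfolding Dspace_def D_seminorms_def ..

lemma topspace_Dspace: "topspace (Dspace \<Omega>) = test_funs \<Omega>"
  unfolding Dspace_alt topspace_seminorm_topology ..

lemma fsuppI: "f x \<noteq> 0 \<Longrightarrow> x \<in> fsupp f"
  unfolding fsupp_def by (rule subsetD[OF closure_subset]) simp

lemma fsupp_subset: "closed K \<Longrightarrow> (\<And>x. x \<notin> K \<Longrightarrow> f x = 0) \<Longrightarrow> fsupp f \<subseteq> K"
  unfolding fsupp_def by (intro closure_minimal) auto

lemma test_funsI:
  assumes "f \<in> Cinf_funs \<Omega>" "compact K" "K \<subseteq> \<Omega>" "\<And>x. x \<notin> K \<Longrightarrow> f x = 0"
  shows "f \<in> test_funs \<Omega>" "fsupp f \<subseteq> K"
proof -
  show s: "fsupp f \<subseteq> K" using assms compact_imp_closed by (intro fsupp_subset) auto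
  have "closed (fsupp f)" unfolding fsupp_def by simp
  then have "compact (fsupp f)" using s assms(2) compact_Int_closed[of K "fsupp f"] by (simp add: Int_absorb1)
  then show "f \<in> test_funs \<Omega>" using assms s unfolding test_funs_def by blast
qed

lemma test_funsD:
  assumes "f \<in> test_funs \<Omega>"
  shows "f \<in> Cinf_funs \<Omega>" "compact (fsupp f)" "fsupp f \<subseteq> \<Omega>"
  using assms unfolding test_funs_def by auto

lemma smooth_mapsD:
  assumes "f \<in> smooth_maps E U F" "smooth_curve E c" "range c \<subseteq> U"
  shows "smooth_curve F (\<lambda>t. f (c t))"
proof -
  have "smooth_curve F (f \<circ> c)" using assms unfolding smooth_maps_def by blast
  then show ?thesis by (simp add: comp_def)
qed

context open_set
begin

lemma test_funs_linear:
  assumes f: "f \<in> test_funs \<Omega>" and g: "g \<in> test_funs \<Omega>"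
  shows "(\<lambda>x. a * f x + b * g x) \<in> test_funs \<Omega>" "fsupp (\<lambda>x. a * f x + b * g x) \<subseteq> fsupp f \<union> fsupp g"
proof -
  have K: "compact (fsupp f \<union> fsupp g)" "fsupp f \<union> fsupp g \<subseteq> \<Omega>"
    using test_funsD[OF f] test_funsD[OF g] by auto
  have z: "a * f x + b * g x = 0" if "x \<notin> fsupp f \<union> fsupp g" for x
  proof -
    have "f x = 0" "g x = 0" using that fsuppI[of f x] fsuppI[of g x] by blast+
    then show ?thesis by simp
  qed
  show "(\<lambda>x. a * f x + b * g x) \<in> test_funs \<Omega>" "fsupp (\<lambda>x. a * f x + b * g x) \<subseteq> fsupp f \<union> fsupp g"
    using test_funsI[OF Cinf_funs_linear(2)[OF test_funsD(1)[OF f] test_funsD(1)[OF g], of a b] K z] by auto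
qed

lemma test_funs_add: "f \<in> test_funs \<Omega> \<Longrightarrow> g \<in> test_funs \<Omega> \<Longrightarrow> f + g \<in> test_funs \<Omega>"
  using test_funs_linear(1)[of f g 1 1] by (simp add: plus_fun_def)

lemma test_funs_diff: "f \<in> test_funs \<Omega> \<Longrightarrow> g \<in> test_funs \<Omega> \<Longrightarrow> f - g \<in> test_funs \<Omega>"
  using test_funs_linear(1)[of f g 1 "-1"] by (simp add: fun_diff_def)

lemma fsupp_diff: "f \<in> test_funs \<Omega> \<Longrightarrow> g \<in> test_funs \<Omega> \<Longrightarrow> fsupp (f - g) \<subseteq> fsupp f \<union> fsupp g"
  using test_funs_linear(2)[of f g 1 "-1"] by (simp add: fun_diff_def)

lemma test_funs_scaleR: "f \<in> test_funs \<Omega> \<Longrightarrow> r *\<^sub>R f \<in> test_funs \<Omega>"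
  using test_funs_linear(1)[of f f r 0] by (simp add: scaleR_fun_def scaleR_conv_of_real)

lemma zero_test_funs: "0 \<in> test_funs \<Omega>"
  by (rule test_funsI(1)[OF zero_Cinf_funs, of "{}"]) auto

lemma subspace_test_funs: "subspace (test_funs \<Omega>)"
  by (intro subspaceI zero_test_funs test_funs_add test_funs_scaleR)

text \<open>An estimate by one seminorm of \<open>Cinf \<Omega>\<close> for functions supported in
  \<open>K\<close> gives continuity there, since the difference of two such functions is again
  supported in \<open>K\<close>.\<close>

lemma D_seminormsI:
  assumes q: "seminorm_on (test_funs \<Omega>) q"
    and dom: "\<And>K. compact K \<Longrightarrow> K \<subseteq> \<Omega> \<Longrightarrow>
      \<exists>C p. p \<in> Cinf_seminorms \<Omega> \<and> 0 \<le> C \<and> (\<forall>f\<in>test_funs \<Omega>. fsupp f \<subseteq> K \<longrightarrow> q f \<le> C * p f)"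
  shows "q \<in> D_seminorms \<Omega>"
  unfolding D_seminorms_def
proof (intro CollectI conjI allI impI q)
  fix K assume K: "compact K \<and> K \<subseteq> \<Omega>"
  let ?W = "{f \<in> test_funs \<Omega>. fsupp f \<subseteq> K}"
  from dom[OF conjunct1[OF K] conjunct2[OF K]] obtain C p where
    Cp: "p \<in> Cinf_seminorms \<Omega>" "0 \<le> C" and "\<forall>f\<in>test_funs \<Omega>. fsupp f \<subseteq> K \<longrightarrow> q f \<le> C * p f"
    by (elim exE conjE)
  then have qW: "q f \<le> C * p f" if "f \<in> ?W" for f using that by simp
  have ts: "topspace (subtopology (Cinf \<Omega>) ?W) = ?W"
    using test_funsD(1) unfolding topspace_subtopology topspace_Cinf by blast
  have qr: "real_seminorm (test_funs \<Omega>) q" using q by (rule real_seminorm_of_seminorm_on)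
  show "continuous_map (subtopology (Cinf \<Omega>) ?W) euclideanreal q"
    unfolding continuous_map ts
  proof (intro conjI allI impI)
    fix U :: "real set" assume "openin euclideanreal U"
    then have U: "open U" by simp
    show "openin (subtopology (Cinf \<Omega>) ?W) {f \<in> ?W. q f \<in> U}"
    proof (subst openin_subopen, intro ballI)
      fix g assume g: "g \<in> {f \<in> ?W. q f \<in> U}"
      then obtain e where e: "e > 0" "\<And>y. \<bar>y - q g\<bar> < e \<Longrightarrow> y \<in> U"
        using U unfolding open_dist by (auto simp: dist_real_def)
      have gC: "g \<in> Cinf_funs \<Omega>" using g test_funsD(1) by blast
      let ?B = "{f \<in> Cinf_funs \<Omega>. p (f - g) < e / (C + 1)}"
      have "openin (Cinf \<Omega>) ?B"
        unfolding Cinf_alt using Cp e gC by (intro openin_seminorm_ball) auto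
      then have "openin (subtopology (Cinf \<Omega>) ?W) (?B \<inter> ?W)"
        unfolding openin_subtopology by blast
      moreover have "g \<in> ?B \<inter> ?W"
        using g gC real_seminorm_zero[OF subspace_Cinf_funs real_seminorm_Cinf[OF Cp(1)]] e Cp(2) by simp
      moreover have "?B \<inter> ?W \<subseteq> {f \<in> ?W. q f \<in> U}"
      proof
        fix f assume f: "f \<in> ?B \<inter> ?W"
        have "f - g \<in> ?W" using f g test_funs_diff fsupp_diff by blast
        then have "q (f - g) \<le> C * p (f - g)" by (rule qW)
        also have "\<dots> \<le> C * (e / (C + 1))" using f Cp(2) by (intro mult_left_mono) auto
        also have "\<dots> < e" using e Cp(2) by (simp add: field_simps)
        finally have "\<bar>q f - q g\<bar> < e"
          using real_seminorm_reverse[OF subspace_test_funs qr, of f g] f g by simp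
        then show "f \<in> {f \<in> ?W. q f \<in> U}" using e(2) f by auto
      qed
      ultimately show "\<exists>S. openin (subtopology (Cinf \<Omega>) ?W) S \<and> g \<in> S \<and> S \<subseteq> {f \<in> ?W. q f \<in> U}" by blast
    qed
  qed simp
qed

lemma seminorm_on_test_funs: "p \<in> Cinf_seminorms \<Omega> \<Longrightarrow> seminorm_on (test_funs \<Omega>) p"
  using seminorm_on_Cinf[of p] unfolding seminorm_on_def by (simp add: test_funsD(1))

lemma Cinf_D_seminorms: "p \<in> Cinf_seminorms \<Omega> \<Longrightarrow> p \<in> D_seminorms \<Omega>"
proof (rule D_seminormsI[OF seminorm_on_test_funs])
  fix K assume "p \<in> Cinf_seminorms \<Omega>"
  then show "\<exists>C p'. p' \<in> Cinf_seminorms \<Omega> \<and> 0 \<le> C \<and> (\<forall>f\<in>test_funs \<Omega>. fsupp f \<subseteq> K \<longrightarrow> p f \<le> C * p' f)"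
    by (intro exI[of _ 1] exI[of _ p]) auto
qed

lemma D_separating:
  assumes "f \<in> test_funs \<Omega>" "\<And>p. p \<in> D_seminorms \<Omega> \<Longrightarrow> p f = 0"
  shows "f = 0"
  using Cinf_separating[OF test_funsD(1)[OF assms(1)]] assms(2) Cinf_D_seminorms by blast

lemma D_seminorms_seminorm_on: "p \<in> D_seminorms \<Omega> \<Longrightarrow> seminorm_on (test_funs \<Omega>) p"
  unfolding D_seminorms_def by blast

lemma lcs_Dspace: "lcs (Dspace \<Omega>) (csn (Dspace \<Omega>))"
  unfolding Dspace_alt
  by (rule lcs_csn(1)[OF subspace_test_funs D_seminorms_seminorm_on D_separating])

lemma D_seminorms_csn: "p \<in> D_seminorms \<Omega> \<Longrightarrow> p \<in> csn (Dspace \<Omega>)"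
  unfolding Dspace_alt
  by (rule csn_generating[OF subspace_test_funs _ D_seminorms_seminorm_on])

text \<open>If the supports escaped every compact set, a continuous seminorm \<open>\<Sum>\<^sub>j a\<^sub>j |f (\<xi>\<^sub>j)|\<close> with points \<open>\<xi>\<^sub>j\<close>
  tending to the boundary would be unbounded along the sequence.\<close>

lemma Cauchy_common_support:
  fixes X :: "nat \<Rightarrow> 'n cfun"
  assumes X: "\<And>n. X n \<in> test_funs \<Omega>"
    and C: "\<And>p. p \<in> D_seminorms \<Omega> \<Longrightarrow> \<exists>N. \<forall>m\<ge>N. \<forall>n\<ge>N. p (X m - X n) < 1"
  shows "\<exists>K. compact K \<and> K \<subseteq> \<Omega> \<and> (\<forall>n. fsupp (X n) \<subseteq> K)"
proof (rule ccontr)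
  assume contr: "\<not> ?thesis"
  obtain E where E: "\<And>n::nat. compact (E n)" "\<And>n. E n \<subseteq> \<Omega>"
    "\<And>K. compact K \<Longrightarrow> K \<subseteq> \<Omega> \<Longrightarrow> \<exists>N. \<forall>n\<ge>N. K \<subseteq> E n"
    using open_Union_compact_subsets[OF open_Omega] by metis
  have "\<exists>n x. X n x \<noteq> 0 \<and> x \<notin> E j" for j
  proof (rule ccontr)
    assume "\<not> ?thesis"
    then have "fsupp (X n) \<subseteq> E j" for n
      using E(1) by (intro fsupp_subset compact_imp_closed) auto
    then show False using contr E by blast
  qed
  then obtain \<nu> \<xi> where \<nu>: "\<And>j. X (\<nu> j) (\<xi> j) \<noteq> 0" "\<And>j. \<xi> j \<notin> E j" by metis
  \<comment> \<open>Normalised so that the \<open>j\<close>-th term of the seminorm takes the value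
    \<open>j\<close> on \<open>X (\<nu> j)\<close>.\<close>
  define a where "a j = real j / cmod (X (\<nu> j) (\<xi> j))" for j
  have a0: "0 \<le> a j" for j by (simp add: a_def)
  \<comment> \<open>The index set is finite for a test function: its support lies in
    \<open>E n\<close> for all large \<open>n\<close>, while \<open>\<xi> n\<close> lies outside
    \<open>E n\<close>.\<close>
  define q where "q f = (\<Sum>j\<in>{j. f (\<xi> j) \<noteq> 0}. a j * cmod (f (\<xi> j)))" for f :: "'n cfun"
  have vanish: "\<exists>N. \<forall>f j. fsupp f \<subseteq> K \<longrightarrow> j \<ge> N \<longrightarrow> f (\<xi> j) = (0::complex)" if K: "compact K" "K \<subseteq> \<Omega>" for K
  proof -
    obtain N where N: "\<And>n. n \<ge> N \<Longrightarrow> K \<subseteq> E n" using E(3) K by blast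
    have "f (\<xi> j) = 0" if "fsupp f \<subseteq> K" "j \<ge> N" for f :: "'n cfun" and j
    proof (rule ccontr)
      assume "f (\<xi> j) \<noteq> 0"
      then show False using fsuppI that N[OF that(2)] \<nu>(2) by blast
    qed
    then show ?thesis by blast
  qed
  have qN: "q f = (\<Sum>j<N. a j * cmod (f (\<xi> j)))" if "\<And>j. j \<ge> N \<Longrightarrow> f (\<xi> j) = 0" for f N
    unfolding q_def by (rule sum.mono_neutral_left) (use that not_less in auto)
  have fN: "\<exists>N. \<forall>j\<ge>N. f (\<xi> j) = 0" if "f \<in> test_funs \<Omega>" for f
    using vanish[OF test_funsD(2,3)[OF that]] by blast
  have "seminorm_on (test_funs \<Omega>) q" unfolding seminorm_on_def
  proof (intro conjI ballI allI)
    fix f g assume "f \<in> test_funs \<Omega>" "g \<in> test_funs \<Omega>"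
    then obtain N M where N: "\<And>j. j \<ge> N \<Longrightarrow> f (\<xi> j) = 0" "\<And>j. j \<ge> M \<Longrightarrow> g (\<xi> j) = 0" using fN by metis
    have "q (f + g) = (\<Sum>j<max N M. a j * cmod ((f + g) (\<xi> j)))" by (rule qN) (simp add: N)
    also have "\<dots> \<le> (\<Sum>j<max N M. a j * cmod (f (\<xi> j)) + a j * cmod (g (\<xi> j)))"
      by (intro sum_mono) (simp add: a0 mult_left_mono norm_triangle_ineq flip: distrib_left)
    also have "\<dots> = q f + q g"
      using qN[of "max N M" f] qN[of "max N M" g] N by (simp add: sum.distrib)
    finally show "q (f + g) \<le> q f + q g" .
  next
    fix c :: complex and f assume "f \<in> test_funs \<Omega>"
    then obtain N where N: "\<And>j. j \<ge> N \<Longrightarrow> f (\<xi> j) = 0" using fN by metis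
    have "q (c *\<^sub>C f) = (\<Sum>j<N. a j * cmod ((c *\<^sub>C f) (\<xi> j)))"
      by (rule qN) (simp add: N scaleC_fun_def scaleC_complex_def)
    also have "\<dots> = cmod c * q f"
      using qN[of N f, OF N] by (simp add: sum_distrib_left scaleC_fun_def scaleC_complex_def norm_mult mult_ac)
    finally show "q (c *\<^sub>C f) = cmod c * q f" .
  qed
  then have q: "q \<in> D_seminorms \<Omega>"
  proof (rule D_seminormsI)
    fix K assume K: "compact K" "K \<subseteq> \<Omega>"
    obtain N where N: "\<And>f j. fsupp f \<subseteq> K \<Longrightarrow> j \<ge> N \<Longrightarrow> f (\<xi> j) = (0::complex)" using vanish[OF K] by blast
    have "q f \<le> (\<Sum>j<N. a j) * Cinf_seminorm K [] f" if f: "f \<in> test_funs \<Omega>" "fsupp f \<subseteq> K" for f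
    proof -
      have "cmod (f x) \<le> Cinf_seminorm K [] f" for x
      proof (cases "x \<in> K")
        case True
        then show ?thesis using Cinf_seminorm_upper[OF test_funsD(1)[OF f(1)] K True, of "[]"] by simp
      next
        case False
        then have "f x = 0" using fsuppI f(2) by blast
        then show ?thesis
          using real_seminorm_nonneg[OF subspace_Cinf_funs real_seminorm_Cinf test_funsD(1)[OF f(1)], of "Cinf_seminorm K []"] K
          by (auto simp: Cinf_seminorms_def)
      qed
      then have "(\<Sum>j<N. a j * cmod (f (\<xi> j))) \<le> (\<Sum>j<N. a j * Cinf_seminorm K [] f)"
        by (intro sum_mono mult_left_mono a0)
      then show ?thesis using qN[of N f] N[OF f(2)] by (simp add: sum_distrib_right)
    qed
    moreover have "Cinf_seminorm K [] \<in> Cinf_seminorms \<Omega>" using K by (auto simp: Cinf_seminorms_def)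
    moreover have "0 \<le> (\<Sum>j<N. a j)" by (intro sum_nonneg a0)
    ultimately show "\<exists>C p. p \<in> Cinf_seminorms \<Omega> \<and> 0 \<le> C \<and> (\<forall>f\<in>test_funs \<Omega>. fsupp f \<subseteq> K \<longrightarrow> q f \<le> C * p f)" by blast
  qed
  have qr: "real_seminorm (test_funs \<Omega>) q" using D_seminorms_seminorm_on[OF q] by (rule real_seminorm_of_seminorm_on)
  have big: "real j \<le> q (X (\<nu> j))" for j
  proof -
    obtain N where N: "\<And>i. i \<ge> N \<Longrightarrow> X (\<nu> j) (\<xi> i) = 0" using fN[OF X] by blast
    have "j < N" using N \<nu>(1) not_less by blast
    then have "a j * cmod (X (\<nu> j) (\<xi> j)) \<le> (\<Sum>i<N. a i * cmod (X (\<nu> j) (\<xi> i)))"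
      by (intro member_le_sum) (auto simp: a0)
    then show ?thesis using qN[of N "X (\<nu> j)", OF N] \<nu>(1) by (simp add: a_def)
  qed
  obtain N where N: "\<And>m n. m \<ge> N \<Longrightarrow> n \<ge> N \<Longrightarrow> q (X m - X n) < 1" using C[OF q] by blast
  define B where "B = Max ((\<lambda>n. q (X n)) ` {..N}) + 1"
  have B: "q (X n) \<le> B" for n
  proof (cases "n \<le> N")
    case True
    then have "q (X n) \<le> Max ((\<lambda>n. q (X n)) ` {..N})" by (intro Max_ge) auto
    then show ?thesis by (simp add: B_def)
  next
    case False
    have "q (X n) \<le> q (X n - X N) + q (X N)"
      using real_seminorm_add[OF subspace_test_funs qr, of "X n - X N" "X N"] X test_funs_diff by simp
    moreover have "q (X N) \<le> Max ((\<lambda>n. q (X n)) ` {..N})" by (intro Max_ge) auto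
    moreover have "q (X n - X N) < 1" using N False by simp
    ultimately show ?thesis unfolding B_def by linarith
  qed
  obtain j :: nat where "B < real j" using reals_Archimedean2 by blast
  then show False using big[of j] B[of "\<nu> j"] by linarith
qed

text \<open>By the common support, a Cauchy sequence lives in functions supported in one compact
  \<open>K\<close>, where the topology is that of \<open>Cinf \<Omega>\<close>; so its limit is
  taken in \<open>Cinf \<Omega>\<close>, and every generating seminorm is continuous along
  it.\<close>

lemma complete_lcs_Dspace: "complete_lcs (Dspace \<Omega>) (csn (Dspace \<Omega>))"
proof (intro complete_lcs.intro lcs_Dspace complete_lcs_axioms.intro)
  fix X :: "nat \<Rightarrow> 'n cfun"
  assume "\<And>n. X n \<in> topspace (Dspace \<Omega>)"
    and C: "\<And>p e. p \<in> csn (Dspace \<Omega>) \<Longrightarrow> 0 < e \<Longrightarrow> \<exists>N. \<forall>m\<ge>N. \<forall>n\<ge>N. p (X m - X n) < e"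
  then have X: "\<And>n. X n \<in> test_funs \<Omega>" by (simp add: topspace_Dspace)
  obtain K where K: "compact K" "K \<subseteq> \<Omega>" "\<And>n. fsupp (X n) \<subseteq> K"
    using Cauchy_common_support[where X=X, OF X C[OF D_seminorms_csn zero_less_one]] by blast
  have "\<exists>l\<in>Cinf_funs \<Omega>. \<forall>p\<in>Cinf_seminorms \<Omega>. (\<lambda>n. p (X n - l)) \<longlonglongrightarrow> 0"
    by (rule Cinf_complete[OF test_funsD(1)[OF X]]) (rule C[OF D_seminorms_csn[OF Cinf_D_seminorms]])
  then obtain l where l: "l \<in> Cinf_funs \<Omega>" "\<And>p. p \<in> Cinf_seminorms \<Omega> \<Longrightarrow> (\<lambda>n. p (X n - l)) \<longlonglongrightarrow> 0"
    by blast
  have "l x = 0" if "x \<notin> K" for x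
  proof (cases "x \<in> \<Omega>")
    case True
    have "(\<lambda>n. Cinf_seminorm {x} [] (X n - l)) \<longlonglongrightarrow> 0"
      using True by (intro l(2)) (auto simp: Cinf_seminorms_def)
    moreover have "cmod (l x) \<le> Cinf_seminorm {x} [] (X n - l)" for n
    proof -
      have "X n x = 0" using fsuppI K(3) that by blast
      then show ?thesis
        using Cinf_seminorm_upper[OF Cinf_funs_diff[OF test_funsD(1)[OF X] l(1)], of "{x}" x "[]" n] True by simp
    qed
    ultimately have "cmod (l x) \<le> 0" by (intro tendsto_le[OF sequentially_bot _ tendsto_const]) auto
    then show ?thesis by simp
  next
    case False then show ?thesis using l(1) by (simp add: Cinf_funs_def)
  qed
  then have lD: "l \<in> test_funs \<Omega>" "fsupp l \<subseteq> K" using test_funsI[OF l(1) K(1,2)] by auto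
  let ?W = "{f \<in> test_funs \<Omega>. fsupp f \<subseteq> K}"
  have inW: "X n - l \<in> ?W" for n using test_funs_diff[OF X lD(1)] fsupp_diff[OF X lD(1)] K(3) lD(2) by blast
  have "limitin (Cinf \<Omega>) (\<lambda>n. X n - l) 0 sequentially"
    unfolding Cinf_alt
    by (subst limitin_seminorm_topology)
      (auto simp: subspace_Cinf_funs real_seminorm_Cinf zero_Cinf_funs Cinf_funs_diff test_funsD(1)[OF X] l)
  then have lim: "limitin (subtopology (Cinf \<Omega>) ?W) (\<lambda>n. X n - l) 0 sequentially"
    unfolding limitin_subtopology using inW zero_test_funs by (auto simp: fsupp_def)
  have "(\<lambda>n. p (X n - l)) \<longlonglongrightarrow> 0" if p: "p \<in> D_seminorms \<Omega>" for p
  proof -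
    have "continuous_map (subtopology (Cinf \<Omega>) ?W) euclideanreal p" using p K unfolding D_seminorms_def by blast
    from continuous_map_limit[OF this lim]
    have "(\<lambda>n. p (X n - l)) \<longlonglongrightarrow> p 0" by (simp add: comp_def)
    then show ?thesis
      using real_seminorm_zero[OF subspace_test_funs real_seminorm_of_seminorm_on[OF D_seminorms_seminorm_on[OF p]]] by simp
  qed
  then have lim: "\<forall>p\<in>D_seminorms \<Omega>. (\<lambda>n. p (X n - l)) \<longlonglongrightarrow> 0" by blast
  have rs: "\<forall>p\<in>D_seminorms \<Omega>. real_seminorm (test_funs \<Omega>) p"
    by (intro ballI real_seminorm_of_seminorm_on D_seminorms_seminorm_on)
  have ev: "\<forall>\<^sub>F n in sequentially. X n \<in> test_funs \<Omega>" using X by simp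
  have "\<forall>p\<in>csn (Dspace \<Omega>). (\<lambda>n. p (X n - l)) \<longlonglongrightarrow> 0"
    unfolding Dspace_alt by (intro ballI csn_tendsto[OF subspace_test_funs rs lim ev lD(1)])
  then show "\<exists>l\<in>topspace (Dspace \<Omega>). \<forall>p\<in>csn (Dspace \<Omega>). (\<lambda>n. p (X n - l)) \<longlonglongrightarrow> 0"
    using lD(1) unfolding topspace_Dspace by blast
qed

section \<open>The space of smoothing kernels\<close>

definition SK_seminorms :: "('n kern \<Rightarrow> real) set" where
  "SK_seminorms = {\<lambda>\<phi>. sup0 {q (differential (Dspace \<Omega>) \<phi> x (map (\<lambda>i. axis i 1) is)) | x. x \<in> K} | K is q.
        compact K \<and> K \<subseteq> \<Omega> \<and> q \<in> csn (Dspace \<Omega>)}"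

abbreviation SK_funs :: "'n kern set" where
  "SK_funs \<equiv> smooth_maps euclidean \<Omega> (Dspace \<Omega>)"

lemma SK_alt: "SK \<Omega> = seminorm_topology SK_funs SK_seminorms"
  unfolding SK_def SK_seminorms_def ..

lemma topspace_SK: "topspace (SK \<Omega>) = SK_funs"
  unfolding SK_alt topspace_seminorm_topology ..

lemma smooth_calculus_kernels: "smooth_calculus euclidean {norm} (Dspace \<Omega>) (csn (Dspace \<Omega>)) \<Omega>"
  by (intro smooth_calculus.intro complete_lcs_Dspace complete_lcs.axioms(1)[OF lcs_euclidean]
      smooth_calculus_axioms.intro curve_open_euclidean open_Omega)

text \<open>Kernels are only known to be smooth along curves, so boundedness on compact sets is
  again an instance of the special curve lemma, with order 0 and direction 0: the curve rests for a
  moment at each of the prescribed points.\<close>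

lemma kernel_bounded:
  assumes \<phi>: "\<phi> \<in> SK_funs" and K: "compact K" "K \<subseteq> \<Omega>" and q: "q \<in> csn (Dspace \<Omega>)"
  shows "bdd_above {q (differential (Dspace \<Omega>) \<phi> x vs) | x. x \<in> K}"
proof -
  interpret S: smooth_calculus euclidean "{norm}" "Dspace \<Omega>" "csn (Dspace \<Omega>)" \<Omega>
    by (rule smooth_calculus_kernels)
  let ?\<psi> = "\<lambda>x. if x \<in> \<Omega> then differential (Dspace \<Omega>) \<phi> x vs else 0"
  have \<psi>: "?\<psi> \<in> SK_funs" by (rule S.differential_smooth[OF \<phi>]) simp
  have "\<exists>B. \<forall>x\<in>K. q (?\<psi> x) \<le> B"
  proof (rule bounded_along_curves[OF open_Omega K, where Q="\<lambda>x. q (?\<psi> x)" and k=0 and e=0])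
    fix c :: "real \<Rightarrow> real^'n" assume c: "smooth_curve euclidean c" "range c \<subseteq> \<Omega>"
    from smooth_mapsD[OF \<psi> this] obtain D where D: "D 0 = (\<lambda>t. ?\<psi> (c t))" "derivs (Dspace \<Omega>) D"
      unfolding smooth_curve_derivs by (elim exE conjE)
    have rD: "range (D 0) \<subseteq> topspace (Dspace \<Omega>)" using derivs_in[OF D(2)] by auto
    have dD: "curve_deriv (Dspace \<Omega>) (D 0) t (D (Suc 0) t)" for t using D(2) unfolding derivs_def by blast
    have "continuous_on {0..1} (\<lambda>t. q (D 0 t))" by (rule S.F.continuous_on_seminorm_curve[OF rD dD q])
    moreover have "q (D 0 t0) = l ^ 0 * q (?\<psi> x)"
      if "\<forall>\<^sub>F t in nhds t0. c t = x + (l * (t - t0)) *\<^sub>R 0" for t0 x and l :: real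
      using eventually_nhds_x_imp_x[OF that] by (simp add: D(1))
    ultimately show "\<exists>C. continuous_on {0..1} C \<and> (\<forall>t0 x l. 0 < l \<longrightarrow>
        (\<forall>\<^sub>F t in nhds t0. c t = x + (l * (t - t0)) *\<^sub>R 0) \<longrightarrow> C t0 = l ^ 0 * q (?\<psi> x))" by blast
  qed
  then obtain B where B: "\<And>x. x \<in> K \<Longrightarrow> q (?\<psi> x) \<le> B" by blast
  show ?thesis
  proof (rule bdd_aboveI)
    fix y assume "y \<in> {q (differential (Dspace \<Omega>) \<phi> x vs) | x. x \<in> K}"
    then obtain x where x: "x \<in> K" "y = q (differential (Dspace \<Omega>) \<phi> x vs)" by blast
    then show "y \<le> B" using B[OF x(1)] K(2) by (simp add: subset_iff)
  qed
qed

text \<open>Differentials are linear in the kernel and their suprema finite, so the generating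
  functions are seminorms; one-point sets \<open>K\<close> with no derivatives separate
  kernels.\<close>

lemma lcs_SK: "lcs (SK \<Omega>) SK_seminorms"
proof -
  interpret S: smooth_calculus euclidean "{norm}" "Dspace \<Omega>" "csn (Dspace \<Omega>)" \<Omega>
    by (rule smooth_calculus_kernels)
  show ?thesis unfolding SK_alt
  proof (rule lcs_seminorm_topology[OF S.subspace_smooth_maps])
    fix p assume "p \<in> SK_seminorms"
    from this[unfolded SK_seminorms_def mem_Collect_eq] obtain K "is" q where p: "p = (\<lambda>\<phi>. sup0 {q (differential (Dspace \<Omega>) \<phi> x (map (\<lambda>i. axis i 1) is)) | x. x \<in> K})"
      "compact K" "K \<subseteq> \<Omega>" "q \<in> csn (Dspace \<Omega>)" by (elim exE conjE)
    let ?d = "\<lambda>\<phi> x. differential (Dspace \<Omega>) \<phi> x (map (\<lambda>i. axis i 1) is)"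
    show "real_seminorm SK_funs p" unfolding p(1)
    proof (rule real_seminorm_sup0)
      fix \<phi> assume "\<phi> \<in> SK_funs"
      then show "bdd_above {q (?d \<phi> x) | x. x \<in> K}" using p by (intro kernel_bounded)
    next
      fix x assume "x \<in> K"
      then have x: "x \<in> \<Omega>" using p by auto
      have in': "?d \<phi> x \<in> topspace (Dspace \<Omega>)" if "\<phi> \<in> SK_funs" for \<phi>
        using that x by (intro S.differential_in) auto
      have lin: "?d (\<lambda>y. a *\<^sub>R \<phi> y + b *\<^sub>R \<psi> y) x = a *\<^sub>R ?d \<phi> x + b *\<^sub>R ?d \<psi> x"
        if "\<phi> \<in> SK_funs" "\<psi> \<in> SK_funs" for \<phi> \<psi> a b
        using that x by (intro S.differential_linear) auto
      show "real_seminorm SK_funs (\<lambda>\<phi>. q (?d \<phi> x))" unfolding real_seminorm_def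
      proof (intro conjI ballI allI)
        fix \<phi> \<psi> assume *: "\<phi> \<in> SK_funs" "\<psi> \<in> SK_funs"
        have "?d (\<phi> + \<psi>) x = ?d \<phi> x + ?d \<psi> x" using lin[OF *, of 1 1] by (simp add: plus_fun_def)
        then show "q (?d (\<phi> + \<psi>) x) \<le> q (?d \<phi> x) + q (?d \<psi> x)"
          using S.F.p_add[OF p(4) in'[OF *(1)] in'[OF *(2)]] by simp
      next
        fix r :: real and \<phi> assume *: "\<phi> \<in> SK_funs"
        have "?d (r *\<^sub>R \<phi>) x = r *\<^sub>R ?d \<phi> x" using lin[OF * *, of r 0] by (simp add: scaleR_fun_def[of r \<phi>])
        then show "q (?d (r *\<^sub>R \<phi>) x) = \<bar>r\<bar> * q (?d \<phi> x)"
          using S.F.p_scaleR[OF p(4) in'[OF *]] by simp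
      qed
    qed
  next
    fix \<phi> assume \<phi>: "\<phi> \<in> SK_funs" and z: "\<And>p. p \<in> SK_seminorms \<Longrightarrow> p \<phi> = 0"
    show "\<phi> = 0"
    proof
      fix x show "\<phi> x = 0 x"
      proof (cases "x \<in> \<Omega>")
        case True
        have "\<phi> x = 0"
        proof (rule S.F.separating)
          show in': "\<phi> x \<in> topspace (Dspace \<Omega>)" using \<phi> True by (auto simp: smooth_maps_def)
          fix q assume q: "q \<in> csn (Dspace \<Omega>)"
          have "(\<lambda>\<phi>. sup0 {q (differential (Dspace \<Omega>) \<phi> y (map (\<lambda>i. axis i 1) [])) | y. y \<in> {x}}) \<in> SK_seminorms"
            unfolding SK_seminorms_def using True q by (intro CollectI exI[of _ "{x}"] exI[of _ "[]"] exI[of _ q]) auto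
          from z[OF this] have "sup0 {q (\<phi> x)} = 0" by simp
          then have "q (\<phi> x) \<le> 0" using sup0_upper[of "{q (\<phi> x)}" "q (\<phi> x)"] by simp
          then show "q (\<phi> x) = 0" using S.F.p_nonneg[OF q in'] by simp
        qed
        then show ?thesis by simp
      next
        case False then show ?thesis using \<phi> by (simp add: smooth_maps_def)
      qed
    qed
  qed
qed

lemma lcs_SKI: "lcs (SKI \<Omega>) (power_seminorms SK_seminorms)"
  by (rule lcs.lcs_power_space[OF lcs_SK])

end

subsection \<open>Growth of nets\<close>

lemma eventually_at_right_0: "\<forall>\<^sub>F \<epsilon> in at_right 0. 0 < \<epsilon> \<and> \<epsilon> \<le> (1::real)"
  unfolding eventually_at_right_field by (intro exI[of _ 1]) auto

lemma moderate_net_iff: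
  "moderate_net g \<longleftrightarrow> (\<exists>N C. \<forall>\<^sub>F \<epsilon> in at_right 0. \<bar>g \<epsilon>\<bar> \<le> C * inverse (\<epsilon> ^ N))"
proof
  assume "moderate_net g"
  then obtain N where "g \<in> O[at_right 0](\<lambda>\<epsilon>. inverse (\<epsilon> ^ N))" unfolding moderate_net_def by blast
  then obtain C where "\<forall>\<^sub>F \<epsilon> in at_right 0. norm (g \<epsilon>) \<le> C * norm (inverse (\<epsilon> ^ N))"
    by (elim landau_o.bigE)
  then have "\<forall>\<^sub>F \<epsilon> in at_right 0. \<bar>g \<epsilon>\<bar> \<le> C * inverse (\<epsilon> ^ N)"
    using eventually_at_right_0 by eventually_elim simp
  then show "\<exists>N C. \<forall>\<^sub>F \<epsilon> in at_right 0. \<bar>g \<epsilon>\<bar> \<le> C * inverse (\<epsilon> ^ N)" by blast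
next
  assume "\<exists>N C. \<forall>\<^sub>F \<epsilon> in at_right 0. \<bar>g \<epsilon>\<bar> \<le> C * inverse (\<epsilon> ^ N)"
  then obtain N C where *: "\<forall>\<^sub>F \<epsilon> in at_right 0. \<bar>g \<epsilon>\<bar> \<le> C * inverse (\<epsilon> ^ N)" by blast
  have "\<forall>\<^sub>F \<epsilon> in at_right 0. norm (g \<epsilon>) \<le> \<bar>C\<bar> * norm (inverse (\<epsilon> ^ Suc N))"
    using * eventually_at_right_0
  proof eventually_elim
    case (elim \<epsilon>)
    have "inverse (\<epsilon> ^ N) \<le> inverse (\<epsilon> ^ Suc N)"
      using elim by (intro le_imp_inverse_le power_decreasing) auto
    moreover have "C * inverse (\<epsilon> ^ N) \<le> \<bar>C\<bar> * inverse (\<epsilon> ^ N)" using elim by (intro mult_right_mono) auto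
    ultimately have "\<bar>g \<epsilon>\<bar> \<le> \<bar>C\<bar> * inverse (\<epsilon> ^ Suc N)"
      using elim(1) by (meson abs_ge_zero mult_left_mono order_trans)
    then show ?case using elim by simp
  qed
  then have "g \<in> O[at_right 0](\<lambda>\<epsilon>. inverse (\<epsilon> ^ Suc N))" by (rule bigoI)
  then show "moderate_net g" unfolding moderate_net_def by (intro exI[of _ "Suc N"]) simp
qed

text \<open>Admits \<open>m = 0\<close> as well, since on \<open>(0, 1]\<close> the bound for
  \<open>Suc m\<close> contains the one for \<open>m\<close>.\<close>

lemma negligible_net_iff:
  "negligible_net g \<longleftrightarrow> (\<forall>m. \<exists>C. \<forall>\<^sub>F \<epsilon> in at_right 0. \<bar>g \<epsilon>\<bar> \<le> C * \<epsilon> ^ m)"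
proof
  assume n: "negligible_net g"
  show "\<forall>m. \<exists>C. \<forall>\<^sub>F \<epsilon> in at_right 0. \<bar>g \<epsilon>\<bar> \<le> C * \<epsilon> ^ m"
  proof
    fix m
    have "g \<in> O[at_right 0](\<lambda>\<epsilon>. \<epsilon> ^ Suc m)" using n unfolding negligible_net_def by (simp del: power_Suc)
    then obtain C where C: "C > 0" "\<forall>\<^sub>F \<epsilon> in at_right 0. norm (g \<epsilon>) \<le> C * norm (\<epsilon> ^ Suc m)"
      by (elim landau_o.bigE)
    have "\<forall>\<^sub>F \<epsilon> in at_right 0. \<bar>g \<epsilon>\<bar> \<le> C * \<epsilon> ^ m"
      using C(2) eventually_at_right_0
    proof eventually_elim
      case (elim \<epsilon>)
      have "\<epsilon> ^ Suc m \<le> \<epsilon> ^ m" using elim by (intro power_decreasing) auto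
      then have "C * \<epsilon> ^ Suc m \<le> C * \<epsilon> ^ m" using C(1) by (intro mult_left_mono) auto
      then show ?case using elim by (simp add: abs_mult power_abs)
    qed
    then show "\<exists>C. \<forall>\<^sub>F \<epsilon> in at_right 0. \<bar>g \<epsilon>\<bar> \<le> C * \<epsilon> ^ m" by blast
  qed
next
  assume *: "\<forall>m. \<exists>C. \<forall>\<^sub>F \<epsilon> in at_right 0. \<bar>g \<epsilon>\<bar> \<le> C * \<epsilon> ^ m"
  show "negligible_net g" unfolding negligible_net_def
  proof (intro allI impI)
    fix m :: nat
    obtain C where C: "\<forall>\<^sub>F \<epsilon> in at_right 0. \<bar>g \<epsilon>\<bar> \<le> C * \<epsilon> ^ m" using * by blast
    have "\<forall>\<^sub>F \<epsilon> in at_right 0. norm (g \<epsilon>) \<le> C * norm (\<epsilon> ^ m)"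
      using C eventually_at_right_0 by eventually_elim simp
    then show "g \<in> O[at_right 0](\<lambda>\<epsilon>. \<epsilon> ^ m)" by (rule bigoI)
  qed
qed

lemma moderate_net_mono:
  assumes "moderate_net g" "\<forall>\<^sub>F \<epsilon> in at_right 0. \<bar>f \<epsilon>\<bar> \<le> \<bar>g \<epsilon>\<bar>"
  shows "moderate_net f"
proof -
  obtain N C where "\<forall>\<^sub>F \<epsilon> in at_right 0. \<bar>g \<epsilon>\<bar> \<le> C * inverse (\<epsilon> ^ N)" using assms(1) moderate_net_iff by blast
  with assms(2) have "\<forall>\<^sub>F \<epsilon> in at_right 0. \<bar>f \<epsilon>\<bar> \<le> C * inverse (\<epsilon> ^ N)" by eventually_elim simp
  then show ?thesis unfolding moderate_net_iff by blast
qed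

lemma negligible_net_mono:
  assumes "negligible_net g" "\<forall>\<^sub>F \<epsilon> in at_right 0. \<bar>f \<epsilon>\<bar> \<le> \<bar>g \<epsilon>\<bar>"
  shows "negligible_net f"
  unfolding negligible_net_iff
proof
  fix m
  obtain C where "\<forall>\<^sub>F \<epsilon> in at_right 0. \<bar>g \<epsilon>\<bar> \<le> C * \<epsilon> ^ m" using assms(1) negligible_net_iff by blast
  with assms(2) have "\<forall>\<^sub>F \<epsilon> in at_right 0. \<bar>f \<epsilon>\<bar> \<le> C * \<epsilon> ^ m" by eventually_elim simp
  then show "\<exists>C. \<forall>\<^sub>F \<epsilon> in at_right 0. \<bar>f \<epsilon>\<bar> \<le> C * \<epsilon> ^ m" by blast
qed

text \<open>The growth condition is left as a parameter, so that one estimate of \<open>R(X)\<close>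
  yields both that point values are moderate and that they are negligible for negligible
  \<open>R\<close>.\<close>

lemma growth_mono:
  assumes "growth = moderate_net \<or> growth = negligible_net"
    and "growth g" "\<forall>\<^sub>F \<epsilon> in at_right 0. \<bar>f \<epsilon>\<bar> \<le> \<bar>g \<epsilon>\<bar>"
  shows "growth f"
  using assms(1)
proof
  assume "growth = moderate_net"
  then show ?thesis using moderate_net_mono[OF _ assms(3)] assms(2) by simp
next
  assume "growth = negligible_net"
  then show ?thesis using negligible_net_mono[OF _ assms(3)] assms(2) by simp
qed

lemma moderate_net_mult:
  assumes "moderate_net f" "moderate_net g"
  shows "moderate_net (\<lambda>\<epsilon>. f \<epsilon> * g \<epsilon>)"
proof -
  obtain N C where 1: "\<forall>\<^sub>F \<epsilon> in at_right 0. \<bar>f \<epsilon>\<bar> \<le> C * inverse (\<epsilon> ^ N)" using assms(1) moderate_net_iff by blast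
  obtain M D where 2: "\<forall>\<^sub>F \<epsilon> in at_right 0. \<bar>g \<epsilon>\<bar> \<le> D * inverse (\<epsilon> ^ M)" using assms(2) moderate_net_iff by blast
  have "\<forall>\<^sub>F \<epsilon> in at_right 0. \<bar>f \<epsilon> * g \<epsilon>\<bar> \<le> (C * D) * inverse (\<epsilon> ^ (N + M))"
    using 1 2
  proof eventually_elim
    case (elim \<epsilon>)
    have "\<bar>f \<epsilon>\<bar> * \<bar>g \<epsilon>\<bar> \<le> (C * inverse (\<epsilon> ^ N)) * (D * inverse (\<epsilon> ^ M))"
      using elim by (intro mult_mono) (auto intro: order_trans[OF abs_ge_zero])
    then show ?case by (simp add: abs_mult power_add mult_ac)
  qed
  then show ?thesis unfolding moderate_net_iff by blast
qed

lemma negligible_net_mult: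
  assumes "moderate_net f" "negligible_net g"
  shows "negligible_net (\<lambda>\<epsilon>. f \<epsilon> * g \<epsilon>)"
  unfolding negligible_net_iff
proof
  fix m
  obtain N C where 1: "\<forall>\<^sub>F \<epsilon> in at_right 0. \<bar>f \<epsilon>\<bar> \<le> C * inverse (\<epsilon> ^ N)" using assms(1) moderate_net_iff by blast
  obtain D where 2: "\<forall>\<^sub>F \<epsilon> in at_right 0. \<bar>g \<epsilon>\<bar> \<le> D * \<epsilon> ^ (N + m)" using assms(2) negligible_net_iff by blast
  have "\<forall>\<^sub>F \<epsilon> in at_right 0. \<bar>f \<epsilon> * g \<epsilon>\<bar> \<le> (C * D) * \<epsilon> ^ m"
    using 1 2 eventually_at_right_0
  proof eventually_elim
    case (elim \<epsilon>)
    have "\<bar>f \<epsilon>\<bar> * \<bar>g \<epsilon>\<bar> \<le> (C * inverse (\<epsilon> ^ N)) * (D * \<epsilon> ^ (N + m))"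
      using elim by (intro mult_mono) (auto intro: order_trans[OF abs_ge_zero])
    also have "\<dots> = (C * D) * \<epsilon> ^ m" using elim by (simp add: power_add)
    finally show ?case by (simp add: abs_mult)
  qed
  then show "\<exists>C. \<forall>\<^sub>F \<epsilon> in at_right 0. \<bar>f \<epsilon> * g \<epsilon>\<bar> \<le> C * \<epsilon> ^ m" by blast
qed

lemma moderate_net_add:
  assumes "moderate_net f" "moderate_net g"
  shows "moderate_net (\<lambda>\<epsilon>. f \<epsilon> + g \<epsilon>)"
proof -
  obtain N C where 1: "\<forall>\<^sub>F \<epsilon> in at_right 0. \<bar>f \<epsilon>\<bar> \<le> C * inverse (\<epsilon> ^ N)" using assms(1) moderate_net_iff by blast
  obtain M D where 2: "\<forall>\<^sub>F \<epsilon> in at_right 0. \<bar>g \<epsilon>\<bar> \<le> D * inverse (\<epsilon> ^ M)" using assms(2) moderate_net_iff by blast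
  have "\<forall>\<^sub>F \<epsilon> in at_right 0. \<bar>f \<epsilon> + g \<epsilon>\<bar> \<le> (\<bar>C\<bar> + \<bar>D\<bar>) * inverse (\<epsilon> ^ (N + M))"
    using 1 2 eventually_at_right_0
  proof eventually_elim
    case (elim \<epsilon>)
    have i: "inverse (\<epsilon> ^ N) \<le> inverse (\<epsilon> ^ (N + M))" "inverse (\<epsilon> ^ M) \<le> inverse (\<epsilon> ^ (N + M))"
      using elim by (intro le_imp_inverse_le power_decreasing; simp)+
    have "C * inverse (\<epsilon> ^ N) \<le> \<bar>C\<bar> * inverse (\<epsilon> ^ (N + M))" "D * inverse (\<epsilon> ^ M) \<le> \<bar>D\<bar> * inverse (\<epsilon> ^ (N + M))"
      using i elim by (intro mult_mono; simp)+
    then have "\<bar>f \<epsilon>\<bar> + \<bar>g \<epsilon>\<bar> \<le> \<bar>C\<bar> * inverse (\<epsilon> ^ (N + M)) + \<bar>D\<bar> * inverse (\<epsilon> ^ (N + M))" using elim by linarith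
    then show ?case unfolding distrib_right using abs_triangle_ineq order_trans by blast
  qed
  then show ?thesis unfolding moderate_net_iff by blast
qed

lemma negligible_net_add:
  assumes "negligible_net f" "negligible_net g"
  shows "negligible_net (\<lambda>\<epsilon>. f \<epsilon> + g \<epsilon>)"
  unfolding negligible_net_iff
proof
  fix m
  obtain C where 1: "\<forall>\<^sub>F \<epsilon> in at_right 0. \<bar>f \<epsilon>\<bar> \<le> C * \<epsilon> ^ m" using assms(1) negligible_net_iff by blast
  obtain D where 2: "\<forall>\<^sub>F \<epsilon> in at_right 0. \<bar>g \<epsilon>\<bar> \<le> D * \<epsilon> ^ m" using assms(2) negligible_net_iff by blast
  have "\<forall>\<^sub>F \<epsilon> in at_right 0. \<bar>f \<epsilon> + g \<epsilon>\<bar> \<le> (C + D) * \<epsilon> ^ m"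
    using 1 2 by eventually_elim (simp add: distrib_right abs_le_iff)
  then show "\<exists>C. \<forall>\<^sub>F \<epsilon> in at_right 0. \<bar>f \<epsilon> + g \<epsilon>\<bar> \<le> C * \<epsilon> ^ m" by blast
qed

lemma negligible_net_0: "negligible_net (\<lambda>_. 0)"
  unfolding negligible_net_iff by (intro allI exI[of _ 0]) simp

lemma moderate_net_const: "moderate_net (\<lambda>_. c)"
  unfolding moderate_net_iff by (intro exI[of _ 0] exI[of _ "\<bar>c\<bar>"]) simp

lemma moderate_net_bounded: "\<forall>\<^sub>F \<epsilon> in at_right 0. \<bar>f \<epsilon>\<bar> \<le> c \<Longrightarrow> moderate_net f"
  by (rule moderate_net_mono[OF moderate_net_const[of c]]) (erule eventually_mono, linarith)

lemma negligible_imp_moderate_net: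
  assumes "negligible_net f"
  shows "moderate_net f"
proof -
  obtain C where "\<forall>\<^sub>F \<epsilon> in at_right 0. \<bar>f \<epsilon>\<bar> \<le> C * \<epsilon> ^ 0" using assms negligible_net_iff by blast
  then show ?thesis unfolding moderate_net_iff by (intro exI[of _ 0] exI[of _ C]) simp
qed

lemma negligible_net_sum:
  "(\<And>i. i \<in> A \<Longrightarrow> negligible_net (f i)) \<Longrightarrow> negligible_net (\<lambda>\<epsilon>. \<Sum>i\<in>A. f i \<epsilon>)"
  by (induction A rule: infinite_finite_induct) (simp_all add: negligible_net_0 negligible_net_add)

subsection \<open>Components of maps into powers\<close>

lemma curve_deriv_power_component:
  assumes "curve_deriv (power_space T) c t d" "\<epsilon> \<in> unit_ivl"
  shows "curve_deriv T (\<lambda>s. c s \<epsilon>) t (d \<epsilon>)"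
  using assms unfolding curve_deriv_def limitin_power_space by (auto simp: scaleR_fun_def)

lemma smooth_curve_power_component:
  assumes "smooth_curve (power_space T) c" "\<epsilon> \<in> unit_ivl"
  shows "smooth_curve T (\<lambda>s. c s \<epsilon>)"
proof -
  obtain D where D: "D 0 = c" "derivs (power_space T) D" using assms(1) smooth_curve_derivs by metis
  have "derivs T (\<lambda>k s. D k s \<epsilon>)"
    using D(2) assms(2) curve_deriv_power_component unfolding derivs_def topspace_power_space by blast
  then show ?thesis unfolding smooth_curve_derivs using D(1) by (intro exI[of _ "\<lambda>k s. D k s \<epsilon>"]) simp
qed

lemma (in lcs) curve_deriv_powerI:
  assumes c: "range c \<subseteq> topspace (power_space T)" and d: "d \<in> topspace (power_space T)"
    and der: "\<And>\<epsilon>. \<epsilon> \<in> unit_ivl \<Longrightarrow> curve_deriv T (\<lambda>s. c s \<epsilon>) t (d \<epsilon>)"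
  shows "curve_deriv (power_space T) c t d"
proof -
  interpret Pw: lcs "power_space T" "power_seminorms P" by (rule lcs_power_space)
  have "inverse h *\<^sub>R (c (t + h) - c t) \<in> topspace (power_space T)" for h
    by (intro Pw.in_scale Pw.in_diff) (use c in auto)
  then show ?thesis using d der unfolding curve_deriv_def limitin_power_space by (auto simp: scaleR_fun_def)
qed

text \<open>The product topology asks for no uniformity in \<epsilon>, so the derivatives can be
  chosen separately in each component.\<close>

lemma (in lcs) smooth_curve_powerI:
  assumes c: "\<And>\<epsilon>. \<epsilon> \<in> unit_ivl \<Longrightarrow> smooth_curve T (\<lambda>s. c s \<epsilon>)" and 0: "\<And>s \<epsilon>. \<epsilon> \<notin> unit_ivl \<Longrightarrow> c s \<epsilon> = 0"
  shows "smooth_curve (power_space T) c"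
proof -
  have "\<forall>\<epsilon>. \<exists>D. \<epsilon> \<in> unit_ivl \<longrightarrow> D 0 = (\<lambda>s. c s \<epsilon>) \<and> derivs T D" using c smooth_curve_derivs by blast
  from choice[OF this] obtain D where D: "\<And>\<epsilon>. \<epsilon> \<in> unit_ivl \<Longrightarrow> D \<epsilon> 0 = (\<lambda>s. c s \<epsilon>)" "\<And>\<epsilon>. \<epsilon> \<in> unit_ivl \<Longrightarrow> derivs T (D \<epsilon>)"
    by blast
  define G where "G k s \<epsilon> = (if \<epsilon> \<in> unit_ivl then D \<epsilon> k s else 0)" for k s \<epsilon>
  have Gin: "G k s \<in> topspace (power_space T)" for k s
    using derivs_in[OF D(2)] by (auto simp: topspace_power_space G_def)
  have "derivs (power_space T) G" unfolding derivs_def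
  proof (intro allI conjI Gin curve_deriv_powerI)
    show "range (G k) \<subseteq> topspace (power_space T)" for k using Gin by auto
    show "curve_deriv T (\<lambda>s. G k s \<epsilon>) t (G (Suc k) t \<epsilon>)" if "\<epsilon> \<in> unit_ivl" for k t \<epsilon>
      using D(2)[OF that] that unfolding derivs_def G_def by simp
  qed
  moreover have "G 0 = c" using D(1) 0 by (intro ext) (simp add: G_def)
  ultimately show ?thesis unfolding smooth_curve_derivs by blast
qed

subsection \<open>Point values of representatives\<close>

lemma lcs_euclidean': "lcs (euclidean :: 'a::banach topology) {norm}"
  by (rule complete_lcs.axioms(1)[OF lcs_euclidean])

lemma test_objs_SKI: "\<phi> \<in> test_objs \<Omega> \<Longrightarrow> \<phi> \<in> topspace (SKI \<Omega>)"
  unfolding test_objs_def mem_Collect_eq by (rule conjunct1)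

lemma test_objs0_SKI: "set vs \<subseteq> test_objs0 \<Omega> \<Longrightarrow> set vs \<subseteq> topspace (SKI \<Omega>)"
  unfolding test_objs0_def by (rule order_trans, assumption) (rule Collect_restrict)

text \<open>The expressions that arise when \<open>R(X)\<close> is differentiated repeatedly in the
  direction of 0-test objects. Closure under one more differentiation replaces an explicit formula
  for higher chain rules.\<close>

inductive_set value_terms :: "(real^'n::finite) set \<Rightarrow> 'n gfun \<Rightarrow> 'n gpoint \<Rightarrow> 'n gnum set"
  for \<Omega> R X where
  base: "set vs \<subseteq> test_objs0 \<Omega> \<Longrightarrow>
    (\<lambda>\<phi> \<epsilon>. partial is (differential (power_space (Cinf \<Omega>)) R \<phi> vs \<epsilon>) (X \<phi> \<epsilon>)) \<in> value_terms \<Omega> R X"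
| mult: "Y \<in> value_terms \<Omega> R X \<Longrightarrow> set us \<subseteq> test_objs0 \<Omega> \<Longrightarrow>
    (\<lambda>\<phi> \<epsilon>. (differential (power_space euclidean) X \<phi> us \<epsilon> $ i) *\<^sub>R Y \<phi> \<epsilon>) \<in> value_terms \<Omega> R X"
| add: "Y \<in> value_terms \<Omega> R X \<Longrightarrow> Z \<in> value_terms \<Omega> R X \<Longrightarrow> (\<lambda>\<phi> \<epsilon>. Y \<phi> \<epsilon> + Z \<phi> \<epsilon>) \<in> value_terms \<Omega> R X"

lemma value_terms_sum:
  assumes "finite A" "A \<noteq> {}" "\<And>i. i \<in> A \<Longrightarrow> Y i \<in> value_terms \<Omega> R X"
  shows "(\<lambda>\<phi> \<epsilon>. \<Sum>i\<in>A. Y i \<phi> \<epsilon>) \<in> value_terms \<Omega> R X"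
  using assms by (induction A rule: finite_ne_induct) (simp_all add: value_terms.add)

context open_set
begin

abbreviation "EI \<equiv> topspace (SKI \<Omega>)"
abbreviation "PE \<equiv> power_seminorms SK_seminorms"
abbreviation "CI \<equiv> power_space (Cinf \<Omega>)"

lemma smooth_calculus_SKI:
  "complete_lcs F PF \<Longrightarrow> smooth_calculus (SKI \<Omega>) PE (power_space F) (power_seminorms PF) EI"
  by (intro smooth_calculus.intro lcs_SKI complete_lcs.complete_lcs_power_space smooth_calculus_axioms.intro
      lcs.curve_open_topspace[OF lcs_SKI])

lemmas calc_fun = smooth_calculus_SKI[OF complete_lcs_Cinf]
  and calc_euclidean = smooth_calculus_SKI[OF lcs_euclidean]

lemma line_in_EI: "\<phi> \<in> EI \<Longrightarrow> w \<in> EI \<Longrightarrow> \<phi> + s *\<^sub>R w \<in> EI"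
  using lcs.in_add[OF lcs_SKI] lcs.in_scale[OF lcs_SKI] by blast

lemma differential_fun:
  assumes "R \<in> basic_space \<Omega>" "set vs \<subseteq> EI" "\<phi> \<in> EI" "\<epsilon> \<in> unit_ivl"
  shows "differential CI R \<phi> vs \<epsilon> \<in> Cinf_funs \<Omega>"
    and "w \<in> EI \<Longrightarrow> curve_deriv (Cinf \<Omega>) (\<lambda>s. differential CI R (\<phi> + s *\<^sub>R w) vs \<epsilon>) 0 (differential CI R \<phi> (w # vs) \<epsilon>)"
proof -
  have R: "R \<in> smooth_maps (SKI \<Omega>) EI CI" using assms(1) by (simp add: basic_space_def)
  show "differential CI R \<phi> vs \<epsilon> \<in> Cinf_funs \<Omega>"
    using smooth_calculus.differential_in[OF calc_fun R assms(2,3)] assms(4)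
    unfolding topspace_power_space topspace_Cinf by blast
  show "curve_deriv (Cinf \<Omega>) (\<lambda>s. differential CI R (\<phi> + s *\<^sub>R w) vs \<epsilon>) 0 (differential CI R \<phi> (w # vs) \<epsilon>)" if "w \<in> EI"
    by (rule curve_deriv_power_component[OF smooth_calculus.differential_deriv[OF calc_fun R assms(2) that assms(3)] assms(4)])
qed

lemma differential_map:
  fixes X :: "(real \<Rightarrow> 'n kern) \<Rightarrow> real \<Rightarrow> 'y::euclidean_space"
  assumes "X \<in> basic_maps \<Omega>" "set vs \<subseteq> EI" "\<phi> \<in> EI" "w \<in> EI" "\<epsilon> \<in> unit_ivl"
  shows "((\<lambda>s. differential (power_space euclidean) X (\<phi> + s *\<^sub>R w) vs \<epsilon>) has_vector_derivative
      differential (power_space euclidean) X \<phi> (w # vs) \<epsilon>) (at 0)"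
proof -
  have X: "X \<in> smooth_maps (SKI \<Omega>) EI (power_space euclidean)" using assms(1) by (simp add: basic_maps_def)
  show ?thesis
    using curve_deriv_power_component[OF smooth_calculus.differential_deriv[OF calc_euclidean X assms(2,4,3)] assms(5)]
    unfolding curve_deriv_euclidean .
qed

text \<open>On a base term the derivative hits either the differential of \<open>R\<close>, which
  gains the direction \<open>w\<close>, or the point, which contributes a component of its
  derivative and one more spatial derivative; on products it is the Leibniz rule.\<close>

lemma value_terms_deriv:
  assumes R: "R \<in> basic_space \<Omega>" and X: "X \<in> basic_maps \<Omega>"
    and XO: "\<And>\<phi> \<epsilon>. \<phi> \<in> EI \<Longrightarrow> \<epsilon> \<in> unit_ivl \<Longrightarrow> X \<phi> \<epsilon> \<in> \<Omega>"
    and w: "w \<in> test_objs0 \<Omega>" and Y: "Y \<in> value_terms \<Omega> R X"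
  shows "\<exists>Y'\<in>value_terms \<Omega> R X. \<forall>\<phi>\<in>EI. \<forall>\<epsilon>\<in>unit_ivl.
    ((\<lambda>s. Y (\<phi> + s *\<^sub>R w) \<epsilon>) has_vector_derivative Y' \<phi> \<epsilon>) (at 0)"
  using Y
proof (induction rule: value_terms.induct)
  have wE: "w \<in> EI" using w test_objs0_SKI[of "[w]"] by simp
  case (base vs "is")
  have vs: "set vs \<subseteq> EI" using base test_objs0_SKI by blast
  let ?Y' = "\<lambda>\<phi> \<epsilon>. partial is (differential CI R \<phi> (w # vs) \<epsilon>) (X \<phi> \<epsilon>) +
      (\<Sum>i\<in>UNIV. (differential (power_space euclidean) X \<phi> [w] \<epsilon> $ i) *\<^sub>R partial (i # is) (differential CI R \<phi> vs \<epsilon>) (X \<phi> \<epsilon>))"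
  have 1: "?Y' \<in> value_terms \<Omega> R X"
    using base w
    by (intro value_terms.add value_terms.base value_terms_sum value_terms.mult) auto
  have 2: "((\<lambda>s. partial is (differential CI R (\<phi> + s *\<^sub>R w) vs \<epsilon>) (X (\<phi> + s *\<^sub>R w) \<epsilon>)) has_vector_derivative ?Y' \<phi> \<epsilon>) (at 0)"
    if "\<phi> \<in> EI" "\<epsilon> \<in> unit_ivl" for \<phi> \<epsilon>
  proof -
    have "range (\<lambda>s. differential CI R (\<phi> + s *\<^sub>R w) vs \<epsilon>) \<subseteq> Cinf_funs \<Omega>"
      using differential_fun(1)[OF R vs line_in_EI[OF that(1) wE] that(2)] by auto
    from evaluation_deriv[OF this differential_fun(2)[OF R vs that wE] differential_map[OF X _ that(1) wE that(2), of "[]"], of "is"]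
    show ?thesis using XO[OF that] by simp
  qed
  show ?case by (rule bexI[OF _ 1]) (intro ballI 2)
next
  have wE: "w \<in> EI" using w test_objs0_SKI[of "[w]"] by simp
  case (mult Y us i)
  have us: "set us \<subseteq> EI" using mult test_objs0_SKI by blast
  obtain Y' where Y': "Y' \<in> value_terms \<Omega> R X"
    "\<And>\<phi> \<epsilon>. \<phi> \<in> EI \<Longrightarrow> \<epsilon> \<in> unit_ivl \<Longrightarrow> ((\<lambda>s. Y (\<phi> + s *\<^sub>R w) \<epsilon>) has_vector_derivative Y' \<phi> \<epsilon>) (at 0)"
    using mult.IH by blast
  let ?X = "differential (power_space euclidean) X"
  let ?Y' = "\<lambda>\<phi> \<epsilon>. (?X \<phi> us \<epsilon> $ i) *\<^sub>R Y' \<phi> \<epsilon> + (?X \<phi> (w # us) \<epsilon> $ i) *\<^sub>R Y \<phi> \<epsilon>"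
  have 1: "?Y' \<in> value_terms \<Omega> R X"
    using mult w Y'(1) by (intro value_terms.add value_terms.mult) auto
  have 2: "((\<lambda>s. (?X (\<phi> + s *\<^sub>R w) us \<epsilon> $ i) *\<^sub>R Y (\<phi> + s *\<^sub>R w) \<epsilon>) has_vector_derivative ?Y' \<phi> \<epsilon>) (at 0)"
    if "\<phi> \<in> EI" "\<epsilon> \<in> unit_ivl" for \<phi> \<epsilon>
  proof -
    have "((\<lambda>s. ?X (\<phi> + s *\<^sub>R w) us \<epsilon> $ i) has_vector_derivative ?X \<phi> (w # us) \<epsilon> $ i) (at 0)"
      by (rule bounded_linear.has_vector_derivative[OF bounded_linear_vec_nth differential_map[OF X us that(1) wE that(2)]])
    then have "((\<lambda>s. ?X (\<phi> + s *\<^sub>R w) us \<epsilon> $ i) has_real_derivative ?X \<phi> (w # us) \<epsilon> $ i) (at 0)"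
      by (simp only: has_real_derivative_iff_has_vector_derivative)
    from has_vector_derivative_scaleR[OF this Y'(2)[OF that]] show ?thesis by simp
  qed
  show ?case by (rule bexI[OF _ 1]) (intro ballI 2)
next
  case (add Y Z)
  then obtain Y' Z' where "Y' \<in> value_terms \<Omega> R X" "Z' \<in> value_terms \<Omega> R X"
    "\<And>\<phi> \<epsilon>. \<phi> \<in> EI \<Longrightarrow> \<epsilon> \<in> unit_ivl \<Longrightarrow> ((\<lambda>s. Y (\<phi> + s *\<^sub>R w) \<epsilon>) has_vector_derivative Y' \<phi> \<epsilon>) (at 0)"
    "\<And>\<phi> \<epsilon>. \<phi> \<in> EI \<Longrightarrow> \<epsilon> \<in> unit_ivl \<Longrightarrow> ((\<lambda>s. Z (\<phi> + s *\<^sub>R w) \<epsilon>) has_vector_derivative Z' \<phi> \<epsilon>) (at 0)" by blast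
  then show ?case
    by (intro bexI[of _ "\<lambda>\<phi> \<epsilon>. Y' \<phi> \<epsilon> + Z' \<phi> \<epsilon>"] ballI has_vector_derivative_add value_terms.add) blast+
qed

lemma rep_value_basic_maps:
  assumes R: "R \<in> basic_space \<Omega>" and X: "X \<in> basic_maps \<Omega>"
    and XO: "\<And>\<phi> \<epsilon>. \<phi> \<in> EI \<Longrightarrow> \<epsilon> \<in> unit_ivl \<Longrightarrow> X \<phi> \<epsilon> \<in> \<Omega>"
  shows "rep_value R X \<in> basic_maps \<Omega>"
proof -
  have Rs: "R \<in> smooth_maps (SKI \<Omega>) EI CI" and Xs: "X \<in> smooth_maps (SKI \<Omega>) EI (power_space euclidean)"
    using R X unfolding basic_space_def basic_maps_def .
  \<comment> \<open>\<open>rep_value\<close> evaluates \<open>R\<close> for every net and every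
    \<epsilon>; that \<open>R\<close> is 0 off its domain yields the default values demanded of
    \<open>basic_maps\<close>.\<close>
  have R0: "R \<phi> \<epsilon> = 0" if "\<epsilon> \<notin> unit_ivl \<or> \<phi> \<notin> EI" for \<phi> \<epsilon>
  proof (cases "\<phi> \<in> EI")
    case True
    then have "R \<phi> \<in> topspace CI" using Rs by (simp add: smooth_maps_def)
    then show ?thesis using that True unfolding topspace_power_space by blast
  next
    case False
    then have "R \<phi> = 0" using Rs by (simp add: smooth_maps_def)
    then show ?thesis by simp
  qed
  show ?thesis unfolding basic_maps_def smooth_maps_def
  proof (intro CollectI conjI ballI allI impI)
    show "rep_value R X \<phi> \<in> topspace (power_space euclidean)" for \<phi>
      using R0 by (auto simp: topspace_power_space rep_value_def)
    show "rep_value R X \<phi> = 0" if "\<phi> \<notin> EI" for \<phi>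
      using R0 that by (intro ext) (simp add: rep_value_def)
    fix c assume c: "smooth_curve (SKI \<Omega>) c \<and> range c \<subseteq> EI"
    have Rc: "smooth_curve CI (\<lambda>t. R (c t))" and Xc: "smooth_curve (power_space euclidean) (\<lambda>t. X (c t))"
      using smooth_mapsD[OF Rs] smooth_mapsD[OF Xs] c by blast+
    have "smooth_curve (power_space euclidean) (\<lambda>t. rep_value R X (c t))"
    proof (rule lcs.smooth_curve_powerI[OF lcs_euclidean'])
      fix \<epsilon> assume \<epsilon>: "\<epsilon> \<in> unit_ivl"
      have "smooth_curve euclidean (\<lambda>t. partial [] (R (c t) \<epsilon>) (X (c t) \<epsilon>))"
        by (rule smooth_curve_evaluation[OF smooth_curve_power_component[OF Rc \<epsilon>] smooth_curve_power_component[OF Xc \<epsilon>]])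
          (use XO \<epsilon> c in blast)
      then show "smooth_curve euclidean (\<lambda>t. rep_value R X (c t) \<epsilon>)" by (simp add: rep_value_def)
    next
      show "rep_value R X (c t) \<epsilon> = 0" if "\<epsilon> \<notin> unit_ivl" for t \<epsilon>
        using R0 that by (simp add: rep_value_def)
    qed
    then show "smooth_curve (power_space euclidean) (rep_value R X \<circ> c)" by (simp add: comp_def)
  qed
qed

text \<open>The equality with a term holds on all of \<open>EI\<close>, not only at test objects, so
  that it can be differentiated along the next line.\<close>

lemma differential_rep_value:
  assumes R: "R \<in> basic_space \<Omega>" and X: "X \<in> basic_maps \<Omega>"
    and XO: "\<And>\<phi> \<epsilon>. \<phi> \<in> EI \<Longrightarrow> \<epsilon> \<in> unit_ivl \<Longrightarrow> X \<phi> \<epsilon> \<in> \<Omega>"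
    and vs: "set vs \<subseteq> test_objs0 \<Omega>"
  shows "\<exists>Y\<in>value_terms \<Omega> R X. \<forall>\<phi>\<in>EI. \<forall>\<epsilon>\<in>unit_ivl.
    differential (power_space euclidean) (rep_value R X) \<phi> vs \<epsilon> = Y \<phi> \<epsilon>"
  using vs
proof (induction vs)
  case Nil
  then show ?case using value_terms.base[of "[]" \<Omega> "[]" R X]
    by (intro bexI[of _ "\<lambda>\<phi> \<epsilon>. partial [] (differential CI R \<phi> [] \<epsilon>) (X \<phi> \<epsilon>)"]) (auto simp: rep_value_def)
next
  case (Cons w vs)
  have RX: "rep_value R X \<in> basic_maps \<Omega>" by (rule rep_value_basic_maps[OF R X XO])
  have w: "w \<in> test_objs0 \<Omega>" and vs: "set vs \<subseteq> test_objs0 \<Omega>" using Cons.prems by auto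
  then have wE: "w \<in> EI" "set vs \<subseteq> EI" using test_objs0_SKI[of "[w]"] test_objs0_SKI[of vs] by auto
  obtain Y where Y: "Y \<in> value_terms \<Omega> R X"
    "\<And>\<phi> \<epsilon>. \<phi> \<in> EI \<Longrightarrow> \<epsilon> \<in> unit_ivl \<Longrightarrow> differential (power_space euclidean) (rep_value R X) \<phi> vs \<epsilon> = Y \<phi> \<epsilon>"
    using Cons.IH[OF vs] by blast
  obtain Y' where Y': "Y' \<in> value_terms \<Omega> R X"
    "\<And>\<phi> \<epsilon>. \<phi> \<in> EI \<Longrightarrow> \<epsilon> \<in> unit_ivl \<Longrightarrow> ((\<lambda>s. Y (\<phi> + s *\<^sub>R w) \<epsilon>) has_vector_derivative Y' \<phi> \<epsilon>) (at 0)"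
    using value_terms_deriv[OF R X XO w Y(1)] by blast
  have "differential (power_space euclidean) (rep_value R X) \<phi> (w # vs) \<epsilon> = Y' \<phi> \<epsilon>" if "\<phi> \<in> EI" "\<epsilon> \<in> unit_ivl" for \<phi> \<epsilon>
  proof -
    have "((\<lambda>s. Y (\<phi> + s *\<^sub>R w) \<epsilon>) has_vector_derivative differential (power_space euclidean) (rep_value R X) \<phi> (w # vs) \<epsilon>) (at 0)"
      using differential_map[OF RX wE(2) that(1) wE(1) that(2)] Y(2)[OF line_in_EI[OF that(1) wE(1)] that(2)] by simp
    then show ?thesis using Y'(2)[OF that] vector_derivative_unique_at by blast
  qed
  then show ?case using Y'(1) by (intro bexI[of _ Y'] ballI)
qed

text \<open>Each product contains one factor from \<open>R\<close>, which carries the growth, and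
  otherwise components of differentials of \<open>X\<close>, which are moderate. Since
  \<open>X \<phi> \<epsilon>\<close> is eventually in \<open>K\<close>, the factor from
  \<open>R\<close> is bounded by a seminorm over \<open>K\<close>.\<close>

lemma value_terms_growth:
  assumes growth: "growth = moderate_net \<or> growth = negligible_net"
    and R: "R \<in> basic_space \<Omega>" and \<phi>: "\<phi> \<in> test_objs \<Omega>"
    and Rg: "\<And>p vs. p \<in> csn (Cinf \<Omega>) \<Longrightarrow> set vs \<subseteq> test_objs0 \<Omega> \<Longrightarrow> growth (\<lambda>\<epsilon>. p (differential CI R \<phi> vs \<epsilon>))"
    and Xm: "moderate_map \<Omega> X"
    and K: "compact K" "K \<subseteq> \<Omega>" "\<forall>\<^sub>F \<epsilon> in at_right 0. X \<phi> \<epsilon> \<in> K"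
    and Y: "Y \<in> value_terms \<Omega> R X"
  shows "growth (\<lambda>\<epsilon>. norm (Y \<phi> \<epsilon>))"
  using Y
proof (induction rule: value_terms.induct)
  have mono: "growth f" if "growth g" "\<forall>\<^sub>F \<epsilon> in at_right 0. \<bar>f \<epsilon>\<bar> \<le> \<bar>g \<epsilon>\<bar>" for f g
    by (rule growth_mono[OF growth that])
  {
    case (base vs "is")
    have p: "Cinf_seminorm K is \<in> Cinf_seminorms \<Omega>" using K by (auto simp: Cinf_seminorms_def)
    have E: "\<phi> \<in> EI" "set vs \<subseteq> EI" using \<phi> base test_objs_SKI test_objs0_SKI by blast+
    show ?case
    proof (rule mono[OF Rg[OF Cinf_seminorms_csn[OF p] base]])
      show "\<forall>\<^sub>F \<epsilon> in at_right 0. \<bar>norm (partial is (differential CI R \<phi> vs \<epsilon>) (X \<phi> \<epsilon>))\<bar> \<le> \<bar>Cinf_seminorm K is (differential CI R \<phi> vs \<epsilon>)\<bar>"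
        using K(3) eventually_at_right_0
      proof eventually_elim
        case (elim \<epsilon>)
        have "norm (partial is (differential CI R \<phi> vs \<epsilon>) (X \<phi> \<epsilon>)) \<le> Cinf_seminorm K is (differential CI R \<phi> vs \<epsilon>)"
          using elim by (intro Cinf_seminorm_upper differential_fun(1) R E K) auto
        then show ?case by simp
      qed
    qed
  next
    case (mult Y us i)
    have "moderate_net (\<lambda>\<epsilon>. norm (differential (power_space euclidean) X \<phi> us \<epsilon>))"
      using Xm \<phi> mult unfolding moderate_map_def by blast
    then have g: "growth (\<lambda>\<epsilon>. norm (differential (power_space euclidean) X \<phi> us \<epsilon>) * norm (Y \<phi> \<epsilon>))"
      using growth mult.IH moderate_net_mult negligible_net_mult by blast
    show ?case
    proof (rule mono[OF g], intro always_eventually allI)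
      fix \<epsilon>
      have "norm ((differential (power_space euclidean) X \<phi> us \<epsilon> $ i) *\<^sub>R Y \<phi> \<epsilon>) \<le> norm (differential (power_space euclidean) X \<phi> us \<epsilon>) * norm (Y \<phi> \<epsilon>)"
        unfolding norm_scaleR by (intro mult_right_mono component_le_norm_cart) simp
      then show "\<bar>norm ((differential (power_space euclidean) X \<phi> us \<epsilon> $ i) *\<^sub>R Y \<phi> \<epsilon>)\<bar> \<le> \<bar>norm (differential (power_space euclidean) X \<phi> us \<epsilon>) * norm (Y \<phi> \<epsilon>)\<bar>"
        by simp
    qed
  next
    case (add Y Z)
    then have g: "growth (\<lambda>\<epsilon>. norm (Y \<phi> \<epsilon>) + norm (Z \<phi> \<epsilon>))"
      using growth moderate_net_add negligible_net_add by blast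
    show ?case
      by (rule mono[OF g], intro always_eventually allI) (use norm_triangle_ineq in \<open>auto intro: order_trans[OF _ abs_ge_self]\<close>)
  }
qed

text \<open>The compact set may depend on the test object, so that the estimate applies to every
  representative of a compactly supported point.\<close>

lemma rep_value_growth:
  assumes growth: "growth = moderate_net \<or> growth = negligible_net"
    and R: "R \<in> basic_space \<Omega>"
    and Rg: "\<And>p \<phi> vs. p \<in> csn (Cinf \<Omega>) \<Longrightarrow> \<phi> \<in> test_objs \<Omega> \<Longrightarrow> set vs \<subseteq> test_objs0 \<Omega> \<Longrightarrow>
      growth (\<lambda>\<epsilon>. p (differential CI R \<phi> vs \<epsilon>))"
    and X: "X \<in> moderate_points \<Omega>"
    and K: "\<And>\<phi>. \<phi> \<in> test_objs \<Omega> \<Longrightarrow> \<exists>K. compact K \<and> K \<subseteq> \<Omega> \<and> (\<forall>\<^sub>F \<epsilon> in at_right 0. X \<phi> \<epsilon> \<in> K)"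
    and \<phi>: "\<phi> \<in> test_objs \<Omega>" and vs: "set vs \<subseteq> test_objs0 \<Omega>"
  shows "growth (\<lambda>\<epsilon>. norm (differential (power_space euclidean) (rep_value R X) \<phi> vs \<epsilon>))"
proof -
  have Xb: "X \<in> basic_maps \<Omega>" "moderate_map \<Omega> X"
    and XO: "\<And>\<phi> \<epsilon>. \<phi> \<in> EI \<Longrightarrow> \<epsilon> \<in> unit_ivl \<Longrightarrow> X \<phi> \<epsilon> \<in> \<Omega>"
    using X unfolding moderate_points_def by auto
  obtain Y where Y: "Y \<in> value_terms \<Omega> R X"
    "\<And>\<phi> \<epsilon>. \<phi> \<in> EI \<Longrightarrow> \<epsilon> \<in> unit_ivl \<Longrightarrow> differential (power_space euclidean) (rep_value R X) \<phi> vs \<epsilon> = Y \<phi> \<epsilon>"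
    using differential_rep_value[OF R Xb(1) XO vs] by blast
  obtain L where L: "compact L" "L \<subseteq> \<Omega>" "\<forall>\<^sub>F \<epsilon> in at_right 0. X \<phi> \<epsilon> \<in> L" using K[OF \<phi>] by blast
  have g: "growth (\<lambda>\<epsilon>. norm (Y \<phi> \<epsilon>))"
    by (rule value_terms_growth[OF growth R \<phi> Rg[OF _ \<phi>] Xb(2) L Y(1)])
  have "\<forall>\<^sub>F \<epsilon> in at_right 0. \<bar>norm (differential (power_space euclidean) (rep_value R X) \<phi> vs \<epsilon>)\<bar> \<le> \<bar>norm (Y \<phi> \<epsilon>)\<bar>"
    using eventually_at_right_0 by eventually_elim (use Y(2)[OF test_objs_SKI[OF \<phi>]] in simp)
  from growth_mono[OF growth g this] show ?thesis .
qed

text \<open>Where the point does not move, the chain rule produces only the terms of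
  \<open>R\<close>. This recovers the differentials of \<open>R\<close> at \<open>x\<close> from
  those of the point value: \<open>W\<close> is all of \<open>EI\<close> for \<epsilon>-local
  points, and a slab around the test object for the others.\<close>

lemma differential_rep_value_locally_constant:
  assumes R: "R \<in> basic_space \<Omega>" and X: "X \<in> basic_maps \<Omega>"
    and XO: "\<And>\<phi> \<epsilon>. \<phi> \<in> EI \<Longrightarrow> \<epsilon> \<in> unit_ivl \<Longrightarrow> X \<phi> \<epsilon> \<in> \<Omega>"
    and W: "W \<subseteq> EI" "\<And>\<phi> w. \<phi> \<in> W \<Longrightarrow> w \<in> EI \<Longrightarrow> \<forall>\<^sub>F s in nhds 0. \<phi> + s *\<^sub>R w \<in> W"
    and \<epsilon>: "\<epsilon> \<in> unit_ivl" and Xx: "\<And>\<phi>. \<phi> \<in> W \<Longrightarrow> X \<phi> \<epsilon> = x"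
    and vs: "set vs \<subseteq> EI" and \<phi>: "\<phi> \<in> W"
  shows "differential (power_space euclidean) (rep_value R X) \<phi> vs \<epsilon> = differential CI R \<phi> vs \<epsilon> x"
  using vs \<phi>
proof (induction vs arbitrary: \<phi>)
  case Nil then show ?case by (simp add: rep_value_def Xx)
next
  case (Cons w vs)
  have w: "w \<in> EI" and vs: "set vs \<subseteq> EI" using Cons.prems by auto
  have \<phi>: "\<phi> \<in> EI" using Cons.prems W by blast
  have x: "x \<in> \<Omega>" using XO[OF \<phi> \<epsilon>] Xx[OF Cons.prems(2)] by simp
  have RX: "rep_value R X \<in> basic_maps \<Omega>" by (rule rep_value_basic_maps[OF R X XO])
  note A = differential_map[OF RX vs \<phi> w \<epsilon>]
  have ev: "\<forall>\<^sub>F s in nhds 0. differential (power_space euclidean) (rep_value R X) (\<phi> + s *\<^sub>R w) vs \<epsilon> = differential CI R (\<phi> + s *\<^sub>R w) vs \<epsilon> x"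
    using W(2)[OF Cons.prems(2) w] by (rule eventually_mono) (rule Cons.IH[OF vs])
  have r: "range (\<lambda>s. differential CI R (\<phi> + s *\<^sub>R w) vs \<epsilon>) \<subseteq> Cinf_funs \<Omega>"
    using differential_fun(1)[OF R vs line_in_EI[OF \<phi> w] \<epsilon>] by auto
  have "((\<lambda>s. partial [] (differential CI R (\<phi> + s *\<^sub>R w) vs \<epsilon>) x) has_vector_derivative
      partial [] (differential CI R \<phi> (w # vs) \<epsilon>) x + (\<Sum>i\<in>UNIV. (0::real^'n) $ i *\<^sub>R partial [i] (differential CI R (\<phi> + 0 *\<^sub>R w) vs \<epsilon>) x)) (at 0)"
    by (rule evaluation_deriv[OF r differential_fun(2)[OF R vs \<phi> \<epsilon> w] has_vector_derivative_const x])
  then have "((\<lambda>s. differential CI R (\<phi> + s *\<^sub>R w) vs \<epsilon> x) has_vector_derivative differential CI R \<phi> (w # vs) \<epsilon> x) (at 0)"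
    by simp
  then have "((\<lambda>s. differential (power_space euclidean) (rep_value R X) (\<phi> + s *\<^sub>R w) vs \<epsilon>) has_vector_derivative differential CI R \<phi> (w # vs) \<epsilon> x) (at 0)"
    unfolding has_vector_derivative_cong_nhds[OF ev] .
  then show ?case using A vector_derivative_unique_at by blast
qed

end

subsection \<open>Spatial derivatives are controlled by interpolation\<close>

context open_set
begin

text \<open>Landau's inequality on a one-sided segment: two mean value estimates bound the first
  order Taylor remainder by \<open>h * (h * M2)\<close>. The length \<open>h\<close> stays free and
  will be a power of \<epsilon>.\<close>

lemma partial_interpolation:
  assumes f: "f \<in> Cinf_funs \<Omega>" and h: "0 < h" and K: "K \<subseteq> \<Omega>"
    and seg: "\<And>t. 0 \<le> t \<Longrightarrow> t \<le> h \<Longrightarrow> x + t *\<^sub>R axis i 1 \<in> K"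
    and M0: "\<And>y. y \<in> K \<Longrightarrow> cmod (partial is f y) \<le> M0"
    and M2: "\<And>y. y \<in> K \<Longrightarrow> cmod (partial (i # i # is) f y) \<le> M2"
  shows "cmod (partial (i # is) f x) \<le> 2 * M0 / h + h * M2"
proof -
  let ?u = "\<lambda>t. partial is f (x + t *\<^sub>R axis i 1)" and ?v = "\<lambda>t. partial (i # is) f (x + t *\<^sub>R axis i 1)"
    and ?w = "\<lambda>t. partial (i # i # is) f (x + t *\<^sub>R axis i 1)"
  have du: "(?u has_vector_derivative ?v t) (at t)" and dv: "(?v has_vector_derivative ?w t) (at t)"
    if "0 \<le> t" "t \<le> h" for t
    using Cinf_funs_deriv[OF f] seg[OF that] K by blast+
  have M20: "0 \<le> M2" using M2[OF seg[of 0]] h by (intro order_trans[OF norm_ge_zero]) auto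
  have v: "norm (?v t - ?v 0) \<le> h * M2" if t: "0 < t" "t \<le> h" for t
  proof -
    have "continuous_on {0..t} ?v"
      using t by (intro continuous_at_imp_continuous_on ballI has_vector_derivative_continuous[OF dv]) auto
    moreover have "(?v has_derivative (\<lambda>r. r *\<^sub>R ?w s)) (at s)" if "0 < s" "s < t" for s
      using dv[of s] that t by (simp add: has_vector_derivative_def)
    ultimately obtain s where s: "0 < s" "s < t" "norm (?v t - ?v 0) \<le> norm ((t - 0) *\<^sub>R ?w s)"
      using mvt_general[OF t(1), of ?v "\<lambda>s r. r *\<^sub>R ?w s"] by auto
    note s(3)
    also have "norm ((t - 0) *\<^sub>R ?w s) \<le> h * M2"
      unfolding norm_scaleR using s t M20 by (intro mult_mono M2 seg) auto
    finally show ?thesis .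
  qed
  let ?e = "\<lambda>t. ?u t - t *\<^sub>R ?v 0"
  have de: "(?e has_vector_derivative (?v t - 1 *\<^sub>R ?v 0)) (at t)" if "0 \<le> t" "t \<le> h" for t
    by (intro has_vector_derivative_diff du that) (auto intro!: derivative_eq_intros)
  have "continuous_on {0..h} ?e"
    by (intro continuous_at_imp_continuous_on ballI has_vector_derivative_continuous[OF de]) auto
  moreover have "(?e has_derivative (\<lambda>r. r *\<^sub>R (?v s - 1 *\<^sub>R ?v 0))) (at s)" if "0 < s" "s < h" for s
    using de[of s] that by (simp add: has_vector_derivative_def)
  ultimately obtain s where s: "0 < s" "s < h" "norm (?e h - ?e 0) \<le> norm ((h - 0) *\<^sub>R (?v s - 1 *\<^sub>R ?v 0))"
    using mvt_general[OF h, of ?e "\<lambda>s r. r *\<^sub>R (?v s - 1 *\<^sub>R ?v 0)"] by auto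
  have "norm ((h - 0) *\<^sub>R (?v s - 1 *\<^sub>R ?v 0)) \<le> h * (h * M2)"
    unfolding norm_scaleR using v[of s] s h by (intro mult_mono) auto
  with s(3) have A: "norm (?e h - ?e 0) \<le> h * (h * M2)" by linarith
  have "h *\<^sub>R ?v 0 = (?u h - ?u 0) - (?e h - ?e 0)" by simp
  then have "norm (h *\<^sub>R ?v 0) \<le> norm (?u h - ?u 0) + norm (?e h - ?e 0)" by (metis norm_triangle_ineq4)
  also have "norm (?u h - ?u 0) \<le> M0 + M0"
    using M0[OF seg[of h]] M0[OF seg[of 0]] h by (intro norm_triangle_le_diff add_mono) auto
  finally have "h * norm (?v 0) \<le> 2 * M0 + h * (h * M2)" using A h by simp
  then show ?thesis using h by (simp add: field_simps)
qed

lemma compact_neighbourhood: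
  assumes "compact K" "K \<subseteq> \<Omega>"
  obtains L d where "compact L" "L \<subseteq> \<Omega>" "0 < d" "\<And>x y. x \<in> K \<Longrightarrow> dist x y \<le> d \<Longrightarrow> y \<in> L"
proof -
  obtain e where e: "e > 0" "(\<Union>x\<in>K. ball x e) \<subseteq> \<Omega>"
    using compact_subset_open_imp_ball_epsilon_subset[OF assms(1) open_Omega assms(2)] by blast
  show ?thesis
  proof (rule that[of "{x + y | x y. x \<in> K \<and> y \<in> cball 0 (e/2)}" "e / 2"])
    show "compact {x + y | x y. x \<in> K \<and> y \<in> cball 0 (e/2)}" by (intro compact_sums assms compact_cball)
    show "{x + y | x y. x \<in> K \<and> y \<in> cball 0 (e/2)} \<subseteq> \<Omega>"
    proof safe
      fix x y assume "x \<in> K" "y \<in> cball (0 :: real^'n) (e/2)"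
      then have "x + y \<in> ball x e" using e(1) by (simp add: dist_norm)
      then show "x + y \<in> \<Omega>" using e(2) \<open>x \<in> K\<close> by blast
    qed
    show "y \<in> {x + y | x y. x \<in> K \<and> y \<in> cball 0 (e/2)}" if "x \<in> K" "dist x y \<le> e / 2" for x y
      using that by (intro CollectI exI[of _ x] exI[of _ "y - x"]) (simp add: dist_norm norm_minus_commute)
  qed (use e in simp)
qed

lemma net_interpolation:
  assumes f: "\<And>\<epsilon>. \<epsilon> \<in> unit_ivl \<Longrightarrow> f \<epsilon> \<in> Cinf_funs \<Omega>"
    and neg: "\<And>K. compact K \<Longrightarrow> K \<subseteq> \<Omega> \<Longrightarrow> negligible_net (\<lambda>\<epsilon>. Cinf_seminorm K [] (f \<epsilon>))"
    and mod: "\<And>K is. compact K \<Longrightarrow> K \<subseteq> \<Omega> \<Longrightarrow> moderate_net (\<lambda>\<epsilon>. Cinf_seminorm K is (f \<epsilon>))"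
    and "compact K" "K \<subseteq> \<Omega>"
  shows "negligible_net (\<lambda>\<epsilon>. Cinf_seminorm K is (f \<epsilon>))"
  using assms(4,5)
proof (induction "is" arbitrary: K)
  case Nil then show ?case by (rule neg)
next
  case (Cons i "is")
  \<comment> \<open>The segments used for interpolation leave \<open>K\<close>, so the bounds are
    taken on a compact neighbourhood; the induction is therefore over all compact sets.\<close>
  obtain L d where L: "compact L" "L \<subseteq> \<Omega>" "0 < d" "\<And>x y. x \<in> K \<Longrightarrow> dist x y \<le> d \<Longrightarrow> y \<in> L"
    using compact_neighbourhood[OF Cons.prems] by blast
  show ?case unfolding negligible_net_iff
  proof
    fix m
    obtain N C2 where C2: "\<forall>\<^sub>F \<epsilon> in at_right 0. \<bar>Cinf_seminorm L (i # i # is) (f \<epsilon>)\<bar> \<le> C2 * inverse (\<epsilon> ^ N)"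
      using mod[OF L(1,2), of "i # i # is", unfolded moderate_net_iff] by (elim exE)
    obtain C0 where C0: "\<forall>\<^sub>F \<epsilon> in at_right 0. \<bar>Cinf_seminorm L is (f \<epsilon>)\<bar> \<le> C0 * \<epsilon> ^ (2 * m + N + 1)"
      using Cons.IH[OF L(1,2), unfolded negligible_net_iff, rule_format, of "2 * m + N + 1"] by (elim exE)
    have ed: "\<forall>\<^sub>F \<epsilon> in at_right 0. \<epsilon> < d"
      using L(3) unfolding eventually_at_right_field by (intro exI[of _ d]) auto
    have "\<forall>\<^sub>F \<epsilon> in at_right 0. \<bar>Cinf_seminorm K (i # is) (f \<epsilon>)\<bar> \<le> (2 * C0 + \<bar>C2\<bar>) * \<epsilon> ^ m"
      using C2 C0 ed eventually_at_right_0
    proof eventually_elim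
      case (elim \<epsilon>)
      then have \<epsilon>: "\<epsilon> \<in> unit_ivl" by simp
      \<comment> \<open>With this power the lower derivative, of size
        \<open>\<epsilon> ^ (2 * m + N + 1)\<close>, contributes \<open>\<epsilon> ^ m\<close> after
        division by \<open>h\<close>, and the upper one, of size \<open>\<epsilon> ^ -N\<close>,
        contributes \<open>\<epsilon> ^ (m + 1)\<close>.\<close>
      define h where "h = \<epsilon> ^ (m + N + 1)"
      have h: "0 < h" "h \<le> \<epsilon>"
        using \<epsilon> power_decreasing[of 1 "m + N + 1" \<epsilon>] by (auto simp: h_def)
      have B: "cmod (partial (i # is) (f \<epsilon>) x) \<le> (2 * C0 + \<bar>C2\<bar>) * \<epsilon> ^ m" if x: "x \<in> K" for x
      proof -
        have "cmod (partial (i # is) (f \<epsilon>) x) \<le> 2 * (C0 * \<epsilon> ^ (2 * m + N + 1)) / h + h * (C2 * inverse (\<epsilon> ^ N))"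
        proof (rule partial_interpolation[OF f[OF \<epsilon>] h(1) L(2)])
          show "x + t *\<^sub>R axis i 1 \<in> L" if "0 \<le> t" "t \<le> h" for t
            using that h(2) elim(3) by (intro L(4)[OF x]) (simp add: dist_norm)
          show "cmod (partial is (f \<epsilon>) y) \<le> C0 * \<epsilon> ^ (2 * m + N + 1)" if "y \<in> L" for y
            using Cinf_seminorm_upper[OF f[OF \<epsilon>] L(1,2) that, of "is"] elim(2) by linarith
          show "cmod (partial (i # i # is) (f \<epsilon>) y) \<le> C2 * inverse (\<epsilon> ^ N)" if "y \<in> L" for y
            using Cinf_seminorm_upper[OF f[OF \<epsilon>] L(1,2) that, of "i # i # is"] elim(1) by linarith
        qed
        also have "2 * (C0 * \<epsilon> ^ (2 * m + N + 1)) / h = 2 * C0 * \<epsilon> ^ m"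
        proof -
          have "\<epsilon> ^ (2 * m + N + 1) = \<epsilon> ^ m * h" unfolding h_def power_add[symmetric] by (simp add: mult_2 add_ac)
          then show ?thesis using h by simp
        qed
        also have "h * (C2 * inverse (\<epsilon> ^ N)) \<le> \<bar>C2\<bar> * \<epsilon> ^ m"
        proof -
          have "h * (C2 * inverse (\<epsilon> ^ N)) = C2 * \<epsilon> ^ (m + 1)" using \<epsilon> by (simp add: h_def power_add)
          also have "\<dots> \<le> \<bar>C2\<bar> * \<epsilon> ^ m" using \<epsilon> by (intro mult_mono power_decreasing) auto
          finally show ?thesis .
        qed
        finally show ?thesis by (simp add: distrib_right)
      qed
      have nn: "0 \<le> (2 * C0 + \<bar>C2\<bar>) * \<epsilon> ^ m"
      proof -
        have "0 \<le> C0 * \<epsilon> ^ (2 * m + N + 1)" using elim(2) by (rule order_trans[OF abs_ge_zero])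
        moreover have "0 < \<epsilon> ^ (2 * m + N + 1)" using \<epsilon> by simp
        ultimately have "0 \<le> C0" by (simp only: zero_le_mult_iff) linarith
        then show ?thesis using \<epsilon> by (intro mult_nonneg_nonneg) auto
      qed
      have "Cinf_seminorm K (i # is) (f \<epsilon>) \<le> (2 * C0 + \<bar>C2\<bar>) * \<epsilon> ^ m" by (rule Cinf_seminorm_least[OF nn B])
      moreover have "0 \<le> Cinf_seminorm K (i # is) (f \<epsilon>)"
        unfolding Cinf_seminorm_def by (rule sup0_nonneg[OF Cinf_bdd[OF f[OF \<epsilon>] Cons.prems]])
      ultimately show ?case by simp
    qed
    then show "\<exists>C. \<forall>\<^sub>F \<epsilon> in at_right 0. \<bar>Cinf_seminorm K (i # is) (f \<epsilon>)\<bar> \<le> C * \<epsilon> ^ m" by blast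
  qed
qed

lemma csn_growth:
  assumes f: "\<And>\<epsilon>. \<epsilon> \<in> unit_ivl \<Longrightarrow> f \<epsilon> \<in> Cinf_funs \<Omega>"
    and neg: "\<And>K is. compact K \<Longrightarrow> K \<subseteq> \<Omega> \<Longrightarrow> negligible_net (\<lambda>\<epsilon>. Cinf_seminorm K is (f \<epsilon>))"
    and p: "p \<in> csn (Cinf \<Omega>)"
  shows "negligible_net (\<lambda>\<epsilon>. p (f \<epsilon>))"
proof -
  have rs: "\<forall>q\<in>Cinf_seminorms \<Omega>. real_seminorm (Cinf_funs \<Omega>) q" using real_seminorm_Cinf by blast
  obtain Q C where Q: "finite Q" "Q \<subseteq> Cinf_seminorms \<Omega>" "C > 0" "\<forall>x\<in>Cinf_funs \<Omega>. p x \<le> C * (\<Sum>q\<in>Q. q x)"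
    using csn_dominated[OF subspace_Cinf_funs rs p[unfolded Cinf_alt]] by (elim exE conjE)
  have "negligible_net (\<lambda>\<epsilon>. q (f \<epsilon>))" if "q \<in> Q" for q
  proof -
    have "q \<in> Cinf_seminorms \<Omega>" using that Q by blast
    then obtain K "is" where "q = Cinf_seminorm K is" "compact K" "K \<subseteq> \<Omega>" unfolding Cinf_seminorms_def by blast
    then show ?thesis using neg by blast
  qed
  then have "negligible_net (\<lambda>\<epsilon>. C * (\<Sum>q\<in>Q. q (f \<epsilon>)))"
    by (intro negligible_net_mult[OF moderate_net_const] negligible_net_sum)
  then show ?thesis
  proof (rule negligible_net_mono)
    have pr: "real_seminorm (Cinf_funs \<Omega>) p"
      using p unfolding csn_def topspace_Cinf by (blast intro: real_seminorm_of_seminorm_on)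
    show "\<forall>\<^sub>F \<epsilon> in at_right 0. \<bar>p (f \<epsilon>)\<bar> \<le> \<bar>C * (\<Sum>q\<in>Q. q (f \<epsilon>))\<bar>"
      using eventually_at_right_0
    proof eventually_elim
      case (elim \<epsilon>)
      then have fe: "f \<epsilon> \<in> Cinf_funs \<Omega>" by (intro f) simp
      have "0 \<le> p (f \<epsilon>)" by (rule real_seminorm_nonneg[OF subspace_Cinf_funs pr fe])
      then show ?case using Q(4) fe by fastforce
    qed
  qed
qed

subsection \<open>The quotient spaces\<close>

lemma zero_smooth_maps:
  "smooth_calculus E PE' F PF U \<Longrightarrow> 0 \<in> smooth_maps E U F"
  using subspace_0[OF smooth_calculus.subspace_smooth_maps] .

lemma differential_diff:
  assumes "smooth_calculus E PE' F PF U" "f \<in> smooth_maps E U F" "g \<in> smooth_maps E U F" "set vs \<subseteq> topspace E" "x \<in> U"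
  shows "differential F (f - g) x vs = differential F f x vs - differential F g x vs"
  using smooth_calculus.differential_linear[OF assms, of 1 "-1"] by (simp add: fun_diff_def)

lemma differential_zero:
  assumes "smooth_calculus E PE' F PF U" "set vs \<subseteq> topspace E" "x \<in> U"
  shows "differential F 0 x vs = 0"
  using differential_diff[OF assms(1) zero_smooth_maps[OF assms(1)] zero_smooth_maps[OF assms(1)] assms(2,3)] by simp

lemma basic_space_alt: "basic_space \<Omega> = smooth_maps (SKI \<Omega>) EI CI"
  and basic_maps_alt: "basic_maps \<Omega> = smooth_maps (SKI \<Omega>) EI (power_space euclidean)"
  unfolding basic_space_def basic_maps_def by (rule refl)+

lemma csn_zero: "p \<in> csn (Cinf \<Omega>) \<Longrightarrow> p 0 = 0"
  unfolding csn_def topspace_Cinf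
  using real_seminorm_zero[OF subspace_Cinf_funs real_seminorm_of_seminorm_on] by blast

lemma zero_negligible_funs: "0 \<in> negligible_funs \<Omega>"
  unfolding negligible_funs_def mem_Collect_eq basic_space_alt
proof (intro conjI zero_smooth_maps[OF calc_fun] ballI allI impI)
  fix p \<phi> vs assume p: "p \<in> csn (Cinf \<Omega>)" and \<phi>: "\<phi> \<in> test_objs \<Omega>" and vs: "set vs \<subseteq> test_objs0 \<Omega>"
  have "p (differential CI 0 \<phi> vs \<epsilon>) = 0" for \<epsilon>
  proof -
    have "differential CI 0 \<phi> vs = 0" by (rule differential_zero[OF calc_fun test_objs0_SKI[OF vs] test_objs_SKI[OF \<phi>]])
    then have "differential CI 0 \<phi> vs \<epsilon> = 0" by simp
    then show ?thesis using csn_zero[OF p] by simp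
  qed
  then show "negligible_net (\<lambda>\<epsilon>. p (differential CI 0 \<phi> vs \<epsilon>))" by (simp only: negligible_net_0)
qed

lemma negligible_imp_moderate_funs: "R \<in> negligible_funs \<Omega> \<Longrightarrow> R \<in> moderate_funs \<Omega>"
  unfolding negligible_funs_def moderate_funs_def using negligible_imp_moderate_net by blast

lemma negligible_funs_diff:
  assumes R: "R \<in> negligible_funs \<Omega>" and S: "S \<in> negligible_funs \<Omega>"
  shows "R - S \<in> negligible_funs \<Omega>"
  unfolding negligible_funs_def mem_Collect_eq basic_space_alt
proof (intro conjI ballI allI impI)
  have RS: "R \<in> smooth_maps (SKI \<Omega>) EI CI" "S \<in> smooth_maps (SKI \<Omega>) EI CI"
    using R S unfolding negligible_funs_def basic_space_alt by blast+
  show "R - S \<in> smooth_maps (SKI \<Omega>) EI CI"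
    by (rule subspace_diff[OF smooth_calculus.subspace_smooth_maps[OF calc_fun] RS])
  fix p \<phi> vs assume p: "p \<in> csn (Cinf \<Omega>)" and \<phi>: "\<phi> \<in> test_objs \<Omega>" and vs: "set vs \<subseteq> test_objs0 \<Omega>"
  let ?d = "\<lambda>R \<epsilon>. differential CI R \<phi> vs \<epsilon>"
  have rb: "R \<in> basic_space \<Omega>" "S \<in> basic_space \<Omega>" using RS basic_space_alt by auto
  have pr: "real_seminorm (Cinf_funs \<Omega>) p"
    using p unfolding csn_def topspace_Cinf by (blast intro: real_seminorm_of_seminorm_on)
  have "negligible_net (\<lambda>\<epsilon>. p (?d R \<epsilon>) + p (?d S \<epsilon>))"
    by (rule negligible_net_add) (use R S p \<phi> vs in \<open>simp_all add: negligible_funs_def\<close>)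
  then show "negligible_net (\<lambda>\<epsilon>. p (?d (R - S) \<epsilon>))"
  proof (rule negligible_net_mono)
    show "\<forall>\<^sub>F \<epsilon> in at_right 0. \<bar>p (?d (R - S) \<epsilon>)\<bar> \<le> \<bar>p (?d R \<epsilon>) + p (?d S \<epsilon>)\<bar>"
      using eventually_at_right_0
    proof eventually_elim
      case (elim \<epsilon>)
      then have \<epsilon>: "\<epsilon> \<in> unit_ivl" by simp
      note in' = differential_fun(1)[OF rb(1) test_objs0_SKI[OF vs] test_objs_SKI[OF \<phi>] \<epsilon>]
        differential_fun(1)[OF rb(2) test_objs0_SKI[OF vs] test_objs_SKI[OF \<phi>] \<epsilon>]
      have eq: "?d (R - S) \<epsilon> = ?d R \<epsilon> - ?d S \<epsilon>"
        using differential_diff[OF calc_fun RS test_objs0_SKI[OF vs] test_objs_SKI[OF \<phi>]] by simp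
      have "p (?d R \<epsilon> - ?d S \<epsilon>) \<le> p (?d R \<epsilon>) + p (?d S \<epsilon>)"
        by (rule real_seminorm_diff[OF subspace_Cinf_funs pr in'])
      moreover have "0 \<le> p (?d R \<epsilon> - ?d S \<epsilon>)"
        by (rule real_seminorm_nonneg[OF subspace_Cinf_funs pr Cinf_funs_diff[OF in']])
      ultimately show ?case unfolding eq by linarith
    qed
  qed
qed

lemma negligible_map_zero: "negligible_map \<Omega> (0 :: (real \<Rightarrow> 'n kern) \<Rightarrow> real \<Rightarrow> 'y::euclidean_space)"
  unfolding negligible_map_def
proof (intro ballI allI impI)
  fix \<phi> vs assume \<phi>: "\<phi> \<in> test_objs \<Omega>" and vs: "set vs \<subseteq> test_objs0 \<Omega>"
  have "norm (differential (power_space euclidean) (0 :: (real \<Rightarrow> 'n kern) \<Rightarrow> real \<Rightarrow> 'y) \<phi> vs \<epsilon>) = 0" for \<epsilon>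
    unfolding differential_zero[OF calc_euclidean test_objs0_SKI[OF vs] test_objs_SKI[OF \<phi>]] by simp
  then show "negligible_net (\<lambda>\<epsilon>. norm (differential (power_space euclidean) (0 :: (real \<Rightarrow> 'n kern) \<Rightarrow> real \<Rightarrow> 'y) \<phi> vs \<epsilon>))"
    by (simp only: negligible_net_0)
qed

lemma zero_negligible_nums: "0 \<in> negligible_nums \<Omega>"
  unfolding negligible_nums_def mem_Collect_eq basic_maps_alt
  by (intro conjI zero_smooth_maps[OF calc_euclidean] negligible_map_zero)

lemma negligible_nums_diff:
  assumes X: "X \<in> negligible_nums \<Omega>" and Y: "Y \<in> negligible_nums \<Omega>"
  shows "X - Y \<in> negligible_nums \<Omega>"
  unfolding negligible_nums_def mem_Collect_eq basic_maps_alt negligible_map_def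
proof (intro conjI ballI allI impI)
  have XY: "X \<in> smooth_maps (SKI \<Omega>) EI (power_space euclidean)" "Y \<in> smooth_maps (SKI \<Omega>) EI (power_space euclidean)"
    using X Y unfolding negligible_nums_def basic_maps_alt by blast+
  show "X - Y \<in> smooth_maps (SKI \<Omega>) EI (power_space euclidean)"
    by (rule subspace_diff[OF smooth_calculus.subspace_smooth_maps[OF calc_euclidean] XY])
  fix \<phi> vs assume \<phi>: "\<phi> \<in> test_objs \<Omega>" and vs: "set vs \<subseteq> test_objs0 \<Omega>"
  let ?d = "\<lambda>X \<epsilon>. differential (power_space euclidean) X \<phi> vs \<epsilon>"
  have "negligible_net (\<lambda>\<epsilon>. norm (?d X \<epsilon>) + norm (?d Y \<epsilon>))"
    by (rule negligible_net_add) (use X Y \<phi> vs in \<open>simp_all add: negligible_nums_def negligible_map_def\<close>)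
  then show "negligible_net (\<lambda>\<epsilon>. norm (?d (X - Y) \<epsilon>))"
  proof (rule negligible_net_mono, intro always_eventually allI)
    fix \<epsilon>
    have "?d (X - Y) \<epsilon> = ?d X \<epsilon> - ?d Y \<epsilon>"
      using differential_diff[OF calc_euclidean XY test_objs0_SKI[OF vs] test_objs_SKI[OF \<phi>]] by simp
    then show "\<bar>norm (?d (X - Y) \<epsilon>)\<bar> \<le> \<bar>norm (?d X \<epsilon>) + norm (?d Y \<epsilon>)\<bar>"
      using norm_triangle_ineq4 by simp
  qed
qed

lemma gfun_zero_iff:
  assumes R: "R \<in> moderate_funs \<Omega>"
  shows "gfun_rel \<Omega> `` {R} = gfun_zero \<Omega> \<longleftrightarrow> R \<in> negligible_funs \<Omega>"
proof
  assume "gfun_rel \<Omega> `` {R} = gfun_zero \<Omega>"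
  moreover have "R \<in> gfun_rel \<Omega> `` {R}" using R zero_negligible_funs by (simp add: gfun_rel_def quot_rel_def)
  ultimately have "0 - R \<in> negligible_funs \<Omega>" by (simp add: gfun_zero_def gfun_rel_def quot_rel_def)
  from negligible_funs_diff[OF zero_negligible_funs this] show "R \<in> negligible_funs \<Omega>" by simp
next
  assume N: "R \<in> negligible_funs \<Omega>"
  have "R - S \<in> negligible_funs \<Omega> \<longleftrightarrow> 0 - S \<in> negligible_funs \<Omega>" for S
  proof
    assume "R - S \<in> negligible_funs \<Omega>"
    from negligible_funs_diff[OF this N] show "0 - S \<in> negligible_funs \<Omega>" by simp
  next
    assume "0 - S \<in> negligible_funs \<Omega>"
    from negligible_funs_diff[OF N negligible_funs_diff[OF zero_negligible_funs this]] show "R - S \<in> negligible_funs \<Omega>" by simp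
  qed
  then show "gfun_rel \<Omega> `` {R} = gfun_zero \<Omega>"
    using R negligible_imp_moderate_funs[OF zero_negligible_funs]
    unfolding gfun_zero_def gfun_rel_def quot_rel_def by auto
qed

lemma gfun_zero_subset: "R \<in> gfun_zero \<Omega> \<Longrightarrow> R \<in> negligible_funs \<Omega>"
  using negligible_funs_diff[OF zero_negligible_funs, of "0 - R"]
  by (simp add: gfun_zero_def gfun_rel_def quot_rel_def)

lemma moderate_nums_zero: "0 \<in> moderate_nums \<Omega>"
  using zero_negligible_nums negligible_imp_moderate_net
  unfolding moderate_nums_def negligible_nums_def moderate_map_def negligible_map_def by blast

section \<open>Classes of points and their values\<close>

text \<open>Compactness is known for one representative only. Any other differs from it by a
  negligible net, as both are compared with the generator \<open>Y\<close> of the class, and so is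
  eventually in a compact neighbourhood of \<open>K\<close>.\<close>

lemma compact_points_eventually:
  assumes Xt: "Xt \<in> compact_points \<Omega>" and X: "X \<in> Xt" and \<phi>: "\<phi> \<in> test_objs \<Omega>"
  shows "X \<in> moderate_points \<Omega>" "\<exists>K. compact K \<and> K \<subseteq> \<Omega> \<and> (\<forall>\<^sub>F \<epsilon> in at_right 0. X \<phi> \<epsilon> \<in> K)"
proof -
  obtain X0 K where X0: "X0 \<in> Xt" and K: "compact K" "K \<subseteq> \<Omega>"
    "\<forall>\<phi>\<in>test_objs \<Omega>. \<exists>\<epsilon>\<^sub>0>0. \<forall>\<epsilon>\<in>unit_ivl. \<epsilon> < \<epsilon>\<^sub>0 \<longrightarrow> X0 \<phi> \<epsilon> \<in> K"
    using Xt unfolding compact_points_def by blast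
  have "Xt \<in> gen_points \<Omega>" using Xt unfolding compact_points_def by blast
  then obtain Y where Y: "Xt = gpoint_rel \<Omega> `` {Y}" unfolding gen_points_def quotient_def by blast
  have YX: "X \<in> moderate_points \<Omega>" "negligible_map \<Omega> (Y - X)" "negligible_map \<Omega> (Y - X0)"
    using X X0 unfolding Y gpoint_rel_def quot_rel_def by auto
  show "X \<in> moderate_points \<Omega>" by (rule YX(1))
  have nn: "negligible_net (\<lambda>\<epsilon>. norm ((Y - X) \<phi> \<epsilon>))" "negligible_net (\<lambda>\<epsilon>. norm ((Y - X0) \<phi> \<epsilon>))"
    using YX(2,3)[unfolded negligible_map_def, rule_format, OF \<phi>, of "[]"] by simp_all
  obtain L d where L: "compact L" "L \<subseteq> \<Omega>" "0 < d" "\<And>x y. x \<in> K \<Longrightarrow> dist x y \<le> d \<Longrightarrow> y \<in> L"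
    using compact_neighbourhood[OF K(1,2)] by blast
  obtain C where C: "\<forall>\<^sub>F \<epsilon> in at_right 0. \<bar>norm ((Y - X) \<phi> \<epsilon>) + norm ((Y - X0) \<phi> \<epsilon>)\<bar> \<le> C * \<epsilon> ^ 1"
    using negligible_net_add[OF nn, unfolded negligible_net_iff, rule_format, of 1] by (elim exE)
  obtain \<epsilon>\<^sub>0 where e0: "\<epsilon>\<^sub>0 > 0" "\<And>\<epsilon>. \<epsilon> \<in> unit_ivl \<Longrightarrow> \<epsilon> < \<epsilon>\<^sub>0 \<Longrightarrow> X0 \<phi> \<epsilon> \<in> K" using K(3) \<phi> by blast
  define r where "r = min \<epsilon>\<^sub>0 (d / (\<bar>C\<bar> + 1))"
  have "0 < r" using e0 L by (simp add: r_def)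
  then have "\<forall>\<^sub>F \<epsilon> in at_right 0. \<epsilon> < r" unfolding eventually_at_right_field by (intro exI[of _ r]) auto
  with C eventually_at_right_0 have "\<forall>\<^sub>F \<epsilon> in at_right 0. X \<phi> \<epsilon> \<in> L"
  proof eventually_elim
    case (elim \<epsilon>)
    have K0: "X0 \<phi> \<epsilon> \<in> K" using elim e0(2) by (simp add: r_def)
    have "C * \<epsilon> ^ 1 \<le> (\<bar>C\<bar> + 1) * (d / (\<bar>C\<bar> + 1))" using elim by (simp only: power_one_right) (intro mult_mono; simp add: r_def)
    also have "\<dots> = d" by simp
    finally have "C * \<epsilon> ^ 1 \<le> d" .
    moreover have "dist (X0 \<phi> \<epsilon>) (X \<phi> \<epsilon>) \<le> norm ((Y - X) \<phi> \<epsilon>) + norm ((Y - X0) \<phi> \<epsilon>)"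
      using norm_triangle_ineq4[of "(Y - X) \<phi> \<epsilon>" "(Y - X0) \<phi> \<epsilon>"] by (simp add: dist_norm)
    ultimately show ?case using elim by (intro L(4)[OF K0]) linarith
  qed
  then show "\<exists>K. compact K \<and> K \<subseteq> \<Omega> \<and> (\<forall>\<^sub>F \<epsilon> in at_right 0. X \<phi> \<epsilon> \<in> K)" using L by blast
qed

lemma rep_value_negligible_map:
  assumes R: "R \<in> negligible_funs \<Omega>" and Xt: "Xt \<in> compact_points \<Omega>" and X: "X \<in> Xt"
  shows "negligible_map \<Omega> (rep_value R X)"
  unfolding negligible_map_def
proof (intro ballI allI impI)
  fix \<phi> vs assume \<phi>: "\<phi> \<in> test_objs \<Omega>" and vs: "set vs \<subseteq> test_objs0 \<Omega>"
  have Rb: "R \<in> basic_space \<Omega>"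
    and Rn: "\<And>p \<phi> vs. p \<in> csn (Cinf \<Omega>) \<Longrightarrow> \<phi> \<in> test_objs \<Omega> \<Longrightarrow> set vs \<subseteq> test_objs0 \<Omega> \<Longrightarrow>
      negligible_net (\<lambda>\<epsilon>. p (differential CI R \<phi> vs \<epsilon>))"
    using R unfolding negligible_funs_def by blast+
  show "negligible_net (\<lambda>\<epsilon>. norm (differential (power_space euclidean) (rep_value R X) \<phi> vs \<epsilon>))"
    by (rule rep_value_growth[where growth=negligible_net, OF disjI2[OF refl] Rb Rn
          compact_points_eventually(1)[OF Xt X \<phi>] compact_points_eventually(2)[OF Xt X] \<phi> vs])
qed

text \<open>\<open>point_value\<close> is a union over all representatives. Each of them gives a
  negligible number, and the representative 0 of the zero class has the value 0 exactly, so nothing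
  of the zero class is missed.\<close>

lemma point_value_zero:
  assumes Xt: "Xt \<in> compact_points \<Omega>"
  shows "point_value \<Omega> (gfun_zero \<Omega>) Xt = gnum_zero \<Omega>"
proof
  show "point_value \<Omega> (gfun_zero \<Omega>) Xt \<subseteq> gnum_zero \<Omega>"
  proof
    fix Y assume "Y \<in> point_value \<Omega> (gfun_zero \<Omega>) Xt"
    then obtain R X where RX: "R \<in> gfun_zero \<Omega>" "X \<in> Xt" and rel: "(rep_value R X, Y) \<in> gnum_rel \<Omega>"
      unfolding point_value_def by blast
    have m: "rep_value R X \<in> moderate_nums \<Omega>" "Y \<in> moderate_nums \<Omega>" "rep_value R X - Y \<in> negligible_nums \<Omega>"
      using rel unfolding gnum_rel_def quot_rel_def by auto
    then have "rep_value R X \<in> negligible_nums \<Omega>"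
      using rep_value_negligible_map[OF gfun_zero_subset[OF RX(1)] Xt RX(2)]
      unfolding negligible_nums_def moderate_nums_def by blast
    from negligible_nums_diff[OF m(3) this] have "0 - Y \<in> negligible_nums \<Omega>" by simp
    then show "Y \<in> gnum_zero \<Omega>"
      using m(2) moderate_nums_zero by (simp add: gnum_zero_def gnum_rel_def quot_rel_def)
  qed
  obtain X where X: "X \<in> Xt" using Xt unfolding compact_points_def by blast
  have "0 \<in> gfun_zero \<Omega>"
    using zero_negligible_funs negligible_imp_moderate_funs[OF zero_negligible_funs]
    by (simp add: gfun_zero_def gfun_rel_def quot_rel_def)
  moreover have "rep_value 0 X = 0" by (intro ext) (simp add: rep_value_def)
  ultimately show "gnum_zero \<Omega> \<subseteq> point_value \<Omega> (gfun_zero \<Omega>) Xt"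
    unfolding gnum_zero_def point_value_def using X by (intro Image_mono subset_refl) force
qed

lemma moderate_point_class:
  assumes X: "X \<in> moderate_points \<Omega>" and K: "compact K" "K \<subseteq> \<Omega>" "\<And>\<phi> \<epsilon>. \<phi> \<in> EI \<Longrightarrow> \<epsilon> \<in> unit_ivl \<Longrightarrow> X \<phi> \<epsilon> \<in> K"
  shows "X \<in> gpoint_rel \<Omega> `` {X}" "gpoint_rel \<Omega> `` {X} \<in> compact_points \<Omega>"
proof -
  show XX: "X \<in> gpoint_rel \<Omega> `` {X}"
    using X negligible_map_zero by (simp add: gpoint_rel_def quot_rel_def)
  have "\<forall>\<phi>\<in>test_objs \<Omega>. \<exists>\<epsilon>\<^sub>0>0. \<forall>\<epsilon>\<in>unit_ivl. \<epsilon> < \<epsilon>\<^sub>0 \<longrightarrow> X \<phi> \<epsilon> \<in> K"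
    using K(3)[OF test_objs_SKI] by (intro ballI exI[of _ 1]) simp
  moreover have "gpoint_rel \<Omega> `` {X} \<in> gen_points \<Omega>"
    unfolding gen_points_def quotient_def using X by blast
  ultimately show "gpoint_rel \<Omega> `` {X} \<in> compact_points \<Omega>"
    unfolding compact_points_def using XX K(1,2) by blast
qed

text \<open>\<open>gnum_rel\<close> relates moderate numbers only; without moderateness of
  \<open>R(X)\<close> its class would be empty, and equality of the point value with zero would say
  nothing about it.\<close>

lemma point_value_zero_imp_negligible:
  assumes R: "R \<in> moderate_funs \<Omega>" and X: "X \<in> moderate_points \<Omega>"
    and K: "compact K" "K \<subseteq> \<Omega>" "\<And>\<phi> \<epsilon>. \<phi> \<in> EI \<Longrightarrow> \<epsilon> \<in> unit_ivl \<Longrightarrow> X \<phi> \<epsilon> \<in> K"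
    and z: "point_value \<Omega> (gfun_rel \<Omega> `` {R}) (gpoint_rel \<Omega> `` {X}) = gnum_zero \<Omega>"
  shows "negligible_map \<Omega> (rep_value R X)"
proof -
  have Rb: "R \<in> basic_space \<Omega>"
    and Rn: "\<And>p \<phi> vs. p \<in> csn (Cinf \<Omega>) \<Longrightarrow> \<phi> \<in> test_objs \<Omega> \<Longrightarrow> set vs \<subseteq> test_objs0 \<Omega> \<Longrightarrow>
      moderate_net (\<lambda>\<epsilon>. p (differential CI R \<phi> vs \<epsilon>))"
    using R unfolding moderate_funs_def by blast+
  have Xb: "X \<in> basic_maps \<Omega>" using X unfolding moderate_points_def by blast
  have XO: "X \<phi> \<epsilon> \<in> \<Omega>" if "\<phi> \<in> EI" "\<epsilon> \<in> unit_ivl" for \<phi> \<epsilon> using K(2,3) that by blast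
  have Kev: "\<exists>K. compact K \<and> K \<subseteq> \<Omega> \<and> (\<forall>\<^sub>F \<epsilon> in at_right 0. X \<phi> \<epsilon> \<in> K)" if "\<phi> \<in> test_objs \<Omega>" for \<phi>
  proof -
    have "\<forall>\<^sub>F \<epsilon> in at_right 0. X \<phi> \<epsilon> \<in> K"
      using eventually_at_right_0 by (rule eventually_mono) (use K(3)[OF test_objs_SKI[OF that]] in simp)
    then show ?thesis using K by blast
  qed
  have "moderate_map \<Omega> (rep_value R X)"
    unfolding moderate_map_def
    by (intro ballI allI impI rep_value_growth[where growth=moderate_net, OF disjI1[OF refl] Rb Rn X Kev])
  then have m: "rep_value R X \<in> moderate_nums \<Omega>"
    using rep_value_basic_maps[OF Rb Xb XO] unfolding moderate_nums_def by blast
  have "R \<in> gfun_rel \<Omega> `` {R}" using R zero_negligible_funs by (simp add: gfun_rel_def quot_rel_def)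
  moreover have "(rep_value R X, rep_value R X) \<in> gnum_rel \<Omega>"
    using m zero_negligible_nums by (simp add: gnum_rel_def quot_rel_def)
  ultimately have "rep_value R X \<in> gnum_zero \<Omega>"
    using moderate_point_class(1)[OF X K] unfolding z[symmetric] point_value_def by blast
  then have "0 - rep_value R X \<in> negligible_nums \<Omega>" by (simp add: gnum_zero_def gnum_rel_def quot_rel_def)
  from negligible_nums_diff[OF zero_negligible_nums this] show ?thesis by (simp add: negligible_nums_def)
qed

text \<open>A supremum over a compact set is attained, so nets of points test the seminorms without
  derivatives; interpolation with the moderate bounds reaches the others.\<close>

lemma negligible_funsI:
  assumes R: "R \<in> moderate_funs \<Omega>"
    and pt: "\<And>\<phi> vs K x. \<phi> \<in> test_objs \<Omega> \<Longrightarrow> set vs \<subseteq> test_objs0 \<Omega> \<Longrightarrow> compact K \<Longrightarrow> K \<subseteq> \<Omega> \<Longrightarrow>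
      (\<And>\<epsilon>. x \<epsilon> \<in> K) \<Longrightarrow> negligible_net (\<lambda>\<epsilon>. cmod (differential CI R \<phi> vs \<epsilon> (x \<epsilon>)))"
  shows "R \<in> negligible_funs \<Omega>"
  unfolding negligible_funs_def mem_Collect_eq
proof (intro conjI ballI allI impI)
  show Rb: "R \<in> basic_space \<Omega>" using R unfolding moderate_funs_def by blast
  fix p \<phi> vs assume p: "p \<in> csn (Cinf \<Omega>)" and \<phi>: "\<phi> \<in> test_objs \<Omega>" and vs: "set vs \<subseteq> test_objs0 \<Omega>"
  define f where "f \<epsilon> = differential CI R \<phi> vs \<epsilon>" for \<epsilon>
  have f: "f \<epsilon> \<in> Cinf_funs \<Omega>" if "\<epsilon> \<in> unit_ivl" for \<epsilon>
    unfolding f_def using differential_fun(1)[OF Rb test_objs0_SKI[OF vs] test_objs_SKI[OF \<phi>] that] .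
  have neg0: "negligible_net (\<lambda>\<epsilon>. Cinf_seminorm K [] (f \<epsilon>))" if K: "compact K" "K \<subseteq> \<Omega>" for K
  proof (cases "K = {}")
    case True
    then show ?thesis by (simp add: Cinf_seminorm_def sup0_def negligible_net_0)
  next
    case False
    have "\<exists>x\<in>K. \<epsilon> \<in> unit_ivl \<longrightarrow> (\<forall>y\<in>K. cmod (f \<epsilon> y) \<le> cmod (f \<epsilon> x))" for \<epsilon>
    proof (cases "\<epsilon> \<in> unit_ivl")
      case True
      have "continuous_on \<Omega> (partial [] (f \<epsilon>))" using f[OF True] unfolding Cinf_funs_def by blast
      then have "continuous_on K (\<lambda>x. cmod (f \<epsilon> x))" using K(2) by (auto intro: continuous_on_norm continuous_on_subset)
      from continuous_attains_sup[OF K(1) False this] show ?thesis by blast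
    qed (use False in blast)
    \<comment> \<open>\<open>K\<close> is nonempty here, so a point can also be chosen for
      \<epsilon> outside the interval.\<close>
    then obtain x where x: "\<And>\<epsilon>. x \<epsilon> \<in> K" "\<And>\<epsilon> y. \<epsilon> \<in> unit_ivl \<Longrightarrow> y \<in> K \<Longrightarrow> cmod (f \<epsilon> y) \<le> cmod (f \<epsilon> (x \<epsilon>))" by metis
    have "negligible_net (\<lambda>\<epsilon>. cmod (f \<epsilon> (x \<epsilon>)))" unfolding f_def by (rule pt[OF \<phi> vs K x(1)])
    then show ?thesis
    proof (rule negligible_net_mono)
      show "\<forall>\<^sub>F \<epsilon> in at_right 0. \<bar>Cinf_seminorm K [] (f \<epsilon>)\<bar> \<le> \<bar>cmod (f \<epsilon> (x \<epsilon>))\<bar>"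
        using eventually_at_right_0
      proof eventually_elim
        case (elim \<epsilon>)
        then have \<epsilon>: "\<epsilon> \<in> unit_ivl" by simp
        have "Cinf_seminorm K [] (f \<epsilon>) \<le> cmod (f \<epsilon> (x \<epsilon>))"
          by (rule Cinf_seminorm_least) (use x(2)[OF \<epsilon>] in auto)
        moreover have "0 \<le> Cinf_seminorm K [] (f \<epsilon>)"
          unfolding Cinf_seminorm_def by (rule sup0_nonneg[OF Cinf_bdd[OF f[OF \<epsilon>] K]])
        ultimately show ?case by simp
      qed
    qed
  qed
  have mod: "moderate_net (\<lambda>\<epsilon>. Cinf_seminorm K is (f \<epsilon>))" if K: "compact K" "K \<subseteq> \<Omega>" for K "is"
  proof -
    have "Cinf_seminorm K is \<in> Cinf_seminorms \<Omega>" using K by (auto simp: Cinf_seminorms_def)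
    from Cinf_seminorms_csn[OF this] show ?thesis
      using R \<phi> vs unfolding moderate_funs_def f_def by blast
  qed
  show "negligible_net (\<lambda>\<epsilon>. p (differential CI R \<phi> vs \<epsilon>))"
    unfolding f_def[symmetric] by (rule csn_growth[OF f net_interpolation[OF f neg0 mod] p])
qed

text \<open>Any net in \<open>K\<close> is admissible: nothing relates different \<epsilon>, and the
  map is constant in the net of kernels, so its differentials of positive order are 0 and the map
  itself is bounded.\<close>

lemma eps_local_point:
  fixes x :: "real \<Rightarrow> real^'n"
  assumes K: "compact K" "K \<subseteq> \<Omega>" and x: "\<And>\<epsilon>. x \<epsilon> \<in> K"
  defines "X \<equiv> \<lambda>\<phi> \<epsilon>. if \<phi> \<in> EI \<and> \<epsilon> \<in> unit_ivl then x \<epsilon> else 0"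
  shows "X \<in> moderate_points \<Omega>" "eps_local \<Omega> X"
proof -
  let ?c = "\<lambda>\<epsilon>. if \<epsilon> \<in> unit_ivl then x \<epsilon> else 0"
  interpret N: complete_lcs "power_space (euclidean :: (real^'n) topology)" "power_seminorms {norm}"
    by (rule complete_lcs.complete_lcs_power_space[OF lcs_euclidean])
  have XE: "X \<phi> = ?c" if "\<phi> \<in> EI" for \<phi> using that by (auto simp: X_def)
  have cin: "?c \<in> topspace (power_space euclidean)" by (auto simp: topspace_power_space)
  have Xb: "X \<in> smooth_maps (SKI \<Omega>) EI (power_space euclidean)"
    unfolding smooth_maps_def
  proof (intro CollectI conjI ballI allI impI)
    show "X \<phi> \<in> topspace (power_space euclidean)" if "\<phi> \<in> EI" for \<phi> unfolding XE[OF that] by (rule cin)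
    show "X \<phi> = 0" if "\<phi> \<notin> EI" for \<phi> using that by (auto simp: X_def)
    fix c assume c: "smooth_curve (SKI \<Omega>) c \<and> range c \<subseteq> EI"
    then have "X (c t) = ?c" for t by (intro XE) blast
    then have "X \<circ> c = (\<lambda>_. ?c)" by (simp only: comp_def)
    then show "smooth_curve (power_space euclidean) (X \<circ> c)" using N.smooth_curve_const[OF cin] by simp
  qed
  have d0: "differential (power_space euclidean) X \<phi> (w # vs) = 0" if "set (w # vs) \<subseteq> EI" "\<phi> \<in> EI" for \<phi> w vs
    using that
  proof (induction vs arbitrary: \<phi> w)
    have dc: "dir_deriv (power_space euclidean) (\<lambda>_. y) \<phi> w = 0"
      if "y \<in> topspace (power_space (euclidean :: (real^'n) topology))" for y and \<phi> w :: "real \<Rightarrow> 'n kern"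
      by (rule N.dir_deriv_eqI[OF N.curve_deriv_const[OF that]])
    {
      case Nil
      have "dir_deriv (power_space euclidean) X \<phi> w = dir_deriv (power_space euclidean) (\<lambda>_. ?c) \<phi> w"
        by (rule smooth_calculus.dir_deriv_cong[OF calc_euclidean XE]) (use Nil in auto)
      then show ?case unfolding differential.simps dc[OF cin] .
    next
      case (Cons v vs)
      have "dir_deriv (power_space euclidean) (\<lambda>\<psi>. differential (power_space euclidean) X \<psi> (v # vs)) \<phi> w
          = dir_deriv (power_space euclidean) (\<lambda>_. 0) \<phi> w"
        by (rule smooth_calculus.dir_deriv_cong[OF calc_euclidean Cons.IH]) (use Cons.prems in auto)
      then show ?case by (simp only: differential.simps(2)[of _ X] dc[OF N.in_zero])
    }
  qed
  obtain B where B: "\<And>y. y \<in> K \<Longrightarrow> norm y \<le> B" using compact_imp_bounded[OF K(1)] unfolding bounded_iff by blast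
  have "moderate_map \<Omega> X" unfolding moderate_map_def
  proof (intro ballI allI impI)
    fix \<phi> vs assume \<phi>: "\<phi> \<in> test_objs \<Omega>" and vs: "set vs \<subseteq> test_objs0 \<Omega>"
    show "moderate_net (\<lambda>\<epsilon>. norm (differential (power_space euclidean) X \<phi> vs \<epsilon>))"
    proof (cases vs)
      case Nil
      have "\<bar>norm (differential (power_space euclidean) X \<phi> vs \<epsilon>)\<bar> \<le> \<bar>B\<bar>" for \<epsilon>
        using B[OF x] XE[OF test_objs_SKI[OF \<phi>]] Nil by (auto intro: order_trans[OF _ abs_ge_self])
      then show ?thesis by (intro moderate_net_bounded[of _ "\<bar>B\<bar>"] always_eventually allI)
    next
      case (Cons w us)
      then show ?thesis using d0[of w us \<phi>] test_objs0_SKI[OF vs] test_objs_SKI[OF \<phi>] moderate_net_const[of 0] by simp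
    qed
  qed
  then show "X \<in> moderate_points \<Omega>"
    unfolding moderate_points_def mem_Collect_eq basic_maps_alt
    using Xb K(2) x by (auto simp: X_def)
  show "eps_local \<Omega> X" unfolding eps_local_def using XE by simp
qed

lemma negligible_if_eps_local_values_zero:
  assumes R: "R \<in> moderate_funs \<Omega>"
    and z: "\<And>Xt. Xt \<in> compact_points_eps \<Omega> \<Longrightarrow> point_value \<Omega> (gfun_rel \<Omega> `` {R}) Xt = gnum_zero \<Omega>"
  shows "R \<in> negligible_funs \<Omega>"
proof (rule negligible_funsI[OF R])
  fix \<phi> vs K and x :: "real \<Rightarrow> real^'n"
  assume \<phi>: "\<phi> \<in> test_objs \<Omega>" and vs: "set vs \<subseteq> test_objs0 \<Omega>" and K: "compact K" "K \<subseteq> \<Omega>" and x: "\<And>\<epsilon>. x \<epsilon> \<in> K"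
  define X where "X = (\<lambda>\<phi> \<epsilon>. if \<phi> \<in> EI \<and> \<epsilon> \<in> unit_ivl then x \<epsilon> else 0)"
  have X: "X \<in> moderate_points \<Omega>" "eps_local \<Omega> X" unfolding X_def using eps_local_point[OF K x] by auto
  have XK: "X \<psi> \<epsilon> \<in> K" if "\<psi> \<in> EI" "\<epsilon> \<in> unit_ivl" for \<psi> \<epsilon> using x that by (simp add: X_def)
  have Rb: "R \<in> basic_space \<Omega>" using R unfolding moderate_funs_def by blast
  have Xb: "X \<in> basic_maps \<Omega>" using X unfolding moderate_points_def by blast
  have XO: "X \<psi> \<epsilon> \<in> \<Omega>" if "\<psi> \<in> EI" "\<epsilon> \<in> unit_ivl" for \<psi> \<epsilon> using XK[OF that] K by blast
  have "gpoint_rel \<Omega> `` {X} \<in> compact_points_eps \<Omega>"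
    unfolding compact_points_eps_def using moderate_point_class[OF X(1) K XK] X(2) by blast
  from point_value_zero_imp_negligible[OF R X(1) K XK z[OF this]]
  have "negligible_net (\<lambda>\<epsilon>. norm (differential (power_space euclidean) (rep_value R X) \<phi> vs \<epsilon>))"
    using \<phi> vs unfolding negligible_map_def by blast
  then show "negligible_net (\<lambda>\<epsilon>. cmod (differential CI R \<phi> vs \<epsilon> (x \<epsilon>)))"
  proof (rule negligible_net_mono)
    show "\<forall>\<^sub>F \<epsilon> in at_right 0. \<bar>cmod (differential CI R \<phi> vs \<epsilon> (x \<epsilon>))\<bar> \<le>
        \<bar>norm (differential (power_space euclidean) (rep_value R X) \<phi> vs \<epsilon>)\<bar>"
      using eventually_at_right_0
    proof eventually_elim
      case (elim \<epsilon>)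
      then have \<epsilon>: "\<epsilon> \<in> unit_ivl" by simp
      have "differential (power_space euclidean) (rep_value R X) \<phi> vs \<epsilon> = differential CI R \<phi> vs \<epsilon> (x \<epsilon>)"
      \<comment> \<open>The point is constant at each \<epsilon> on the whole space, so
        \<open>W\<close> is \<open>EI\<close>.\<close>
      proof (rule differential_rep_value_locally_constant[OF Rb Xb XO order_refl _ \<epsilon> _ test_objs0_SKI[OF vs] test_objs_SKI[OF \<phi>]])
        show "\<forall>\<^sub>F s in nhds 0. \<psi> + s *\<^sub>R w \<in> EI" if "\<psi> \<in> EI" "w \<in> EI" for \<psi> w
          using line_in_EI[OF that] by simp
        show "X \<psi> \<epsilon> = x \<epsilon>" if "\<psi> \<in> EI" for \<psi> using that \<epsilon> by (simp add: X_def)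
      qed
      then show ?case by simp
    qed
  qed
qed

end

subsection \<open>A functional that is unbounded along a net of kernels\<close>

text \<open>
  Gliding hump: the sign of the \<open>k\<close>-th summand is chosen so that it does not cancel the previous
  ones, and the weights decay so fast that the later summands take away at most half of it.
\<close>

lemma gliding_hump:
  fixes g :: "nat \<Rightarrow> 'a \<Rightarrow> complex"
  assumes max: "\<And>k j. cmod (g k (y j)) \<le> cmod (g k (y k))"
  shows "\<exists>s. (\<forall>k. cmod (s k) \<le> 1) \<and>
    (\<forall>k. (1/3)^k * cmod (g k (y k)) \<le> 2 * \<bar>Re (\<Sum>j. (1/3)^j * s j * g k (y j))\<bar>)"
proof -
  define a where "a s k j = (1/3)^j * s j * g k (y j)" for s :: "nat \<Rightarrow> complex" and k j
  \<comment> \<open>The admissibility of the \<open>k\<close>-th sign depends on the signs chosen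
    before, which calls for dependent choice.\<close>
  define Q where "Q s k r \<longleftrightarrow> cmod r \<le> 1 \<and>
    (1/3)^k * cmod (g k (y k)) \<le> \<bar>Re ((\<Sum>j<k. a s k j) + (1/3)^k * r * g k (y k))\<bar>" for s k r
  have "\<exists>s. \<forall>k. Q s k (s k)"
  proof (rule dependent_wellorder_choice)
    show "Q s k r = Q s' k r" if "\<And>j. j < k \<Longrightarrow> s j = s' j" for r s s' k
    proof -
      have "(\<Sum>j<k. a s k j) = (\<Sum>j<k. a s' k j)" using that by (intro sum.cong) (auto simp: a_def)
      then show ?thesis by (simp add: Q_def)
    qed
    show "\<exists>r. Q s k r" for s k
    proof -
      define z where "z = g k (y k)"
      define A where "A = Re (\<Sum>j<k. a s k j)"
      \<comment> \<open>\<open>cnj (sgn z)\<close> turns the new summand into a nonnegative real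
        number, and \<sigma> gives it the sign of the real part accumulated so far.\<close>
      define \<sigma> :: real where "\<sigma> = (if 0 \<le> A then 1 else -1)"
      define r where "r = of_real \<sigma> * cnj (sgn z)"
      have "cnj (sgn z) * z = of_real (cmod z)"
      proof (cases "z = 0")
        case False
        have "cnj (sgn z) * z = of_real (inverse (cmod z)) * (z * cnj z)" by (simp add: sgn_div_norm scaleR_conv_of_real divide_inverse)
        also have "z * cnj z = of_real ((cmod z)\<^sup>2)" by (rule complex_norm_square[symmetric])
        finally show ?thesis using False by (simp add: power2_eq_square)
      qed simp
      then have "(1/3)^k * r * z = of_real ((1/3)^k * \<sigma> * cmod z)" by (simp add: r_def mult.assoc)
      then have "Re ((\<Sum>j<k. a s k j) + (1/3)^k * r * z) = A + \<sigma> * ((1/3)^k * cmod z)"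
        by (simp only: plus_complex.sel Re_complex_of_real A_def) (simp add: mult_ac)
      moreover have "(1/3)^k * cmod z \<le> \<bar>A + \<sigma> * ((1/3)^k * cmod z)\<bar>" by (auto simp: \<sigma>_def)
      moreover have "cmod r \<le> 1" by (simp add: r_def norm_mult \<sigma>_def norm_sgn)
      ultimately show ?thesis unfolding Q_def z_def[symmetric] by metis
    qed
  qed
  then obtain s where s: "\<And>k. Q s k (s k)" by blast
  have s1: "cmod (s k) \<le> 1" for k using s[of k] by (simp add: Q_def)
  have "(1/3)^k * cmod (g k (y k)) \<le> 2 * \<bar>Re (\<Sum>j. a s k j)\<bar>" for k
  proof -
    let ?M = "cmod (g k (y k))"
    have na: "norm (a s k j) \<le> (1/3)^j * ?M" for j
    proof -
      have "cmod (s j) * cmod (g k (y j)) \<le> 1 * ?M" by (intro mult_mono s1 max) auto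
      then show ?thesis by (simp add: a_def norm_mult norm_power norm_divide mult.assoc)
    qed
    have sg: "summable (\<lambda>j. (1/3)^j * ?M)" by (intro summable_mult2 summable_geometric) simp
    then have sa: "summable (a s k)" by (rule summable_comparison_test'[of _ 0]) (use na in auto)
    \<comment> \<open>With ratio 1/3 the weights after the \<open>k\<close>-th add up to half of the
      \<open>k\<close>-th. Their coefficients are no larger than at \<open>y k\<close>, where
      \<open>g k\<close> is maximal among the chosen points.\<close>
    have "norm (\<Sum>j. a s k (j + Suc k)) \<le> (\<Sum>j. (1/3)^(j + Suc k) * ?M)"
      by (rule norm_suminf_le[OF na summable_ignore_initial_segment[OF sg]])
    also have "\<dots> = (\<Sum>j. ((1/3)^Suc k * ?M) * (1/3)^j)" by (simp add: power_add mult_ac)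
    also have "\<dots> = ((1/3)^Suc k * ?M) * (3/2)"
      by (subst suminf_mult) (simp_all add: suminf_geometric)
    finally have "norm (\<Sum>j. a s k (j + Suc k)) \<le> (1/3)^k * ?M / 2" by simp
    then have 1: "\<bar>Re (\<Sum>j. a s k (j + Suc k))\<bar> \<le> (1/3)^k * ?M / 2" using abs_Re_le_cmod order_trans by blast
    have "(\<Sum>j. a s k j) = (\<Sum>j. a s k (j + Suc k)) + ((\<Sum>j<k. a s k j) + a s k k)"
      using suminf_split_initial_segment[OF sa, of "Suc k"] by simp
    then have "Re (\<Sum>j. a s k j) = Re (\<Sum>j. a s k (j + Suc k)) + Re ((\<Sum>j<k. a s k j) + a s k k)" by simp
    moreover have "(1/3)^k * ?M \<le> \<bar>Re ((\<Sum>j<k. a s k j) + a s k k)\<bar>"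
      using s[of k] unfolding Q_def by (simp only: a_def[of s k k])
    ultimately show ?thesis using 1 by linarith
  qed
  then show ?thesis using s1 unfolding a_def by blast
qed

text \<open>The condition links consecutive indices, as needed when each term has to be large
  compared with the one before.\<close>

lemma dependent_subseq:
  assumes "\<And>k m. \<forall>\<^sub>F n in sequentially. P k m n"
  shows "\<exists>\<sigma>. strict_mono \<sigma> \<and> (\<forall>k::nat. P k (\<sigma> k) (\<sigma> (Suc k)))"
proof -
  have "\<exists>\<sigma>. \<forall>k. True \<and> (\<sigma> k < \<sigma> (Suc k) \<and> P k (\<sigma> k) (\<sigma> (Suc k)))"
  proof (rule dependent_nat_choice)
    fix m k
    have "\<forall>\<^sub>F n in sequentially. m < n \<and> P k m n" using assms eventually_gt_at_top by (rule eventually_conj[rotated])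
    then show "\<exists>n. True \<and> (m < n \<and> P k m n)" using eventually_happens'[OF sequentially_bot] by blast
  qed simp
  then show ?thesis unfolding strict_mono_Suc_iff by blast
qed

text \<open>A sum of bumps centred at \<open>l n\<close> with weights \<open>x n - x0\<close>. Since
  all bumps have the same width, summability of the weights bounds every derivative on the whole
  line, wherever the centres lie; the gaps make the bumps disjoint.\<close>

lemma interpolating_curve:
  fixes x :: "nat \<Rightarrow> 'a::banach" and l :: "nat \<Rightarrow> real"
  assumes sep: "\<And>k. \<bar>l k\<bar> + 4 \<le> \<bar>l (Suc k)\<bar>" and x: "\<And>k. norm (x k - x0) \<le> r * (1/2)^k / 2"
  shows "\<exists>Z C. derivs euclidean Z \<and> (\<forall>k s. norm (Z k s) \<le> C k) \<and> (\<forall>s. norm (Z 0 s - x0) \<le> r) \<and>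
    (\<forall>k s. \<bar>s - l k\<bar> \<le> 1 \<longrightarrow> Z 0 s = x k)"
proof -
  obtain D where D: "D 0 = bump" "derivs euclideanreal D" using smooth_bump unfolding smooth_curve_derivs by blast
  have "\<exists>c. \<forall>t. \<bar>D k t\<bar> \<le> c" for k
    by (rule compact_support_derivs_bounded[OF D(2), of 2]) (simp add: D(1) bump_eq_0)
  then obtain c where c: "\<And>k t. \<bar>D k t\<bar> \<le> c k" by metis
  \<comment> \<open>At order 0 the constant has to be exactly 1, since it decides whether the curve
    stays within \<open>r\<close> of \<open>x0\<close>; the weights add up to at most
    \<open>r\<close>.\<close>
  define C where "C k = (if k = 0 then 1 else c k)" for k :: nat
  have C: "\<bar>D k t\<bar> \<le> C k" for k t using c bump_range(3) by (simp add: C_def D(1))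
  define w where "w n = x n - x0" for n
  define S where "S k t = (\<Sum>n. (1 ^ k * D k (1 * t + - l n)) *\<^sub>R w n)" for k t
  have geo: "summable (\<lambda>n. r * (1/2)^n / 2)" by (intro summable_divide summable_mult summable_geometric) simp
  have sw: "summable (\<lambda>n. norm (w n))"
    by (rule summable_comparison_test'[OF geo, of 0]) (use x in \<open>simp add: w_def\<close>)
  then have sm: "summable (\<lambda>n. \<bar>1\<bar> ^ k * norm (w n))" for k by simp
  have S: "derivs euclidean S" "norm (S k t) \<le> C k * (\<Sum>n. norm (w n))" for k t
    using smooth_series[OF D(2) C, where a="\<lambda>_. 1" and b="\<lambda>n. - l n", OF sm] by (simp_all add: S_def[abs_def])
  have "(\<Sum>n. norm (w n)) \<le> (\<Sum>n. r * (1/2)^n / 2)" by (intro suminf_le sw geo) (use x in \<open>simp add: w_def\<close>)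
  also have "\<dots> = (\<Sum>n. (r / 2) * (1/2)^n)" by simp
  also have "\<dots> = r" by (subst suminf_mult) (simp_all add: suminf_geometric)
  finally have wr: "(\<Sum>n. norm (w n)) \<le> r" .
  have mono: "\<bar>l m\<bar> + 4 \<le> \<bar>l n\<bar>" if "m < n" for m n
    using that
  proof (induction n)
    case (Suc n) then show ?case using sep[of n] by (cases "m = n") auto
  qed simp
  have bz: "bump (t - l n) = 0" if "\<bar>t - l k\<bar> \<le> 1" "n \<noteq> k" for t k n
    using that mono[of n k] mono[of k n] by (intro bump_eq_0) (cases n k rule: linorder_cases; linarith)
  have S0: "S 0 t = w k" if t: "\<bar>t - l k\<bar> \<le> 1" for t k
  proof -
    have "S 0 t = (\<Sum>n\<in>{k}. bump (t - l n) *\<^sub>R w n)"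
      unfolding S_def D(1) by (subst suminf_finite[of "{k}"]) (use bz[OF t] in auto)
    then show ?thesis using bump_eq_1[OF t] by simp
  qed
  define Z where "Z k t = S k t + (if k = 0 then x0 else 0)" for k t
  have "derivs euclidean Z"
    using S(1) unfolding derivs_def curve_deriv_euclidean Z_def
    by (auto intro!: derivative_eq_intros has_vector_derivative_add_const[THEN iffD2])
  moreover have "norm (Z k t) \<le> C k * (\<Sum>n. norm (w n)) + norm x0" for k t
    unfolding Z_def by (intro norm_triangle_mono[OF S(2)]) simp
  moreover have "norm (Z 0 t - x0) \<le> r" for t using S(2)[of 0 t] wr by (simp add: Z_def C_def)
  moreover have "Z 0 t = x k" if "\<bar>t - l k\<bar> \<le> 1" for k t using S0[OF that] by (simp add: Z_def w_def)
  ultimately show ?thesis by (intro exI[of _ Z] exI[of _ "\<lambda>k. C k * (\<Sum>n. norm (w n)) + norm x0"]) blast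
qed

lemma (in lcs) smooth_curve_functional:
  assumes add: "\<And>x y. x \<in> topspace T \<Longrightarrow> y \<in> topspace T \<Longrightarrow> l (x + y) = l x + l y"
    and scale: "\<And>r x. x \<in> topspace T \<Longrightarrow> l (r *\<^sub>R x) = r * l x"
    and p: "p \<in> P" "\<And>x. x \<in> topspace T \<Longrightarrow> \<bar>l x\<bar> \<le> p x" and c: "smooth_curve T c"
  shows "smooth_curve euclideanreal (\<lambda>t. l (c t))"
proof -
  obtain D where D: "D 0 = c" "derivs T D" using c unfolding smooth_curve_derivs by (elim exE conjE)
  have Din: "D k t \<in> topspace T" for k t by (rule derivs_in[OF D(2)])
  have diff: "l (x - y) = l x - l y" if "x \<in> topspace T" "y \<in> topspace T" for x y
    using add[OF subspace_diff[OF subspace that] that(2)] by simp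
  have "curve_deriv euclideanreal (\<lambda>t. l (D k t)) t (l (D (Suc k) t))" for k t
  proof -
    let ?q = "\<lambda>h. inverse h *\<^sub>R (D k (t + h) - D k t)"
    have qin: "?q h \<in> topspace T" for h by (intro in_scale subspace_diff[OF subspace] Din)
    have "curve_deriv T (D k) t (D (Suc k) t)" using D(2) unfolding derivs_def by blast
    then have lim: "((\<lambda>h. p (?q h - D (Suc k) t)) \<longlongrightarrow> 0) (at 0)"
      using p(1) unfolding curve_deriv_def limitin_iff by blast
    have "((\<lambda>h. l (?q h) - l (D (Suc k) t)) \<longlongrightarrow> 0) (at 0)"
    proof (rule Lim_null_comparison[OF always_eventually lim], intro allI)
      fix h
      show "norm (l (?q h) - l (D (Suc k) t)) \<le> p (?q h - D (Suc k) t)"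
        using p(2)[OF subspace_diff[OF subspace qin Din]] by (simp add: diff[OF qin Din])
    qed
    then have "((\<lambda>h. l (?q h)) \<longlongrightarrow> l (D (Suc k) t)) (at 0)" by (rule LIM_zero_cancel)
    moreover have "l (?q h) = (l (D k (t + h)) - l (D k t)) / h" for h
      by (simp add: scale[OF subspace_diff[OF subspace Din Din]] diff[OF Din Din] divide_inverse mult.commute)
    ultimately show ?thesis unfolding curve_deriv_real DERIV_def by simp
  qed
  then have "derivs euclideanreal (\<lambda>k t. l (D k t))" unfolding derivs_def by simp
  then show ?thesis unfolding smooth_curve_derivs using D(1) by (intro exI[of _ "\<lambda>k t. l (D k t)"]) simp
qed

section \<open>Distributions and operator seminorms at a single argument\<close>

lemma sup0_singleton: "sup0 {f v | v. v \<in> {a}} = max 0 (f a)"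
proof -
  have "insert 0 {f v | v. v \<in> {a}} = {0, f a}" by auto
  then show ?thesis unfolding sup0_def by (simp add: cSup_insert sup_max)
qed

context open_set
begin

lemma topspace_Distr: "topspace (Distr \<Omega>) = lin_maps (Dspace \<Omega>) euclidean"
  unfolding Distr_def lin_space_def topspace_seminorm_topology ..

text \<open>An estimate without derivatives on each set of functions with support in
  \<open>K\<close> makes the modulus of \<open>u\<close> a continuous seminorm, from which
  continuity of \<open>u\<close> follows. The seminorm is recorded because it yields a seminorm of
  \<open>SK \<Omega>\<close> that controls \<open>u (\<phi> x)\<close>.\<close>

lemma distributionI:
  assumes add: "\<And>f g. f \<in> test_funs \<Omega> \<Longrightarrow> g \<in> test_funs \<Omega> \<Longrightarrow> u (f + g) = u f + u g"
    and scale: "\<And>c f. f \<in> test_funs \<Omega> \<Longrightarrow> u (c *\<^sub>C f) = c * u f"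
    and zero: "\<And>f. f \<notin> test_funs \<Omega> \<Longrightarrow> u f = 0"
    and bound: "\<And>K. compact K \<Longrightarrow> K \<subseteq> \<Omega> \<Longrightarrow>
      \<exists>L C. compact L \<and> L \<subseteq> \<Omega> \<and> 0 \<le> C \<and> (\<forall>f\<in>test_funs \<Omega>. fsupp f \<subseteq> K \<longrightarrow> cmod (u f) \<le> C * Cinf_seminorm L [] f)"
  shows "u \<in> topspace (Distr \<Omega>)" "(\<lambda>f. cmod (u f)) \<in> csn (Dspace \<Omega>)"
proof -
  let ?q = "\<lambda>f. cmod (u f)"
  have q: "?q \<in> D_seminorms \<Omega>"
  proof (rule D_seminormsI)
    show "seminorm_on (test_funs \<Omega>) ?q"
      unfolding seminorm_on_def using add scale by (simp add: norm_triangle_ineq norm_mult)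
    fix K assume "compact K" "K \<subseteq> \<Omega>"
    from bound[OF this] obtain L C where L: "compact L" "L \<subseteq> \<Omega>" and C: "0 \<le> C"
      "\<forall>f\<in>test_funs \<Omega>. fsupp f \<subseteq> K \<longrightarrow> cmod (u f) \<le> C * Cinf_seminorm L [] f" by (elim exE conjE)
    have "Cinf_seminorm L [] \<in> Cinf_seminorms \<Omega>" using L by (auto simp: Cinf_seminorms_def)
    with C show "\<exists>C p. p \<in> Cinf_seminorms \<Omega> \<and> 0 \<le> C \<and> (\<forall>f\<in>test_funs \<Omega>. fsupp f \<subseteq> K \<longrightarrow> ?q f \<le> C * p f)"
      by (intro exI[of _ C] exI[of _ "Cinf_seminorm L []"]) blast
  qed
  then show "?q \<in> csn (Dspace \<Omega>)" by (rule D_seminorms_csn)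
  have diff: "u f - u g = u (f - g)" if "f \<in> test_funs \<Omega>" "g \<in> test_funs \<Omega>" for f g
    using add[OF test_funs_diff[OF that] that(2)] by simp
  have "continuous_map (Dspace \<Omega>) euclidean u"
    unfolding continuous_map topspace_Dspace
  proof (intro conjI allI impI)
    fix U :: "complex set" assume "openin euclidean U"
    then have U: "open U" by simp
    show "openin (Dspace \<Omega>) {f \<in> test_funs \<Omega>. u f \<in> U}"
    proof (subst openin_subopen, intro ballI)
      fix f assume f: "f \<in> {f \<in> test_funs \<Omega>. u f \<in> U}"
      then obtain e where e: "e > 0" "ball (u f) e \<subseteq> U" using U open_contains_ball by blast
      have "openin (Dspace \<Omega>) {g \<in> test_funs \<Omega>. ?q (g - f) < e}"
        unfolding Dspace_alt using f e(1) by (intro openin_seminorm_ball[OF q]) auto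
      moreover have "f \<in> {g \<in> test_funs \<Omega>. ?q (g - f) < e}" using f e(1) diff[of f f] by simp
      moreover have "{g \<in> test_funs \<Omega>. ?q (g - f) < e} \<subseteq> {f \<in> test_funs \<Omega>. u f \<in> U}"
      proof safe
        fix g assume g: "g \<in> test_funs \<Omega>" "?q (g - f) < e"
        have "dist (u g) (u f) < e" using g f diff[of g f] by (simp add: dist_norm)
        then have "u g \<in> ball (u f) e" by (simp add: dist_commute)
        then show "u g \<in> U" using e(2) by blast
      qed
      ultimately show "\<exists>S. openin (Dspace \<Omega>) S \<and> f \<in> S \<and> S \<subseteq> {f \<in> test_funs \<Omega>. u f \<in> U}" by blast
    qed
  qed simp
  then show "u \<in> topspace (Distr \<Omega>)"
    unfolding topspace_Distr lin_maps_def topspace_Dspace using add scale zero by (simp add: scaleC_complex_def)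
qed

text \<open>A finite complex measure made of point masses in the compact set \<open>K\<close>, hence
  a distribution of order 0; the seminorm over \<open>K\<close> bounds it on all test functions,
  whatever their support. The factor 3/2 is the sum of the weights.\<close>

lemma point_series_distribution:
  assumes K: "compact K" "K \<subseteq> \<Omega>" and y: "\<And>j. y j \<in> K" and s: "\<And>j. cmod (s j) \<le> 1"
  defines "u \<equiv> \<lambda>f. if f \<in> test_funs \<Omega> then \<Sum>j. (1/3)^j * s j * f (y j) else 0"
  shows "u \<in> topspace (Distr \<Omega>)" "(\<lambda>f. cmod (u f)) \<in> csn (Dspace \<Omega>)"
    and "\<And>f B. (\<And>j. cmod (f (y j)) \<le> B) \<Longrightarrow> cmod (u f) \<le> 3/2 * B"
proof -
  have trm: "norm ((1/3)^j * s j * f (y j)) \<le> B * (1/3)^j" if "\<And>j. cmod (f (y j)) \<le> B" for f :: "'n cfun" and B j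
  proof -
    have "cmod (s j) * cmod (f (y j)) \<le> 1 * B" by (intro mult_mono s that) auto
    then have "(1/3)^j * (cmod (s j) * cmod (f (y j))) \<le> (1/3)^j * (1 * B)" by (intro mult_left_mono) auto
    then show ?thesis by (simp add: norm_mult norm_power norm_divide mult_ac)
  qed
  have geo: "summable (\<lambda>j. B * (1/3)^j)" for B :: real by (intro summable_mult summable_geometric) simp
  have geo_sum: "(\<Sum>j. B * (1/3)^j) = 3/2 * B" for B :: real
    by (subst suminf_mult) (simp_all add: suminf_geometric)
  show bnd: "cmod (u f) \<le> 3/2 * B" if "\<And>j. cmod (f (y j)) \<le> B" for f B
  proof -
    have "norm (\<Sum>j. (1/3)^j * s j * f (y j)) \<le> 3/2 * B"
      unfolding geo_sum[symmetric] by (rule norm_suminf_le[OF trm[of f B, OF that] geo])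
    moreover have "0 \<le> B" using that[of 0] norm_ge_zero order_trans by blast
    ultimately show ?thesis by (simp add: u_def)
  qed
  have sem: "cmod (f (y j)) \<le> Cinf_seminorm K [] f" if "f \<in> test_funs \<Omega>" for f j
    using Cinf_seminorm_upper[OF test_funsD(1)[OF that] K y, of "[]"] by simp
  have sm: "summable (\<lambda>j. (1/3)^j * s j * f (y j))" if "f \<in> test_funs \<Omega>" for f
    by (rule summable_comparison_test'[OF geo, of 0]) (rule trm[of f, OF sem[OF that]])
  have sc: "c *\<^sub>C f \<in> test_funs \<Omega>" if "f \<in> test_funs \<Omega>" for c f
    using test_funs_linear(1)[OF that that, of c 0] by (simp add: scaleC_fun_def scaleC_complex_def)
  have A1: "u (f + g) = u f + u g" if "f \<in> test_funs \<Omega>" "g \<in> test_funs \<Omega>" for f g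
    using suminf_add[OF sm[OF that(1)] sm[OF that(2)]] that test_funs_add by (simp add: u_def distrib_left)
  have A2: "u (c *\<^sub>C f) = c * u f" if "f \<in> test_funs \<Omega>" for c f
    using suminf_mult[OF sm[OF that], of c] that sc by (simp add: u_def scaleC_fun_def scaleC_complex_def mult_ac)
  have A3: "u f = 0" if "f \<notin> test_funs \<Omega>" for f using that by (simp add: u_def)
  have A4: "\<exists>L C. compact L \<and> L \<subseteq> \<Omega> \<and> 0 \<le> C \<and>
      (\<forall>f\<in>test_funs \<Omega>. fsupp f \<subseteq> K' \<longrightarrow> cmod (u f) \<le> C * Cinf_seminorm L [] f)" for K'
    by (intro exI[of _ K] exI[of _ "3/2"] conjI K ballI impI bnd sem) simp
  note D = distributionI[of u, OF A1 A2 A3 A4]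
  show "u \<in> topspace (Distr \<Omega>)" by (rule D(1); assumption)
  show "(\<lambda>f. cmod (u f)) \<in> csn (Dspace \<Omega>)" by (rule D(2); assumption)
qed

text \<open>One-point sets are bounded. This makes the conditions on test objects, stated for
  operators, available for one distribution or one smooth function at a time.\<close>

lemma point_seminorm_csn:
  assumes v: "v \<in> topspace E" and q: "q \<in> csn (Cinf \<Omega>)"
  shows "(\<lambda>T. sup0 {q (T u) | u. u \<in> {v}}) \<in> csn (lin_space E (Cinf \<Omega>))"
  unfolding lin_space_def
proof (rule csn_seminorm_topologyI)
  have qs: "seminorm_on (Cinf_funs \<Omega>) q" using q by (simp add: csn_def topspace_Cinf)
  note rs = real_seminorm_of_seminorm_on[OF qs]
  have Tv: "T v \<in> Cinf_funs \<Omega>" if "T \<in> lin_maps E (Cinf \<Omega>)" for T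
    using that v unfolding lin_maps_def continuous_map_def topspace_Cinf by blast
  have nn: "0 \<le> q h" if "h \<in> Cinf_funs \<Omega>" for h by (rule real_seminorm_nonneg[OF subspace_Cinf_funs rs that])
  have "bounded_in E {v}" using v by (simp add: bounded_in_def)
  then show "(\<lambda>T. sup0 {q (T u) | u. u \<in> {v}}) \<in> {\<lambda>T. sup0 {q (T u) | u. u \<in> B} | B q. bounded_in E B \<and> q \<in> csn (Cinf \<Omega>)}"
    using q by blast
  show "seminorm_on (lin_maps E (Cinf \<Omega>)) (\<lambda>T. sup0 {q (T u) | u. u \<in> {v}})"
    unfolding seminorm_on_def sup0_singleton
  proof (intro conjI ballI allI)
    fix S T assume ST: "S \<in> lin_maps E (Cinf \<Omega>)" "T \<in> lin_maps E (Cinf \<Omega>)"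
    have "q (S v + T v) \<le> q (S v) + q (T v)" using qs Tv[OF ST(1)] Tv[OF ST(2)] unfolding seminorm_on_def by blast
    then show "max 0 (q ((S + T) v)) \<le> max 0 (q (S v)) + max 0 (q (T v))" by simp
  next
    fix c T assume T: "T \<in> lin_maps E (Cinf \<Omega>)"
    have "q (c *\<^sub>C T v) = cmod c * q (T v)" using qs Tv[OF T] unfolding seminorm_on_def by blast
    then show "max 0 (q ((c *\<^sub>C T) v)) = cmod c * max 0 (q (T v))"
      using nn[OF Tv[OF T]] by (simp add: scaleC_fun_def)
  qed
  show "sup0 {q (0 u) | u. u \<in> {v}} = 0" unfolding sup0_singleton using csn_zero[OF q] by simp
  fix S T assume ST: "S \<in> lin_maps E (Cinf \<Omega>)" "T \<in> lin_maps E (Cinf \<Omega>)"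
  have d: "T v - S v \<in> Cinf_funs \<Omega>" "S v - T v \<in> Cinf_funs \<Omega>" using Tv[OF ST(1)] Tv[OF ST(2)] Cinf_funs_diff by blast+
  have tri: "\<forall>x\<in>Cinf_funs \<Omega>. \<forall>y\<in>Cinf_funs \<Omega>. q (x + y) \<le> q x + q y" using qs unfolding seminorm_on_def by blast
  have "q (T v) \<le> q (S v) + q (T v - S v)"
    using bspec[OF bspec[OF tri Tv[OF ST(1)]] d(1)] by simp
  moreover have "q (S v) \<le> q (T v) + q (T v - S v)"
  proof -
    have "q (S v) \<le> q (T v) + q (S v - T v)"
      using bspec[OF bspec[OF tri Tv[OF ST(2)]] d(2)] by simp
    also have "q (S v - T v) = q (T v - S v)"
      using real_seminorm_minus[OF subspace_Cinf_funs rs d(1)] by simp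
    finally show ?thesis .
  qed
  ultimately show "\<bar>sup0 {q (T u) | u. u \<in> {v}} - sup0 {q (S u) | u. u \<in> {v}}\<bar> \<le> sup0 {q ((T - S) u) | u. u \<in> {v}}"
    unfolding sup0_singleton using nn[OF d(1)] nn[OF Tv[OF ST(1)]] nn[OF Tv[OF ST(2)]] by simp
qed

text \<open>Condition (ii) for the operators, tested on the single distribution \<open>u\<close> and
  the single point \<open>x\<close>.\<close>

lemma moderate_point_functional:
  assumes "\<phi> \<in> test_objs0 \<Omega>" and u: "u \<in> topspace (Distr \<Omega>)" and x: "x \<in> \<Omega>"
  shows "moderate_net (\<lambda>\<epsilon>. Re (u (\<phi> \<epsilon> x)))"
proof -
  have "Cinf_seminorm {x} [] \<in> Cinf_seminorms \<Omega>" using x by (auto simp: Cinf_seminorms_def)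
  note p = point_seminorm_csn[OF u Cinf_seminorms_csn[OF this]]
  have "moderate_op \<Omega> \<phi>" using assms(1) unfolding test_objs0_def by blast
  from bspec[OF this[unfolded moderate_op_def] p]
  have "moderate_net (\<lambda>\<epsilon>. sup0 {Cinf_seminorm {x} [] (smoothing_op \<Omega> (\<phi> \<epsilon>) v) | v. v \<in> {u}})"
    .
  then show ?thesis
  proof (rule moderate_net_mono, intro always_eventually allI)
    fix \<epsilon>
    have "Cinf_seminorm {x} [] (smoothing_op \<Omega> (\<phi> \<epsilon>) u) = max 0 (cmod (u (\<phi> \<epsilon> x)))"
      unfolding Cinf_seminorm_def sup0_singleton using u x by (simp add: smoothing_op_def)
    then show "\<bar>Re (u (\<phi> \<epsilon> x))\<bar> \<le> \<bar>sup0 {Cinf_seminorm {x} [] (smoothing_op \<Omega> (\<phi> \<epsilon>) v) | v. v \<in> {u}}\<bar>"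
      unfolding sup0_singleton using abs_Re_le_cmod by simp
  qed
qed

text \<open>\<open>smoothing_op\<close> is 0 by default off \<open>Distr \<Omega>\<close>, so the
  value of \<open>op_Cinf\<close> on a smooth function can be computed only once its regular
  distribution is known to be one.\<close>

lemma reg_distr_distribution:
  assumes f: "f \<in> Cinf_funs \<Omega>"
  shows "reg_distr \<Omega> f \<in> topspace (Distr \<Omega>)"
proof (rule distributionI(1))
  have cont: "continuous_on \<Omega> h" if "h \<in> Cinf_funs \<Omega>" for h
  proof -
    have "continuous_on \<Omega> (partial [] h)" using that unfolding Cinf_funs_def by blast
    then show ?thesis by simp
  qed
  have integ: "set_integrable lborel \<Omega> (\<lambda>x. f x * g x)"
    and bnd: "cmod (LINT x:\<Omega>|lborel. f x * g x) \<le> measure lborel K * Cinf_seminorm K [] f * Cinf_seminorm K [] g"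
    if g: "g \<in> test_funs \<Omega>" and K: "compact K" "K \<subseteq> \<Omega>" "fsupp g \<subseteq> K" for g K
  proof -
    \<comment> \<open>Off the support of \<open>g\<close> both sides vanish, which replaces
      \<Omega>, possibly of infinite measure, by a compact set.\<close>
    have eq: "indicator \<Omega> x *\<^sub>R (f x * g x) = indicator K x *\<^sub>R (f x * g x)" for x
      using K(2,3) fsuppI[of g x] by (auto simp: indicator_def)
    have "continuous_on K (\<lambda>x. f x * g x)"
      using cont[OF f] cont[OF test_funsD(1)[OF g]] K(2) by (intro continuous_intros) (auto intro: continuous_on_subset)
    from borel_integrable_compact[OF K(1) this]
    show "set_integrable lborel \<Omega> (\<lambda>x. f x * g x)" unfolding set_integrable_def eq .
    let ?B = "Cinf_seminorm K [] f * Cinf_seminorm K [] g"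
    have p: "cmod (f x) \<le> Cinf_seminorm K [] f" "cmod (g x) \<le> Cinf_seminorm K [] g" if "x \<in> K" for x
      using Cinf_seminorm_upper[OF f K(1,2) that, of "[]"] Cinf_seminorm_upper[OF test_funsD(1)[OF g] K(1,2) that, of "[]"] by simp_all
    have "cmod (LINT x:\<Omega>|lborel. f x * g x) \<le> (\<integral>x. norm (indicator K x *\<^sub>R (f x * g x)) \<partial>lborel)"
      unfolding set_lebesgue_integral_def eq by (rule integral_norm_bound)
    also have "\<dots> \<le> (\<integral>x. indicator K x *\<^sub>R ?B \<partial>lborel)"
    proof (rule integral_mono')
      show "integrable lborel (\<lambda>x. indicator K x *\<^sub>R ?B)" by (intro borel_integrable_compact K) simp
      fix x :: "real^'n"
      show "norm (indicator K x *\<^sub>R (f x * g x)) \<le> indicator K x *\<^sub>R ?B"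
        using p[of x] by (auto simp: indicator_def norm_mult intro!: mult_mono order_trans[OF norm_ge_zero])
      then show "0 \<le> indicator K x *\<^sub>R ?B" using norm_ge_zero order_trans by blast
    qed
    also have "\<dots> = measure lborel K * ?B" using K(1) by (simp add: emeasure_compact_finite borel_compact)
    finally show "cmod (LINT x:\<Omega>|lborel. f x * g x) \<le> measure lborel K * Cinf_seminorm K [] f * Cinf_seminorm K [] g"
      by (simp add: mult.assoc)
  qed
  note integ' = integ[OF _ test_funsD(2,3) order_refl]
  show "reg_distr \<Omega> f (g + h) = reg_distr \<Omega> f g + reg_distr \<Omega> f h" if "g \<in> test_funs \<Omega>" "h \<in> test_funs \<Omega>" for g h
    using set_integral_add(2)[OF integ'[OF that(1,1,1)] integ'[OF that(2,2,2)]] that test_funs_add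
    by (simp add: reg_distr_def topspace_Dspace distrib_left)
  show "reg_distr \<Omega> f (c *\<^sub>C g) = c * reg_distr \<Omega> f g" if g: "g \<in> test_funs \<Omega>" for c g
  proof -
    have "c *\<^sub>C g \<in> test_funs \<Omega>"
      using test_funs_linear(1)[OF g g, of c 0] by (simp add: scaleC_fun_def scaleC_complex_def)
    then show ?thesis using g
      by (simp add: reg_distr_def topspace_Dspace scaleC_fun_def scaleC_complex_def mult.left_commute[of _ c])
  qed
  show "reg_distr \<Omega> f g = 0" if "g \<notin> test_funs \<Omega>" for g using that by (simp add: reg_distr_def topspace_Dspace)
  show "\<exists>L C. compact L \<and> L \<subseteq> \<Omega> \<and> 0 \<le> C \<and>
      (\<forall>g\<in>test_funs \<Omega>. fsupp g \<subseteq> K \<longrightarrow> cmod (reg_distr \<Omega> f g) \<le> C * Cinf_seminorm L [] g)"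
    if K: "compact K" "K \<subseteq> \<Omega>" for K
  proof (intro exI[of _ K] exI[of _ "measure lborel K * Cinf_seminorm K [] f"] conjI K ballI impI)
    show "0 \<le> measure lborel K * Cinf_seminorm K [] f"
      unfolding Cinf_seminorm_def by (intro mult_nonneg_nonneg sup0_nonneg[OF Cinf_bdd[OF f K]]) simp
    show "cmod (reg_distr \<Omega> f g) \<le> measure lborel K * Cinf_seminorm K [] f * Cinf_seminorm K [] g"
      if "g \<in> test_funs \<Omega>" "fsupp g \<subseteq> K" for g
      using bnd[OF that(1) K that(2)] that(1) by (simp add: reg_distr_def topspace_Dspace)
  qed
qed

text \<open>The constant function 1, put to 0 outside \<Omega> as membership requires; applied to
  it, the operator of a kernel gives the integral of the kernel.\<close>

lemma indicator_Cinf_funs: "(\<lambda>x. if x \<in> \<Omega> then 1 else 0) \<in> Cinf_funs \<Omega>"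
proof -
  let ?f = "\<lambda>x. if x \<in> \<Omega> then 1 else 0 :: complex"
  have P: "partial is ?f x = (if is = [] then 1 else 0)" if "x \<in> \<Omega>" for "is" x
    using that
  proof (induction "is" arbitrary: x)
    case (Cons i "is")
    have "\<forall>\<^sub>F t in nhds 0. x + t *\<^sub>R axis i 1 \<in> \<Omega>" by (rule eventually_line_in[of x 0]) (simp add: Cons.prems)
    then have "\<forall>\<^sub>F t in nhds 0. partial is ?f (x + t *\<^sub>R axis i 1) = (if is = [] then 1 else 0)"
      by eventually_elim (rule Cons.IH)
    from has_vector_derivative_cong_nhds[OF this]
    have "((\<lambda>t. partial is ?f (x + t *\<^sub>R axis i 1)) has_vector_derivative 0) (at 0)" by simp
    from vector_derivative_at[OF this] show ?case by (simp add: partial.simps(2))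
  qed simp
  show ?thesis unfolding Cinf_funs_def
  proof (intro CollectI conjI allI impI ballI)
    show "continuous_on \<Omega> (partial is ?f)" for "is"
    proof -
      have "continuous_on \<Omega> (partial is ?f) \<longleftrightarrow> continuous_on \<Omega> (\<lambda>_. if is = [] then 1 else 0 :: complex)"
        by (rule continuous_on_cong[OF refl P])
      then show ?thesis by simp
    qed
    fix "is" i x assume x: "x \<in> \<Omega>"
    have "\<forall>\<^sub>F t in nhds 0. x + t *\<^sub>R axis i 1 \<in> \<Omega>" by (rule eventually_line_in[of x 0]) (simp add: x)
    then have "\<forall>\<^sub>F t in nhds 0. partial is ?f (x + t *\<^sub>R axis i 1) = (if is = [] then 1 else 0)"
      by eventually_elim (rule P)
    from has_vector_derivative_cong_nhds[OF this]
    have "((\<lambda>t. partial is ?f (x + t *\<^sub>R axis i 1)) has_vector_derivative 0) (at 0)" by simp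
    then show "(\<lambda>t. partial is ?f (x + t *\<^sub>R axis i 1)) differentiable at 0" by (rule differentiableI_vector)
  qed simp
qed

lemma kernel_in_SK: "\<phi> \<in> EI \<Longrightarrow> \<epsilon> \<in> unit_ivl \<Longrightarrow> \<phi> \<epsilon> \<in> SK_funs"
  unfolding topspace_power_space topspace_SK by blast

lemma SK_test_fun: "\<phi> \<in> SK_funs \<Longrightarrow> x \<in> \<Omega> \<Longrightarrow> \<phi> x \<in> test_funs \<Omega>"
  unfolding smooth_maps_def mem_Collect_eq topspace_Dspace by blast

lemmas kernel_test_fun = SK_test_fun[OF kernel_in_SK]

text \<open>The integral of \<open>\<phi> \<epsilon> x\<close> tends to 1 while its support shrinks to \<open>x\<close>.\<close>

lemma test_objs_unbounded:
  assumes \<phi>: "\<phi> \<in> test_objs \<Omega>" and x: "x \<in> \<Omega>" and r: "0 < r"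
  shows "\<forall>\<^sub>F \<epsilon> in at_right 0. \<exists>y\<in>cball x r. M \<le> cmod (\<phi> \<epsilon> x y)"
proof -
  let ?f = "\<lambda>x. if x \<in> \<Omega> then 1 else 0 :: complex" and ?q = "Cinf_seminorm {x} []"
  have "?q \<in> Cinf_seminorms \<Omega>" using x by (auto simp: Cinf_seminorms_def)
  moreover have fC: "?f \<in> topspace (Cinf \<Omega>)" unfolding topspace_Cinf by (rule indicator_Cinf_funs)
  ultimately have p: "(\<lambda>T. sup0 {?q (T u) | u. u \<in> {?f}}) \<in> csn (lin_space (Cinf \<Omega>) (Cinf \<Omega>))"
    by (intro point_seminorm_csn Cinf_seminorms_csn)
  have "\<forall>p\<in>csn (lin_space (Cinf \<Omega>) (Cinf \<Omega>)). negligible_net (\<lambda>\<epsilon>. p (op_Cinf \<Omega> (\<phi> \<epsilon>) - id_on (Cinf \<Omega>)))"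
    using \<phi> unfolding test_objs_def by blast
  from bspec[OF this p] have "negligible_net (\<lambda>\<epsilon>. sup0 {?q ((op_Cinf \<Omega> (\<phi> \<epsilon>) - id_on (Cinf \<Omega>)) u) | u. u \<in> {?f}})"
    .
  from this[unfolded negligible_net_iff, rule_format, of 1]
  obtain C where C: "\<forall>\<^sub>F \<epsilon> in at_right 0. \<bar>sup0 {?q ((op_Cinf \<Omega> (\<phi> \<epsilon>) - id_on (Cinf \<Omega>)) u) | u. u \<in> {?f}}\<bar> \<le> C * \<epsilon> ^ 1"
    by (elim exE)
  define V where "V = unit_ball_vol (real DIM(real^'n))"
  have V: "0 < V" by (simp add: V_def)
  \<comment> \<open>The last entry makes \<open>\<bar>M\<bar> + 1\<close> times the volume of the
    ball at most 1/4, below the lower bound 1/2 for the integral; \<open>\<rho> \<le> 1\<close>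
    allows the power of \<rho> in the volume to be replaced by \<rho>.\<close>
  define \<rho> where "\<rho> = Min {r, 1, 1 / (4 * (\<bar>M\<bar> + 1) * V)}"
  have \<rho>: "0 < \<rho>" "\<rho> \<le> r" "\<rho> \<le> 1" "\<rho> \<le> 1 / (4 * (\<bar>M\<bar> + 1) * V)" using r V by (auto simp: \<rho>_def)
  have vol: "(\<bar>M\<bar> + 1) * measure lborel (cball x \<rho>) \<le> 1/4"
  proof -
    have "measure lborel (cball x \<rho>) = V * \<rho> ^ DIM(real^'n)" unfolding V_def using \<rho> by (intro content_cball) simp
    also have "\<dots> \<le> V * \<rho> ^ 1" using \<rho> V by (intro mult_left_mono power_decreasing) auto
    finally have "measure lborel (cball x \<rho>) \<le> V * \<rho>" by simp
    also have "\<dots> \<le> V * (1 / (4 * (\<bar>M\<bar> + 1) * V))" using \<rho>(4) V by (intro mult_left_mono) auto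
    also have "\<dots> = 1 / (4 * (\<bar>M\<bar> + 1))" using V by simp
    finally have "(\<bar>M\<bar> + 1) * measure lborel (cball x \<rho>) \<le> (\<bar>M\<bar> + 1) * (1 / (4 * (\<bar>M\<bar> + 1)))"
      by (intro mult_left_mono) auto
    also have "\<dots> = 1/4" by simp
    finally show ?thesis .
  qed
  obtain W where W: "x \<in> W" "\<forall>r>0. \<exists>\<epsilon>\<^sub>0>0. \<forall>y\<in>W. \<forall>\<epsilon>\<in>unit_ivl. \<epsilon> < \<epsilon>\<^sub>0 \<longrightarrow> fsupp (\<phi> \<epsilon> y) \<subseteq> ball y r"
  proof -
    have "localizing \<Omega> \<phi>" using \<phi> unfolding test_objs_def by blast
    from bspec[OF this[unfolded localizing_def] x] that show thesis by (elim exE conjE)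
  qed
  from W(2)[rule_format, OF \<rho>(1)] obtain e where e: "e > 0"
    "\<forall>y\<in>W. \<forall>\<epsilon>\<in>unit_ivl. \<epsilon> < e \<longrightarrow> fsupp (\<phi> \<epsilon> y) \<subseteq> ball y \<rho>" by (elim exE conjE)
  \<comment> \<open>For smaller \<epsilon> the support lies in the ball of radius \<rho>, and the
    integral differs from 1 by at most 1/2.\<close>
  define d where "d = min e (1 / (2 * (\<bar>C\<bar> + 1)))"
  have "0 < d" using e by (simp add: d_def)
  then have "\<forall>\<^sub>F \<epsilon> in at_right 0. \<epsilon> < d" unfolding eventually_at_right_field by (intro exI[of _ d]) auto
  with C eventually_at_right_0 show ?thesis
  proof eventually_elim
    case (elim \<epsilon>)
    then have \<epsilon>: "\<epsilon> \<in> unit_ivl" by simp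
    have t: "\<phi> \<epsilon> x \<in> test_funs \<Omega>" by (rule kernel_test_fun[OF test_objs_SKI[OF \<phi>] \<epsilon> x])
    let ?J = "LINT y:\<Omega>|lborel. ?f y * \<phi> \<epsilon> x y"
    have "(op_Cinf \<Omega> (\<phi> \<epsilon>) - id_on (Cinf \<Omega>)) ?f x = ?J - 1"
      using reg_distr_distribution[OF indicator_Cinf_funs] t x fC
      by (simp add: op_Cinf_def id_on_def smoothing_op_def reg_distr_def topspace_Dspace)
    then have "cmod (?J - 1) \<le> sup0 {?q ((op_Cinf \<Omega> (\<phi> \<epsilon>) - id_on (Cinf \<Omega>)) u) | u. u \<in> {?f}}"
      unfolding sup0_singleton Cinf_seminorm_def by simp
    also have "\<dots> \<le> C * \<epsilon>" using elim(1) by simp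
    also have "\<dots> \<le> (\<bar>C\<bar> + 1) * (1 / (2 * (\<bar>C\<bar> + 1)))" using elim by (intro mult_mono) (auto simp: d_def)
    also have "\<dots> = 1/2" by simp
    finally have J: "1/2 \<le> cmod ?J" using norm_triangle_ineq2[of 1 "1 - ?J"] by (simp add: norm_minus_commute)
    have supp: "\<phi> \<epsilon> x y = 0" if "y \<notin> cball x \<rho>" for y
    proof (rule ccontr)
      assume "\<phi> \<epsilon> x y \<noteq> 0"
      then have "y \<in> fsupp (\<phi> \<epsilon> x)" by (rule fsuppI)
      moreover have "\<epsilon> < e" using elim(3) by (simp add: d_def)
      ultimately have "y \<in> ball x \<rho>" using e(2) W(1) \<epsilon> by blast
      then show False using that by simp
    qed
    show ?case
    proof (rule ccontr)
      assume n: "\<not> (\<exists>y\<in>cball x r. M \<le> cmod (\<phi> \<epsilon> x y))"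
      have M: "cmod (\<phi> \<epsilon> x y) \<le> \<bar>M\<bar> + 1" if "y \<in> cball x \<rho>" for y
      proof -
        have "y \<in> cball x r" using that \<rho>(2) by simp
        then have "cmod (\<phi> \<epsilon> x y) < M" using n by (meson not_le)
        then show ?thesis by linarith
      qed
      have "cmod ?J \<le> (\<integral>y. norm (indicator \<Omega> y *\<^sub>R (?f y * \<phi> \<epsilon> x y)) \<partial>lborel)"
        unfolding set_lebesgue_integral_def by (rule integral_norm_bound)
      also have "\<dots> \<le> (\<integral>y. indicator (cball x \<rho>) y *\<^sub>R (\<bar>M\<bar> + 1) \<partial>lborel)"
      proof (rule integral_mono')
        show "integrable lborel (\<lambda>y. indicator (cball x \<rho>) y *\<^sub>R (\<bar>M\<bar> + 1))" by (intro borel_integrable_compact) simp_all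
        show "norm (indicator \<Omega> y *\<^sub>R (?f y * \<phi> \<epsilon> x y)) \<le> indicator (cball x \<rho>) y *\<^sub>R (\<bar>M\<bar> + 1)" for y
        proof (cases "y \<in> cball x \<rho>")
          case True
          then show ?thesis using M[OF True] by (simp add: indicator_def)
        next
          case False
          then show ?thesis using supp[OF False] by simp
        qed
      qed simp
      also have "\<dots> = (\<bar>M\<bar> + 1) * measure lborel (cball x \<rho>)"
        by (simp add: emeasure_compact_finite mult.commute)
      finally show False using J vol by linarith
    qed
  qed
qed

end

subsection \<open>Points depending only on the kernel\<close>

context open_set
begin

lemma point_functional_linear:
  assumes u: "u \<in> topspace (Distr \<Omega>)" and x: "x \<in> \<Omega>" and \<phi>: "\<phi> \<in> SK_funs" and \<psi>: "\<psi> \<in> SK_funs"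
  shows "Re (u ((\<phi> + \<psi>) x)) = Re (u (\<phi> x)) + Re (u (\<psi> x))" "Re (u ((r *\<^sub>R \<phi>) x)) = r * Re (u (\<phi> x))"
proof -
  have t: "\<phi> x \<in> test_funs \<Omega>" "\<psi> x \<in> test_funs \<Omega>"
    by (rule SK_test_fun[OF \<phi> x], rule SK_test_fun[OF \<psi> x])
  have ul: "\<forall>f\<in>test_funs \<Omega>. \<forall>g\<in>test_funs \<Omega>. u (f + g) = u f + u g" "\<forall>c. \<forall>f\<in>test_funs \<Omega>. u (c *\<^sub>C f) = c *\<^sub>C u f"
    using u unfolding topspace_Distr lin_maps_def topspace_Dspace by blast+
  have "u ((\<phi> + \<psi>) x) = u (\<phi> x) + u (\<psi> x)" using ul(1) t by simp
  then show "Re (u ((\<phi> + \<psi>) x)) = Re (u (\<phi> x)) + Re (u (\<psi> x))" by (simp only: plus_complex.sel)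
  have "(r *\<^sub>R \<phi>) x = of_real r *\<^sub>C \<phi> x" by (simp only: scaleR_fun_def[of r \<phi>] scaleC_of_real)
  moreover have "u (of_real r *\<^sub>C \<phi> x) = of_real r * u (\<phi> x)" using ul(2) t by (simp add: scaleC_complex_def)
  ultimately have "Re (u ((r *\<^sub>R \<phi>) x)) = Re (of_real r * u (\<phi> x))" by (simp only:)
  then show "Re (u ((r *\<^sub>R \<phi>) x)) = r * Re (u (\<phi> x))" by simp
qed

lemma point_functional_line:
  assumes u: "u \<in> topspace (Distr \<Omega>)" and x: "x \<in> \<Omega>" and \<phi>: "\<phi> \<in> EI" and w: "w \<in> EI" and \<epsilon>: "\<epsilon> \<in> unit_ivl"
  shows "Re (u ((\<phi> + s *\<^sub>R w) \<epsilon> x)) = Re (u (\<phi> \<epsilon> x)) + s * Re (u (w \<epsilon> x))"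
proof -
  note k = kernel_in_SK[OF \<phi> \<epsilon>] kernel_in_SK[OF w \<epsilon>]
  have "s *\<^sub>R w \<epsilon> \<in> SK_funs"
    using lcs.in_scale[OF lcs_SK] k(2) unfolding topspace_SK by blast
  then have "Re (u ((\<phi> \<epsilon> + s *\<^sub>R w \<epsilon>) x)) = Re (u (\<phi> \<epsilon> x)) + Re (u ((s *\<^sub>R w \<epsilon>) x))"
    by (rule point_functional_linear(1)[OF u x k(1)])
  also have "Re (u ((s *\<^sub>R w \<epsilon>) x)) = s * Re (u (w \<epsilon> x))" by (rule point_functional_linear(2)[OF u x k(2) k(2)])
  also have "\<phi> \<epsilon> + s *\<^sub>R w \<epsilon> = (\<phi> + s *\<^sub>R w) \<epsilon>" by (simp only: plus_fun_def[of \<phi>] scaleR_fun_def[of s w])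
  finally show ?thesis .
qed

text \<open>The functional \<open>l\<close> sees only the kernel at \<epsilon>, and it is linear. So
  the \<open>k\<close>-th differential in given directions is the product of the values of
  \<open>l\<close> on them times the \<open>k\<close>-th derivative of the curve at
  \<open>l (\<phi> \<epsilon>)\<close>: moderate factors times a bounded one.\<close>

lemma phi_eps_local_point:
  fixes Z :: "nat \<Rightarrow> real \<Rightarrow> real^'n"
  assumes Z: "derivs euclidean Z" "\<And>k s. norm (Z k s) \<le> C k"
    and K: "compact K" "K \<subseteq> \<Omega>" "\<And>s. Z 0 s \<in> K"
    and u: "u \<in> topspace (Distr \<Omega>)" "(\<lambda>f. cmod (u f)) \<in> csn (Dspace \<Omega>)" and x: "x \<in> \<Omega>"
  defines "X \<equiv> \<lambda>\<phi> \<epsilon>. if \<phi> \<in> EI \<and> \<epsilon> \<in> unit_ivl then Z 0 (Re (u (\<phi> \<epsilon> x))) else 0"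
  shows "X \<in> moderate_points \<Omega>" "phi_eps_local \<Omega> X"
proof -
  interpret S: lcs "SK \<Omega>" SK_seminorms by (rule lcs_SK)
  interpret Y: lcs "euclidean :: (real^'n) topology" "{norm}" by (rule lcs_euclidean')
  interpret N: complete_lcs "power_space (euclidean :: (real^'n) topology)" "power_seminorms {norm}"
    by (rule complete_lcs.complete_lcs_power_space[OF lcs_euclidean])
  define l where "l \<psi> = Re (u (\<psi> x))" for \<psi> :: "'n kern"
  have XE: "X \<phi> \<epsilon> = Z 0 (l (\<phi> \<epsilon>))" if "\<phi> \<in> EI" "\<epsilon> \<in> unit_ivl" for \<phi> \<epsilon> using that by (simp add: X_def l_def)
  \<comment> \<open>The seminorm of \<open>SK \<Omega>\<close> belonging to the compact set
    \<open>{x}\<close>, no derivatives, and the seminorm \<open>cmod (u f)\<close> of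
    \<open>Dspace \<Omega>\<close>; it dominates \<open>l\<close>.\<close>
  define p where "p \<phi> = sup0 {cmod (u (differential (Dspace \<Omega>) \<phi> y (map (\<lambda>i. axis i 1) []))) | y. y \<in> {x}}" for \<phi> :: "'n kern"
  have p: "p \<in> SK_seminorms"
    unfolding SK_seminorms_def mem_Collect_eq
    by (rule exI[of _ "{x}"], rule exI[of _ "[]"], rule exI[of _ "\<lambda>f. cmod (u f)"]) (use u(2) x in \<open>simp add: p_def[abs_def]\<close>)
  have lp: "\<bar>l \<psi>\<bar> \<le> p \<psi>" for \<psi> unfolding p_def sup0_singleton l_def using abs_Re_le_cmod[of "u (\<psi> x)"] by simp
  have smooth_l: "smooth_curve euclideanreal (\<lambda>t. l (c t))" if "smooth_curve (SK \<Omega>) c" for c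
  proof (rule S.smooth_curve_functional[OF _ _ p lp that])
    show "l (\<phi> + \<psi>) = l \<phi> + l \<psi>" if "\<phi> \<in> topspace (SK \<Omega>)" "\<psi> \<in> topspace (SK \<Omega>)" for \<phi> \<psi>
      using that unfolding l_def topspace_SK by (rule point_functional_linear(1)[OF u(1) x])
    show "l (r *\<^sub>R \<phi>) = r * l \<phi>" if "\<phi> \<in> topspace (SK \<Omega>)" for r \<phi>
      using that unfolding l_def topspace_SK by (intro point_functional_linear(2)[OF u(1) x])
  qed
  have smooth_Z: "smooth_curve euclidean (Z 0)" unfolding smooth_curve_derivs using Z(1) by blast
  have Xb: "X \<in> smooth_maps (SKI \<Omega>) EI (power_space euclidean)"
    unfolding smooth_maps_def
  proof (intro CollectI conjI ballI allI impI)
    show "X \<phi> \<in> topspace (power_space euclidean)" for \<phi> by (auto simp: topspace_power_space X_def)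
    show "X \<phi> = 0" if "\<phi> \<notin> EI" for \<phi> using that by (auto simp: X_def)
    fix c assume c: "smooth_curve (SKI \<Omega>) c \<and> range c \<subseteq> EI"
    have "smooth_curve (power_space euclidean) (\<lambda>t. X (c t))"
    proof (rule Y.smooth_curve_powerI)
      fix \<epsilon> assume \<epsilon>: "\<epsilon> \<in> unit_ivl"
      have "smooth_curve (SK \<Omega>) (\<lambda>t. c t \<epsilon>)" using c \<epsilon> by (blast intro: smooth_curve_power_component)
      from Y.smooth_curve_compose[OF smooth_l[OF this] smooth_Z]
      have "smooth_curve euclidean (\<lambda>t. Z 0 (l (c t \<epsilon>)))" .
      moreover have "X (c t) \<epsilon> = Z 0 (l (c t \<epsilon>))" for t using c by (intro XE \<epsilon>) blast
      ultimately show "smooth_curve euclidean (\<lambda>t. X (c t) \<epsilon>)" by simp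
    qed (auto simp: X_def)
    then show "smooth_curve (power_space euclidean) (X \<circ> c)" by (simp only: comp_def)
  qed
  \<comment> \<open>The closed form of the differentials; it is written for all \<epsilon> so that
    it is an element of the power space.\<close>
  define F where "F vs \<phi> \<epsilon> = (if \<epsilon> \<in> unit_ivl then (\<Prod>v\<leftarrow>vs. l (v \<epsilon>)) *\<^sub>R Z (length vs) (l (\<phi> \<epsilon>)) else 0)"
    for vs and \<phi> :: "real \<Rightarrow> 'n kern" and \<epsilon>
  have dX: "differential (power_space euclidean) X \<phi> vs = F vs \<phi>" if "set vs \<subseteq> EI" "\<phi> \<in> EI" for \<phi> vs
    using that
  proof (induction vs arbitrary: \<phi>)
    case Nil
    have "X \<phi> \<epsilon> = F [] \<phi> \<epsilon>" for \<epsilon> using Nil(2) by (simp add: F_def X_def l_def)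
    then have "X \<phi> = F [] \<phi>" by (rule ext)
    then show ?case by (simp only: differential.simps(1))
  next
    case (Cons w vs)
    have w: "w \<in> EI" using Cons.prems by simp
    have "differential (power_space euclidean) X \<phi> (w # vs) =
        dir_deriv (power_space euclidean) (\<lambda>\<psi>. differential (power_space euclidean) X \<psi> vs) \<phi> w"
      by (rule differential.simps(2))
    also have "\<dots> = dir_deriv (power_space euclidean) (F vs) \<phi> w"
      by (rule smooth_calculus.dir_deriv_cong[OF calc_euclidean Cons.IH]) (use Cons.prems in auto)
    also have "\<dots> = F (w # vs) \<phi>"
    proof (rule N.dir_deriv_eqI, rule Y.curve_deriv_powerI)
      show "range (\<lambda>s. F vs (\<phi> + s *\<^sub>R w)) \<subseteq> topspace (power_space euclidean)" "F (w # vs) \<phi> \<in> topspace (power_space euclidean)"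
        by (auto simp: topspace_power_space F_def)
      fix \<epsilon> assume \<epsilon>: "\<epsilon> \<in> unit_ivl"
      have line: "l ((\<phi> + s *\<^sub>R w) \<epsilon>) = l (\<phi> \<epsilon>) + s * l (w \<epsilon>)" for s
        unfolding l_def by (rule point_functional_line[OF u(1) x Cons.prems(2) w \<epsilon>])
      have "curve_deriv euclidean (Z (length vs)) (l (\<phi> \<epsilon>) + 0 * l (w \<epsilon>)) (Z (Suc (length vs)) (l (\<phi> \<epsilon>) + 0 * l (w \<epsilon>)))"
        using Z(1) unfolding derivs_def by blast
      moreover have "((\<lambda>s. l (\<phi> \<epsilon>) + s * l (w \<epsilon>)) has_real_derivative l (w \<epsilon>)) (at 0)"
        by (auto intro!: derivative_eq_intros)
      ultimately have "curve_deriv euclidean (\<lambda>s. Z (length vs) (l (\<phi> \<epsilon>) + s * l (w \<epsilon>))) 0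
          (l (w \<epsilon>) *\<^sub>R Z (Suc (length vs)) (l (\<phi> \<epsilon>) + 0 * l (w \<epsilon>)))"
        by (intro Y.curve_deriv_compose) auto
      from Y.curve_deriv_scaleR[OF _ this, of "\<Prod>v\<leftarrow>vs. l (v \<epsilon>)"]
      show "curve_deriv euclidean (\<lambda>s. F vs (\<phi> + s *\<^sub>R w) \<epsilon>) 0 (F (w # vs) \<phi> \<epsilon>)"
        using \<epsilon> unfolding F_def line by (simp add: mult.commute)
    qed
    finally show ?case .
  qed
  have "moderate_map \<Omega> X" unfolding moderate_map_def
  proof (intro ballI allI impI)
    fix \<phi> vs assume \<phi>: "\<phi> \<in> test_objs \<Omega>" and vs: "set vs \<subseteq> test_objs0 \<Omega>"
    have "moderate_net (\<lambda>\<epsilon>. \<Prod>v\<leftarrow>vs. l (v \<epsilon>))"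
      using vs
    proof (induction vs)
      case Nil then show ?case using moderate_net_const by simp
    next
      case (Cons v vs)
      have "v \<in> test_objs0 \<Omega>" using Cons.prems by simp
      from moderate_net_mult[OF moderate_point_functional[OF this u(1) x] Cons.IH] Cons.prems
      show ?case by (simp add: l_def)
    qed
    then have "moderate_net (\<lambda>\<epsilon>. (\<Prod>v\<leftarrow>vs. l (v \<epsilon>)) * C (length vs))"
      by (rule moderate_net_mult[OF _ moderate_net_const])
    then show "moderate_net (\<lambda>\<epsilon>. norm (differential (power_space euclidean) X \<phi> vs \<epsilon>))"
    proof (rule moderate_net_mono, intro always_eventually allI)
      fix \<epsilon>
      have "norm (F vs \<phi> \<epsilon>) \<le> \<bar>\<Prod>v\<leftarrow>vs. l (v \<epsilon>)\<bar> * \<bar>C (length vs)\<bar>"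
        using order_trans[OF Z(2)[of "length vs" "l (\<phi> \<epsilon>)"] abs_ge_self] by (auto simp: F_def intro: mult_left_mono)
      then show "\<bar>norm (differential (power_space euclidean) X \<phi> vs \<epsilon>)\<bar> \<le> \<bar>(\<Prod>v\<leftarrow>vs. l (v \<epsilon>)) * C (length vs)\<bar>"
        unfolding dX[OF test_objs0_SKI[OF vs] test_objs_SKI[OF \<phi>]] by (simp add: abs_mult)
    qed
  qed
  then show "X \<in> moderate_points \<Omega>"
    unfolding moderate_points_def mem_Collect_eq basic_maps_alt using Xb K(2,3) XE by auto
  show "phi_eps_local \<Omega> X" unfolding phi_eps_local_def using XE by simp
qed

text \<open>Each kernel contributes a point where it is largest near \<open>x0\<close>, and
  \<open>u\<close> is a weighted sum of point masses at these. The weight \<open>(1/3)^k\<close>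
  weakens the \<open>k\<close>-th peak, but peaks are unbounded, so a sparse subsequence makes up
  for the weights and for the size of the previous value.\<close>

lemma separating_distribution:
  assumes \<phi>: "\<phi> \<in> test_objs \<Omega>" and x0: "x0 \<in> \<Omega>" and f: "filterlim f (at_right 0) sequentially"
    and fI: "\<And>n. f n \<in> unit_ivl" and x: "x \<longlonglongrightarrow> x0" and r: "0 < r"
  shows "\<exists>u \<tau>. u \<in> topspace (Distr \<Omega>) \<and> (\<lambda>f. cmod (u f)) \<in> csn (Dspace \<Omega>) \<and> strict_mono \<tau> \<and>
    (\<forall>k. \<bar>Re (u (\<phi> (f (\<tau> k)) x0))\<bar> + 4 \<le> \<bar>Re (u (\<phi> (f (\<tau> (Suc k))) x0))\<bar>) \<and>
    (\<forall>k. norm (x (\<tau> k) - x0) \<le> r * (1/2)^k / 2)"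
proof -
  obtain \<rho> where \<rho>: "0 < \<rho>" "cball x0 \<rho> \<subseteq> \<Omega>" using open_Omega x0 unfolding open_contains_cball by blast
  have t: "\<phi> (f n) x0 \<in> test_funs \<Omega>" for n by (rule kernel_test_fun[OF test_objs_SKI[OF \<phi>] fI x0])
  have "\<exists>y\<in>cball x0 \<rho>. \<forall>w\<in>cball x0 \<rho>. cmod (\<phi> (f n) x0 w) \<le> cmod (\<phi> (f n) x0 y)" for n
  proof (rule continuous_attains_sup)
    have "continuous_on \<Omega> (partial [] (\<phi> (f n) x0))" using test_funsD(1)[OF t] unfolding Cinf_funs_def by blast
    then have "continuous_on \<Omega> (\<phi> (f n) x0)" by simp
    from continuous_on_norm[OF continuous_on_subset[OF this \<rho>(2)]]
    show "continuous_on (cball x0 \<rho>) (\<lambda>w. cmod (\<phi> (f n) x0 w))" .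
  qed (use \<rho>(1) in auto)
  then obtain y where y: "\<And>n. y n \<in> cball x0 \<rho>"
    and ymax: "\<And>n w. w \<in> cball x0 \<rho> \<Longrightarrow> cmod (\<phi> (f n) x0 w) \<le> cmod (\<phi> (f n) x0 (y n))" by metis
  define M where "M n = cmod (\<phi> (f n) x0 (y n))" for n
  have M: "\<forall>\<^sub>F n in sequentially. B \<le> M n" for B
    using eventually_compose_filterlim[OF test_objs_unbounded[OF \<phi> x0 \<rho>(1), of B] f]
    by eventually_elim (auto simp: M_def intro: order_trans[OF _ ymax])
  \<comment> \<open>The hump guarantees half of the weighted peak, and the previous value is at most
    3/2 of its peak: so the new peak is asked to beat the inverse weight, the factor 2, and the
    previous value plus the gap 4.\<close>
  have "\<exists>\<sigma>. strict_mono \<sigma> \<and> (\<forall>k. 2 * 3^(k + 1) * (3/2 * M (\<sigma> k) + 4) \<le> M (\<sigma> (Suc k)) \<and>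
      norm (x (\<sigma> (Suc k)) - x0) \<le> r * (1/2)^k / 2)"
  proof (rule dependent_subseq)
    fix k m
    have "\<forall>\<^sub>F n in sequentially. dist (x n) x0 < r * (1/2)^k / 2" by (rule tendstoD[OF x]) (use r in simp)
    with M[of "2 * 3^(k + 1) * (3/2 * M m + 4)"]
    show "\<forall>\<^sub>F n in sequentially. 2 * 3^(k + 1) * (3/2 * M m + 4) \<le> M n \<and> norm (x n - x0) \<le> r * (1/2)^k / 2"
      by eventually_elim (simp add: dist_norm)
  qed
  then obtain \<sigma> where \<sigma>: "strict_mono \<sigma>" "\<And>k. 2 * 3^(k + 1) * (3/2 * M (\<sigma> k) + 4) \<le> M (\<sigma> (Suc k))"
    "\<And>k. norm (x (\<sigma> (Suc k)) - x0) \<le> r * (1/2)^k / 2" by blast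
  \<comment> \<open>Shifted by one, as closeness to \<open>x0\<close> is available only from the
    second index on. The surplus factor 3 in the growth condition comes from this shift.\<close>
  define \<tau> where "\<tau> k = \<sigma> (Suc k)" for k
  define g where "g k = \<phi> (f (\<tau> k)) x0" for k
  have gmax: "cmod (g k (y (\<tau> j))) \<le> cmod (g k (y (\<tau> k)))" for k j unfolding g_def by (rule ymax[OF y])
  obtain s where s: "\<And>k. cmod (s k) \<le> 1"
    "\<And>k. (1/3)^k * cmod (g k (y (\<tau> k))) \<le> 2 * \<bar>Re (\<Sum>j. (1/3)^j * s j * g k (y (\<tau> j)))\<bar>"
    using gliding_hump[of g "\<lambda>k. y (\<tau> k)", OF gmax] by blast
  define u where "u f = (if f \<in> test_funs \<Omega> then \<Sum>j. (1/3)^j * s j * f (y (\<tau> j)) else 0)" for f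
  note U = point_series_distribution[where y="\<lambda>j. y (\<tau> j)" and s=s, OF compact_cball \<rho>(2) y s(1), folded u_def]
  have Mg: "cmod (g k (y (\<tau> k))) = M (\<tau> k)" for k by (simp add: g_def M_def)
  have up: "\<bar>Re (u (g k))\<bar> \<le> 3/2 * M (\<tau> k)" for k
    by (rule order_trans[OF abs_Re_le_cmod U(3)]) (use gmax[of k] in \<open>simp only: Mg\<close>)
  have low: "(1/3)^k * M (\<tau> k) \<le> 2 * \<bar>Re (u (g k))\<bar>" for k
    using s(2)[of k] t[of "\<tau> k"] unfolding Mg u_def by (simp add: g_def)
  have "\<bar>Re (u (g k))\<bar> + 4 \<le> \<bar>Re (u (g (Suc k)))\<bar>" for k
  proof -
    have M0: "0 \<le> M (\<tau> k)" by (simp add: M_def)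
    have "(1/3)^Suc k * (2 * 3^(Suc k + 1) * (3/2 * M (\<tau> k) + 4)) \<le> (1/3)^Suc k * M (\<tau> (Suc k))"
      unfolding \<tau>_def by (intro mult_left_mono \<sigma>(2)) simp
    also have "\<dots> \<le> 2 * \<bar>Re (u (g (Suc k)))\<bar>" by (rule low)
    also have "(1/3 :: real)^Suc k * (2 * 3^(Suc k + 1) * (3/2 * M (\<tau> k) + 4)) = 6 * (3/2 * M (\<tau> k) + 4)"
      by (simp add: power_divide)
    finally show ?thesis using up[of k] M0 by simp
  qed
  moreover have "strict_mono \<tau>" using \<sigma>(1) unfolding \<tau>_def strict_mono_Suc_iff by simp
  moreover have "norm (x (\<tau> k) - x0) \<le> r * (1/2)^k / 2" for k unfolding \<tau>_def by (rule \<sigma>(3))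
  ultimately show ?thesis using U(1,2) unfolding g_def by blast
qed

lemma negligible_if_phi_eps_local_values_zero:
  assumes R: "R \<in> moderate_funs \<Omega>"
    and z: "\<And>Xt. Xt \<in> compact_points_phi_eps \<Omega> \<Longrightarrow> point_value \<Omega> (gfun_rel \<Omega> `` {R}) Xt = gnum_zero \<Omega>"
  shows "R \<in> negligible_funs \<Omega>"
proof (rule negligible_funsI[OF R], rule ccontr)
  fix \<phi> vs K and x :: "real \<Rightarrow> real^'n"
  assume \<phi>: "\<phi> \<in> test_objs \<Omega>" and vs: "set vs \<subseteq> test_objs0 \<Omega>" and K: "compact K" "K \<subseteq> \<Omega>" and x: "\<And>\<epsilon>. x \<epsilon> \<in> K"
  define h where "h \<epsilon> = cmod (differential CI R \<phi> vs \<epsilon> (x \<epsilon>))" for \<epsilon>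
  assume "\<not> negligible_net (\<lambda>\<epsilon>. cmod (differential CI R \<phi> vs \<epsilon> (x \<epsilon>)))"
  then obtain m where m: "\<And>C. \<not> (\<forall>\<^sub>F \<epsilon> in at_right 0. \<bar>h \<epsilon>\<bar> \<le> C * \<epsilon> ^ m)"
    unfolding negligible_net_iff h_def by blast
  \<comment> \<open>The constant \<open>n\<close> in the violated bound tends to infinity together
    with the shrinking of \<epsilon>, so the violation remains on every subsequence.\<close>
  have "\<exists>\<epsilon>. 0 < \<epsilon> \<and> \<epsilon> < inverse (real (Suc n)) \<and> real n * \<epsilon> ^ m < h \<epsilon>" for n
  proof (rule ccontr)
    assume no: "\<not> ?thesis"
    have "\<forall>\<^sub>F \<epsilon> in at_right 0. \<epsilon> < inverse (real (Suc n))"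
      unfolding eventually_at_right_field by (intro exI[of _ "inverse (real (Suc n))"]) auto
    with eventually_at_right_0 have "\<forall>\<^sub>F \<epsilon> in at_right 0. \<bar>h \<epsilon>\<bar> \<le> real n * \<epsilon> ^ m"
    proof eventually_elim
      case (elim \<epsilon>)
      then have "h \<epsilon> \<le> real n * \<epsilon> ^ m" using no by (meson not_le)
      then show ?case by (simp add: h_def)
    qed
    then show False using m by blast
  qed
  then obtain e where e: "\<And>n. 0 < e n" "\<And>n. e n < inverse (real (Suc n))" "\<And>n. real n * e n ^ m < h (e n)" by metis
  have eI: "e n \<in> unit_ivl" for n
  proof -
    have "inverse (real (Suc n)) \<le> 1" by (simp add: field_simps)
    then show ?thesis using e(1,2)[of n] by simp
  qed
  have "e \<longlonglongrightarrow> 0"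
    by (rule tendsto_sandwich[OF _ _ tendsto_const LIMSEQ_inverse_real_of_nat];
        intro always_eventually allI less_imp_le e(1,2))
  then have e0: "filterlim e (at_right 0) sequentially"
    unfolding filterlim_at using e(1) by (simp add: less_imp_neq[symmetric])
  obtain x0 r where x0: "x0 \<in> K" and r: "strict_mono r" "((\<lambda>n. x (e n)) \<circ> r) \<longlonglongrightarrow> x0"
    using compact_imp_seq_compact[OF K(1)] x unfolding seq_compact_def by metis
  have x0': "x0 \<in> \<Omega>" using x0 K by blast
  define f where "f n = e (r n)" for n
  have f0: "filterlim f (at_right 0) sequentially"
    unfolding f_def by (rule filterlim_compose[OF e0 filterlim_subseq[OF r(1)]])
  have fI: "f n \<in> unit_ivl" for n unfolding f_def by (rule eI)
  have xf: "(\<lambda>n. x (f n)) \<longlonglongrightarrow> x0" using r(2) by (simp add: comp_def f_def)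
  obtain \<rho> where \<rho>: "0 < \<rho>" "cball x0 \<rho> \<subseteq> \<Omega>" using open_Omega x0' unfolding open_contains_cball by blast
  obtain u \<tau> where u: "u \<in> topspace (Distr \<Omega>)" "(\<lambda>f. cmod (u f)) \<in> csn (Dspace \<Omega>)" and \<tau>: "strict_mono \<tau>"
    and sep: "\<forall>k. \<bar>Re (u (\<phi> (f (\<tau> k)) x0))\<bar> + 4 \<le> \<bar>Re (u (\<phi> (f (\<tau> (Suc k))) x0))\<bar>"
    and near: "\<forall>k. norm (x (f (\<tau> k)) - x0) \<le> \<rho> * (1/2)^k / 2"
    using separating_distribution[OF \<phi> x0' f0 fI xf \<rho>(1)] by (elim exE conjE)
  obtain Z C where Z: "derivs euclidean Z" "\<forall>k s. norm (Z k s) \<le> C k" "\<forall>s. norm (Z 0 s - x0) \<le> \<rho>"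
    "\<forall>k s. \<bar>s - Re (u (\<phi> (f (\<tau> k)) x0))\<bar> \<le> 1 \<longrightarrow> Z 0 s = x (f (\<tau> k))"
    using interpolating_curve[of "\<lambda>k. Re (u (\<phi> (f (\<tau> k)) x0))" "\<lambda>k. x (f (\<tau> k))", OF sep[rule_format] near[rule_format]]
    by (elim exE conjE)
  have ZK: "Z 0 s \<in> cball x0 \<rho>" for s using Z(3) by (simp add: dist_norm norm_minus_commute)
  define X where "X = (\<lambda>\<phi> \<epsilon>. if \<phi> \<in> EI \<and> \<epsilon> \<in> unit_ivl then Z 0 (Re (u (\<phi> \<epsilon> x0))) else 0)"
  have X: "X \<in> moderate_points \<Omega>" "phi_eps_local \<Omega> X"
    unfolding X_def using phi_eps_local_point[OF Z(1) Z(2)[rule_format] compact_cball \<rho>(2) ZK u x0'] by auto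
  have XK: "X \<psi> \<epsilon> \<in> cball x0 \<rho>" if "\<psi> \<in> EI" "\<epsilon> \<in> unit_ivl" for \<psi> \<epsilon> using ZK that by (simp add: X_def)
  have Rb: "R \<in> basic_space \<Omega>" using R unfolding moderate_funs_def by blast
  have Xb: "X \<in> basic_maps \<Omega>" using X unfolding moderate_points_def by blast
  have XO: "X \<psi> \<epsilon> \<in> \<Omega>" if "\<psi> \<in> EI" "\<epsilon> \<in> unit_ivl" for \<psi> \<epsilon> using XK[OF that] \<rho>(2) by blast
  have "gpoint_rel \<Omega> `` {X} \<in> compact_points_phi_eps \<Omega>"
    unfolding compact_points_phi_eps_def using moderate_point_class[OF X(1) compact_cball \<rho>(2) XK] X(2) by blast
  from point_value_zero_imp_negligible[OF R X(1) compact_cball \<rho>(2) XK z[OF this]]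
  have "negligible_net (\<lambda>\<epsilon>. norm (differential (power_space euclidean) (rep_value R X) \<phi> vs \<epsilon>))"
    using \<phi> vs unfolding negligible_map_def by blast
  from this[unfolded negligible_net_iff, rule_format, of m]
  obtain B where B: "\<forall>\<^sub>F \<epsilon> in at_right 0. \<bar>norm (differential (power_space euclidean) (rep_value R X) \<phi> vs \<epsilon>)\<bar> \<le> B * \<epsilon> ^ m"
    by (elim exE)
  \<comment> \<open>Both subsequences only increase the index, so the constant
    \<open>r (\<tau> k)\<close> of the violated bound exceeds \<open>B\<close> from some
    \<open>k\<close> on.\<close>
  have "\<forall>\<^sub>F k in sequentially. B < real k" using filterlim_real_sequentially unfolding filterlim_at_top_dense by blast
  with eventually_compose_filterlim[OF B filterlim_compose[OF f0 filterlim_subseq[OF \<tau>]]]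
  have "\<forall>\<^sub>F k in sequentially. False"
  proof eventually_elim
    case (elim k)
    let ?\<epsilon> = "f (\<tau> k)"
    have EI\<phi>: "\<phi> \<in> EI" by (rule test_objs_SKI[OF \<phi>])
    \<comment> \<open>On this slab the number fed into the curve stays on the \<open>k\<close>-th
      plateau, so the point is constant there. It is open along lines because the functional is
      affine on them.\<close>
    define W where "W = {\<psi> \<in> EI. \<bar>Re (u (\<psi> ?\<epsilon> x0)) - Re (u (\<phi> ?\<epsilon> x0))\<bar> < 1}"
    have "differential (power_space euclidean) (rep_value R X) \<phi> vs ?\<epsilon> = differential CI R \<phi> vs ?\<epsilon> (x ?\<epsilon>)"
    proof (rule differential_rep_value_locally_constant[OF Rb Xb XO _ _ fI _ test_objs0_SKI[OF vs], of W])
      show "W \<subseteq> EI" by (auto simp: W_def)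
      show "\<forall>\<^sub>F s in nhds 0. \<psi> + s *\<^sub>R w \<in> W" if "\<psi> \<in> W" "w \<in> EI" for \<psi> w
      proof -
        have \<psi>: "\<psi> \<in> EI" "\<bar>Re (u (\<psi> ?\<epsilon> x0)) - Re (u (\<phi> ?\<epsilon> x0))\<bar> < 1" using that by (auto simp: W_def)
        have "((\<lambda>s. \<bar>Re (u (\<psi> ?\<epsilon> x0)) + s * Re (u (w ?\<epsilon> x0)) - Re (u (\<phi> ?\<epsilon> x0))\<bar>) \<longlongrightarrow>
            \<bar>Re (u (\<psi> ?\<epsilon> x0)) + 0 * Re (u (w ?\<epsilon> x0)) - Re (u (\<phi> ?\<epsilon> x0))\<bar>) (nhds 0)"
          by (intro tendsto_intros filterlim_ident)
        then have "\<forall>\<^sub>F s in nhds 0. \<bar>Re (u (\<psi> ?\<epsilon> x0)) + s * Re (u (w ?\<epsilon> x0)) - Re (u (\<phi> ?\<epsilon> x0))\<bar> < 1"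
          by (rule order_tendstoD(2)) (use \<psi>(2) in simp)
        then show ?thesis
          unfolding W_def mem_Collect_eq point_functional_line[OF u(1) x0' \<psi>(1) that(2) fI]
          by (rule eventually_mono) (use line_in_EI[OF \<psi>(1) that(2)] in blast)
      qed
      show "X \<psi> ?\<epsilon> = x ?\<epsilon>" if "\<psi> \<in> W" for \<psi>
        using that Z(4) fI[of "\<tau> k"] by (simp add: X_def W_def)
      show "\<phi> \<in> W" using EI\<phi> by (simp add: W_def)
    qed
    then have "h ?\<epsilon> \<le> B * ?\<epsilon> ^ m" using elim(1) by (simp add: h_def)
    also have "\<dots> \<le> real (r (\<tau> k)) * ?\<epsilon> ^ m"
    proof (rule mult_right_mono)
      have "k \<le> r (\<tau> k)" using seq_suble[OF \<tau>, of k] seq_suble[OF r(1), of "\<tau> k"] by simp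
      then show "B \<le> real (r (\<tau> k))" using elim(2) by linarith
      show "0 \<le> ?\<epsilon> ^ m" using fI[of "\<tau> k"] by simp
    qed
    finally show False using e(3)[of "r (\<tau> k)"] by (simp add: f_def)
  qed
  then show False by simp
qed

end

theorem theorem31:
  fixes \<Omega> :: "(real^'n::finite) set" and Rt :: "'n gfun set"
  assumes "open \<Omega>" and "Rt \<in> gen_funs \<Omega>"
  shows "(Rt = gfun_zero \<Omega> \<longleftrightarrow> (\<forall>Xt \<in> compact_points_eps \<Omega>. point_value \<Omega> Rt Xt = gnum_zero \<Omega>)) \<and>
         (Rt = gfun_zero \<Omega> \<longleftrightarrow> (\<forall>Xt \<in> compact_points_phi_eps \<Omega>. point_value \<Omega> Rt Xt = gnum_zero \<Omega>)) \<and>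
         (Rt = gfun_zero \<Omega> \<longleftrightarrow> (\<forall>Xt \<in> compact_points \<Omega>. point_value \<Omega> Rt Xt = gnum_zero \<Omega>))"
proof -
  interpret open_set \<Omega> by standard (rule assms(1))
  obtain R where R: "R \<in> moderate_funs \<Omega>" "Rt = gfun_rel \<Omega> `` {R}"
    using assms(2) unfolding gen_funs_def quotient_def by blast
  note zero_iff = gfun_zero_iff[OF R(1), folded R(2)]
  \<comment> \<open>With these inclusions it suffices that the zero class has zero values on the
    largest set of points and that each of the two smaller sets detects it.\<close>
  have sub: "compact_points_eps \<Omega> \<subseteq> compact_points \<Omega>" "compact_points_phi_eps \<Omega> \<subseteq> compact_points \<Omega>"
    unfolding compact_points_eps_def compact_points_phi_eps_def by blast+
  have "Rt = gfun_zero \<Omega>" if "\<forall>Xt \<in> compact_points_eps \<Omega>. point_value \<Omega> Rt Xt = gnum_zero \<Omega>"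
    unfolding zero_iff
    by (rule negligible_if_eps_local_values_zero[OF R(1)]) (rule bspec[OF that, unfolded R(2)])
  moreover have "Rt = gfun_zero \<Omega>" if "\<forall>Xt \<in> compact_points_phi_eps \<Omega>. point_value \<Omega> Rt Xt = gnum_zero \<Omega>"
    unfolding zero_iff
    by (rule negligible_if_phi_eps_local_values_zero[OF R(1)]) (rule bspec[OF that, unfolded R(2)])
  moreover have "\<forall>Xt \<in> compact_points \<Omega>. point_value \<Omega> Rt Xt = gnum_zero \<Omega>" if "Rt = gfun_zero \<Omega>"
    unfolding that using point_value_zero by blast
  ultimately show ?thesis using sub by blast
qed

end
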